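(* Let $\mathbf{B}$ be a balanced braided monoidal category and let $G$ be a group. There are equivalences of categories (1) $\mathbf{Alg}\left(\mathbb{D}\otimes\mathbb{R}\mathbb{B},\mathbf{B}\right)\simeq\mathbf{Mon}(\mathbf{B})$; (2) $\mathbf{Alg}\left(\mathbb{D}\otimes\mathbb{R}\mathbb{B}\otimes\mathbb{G},\mathbf{B}\right)\simeq\mathbf{GMon}(\mathbf{B})$; (3) $\mathbf{Alg}\left((\mathbb{D}\otimes\mathbb{R}\mathbb{B})^{op},\mathbf{B}\right)\simeq\mathbf{Comon}(\mathbf{B})$ and (4) $\mathbf{Alg}\left((\mathbb{D}\otimes\mathbb{R}\mathbb{B}\otimes\mathbb{G})^{op},\mathbf{B}\right)\simeq\mathbf{GComon}(\mathbf{B})$.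
   Context: For $n\geq 1$, $\underline{n}=\{1,\dots,n\}$, and $\underline{0}=\emptyset$. A PROB is a braided strict monoidal category whose objects are the sets $\underline{n}$, $n\ge 0$, with tensor product of objects given by addition. For a PROB $T$ and a braided monoidal category $\mathbf{B}$, $\mathbf{Alg}(T,\mathbf{B})$ is the category of braided strict monoidal functors $T\to\mathbf{B}$ and natural transformations. A braided monoidal category with braiding $c$ is balanced if it is equipped with a natural family of isomorphisms (full twists) $\Theta_A:A\to A$ such that the full twist on the unit object is the identity and the full twists are compatible with the braiding, $\Theta_{A\otimes A'}=c_{A',A}\circ c_{A,A'}\circ(\Theta_A\otimes\Theta_{A'})$. $\mathbf{Mon}(\mathbf{B})$ and $\mathbf{Comon}(\mathbf{B})$ are the categories of monoids and comonoids in $\mathbf{B}$. Regarding $G$ as a one-object category, $\mathbf{GMon}(\mathbf{B})=\mathrm{Fun}(G,\mathbf{Mon}(\mathbf{B}))$ and $\mathbf{GComon}(\mathbf{B})=\mathrm{Fun}(G,\mathbf{Comon}(\mathbf{B}))$. $\mathbb{D}$ is the strict monoidal category of the sets $\underline{n}$ and order-preserving maps (tensor product: ordinal sum). $RB_n$ is the ribbon braid group on $n$ ribbons, identified with $\mathbb{Z}^n\rtimes B_n$ ($B_n$ the braid group), the integers counting the full twists performed on each ribbon. An element of $G^n\rtimes RB_n$ is a ribbon braid with a label $x_i\in G$ on the ribbon starting at position $i$; multiplication composes ribbon braids and multiplies labels along ribbons, $(y;j')(x;j)=\big((y_{\sigma(i)}x_i)_i;\,j'j\big)$, where $\sigma$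 is the underlying permutation of $j$. The PROB $\mathbb{D}\otimes\mathbb{R}\mathbb{B}\otimes\mathbb{G}$ has as morphisms $\underline{n}\to\underline{m}$ the pairs $(\phi,g)$ with $\phi\in\mathrm{Hom}_{\mathbb{D}}(\underline{n},\underline{m})$, $g\in G^n\rtimes RB_n$ (think "$\phi\circ g$"), with composition $(\phi_2,g_2)\circ(\phi_1,g_1)=\big(\phi_2\circ(g_2)_\star(\phi_1),\ \phi_1^\star(g_2)\,g_1\big)$. Here for $\phi\in\mathrm{Hom}_{\mathbb{D}}(\underline{n},\underline{m})$ and $g\in G^m\rtimes RB_m$ with underlying permutation $\sigma$: $g_\star(\phi)$ is the order-preserving map $\underline{n}\to\underline{m}$ whose fibre over $\sigma(i)$ has $|\phi^{-1}(i)|$ elements, and $\phi^\star(g)$ is obtained from $g$ by replacing its $i$-th ribbon by $|\phi^{-1}(i)|$ parallel ribbons obtained by cutting it lengthwise (deleting it if this number is $0$), each carrying the label $x_i$ (so a full twist on a ribbon becomes the full twist of all the parallel ribbons together). Tensor product is juxtaposition; the braiding is given by the block ribbon braids without twists and with trivial labels. $\mathbb{D}\otimes\mathbb{R}\mathbb{B}$ is the case of trivial $G$. The opposite categories carry the inherited braided monoidal structure.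
   Formalization: In Alg, functors must also preserve the full twists and natural transformations must be monoidal (the claim fails otherwise); for general B the functors are monoidal up to coherent isomorphism, and strict monoidal functors are treated when B is strict. *)

theory Defs
  imports "HOL-Library.FuncSet" "HOL-Combinatorics.Transposition" "HOL-Algebra.Elementary_Groups"
begin

section \<open>Categories, functors, equivalences\<close>

record ('o, 'a) cat =
  Obj :: "'o set"
  Arr :: "'a set"
  Dom :: "'a \<Rightarrow> 'o"
  Cod :: "'a \<Rightarrow> 'o"
  Ident :: "'o \<Rightarrow> 'a"
  Comp :: "'a \<Rightarrow> 'a \<Rightarrow> 'a"  (infixr "\<cdot>\<index>" 75)

text \<open>\<open>g \<cdot> f\<close> is \<open>g\<close> after \<open>f\<close>.\<close>

definition Hom :: "('o, 'a, 'm) cat_scheme \<Rightarrow> 'o \<Rightarrow> 'o \<Rightarrow> 'a set" where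
  "Hom C a b = {f \<in> Arr C. Dom C f = a \<and> Cod C f = b}"

locale category =
  fixes C :: "('o, 'a, 'm) cat_scheme" (structure)
  assumes dom_obj: "f \<in> Arr C \<Longrightarrow> Dom C f \<in> Obj C"
    and cod_obj: "f \<in> Arr C \<Longrightarrow> Cod C f \<in> Obj C"
    and ident_hom: "a \<in> Obj C \<Longrightarrow> Ident C a \<in> Hom C a a"
    and comp_hom: "\<lbrakk>f \<in> Hom C a b; g \<in> Hom C b c\<rbrakk> \<Longrightarrow> g \<cdot> f \<in> Hom C a c"
    and comp_ident_left: "f \<in> Hom C a b \<Longrightarrow> Ident C b \<cdot> f = f"
    and comp_ident_right: "f \<in> Hom C a b \<Longrightarrow> f \<cdot> Ident C a = f"
    and comp_assoc: "\<lbrakk>f \<in> Hom C a b; g \<in> Hom C b c; h \<in> Hom C c d\<rbrakk>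
                      \<Longrightarrow> (h \<cdot> g) \<cdot> f = h \<cdot> (g \<cdot> f)"

definition inverse_arrows :: "('o, 'a, 'm) cat_scheme \<Rightarrow> 'a \<Rightarrow> 'a \<Rightarrow> bool" where
  "inverse_arrows C f g \<longleftrightarrow>
     f \<in> Arr C \<and> g \<in> Hom C (Cod C f) (Dom C f) \<and>
     g \<cdot>\<^bsub>C\<^esub> f = Ident C (Dom C f) \<and> f \<cdot>\<^bsub>C\<^esub> g = Ident C (Cod C f)"

definition iso_arrow :: "('o, 'a, 'm) cat_scheme \<Rightarrow> 'a \<Rightarrow> bool" where
  "iso_arrow C f \<longleftrightarrow> (\<exists>g. inverse_arrows C f g)"

definition inverse_arrow :: "('o, 'a, 'm) cat_scheme \<Rightarrow> 'a \<Rightarrow> 'a" where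
  "inverse_arrow C f = (THE g. inverse_arrows C f g)"

record ('o1, 'a1, 'o2, 'a2) func =
  FObj :: "'o1 \<Rightarrow> 'o2"
  FArr :: "'a1 \<Rightarrow> 'a2"

text \<open>Functors and natural transformations are extensional outside the objects and arrows of their
  source, so that equality of HOL values is equality of functors and of transformations.\<close>

definition is_functor ::
  "('o1, 'a1, 'm1) cat_scheme \<Rightarrow> ('o2, 'a2, 'm2) cat_scheme \<Rightarrow>
   ('o1, 'a1, 'o2, 'a2, 'm3) func_scheme \<Rightarrow> bool" where
  "is_functor C D F \<longleftrightarrow>
     FObj F \<in> Obj C \<rightarrow>\<^sub>E Obj D \<and> FArr F \<in> extensional (Arr C) \<and>
     (\<forall>f\<in>Arr C. FArr F f \<in> Hom D (FObj F (Dom C f)) (FObj F (Cod C f))) \<and>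
     (\<forall>a\<in>Obj C. FArr F (Ident C a) = Ident D (FObj F a)) \<and>
     (\<forall>f\<in>Arr C. \<forall>g\<in>Arr C. Cod C f = Dom C g \<longrightarrow>
        FArr F (g \<cdot>\<^bsub>C\<^esub> f) = FArr F g \<cdot>\<^bsub>D\<^esub> FArr F f)"

definition is_nat_trans ::
  "('o1, 'a1, 'm1) cat_scheme \<Rightarrow> ('o2, 'a2, 'm2) cat_scheme \<Rightarrow>
   ('o1, 'a1, 'o2, 'a2, 'm3) func_scheme \<Rightarrow> ('o1, 'a1, 'o2, 'a2, 'm4) func_scheme \<Rightarrow>
   ('o1 \<Rightarrow> 'a2) \<Rightarrow> bool" where
  "is_nat_trans C D F F' \<alpha> \<longleftrightarrow>
     \<alpha> \<in> extensional (Obj C) \<and>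
     (\<forall>a\<in>Obj C. \<alpha> a \<in> Hom D (FObj F a) (FObj F' a)) \<and>
     (\<forall>f\<in>Arr C. \<alpha> (Cod C f) \<cdot>\<^bsub>D\<^esub> FArr F f = FArr F' f \<cdot>\<^bsub>D\<^esub> \<alpha> (Dom C f))"

definition id_func :: "('o, 'a, 'm) cat_scheme \<Rightarrow> ('o, 'a, 'o, 'a) func" where
  "id_func C = \<lparr>FObj = (\<lambda>a\<in>Obj C. a), FArr = (\<lambda>f\<in>Arr C. f)\<rparr>"

definition comp_func ::
  "('o1, 'a1, 'm) cat_scheme \<Rightarrow> ('o2, 'a2, 'o3, 'a3) func \<Rightarrow> ('o1, 'a1, 'o2, 'a2) func \<Rightarrow>
   ('o1, 'a1, 'o3, 'a3) func" where
  "comp_func C H F = \<lparr>FObj = (\<lambda>a\<in>Obj C. FObj H (FObj F a)), FArr = (\<lambda>f\<in>Arr C. FArr H (FArr F f))\<rparr>"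

definition naturally_isomorphic ::
  "('o1, 'a1, 'm1) cat_scheme \<Rightarrow> ('o2, 'a2, 'm2) cat_scheme \<Rightarrow>
   ('o1, 'a1, 'o2, 'a2) func \<Rightarrow> ('o1, 'a1, 'o2, 'a2) func \<Rightarrow> bool" where
  "naturally_isomorphic C D F F' \<longleftrightarrow>
     (\<exists>\<alpha>. is_nat_trans C D F F' \<alpha> \<and> (\<forall>a\<in>Obj C. iso_arrow D (\<alpha> a)))"

definition equivalent_categories ::
  "('o1, 'a1, 'm1) cat_scheme \<Rightarrow> ('o2, 'a2, 'm2) cat_scheme \<Rightarrow> bool"  (infix "\<simeq>\<^sub>C" 50) where
  "C \<simeq>\<^sub>C D \<longleftrightarrow>
     category C \<and> category D \<and>
     (\<exists>F H. is_functor C D F \<and> is_functor D C H \<and>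
        naturally_isomorphic C C (comp_func C H F) (id_func C) \<and>
        naturally_isomorphic D D (comp_func D F H) (id_func D))"

text \<open>An arrow of a functor category is a triple: source functor, components, target functor.\<close>

definition functor_category ::
  "('o1, 'a1, 'm1) cat_scheme \<Rightarrow> ('o2, 'a2, 'm2) cat_scheme \<Rightarrow>
   (('o1, 'a1, 'o2, 'a2) func,
    ('o1, 'a1, 'o2, 'a2) func \<times> ('o1 \<Rightarrow> 'a2) \<times> ('o1, 'a1, 'o2, 'a2) func) cat" where
  "functor_category C D =
     \<lparr>Obj = {F. is_functor C D F},
      Arr = {(F, \<alpha>, F'). is_functor C D F \<and> is_functor C D F' \<and> is_nat_trans C D F F' \<alpha>},
      Dom = (\<lambda>(F, \<alpha>, F'). F),
      Cod = (\<lambda>(F, \<alpha>, F'). F'),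
      Ident = (\<lambda>F. (F, (\<lambda>a\<in>Obj C. Ident D (FObj F a)), F)),
      Comp = (\<lambda>(F', \<beta>, F'') (F, \<alpha>, _). (F, (\<lambda>a\<in>Obj C. \<beta> a \<cdot>\<^bsub>D\<^esub> \<alpha> a), F''))\<rparr>"

definition one_object_category :: "('g, 'm) monoid_scheme \<Rightarrow> (unit, 'g) cat" where
  "one_object_category G =
     \<lparr>Obj = {()}, Arr = carrier G, Dom = (\<lambda>_. ()), Cod = (\<lambda>_. ()),
      Ident = (\<lambda>_. \<one>\<^bsub>G\<^esub>), Comp = (\<lambda>g f. g \<otimes>\<^bsub>G\<^esub> f)\<rparr>"


section \<open>Balanced braided monoidal categories\<close>

record ('o, 'a) moncat = "('o, 'a) cat" +
  TObj :: "'o \<Rightarrow> 'o \<Rightarrow> 'o"  (infixr "\<diamondop>\<index>" 80)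
  TArr :: "'a \<Rightarrow> 'a \<Rightarrow> 'a"  (infixr "\<star>\<index>" 80)
  Unit :: "'o"
  Assoc :: "'o \<Rightarrow> 'o \<Rightarrow> 'o \<Rightarrow> 'a"
  LUnit :: "'o \<Rightarrow> 'a"
  RUnit :: "'o \<Rightarrow> 'a"

record ('o, 'a) bmoncat = "('o, 'a) moncat" +
  Braid :: "'o \<Rightarrow> 'o \<Rightarrow> 'a"

record ('o, 'a) balcat = "('o, 'a) bmoncat" +
  Twist :: "'o \<Rightarrow> 'a"

locale monoidal_category = category C
  for C :: "('o, 'a, 'm) moncat_scheme" (structure) +
  assumes unit_obj: "Unit C \<in> Obj C"
    and tensor_obj: "\<lbrakk>a \<in> Obj C; b \<in> Obj C\<rbrakk> \<Longrightarrow> a \<diamondop> b \<in> Obj C"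
    and tensor_hom: "\<lbrakk>f \<in> Hom C a b; g \<in> Hom C a' b'\<rbrakk> \<Longrightarrow> f \<star> g \<in> Hom C (a \<diamondop> a') (b \<diamondop> b')"
    and tensor_ident: "\<lbrakk>a \<in> Obj C; b \<in> Obj C\<rbrakk> \<Longrightarrow> Ident C a \<star> Ident C b = Ident C (a \<diamondop> b)"
    and interchange: "\<lbrakk>f \<in> Hom C a b; g \<in> Hom C b c; f' \<in> Hom C a' b'; g' \<in> Hom C b' c'\<rbrakk>
        \<Longrightarrow> (g \<cdot> f) \<star> (g' \<cdot> f') = (g \<star> g') \<cdot> (f \<star> f')"
    and assoc_hom: "\<lbrakk>a \<in> Obj C; b \<in> Obj C; c \<in> Obj C\<rbrakk>
        \<Longrightarrow> Assoc C a b c \<in> Hom C ((a \<diamondop> b) \<diamondop> c) (a \<diamondop> (b \<diamondop> c))"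
    and assoc_iso: "\<lbrakk>a \<in> Obj C; b \<in> Obj C; c \<in> Obj C\<rbrakk> \<Longrightarrow> iso_arrow C (Assoc C a b c)"
    and assoc_natural: "\<lbrakk>f \<in> Hom C a a'; g \<in> Hom C b b'; h \<in> Hom C c c'\<rbrakk>
        \<Longrightarrow> Assoc C a' b' c' \<cdot> ((f \<star> g) \<star> h) = (f \<star> (g \<star> h)) \<cdot> Assoc C a b c"
    and lunit_hom: "a \<in> Obj C \<Longrightarrow> LUnit C a \<in> Hom C (Unit C \<diamondop> a) a"
    and lunit_iso: "a \<in> Obj C \<Longrightarrow> iso_arrow C (LUnit C a)"
    and lunit_natural: "f \<in> Hom C a b \<Longrightarrow> LUnit C b \<cdot> (Ident C (Unit C) \<star> f) = f \<cdot> LUnit C a"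
    and runit_hom: "a \<in> Obj C \<Longrightarrow> RUnit C a \<in> Hom C (a \<diamondop> Unit C) a"
    and runit_iso: "a \<in> Obj C \<Longrightarrow> iso_arrow C (RUnit C a)"
    and runit_natural: "f \<in> Hom C a b \<Longrightarrow> RUnit C b \<cdot> (f \<star> Ident C (Unit C)) = f \<cdot> RUnit C a"
    and triangle: "\<lbrakk>a \<in> Obj C; b \<in> Obj C\<rbrakk>
        \<Longrightarrow> (Ident C a \<star> LUnit C b) \<cdot> Assoc C a (Unit C) b = RUnit C a \<star> Ident C b"
    and pentagon: "\<lbrakk>a \<in> Obj C; b \<in> Obj C; c \<in> Obj C; d \<in> Obj C\<rbrakk>
        \<Longrightarrow> (Ident C a \<star> Assoc C b c d) \<cdot> Assoc C a (b \<diamondop> c) d \<cdot> (Assoc C a b c \<star> Ident C d) =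
            Assoc C a b (c \<diamondop> d) \<cdot> Assoc C (a \<diamondop> b) c d"

locale braided_monoidal_category = monoidal_category C
  for C :: "('o, 'a, 'm) bmoncat_scheme" (structure) +
  assumes braid_hom: "\<lbrakk>a \<in> Obj C; b \<in> Obj C\<rbrakk> \<Longrightarrow> Braid C a b \<in> Hom C (a \<diamondop> b) (b \<diamondop> a)"
    and braid_iso: "\<lbrakk>a \<in> Obj C; b \<in> Obj C\<rbrakk> \<Longrightarrow> iso_arrow C (Braid C a b)"
    and braid_natural: "\<lbrakk>f \<in> Hom C a a'; g \<in> Hom C b b'\<rbrakk>
        \<Longrightarrow> Braid C a' b' \<cdot> (f \<star> g) = (g \<star> f) \<cdot> Braid C a b"
    and hexagon1: "\<lbrakk>a \<in> Obj C; b \<in> Obj C; c \<in> Obj C\<rbrakk>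
        \<Longrightarrow> Assoc C b c a \<cdot> Braid C a (b \<diamondop> c) \<cdot> Assoc C a b c =
            (Ident C b \<star> Braid C a c) \<cdot> Assoc C b a c \<cdot> (Braid C a b \<star> Ident C c)"
    and hexagon2: "\<lbrakk>a \<in> Obj C; b \<in> Obj C; c \<in> Obj C\<rbrakk>
        \<Longrightarrow> Braid C (a \<diamondop> b) c =
            Assoc C c a b \<cdot> (Braid C a c \<star> Ident C b) \<cdot> inverse_arrow C (Assoc C a c b) \<cdot>
            (Ident C a \<star> Braid C b c) \<cdot> Assoc C a b c"

locale balanced_category = braided_monoidal_category C
  for C :: "('o, 'a, 'm) balcat_scheme" (structure) +
  assumes twist_hom: "a \<in> Obj C \<Longrightarrow> Twist C a \<in> Hom C a a"
    and twist_iso: "a \<in> Obj C \<Longrightarrow> iso_arrow C (Twist C a)"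
    and twist_natural: "f \<in> Hom C a b \<Longrightarrow> Twist C b \<cdot> f = f \<cdot> Twist C a"
    and twist_unit: "Twist C (Unit C) = Ident C (Unit C)"
    and twist_tensor: "\<lbrakk>a \<in> Obj C; b \<in> Obj C\<rbrakk>
        \<Longrightarrow> Twist C (a \<diamondop> b) = Braid C b a \<cdot> Braid C a b \<cdot> (Twist C a \<star> Twist C b)"

definition strict_monoidal :: "('o, 'a, 'm) moncat_scheme \<Rightarrow> bool" where
  "strict_monoidal C \<longleftrightarrow>
     (\<forall>a\<in>Obj C. \<forall>b\<in>Obj C. \<forall>c\<in>Obj C.
        (a \<diamondop>\<^bsub>C\<^esub> b) \<diamondop>\<^bsub>C\<^esub> c = a \<diamondop>\<^bsub>C\<^esub> (b \<diamondop>\<^bsub>C\<^esub> c) \<and>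
        Assoc C a b c = Ident C (a \<diamondop>\<^bsub>C\<^esub> (b \<diamondop>\<^bsub>C\<^esub> c))) \<and>
     (\<forall>a\<in>Obj C. Unit C \<diamondop>\<^bsub>C\<^esub> a = a \<and> LUnit C a = Ident C a) \<and>
     (\<forall>a\<in>Obj C. a \<diamondop>\<^bsub>C\<^esub> Unit C = a \<and> RUnit C a = Ident C a)"

text \<open>The braiding \<open>a \<diamondop> b \<rightarrow> b \<diamondop> a\<close> of the opposite category is the arrow
  \<open>b \<diamondop> a \<rightarrow> a \<diamondop> b\<close> given by the braiding of \<open>C\<close>; no inverse is taken.\<close>

definition opposite :: "('o, 'a) balcat \<Rightarrow> ('o, 'a) balcat" where
  "opposite C =
     \<lparr>Obj = Obj C, Arr = Arr C, Dom = Cod C, Cod = Dom C, Ident = Ident C,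
      Comp = (\<lambda>g f. f \<cdot>\<^bsub>C\<^esub> g), TObj = TObj C, TArr = TArr C, Unit = Unit C,
      Assoc = (\<lambda>a b c. inverse_arrow C (Assoc C a b c)),
      LUnit = (\<lambda>a. inverse_arrow C (LUnit C a)), RUnit = (\<lambda>a. inverse_arrow C (RUnit C a)),
      Braid = (\<lambda>a b. Braid C b a), Twist = Twist C\<rparr>"


section \<open>Monoids and comonoids\<close>

definition is_monoid_in :: "('o, 'a, 'm) moncat_scheme \<Rightarrow> 'o \<times> 'a \<times> 'a \<Rightarrow> bool" where
  "is_monoid_in B = (\<lambda>(A, \<mu>, \<eta>).
     A \<in> Obj B \<and> \<mu> \<in> Hom B (A \<diamondop>\<^bsub>B\<^esub> A) A \<and> \<eta> \<in> Hom B (Unit B) A \<and>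
     \<mu> \<cdot>\<^bsub>B\<^esub> (\<mu> \<star>\<^bsub>B\<^esub> Ident B A) = \<mu> \<cdot>\<^bsub>B\<^esub> (Ident B A \<star>\<^bsub>B\<^esub> \<mu>) \<cdot>\<^bsub>B\<^esub> Assoc B A A A \<and>
     \<mu> \<cdot>\<^bsub>B\<^esub> (\<eta> \<star>\<^bsub>B\<^esub> Ident B A) = LUnit B A \<and>
     \<mu> \<cdot>\<^bsub>B\<^esub> (Ident B A \<star>\<^bsub>B\<^esub> \<eta>) = RUnit B A)"

definition is_monoid_hom ::
  "('o, 'a, 'm) moncat_scheme \<Rightarrow> 'o \<times> 'a \<times> 'a \<Rightarrow> 'o \<times> 'a \<times> 'a \<Rightarrow> 'a \<Rightarrow> bool" where
  "is_monoid_hom B = (\<lambda>(A, \<mu>, \<eta>) (A', \<mu>', \<eta>') f.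
     f \<in> Hom B A A' \<and> f \<cdot>\<^bsub>B\<^esub> \<mu> = \<mu>' \<cdot>\<^bsub>B\<^esub> (f \<star>\<^bsub>B\<^esub> f) \<and> f \<cdot>\<^bsub>B\<^esub> \<eta> = \<eta>')"

definition is_comonoid_in :: "('o, 'a, 'm) moncat_scheme \<Rightarrow> 'o \<times> 'a \<times> 'a \<Rightarrow> bool" where
  "is_comonoid_in B = (\<lambda>(A, \<delta>, \<epsilon>).
     A \<in> Obj B \<and> \<delta> \<in> Hom B A (A \<diamondop>\<^bsub>B\<^esub> A) \<and> \<epsilon> \<in> Hom B A (Unit B) \<and>
     Assoc B A A A \<cdot>\<^bsub>B\<^esub> (\<delta> \<star>\<^bsub>B\<^esub> Ident B A) \<cdot>\<^bsub>B\<^esub> \<delta> = (Ident B A \<star>\<^bsub>B\<^esub> \<delta>) \<cdot>\<^bsub>B\<^esub> \<delta> \<and>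
     LUnit B A \<cdot>\<^bsub>B\<^esub> (\<epsilon> \<star>\<^bsub>B\<^esub> Ident B A) \<cdot>\<^bsub>B\<^esub> \<delta> = Ident B A \<and>
     RUnit B A \<cdot>\<^bsub>B\<^esub> (Ident B A \<star>\<^bsub>B\<^esub> \<epsilon>) \<cdot>\<^bsub>B\<^esub> \<delta> = Ident B A)"

definition is_comonoid_hom ::
  "('o, 'a, 'm) moncat_scheme \<Rightarrow> 'o \<times> 'a \<times> 'a \<Rightarrow> 'o \<times> 'a \<times> 'a \<Rightarrow> 'a \<Rightarrow> bool" where
  "is_comonoid_hom B = (\<lambda>(A, \<delta>, \<epsilon>) (A', \<delta>', \<epsilon>') f.
     f \<in> Hom B A A' \<and> \<delta>' \<cdot>\<^bsub>B\<^esub> f = (f \<star>\<^bsub>B\<^esub> f) \<cdot>\<^bsub>B\<^esub> \<delta> \<and> \<epsilon>' \<cdot>\<^bsub>B\<^esub> f = \<epsilon>)"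

definition Mon ::
  "('o, 'a, 'm) moncat_scheme \<Rightarrow>
   ('o \<times> 'a \<times> 'a, ('o \<times> 'a \<times> 'a) \<times> 'a \<times> ('o \<times> 'a \<times> 'a)) cat" where
  "Mon B =
     \<lparr>Obj = {M. is_monoid_in B M},
      Arr = {(M, f, M'). is_monoid_in B M \<and> is_monoid_in B M' \<and> is_monoid_hom B M M' f},
      Dom = (\<lambda>(M, f, M'). M), Cod = (\<lambda>(M, f, M'). M'),
      Ident = (\<lambda>M. (M, Ident B (fst M), M)),
      Comp = (\<lambda>(M', g, M'') (M, f, _). (M, g \<cdot>\<^bsub>B\<^esub> f, M''))\<rparr>"

definition Comon ::
  "('o, 'a, 'm) moncat_scheme \<Rightarrow>
   ('o \<times> 'a \<times> 'a, ('o \<times> 'a \<times> 'a) \<times> 'a \<times> ('o \<times> 'a \<times> 'a)) cat" where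
  "Comon B =
     \<lparr>Obj = {M. is_comonoid_in B M},
      Arr = {(M, f, M'). is_comonoid_in B M \<and> is_comonoid_in B M' \<and> is_comonoid_hom B M M' f},
      Dom = (\<lambda>(M, f, M'). M), Cod = (\<lambda>(M, f, M'). M'),
      Ident = (\<lambda>M. (M, Ident B (fst M), M)),
      Comp = (\<lambda>(M', g, M'') (M, f, _). (M, g \<cdot>\<^bsub>B\<^esub> f, M''))\<rparr>"

abbreviation "GMon G B \<equiv> functor_category (one_object_category G) (Mon B)"
abbreviation "GComon G B \<equiv> functor_category (one_object_category G) (Comon B)"


section \<open>Categories of algebras\<close>

text \<open>Functors between balanced categories are required to preserve the full twists, and natural
  transformations between monoidal functors are required to be monoidal. Without the first condition
  the generating full twist of \<open>\<D> \<otimes> \<R>\<B>\<close> could act by any compatible automorphism instead of by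
  the full twist of \<open>B\<close>.

  \<open>Alg_strict\<close> consists of the functors that preserve all structure on the nose. This is the right
  notion only if the target is strict. For an arbitrary target, \<open>Alg\<close> consists of the functors
  that preserve the monoidal structure up to coherent isomorphism.\<close>

definition is_strict_balanced_functor ::
  "('o1, 'a1, 'm1) balcat_scheme \<Rightarrow> ('o2, 'a2, 'm2) balcat_scheme \<Rightarrow>
   ('o1, 'a1, 'o2, 'a2) func \<Rightarrow> bool" where
  "is_strict_balanced_functor T B F \<longleftrightarrow>
     is_functor T B F \<and>
     FObj F (Unit T) = Unit B \<and>
     (\<forall>a\<in>Obj T. \<forall>b\<in>Obj T. FObj F (a \<diamondop>\<^bsub>T\<^esub> b) = FObj F a \<diamondop>\<^bsub>B\<^esub> FObj F b) \<and>
     (\<forall>f\<in>Arr T. \<forall>g\<in>Arr T. FArr F (f \<star>\<^bsub>T\<^esub> g) = FArr F f \<star>\<^bsub>B\<^esub> FArr F g) \<and>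
     (\<forall>a\<in>Obj T. \<forall>b\<in>Obj T. \<forall>c\<in>Obj T.
        FArr F (Assoc T a b c) = Assoc B (FObj F a) (FObj F b) (FObj F c)) \<and>
     (\<forall>a\<in>Obj T. FArr F (LUnit T a) = LUnit B (FObj F a)) \<and>
     (\<forall>a\<in>Obj T. FArr F (RUnit T a) = RUnit B (FObj F a)) \<and>
     (\<forall>a\<in>Obj T. \<forall>b\<in>Obj T. FArr F (Braid T a b) = Braid B (FObj F a) (FObj F b)) \<and>
     (\<forall>a\<in>Obj T. FArr F (Twist T a) = Twist B (FObj F a))"

definition is_strict_monoidal_trans ::
  "('o1, 'a1, 'm1) moncat_scheme \<Rightarrow> ('o2, 'a2, 'm2) moncat_scheme \<Rightarrow>
   ('o1, 'a1, 'o2, 'a2) func \<Rightarrow> ('o1, 'a1, 'o2, 'a2) func \<Rightarrow> ('o1 \<Rightarrow> 'a2) \<Rightarrow> bool" where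
  "is_strict_monoidal_trans T B F F' \<alpha> \<longleftrightarrow>
     is_nat_trans T B F F' \<alpha> \<and>
     \<alpha> (Unit T) = Ident B (Unit B) \<and>
     (\<forall>a\<in>Obj T. \<forall>b\<in>Obj T. \<alpha> (a \<diamondop>\<^bsub>T\<^esub> b) = \<alpha> a \<star>\<^bsub>B\<^esub> \<alpha> b)"

definition Alg_strict ::
  "('o1, 'a1, 'm1) balcat_scheme \<Rightarrow> ('o2, 'a2, 'm2) balcat_scheme \<Rightarrow>
   (('o1, 'a1, 'o2, 'a2) func,
    ('o1, 'a1, 'o2, 'a2) func \<times> ('o1 \<Rightarrow> 'a2) \<times> ('o1, 'a1, 'o2, 'a2) func) cat" where
  "Alg_strict T B =
     \<lparr>Obj = {F. is_strict_balanced_functor T B F},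
      Arr = {(F, \<alpha>, F'). is_strict_balanced_functor T B F \<and> is_strict_balanced_functor T B F' \<and>
                         is_strict_monoidal_trans T B F F' \<alpha>},
      Dom = (\<lambda>(F, \<alpha>, F'). F), Cod = (\<lambda>(F, \<alpha>, F'). F'),
      Ident = (\<lambda>F. (F, (\<lambda>a\<in>Obj T. Ident B (FObj F a)), F)),
      Comp = (\<lambda>(F', \<beta>, F'') (F, \<alpha>, _). (F, (\<lambda>a\<in>Obj T. \<beta> a \<cdot>\<^bsub>B\<^esub> \<alpha> a), F''))\<rparr>"

text \<open>\<open>MUnit F\<close> is the comparison arrow \<open>I \<rightarrow> F I\<close>, and \<open>MTens F (a, b)\<close> the
  comparison arrow \<open>F a \<diamondop> F b \<rightarrow> F (a \<diamondop> b)\<close>.\<close>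

record ('o1, 'a1, 'o2, 'a2) mfunc = "('o1, 'a1, 'o2, 'a2) func" +
  MUnit :: "'a2"
  MTens :: "'o1 \<times> 'o1 \<Rightarrow> 'a2"

definition is_balanced_functor ::
  "('o1, 'a1, 'm1) balcat_scheme \<Rightarrow> ('o2, 'a2, 'm2) balcat_scheme \<Rightarrow>
   ('o1, 'a1, 'o2, 'a2) mfunc \<Rightarrow> bool" where
  "is_balanced_functor T B F \<longleftrightarrow>
     is_functor T B F \<and>
     MUnit F \<in> Hom B (Unit B) (FObj F (Unit T)) \<and> iso_arrow B (MUnit F) \<and>
     MTens F \<in> extensional (Obj T \<times> Obj T) \<and>
     (\<forall>a\<in>Obj T. \<forall>b\<in>Obj T.
        MTens F (a, b) \<in> Hom B (FObj F a \<diamondop>\<^bsub>B\<^esub> FObj F b) (FObj F (a \<diamondop>\<^bsub>T\<^esub> b)) \<and>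
        iso_arrow B (MTens F (a, b))) \<and>
     (\<forall>f\<in>Arr T. \<forall>g\<in>Arr T.
        MTens F (Cod T f, Cod T g) \<cdot>\<^bsub>B\<^esub> (FArr F f \<star>\<^bsub>B\<^esub> FArr F g) =
        FArr F (f \<star>\<^bsub>T\<^esub> g) \<cdot>\<^bsub>B\<^esub> MTens F (Dom T f, Dom T g)) \<and>
     (\<forall>a\<in>Obj T. \<forall>b\<in>Obj T. \<forall>c\<in>Obj T.
        FArr F (Assoc T a b c) \<cdot>\<^bsub>B\<^esub> MTens F (a \<diamondop>\<^bsub>T\<^esub> b, c) \<cdot>\<^bsub>B\<^esub>
          (MTens F (a, b) \<star>\<^bsub>B\<^esub> Ident B (FObj F c)) =
        MTens F (a, b \<diamondop>\<^bsub>T\<^esub> c) \<cdot>\<^bsub>B\<^esub> (Ident B (FObj F a) \<star>\<^bsub>B\<^esub> MTens F (b, c)) \<cdot>\<^bsub>B\<^esub>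
          Assoc B (FObj F a) (FObj F b) (FObj F c)) \<and>
     (\<forall>a\<in>Obj T.
        FArr F (LUnit T a) \<cdot>\<^bsub>B\<^esub> MTens F (Unit T, a) \<cdot>\<^bsub>B\<^esub> (MUnit F \<star>\<^bsub>B\<^esub> Ident B (FObj F a)) =
        LUnit B (FObj F a)) \<and>
     (\<forall>a\<in>Obj T.
        FArr F (RUnit T a) \<cdot>\<^bsub>B\<^esub> MTens F (a, Unit T) \<cdot>\<^bsub>B\<^esub> (Ident B (FObj F a) \<star>\<^bsub>B\<^esub> MUnit F) =
        RUnit B (FObj F a)) \<and>
     (\<forall>a\<in>Obj T. \<forall>b\<in>Obj T.
        FArr F (Braid T a b) \<cdot>\<^bsub>B\<^esub> MTens F (a, b) =
        MTens F (b, a) \<cdot>\<^bsub>B\<^esub> Braid B (FObj F a) (FObj F b)) \<and>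
     (\<forall>a\<in>Obj T. FArr F (Twist T a) = Twist B (FObj F a))"

definition is_monoidal_trans ::
  "('o1, 'a1, 'm1) moncat_scheme \<Rightarrow> ('o2, 'a2, 'm2) moncat_scheme \<Rightarrow>
   ('o1, 'a1, 'o2, 'a2) mfunc \<Rightarrow> ('o1, 'a1, 'o2, 'a2) mfunc \<Rightarrow> ('o1 \<Rightarrow> 'a2) \<Rightarrow> bool" where
  "is_monoidal_trans T B F F' \<alpha> \<longleftrightarrow>
     is_nat_trans T B F F' \<alpha> \<and>
     \<alpha> (Unit T) \<cdot>\<^bsub>B\<^esub> MUnit F = MUnit F' \<and>
     (\<forall>a\<in>Obj T. \<forall>b\<in>Obj T.
        \<alpha> (a \<diamondop>\<^bsub>T\<^esub> b) \<cdot>\<^bsub>B\<^esub> MTens F (a, b) = MTens F' (a, b) \<cdot>\<^bsub>B\<^esub> (\<alpha> a \<star>\<^bsub>B\<^esub> \<alpha> b))"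

definition Alg ::
  "('o1, 'a1, 'm1) balcat_scheme \<Rightarrow> ('o2, 'a2, 'm2) balcat_scheme \<Rightarrow>
   (('o1, 'a1, 'o2, 'a2) mfunc,
    ('o1, 'a1, 'o2, 'a2) mfunc \<times> ('o1 \<Rightarrow> 'a2) \<times> ('o1, 'a1, 'o2, 'a2) mfunc) cat" where
  "Alg T B =
     \<lparr>Obj = {F. is_balanced_functor T B F},
      Arr = {(F, \<alpha>, F'). is_balanced_functor T B F \<and> is_balanced_functor T B F' \<and>
                         is_monoidal_trans T B F F' \<alpha>},
      Dom = (\<lambda>(F, \<alpha>, F'). F), Cod = (\<lambda>(F, \<alpha>, F'). F'),
      Ident = (\<lambda>F. (F, (\<lambda>a\<in>Obj T. Ident B (FObj F a)), F)),
      Comp = (\<lambda>(F', \<beta>, F'') (F, \<alpha>, _). (F, (\<lambda>a\<in>Obj T. \<beta> a \<cdot>\<^bsub>B\<^esub> \<alpha> a), F''))\<rparr>"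


section \<open>Braid groups\<close>

text \<open>Positions are numbered from 0. The letter \<open>(i, True)\<close> is the Artin generator crossing
  the strands at positions \<open>i\<close> and \<open>i + 1\<close>, and \<open>(i, False)\<close> is its inverse. Words are read
  in time order: the head is the crossing performed first, so that \<open>v @ w\<close> is the braid
  \<open>v\<close> followed by \<open>w\<close>.\<close>

type_synonym braid_word = "(nat \<times> bool) list"

definition braid_words :: "nat \<Rightarrow> braid_word set" where
  "braid_words n = {w. \<forall>(i, e)\<in>set w. Suc i < n}"

inductive braid_eq :: "nat \<Rightarrow> braid_word \<Rightarrow> braid_word \<Rightarrow> bool" for n where
  refl: "w \<in> braid_words n \<Longrightarrow> braid_eq n w w"
| sym: "braid_eq n v w \<Longrightarrow> braid_eq n w v"
| trans: "\<lbrakk>braid_eq n u v; braid_eq n v w\<rbrakk> \<Longrightarrow> braid_eq n u w"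
| cancel: "\<lbrakk>u \<in> braid_words n; v \<in> braid_words n; Suc i < n\<rbrakk>
    \<Longrightarrow> braid_eq n (u @ [(i, e), (i, \<not> e)] @ v) (u @ v)"
| far: "\<lbrakk>u \<in> braid_words n; v \<in> braid_words n; Suc i < j; Suc j < n\<rbrakk>
    \<Longrightarrow> braid_eq n (u @ [(i, True), (j, True)] @ v) (u @ [(j, True), (i, True)] @ v)"
| artin: "\<lbrakk>u \<in> braid_words n; v \<in> braid_words n; Suc (Suc i) < n\<rbrakk>
    \<Longrightarrow> braid_eq n (u @ [(i, True), (Suc i, True), (i, True)] @ v)
                   (u @ [(Suc i, True), (i, True), (Suc i, True)] @ v)"

type_synonym braid = "braid_word set"

definition braid_class :: "nat \<Rightarrow> braid_word \<Rightarrow> braid" where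
  "braid_class n w = {v. braid_eq n w v}"

definition braids :: "nat \<Rightarrow> braid set" where
  "braids n = braid_class n ` braid_words n"

definition braid_rep :: "braid \<Rightarrow> braid_word" where
  "braid_rep b = (SOME w. w \<in> b)"

text \<open>\<open>word_perm w i\<close> is the final position of the strand starting at position \<open>i\<close>.\<close>

fun word_perm :: "braid_word \<Rightarrow> nat \<Rightarrow> nat" where
  "word_perm [] i = i"
| "word_perm ((j, e) # w) i = word_perm w (Transposition.transpose j (Suc j) i)"

definition braid_perm :: "braid \<Rightarrow> nat \<Rightarrow> nat" where
  "braid_perm b = word_perm (braid_rep b)"

definition shift_word :: "nat \<Rightarrow> braid_word \<Rightarrow> braid_word" where
  "shift_word k w = map (\<lambda>(i, e). (i + k, e)) w"

definition inverse_word :: "braid_word \<Rightarrow> braid_word" where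
  "inverse_word w = rev (map (\<lambda>(i, e). (i, \<not> e)) w)"

definition power_word :: "braid_word \<Rightarrow> int \<Rightarrow> braid_word" where
  "power_word w k =
     (if k \<ge> 0 then concat (replicate (nat k) w) else concat (replicate (nat (- k)) (inverse_word w)))"

text \<open>The block of the first \<open>p\<close> strands crosses the block of the last \<open>q\<close> strands: strand
  \<open>p - 1\<close> passes the \<open>q\<close> strands to its right, then strand \<open>p - 2\<close> does, and so on. All
  crossings are positive.\<close>

definition block_word :: "nat \<Rightarrow> nat \<Rightarrow> braid_word" where
  "block_word p q = concat (map (\<lambda>a. map (\<lambda>b. (a + b, True)) [0..<q]) (rev [0..<p]))"

text \<open>The braid underlying the full twist of \<open>r + 1\<close> parallel ribbons: the first \<open>r\<close> are fully
  twisted together, then that block and the last ribbon cross twice.\<close>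

fun full_twist_word :: "nat \<Rightarrow> braid_word" where
  "full_twist_word 0 = []"
| "full_twist_word (Suc r) = full_twist_word r @ block_word r 1 @ block_word 1 r"

text \<open>\<open>cable_word rs w\<close> replaces the strand of \<open>w\<close> starting at position \<open>i\<close> by \<open>rs ! i\<close>
  parallel strands. Inverse crossings become inverses of block crossings.\<close>

fun cable_word :: "nat list \<Rightarrow> braid_word \<Rightarrow> braid_word" where
  "cable_word rs [] = []"
| "cable_word rs ((i, e) # w) =
     (let p = rs ! i; q = rs ! Suc i in
      shift_word (sum_list (take i rs))
        (if e then block_word p q else inverse_word (block_word q p)) @
      cable_word (rs[i := q, Suc i := p]) w)"

text \<open>\<open>cable_twists rs ks\<close>: the \<open>i\<close>-th block of \<open>rs ! i\<close> parallel strands performs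
  \<open>ks ! i\<close> full twists.\<close>

definition cable_twists :: "nat list \<Rightarrow> int list \<Rightarrow> braid_word" where
  "cable_twists rs ks =
     concat (map (\<lambda>i. shift_word (sum_list (take i rs)) (power_word (full_twist_word (rs ! i)) (ks ! i)))
                 [0..<length rs])"


section \<open>Labelled ribbon braids\<close>

text \<open>An element of \<open>G\<^sup>n \<rtimes> RB\<^sub>n\<close> with \<open>RB\<^sub>n = \<int>\<^sup>n \<rtimes> B\<^sub>n\<close>. Labels and full
  twists are indexed by the starting position of the ribbon.\<close>

record 'g ribbon =
  labels :: "'g list"
  twists :: "int list"
  rbraid :: braid

definition ribbons :: "('g, 'm) monoid_scheme \<Rightarrow> nat \<Rightarrow> 'g ribbon set" where
  "ribbons G n = {g. length (labels g) = n \<and> set (labels g) \<subseteq> carrier G \<and>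
                     length (twists g) = n \<and> rbraid g \<in> braids n}"

abbreviation ribbon_perm :: "'g ribbon \<Rightarrow> nat \<Rightarrow> nat" where
  "ribbon_perm g \<equiv> braid_perm (rbraid g)"

text \<open>\<open>ribbon_mult G h g\<close> is \<open>g\<close> followed by \<open>h\<close>.\<close>

definition ribbon_mult :: "('g, 'm) monoid_scheme \<Rightarrow> 'g ribbon \<Rightarrow> 'g ribbon \<Rightarrow> 'g ribbon" where
  "ribbon_mult G h g =
     (let n = length (labels g); \<sigma> = ribbon_perm g in
      \<lparr>labels = map (\<lambda>i. labels h ! \<sigma> i \<otimes>\<^bsub>G\<^esub> labels g ! i) [0..<n],
       twists = map (\<lambda>i. twists h ! \<sigma> i + twists g ! i) [0..<n],
       rbraid = braid_class n (braid_rep (rbraid g) @ braid_rep (rbraid h))\<rparr>)"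

text \<open>An order-preserving map is the nondecreasing list of its values.\<close>

definition monotone_lists :: "nat \<Rightarrow> nat \<Rightarrow> nat list set" where
  "monotone_lists n m = {\<phi>. length \<phi> = n \<and> sorted \<phi> \<and> set \<phi> \<subseteq> {..<m}}"

text \<open>Sorting \<open>\<sigma> \<circ> \<phi>\<close> gives the order-preserving map whose fibre over \<open>\<sigma> i\<close> has as many
  elements as the fibre of \<open>\<phi>\<close> over \<open>i\<close>.\<close>

definition ribbon_push :: "'g ribbon \<Rightarrow> nat list \<Rightarrow> nat list" where
  "ribbon_push g \<phi> = sort (map (ribbon_perm g) \<phi>)"

definition ribbon_pull :: "nat list \<Rightarrow> 'g ribbon \<Rightarrow> 'g ribbon" where
  "ribbon_pull \<phi> g =
     (let rs = map (count_list \<phi>) [0..<length (labels g)] in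
      \<lparr>labels = map (\<lambda>j. labels g ! j) \<phi>,
       twists = map (\<lambda>j. twists g ! j) \<phi>,
       rbraid = braid_class (length \<phi>) (cable_twists rs (twists g) @ cable_word rs (braid_rep (rbraid g)))\<rparr>)"


section \<open>The category \<open>\<D> \<otimes> \<R>\<B> \<otimes> \<G>\<close>\<close>

text \<open>An arrow \<open>(\<phi>, g) : n \<rightarrow> m\<close>; the codomain \<open>m\<close> is recorded because the list
  representing \<open>\<phi>\<close> does not determine it. The object \<open>n\<close> stands for the set of \<open>n\<close> positions.\<close>

record 'g drbg_arr =
  codom :: nat
  omap :: "nat list"
  rib :: "'g ribbon"

definition trivial_ribbon :: "('g, 'm) monoid_scheme \<Rightarrow> nat \<Rightarrow> int \<Rightarrow> braid_word \<Rightarrow> 'g ribbon" where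
  "trivial_ribbon G n k w =
     \<lparr>labels = replicate n \<one>\<^bsub>G\<^esub>, twists = replicate n k, rbraid = braid_class n w\<rparr>"

definition ribbon_arr :: "nat \<Rightarrow> 'g ribbon \<Rightarrow> 'g drbg_arr" where
  "ribbon_arr n g = \<lparr>codom = n, omap = [0..<n], rib = g\<rparr>"

definition drbg_ident :: "('g, 'm) monoid_scheme \<Rightarrow> nat \<Rightarrow> 'g drbg_arr" where
  "drbg_ident G n = ribbon_arr n (trivial_ribbon G n 0 [])"

definition drbg_comp :: "('g, 'm) monoid_scheme \<Rightarrow> 'g drbg_arr \<Rightarrow> 'g drbg_arr \<Rightarrow> 'g drbg_arr" where
  "drbg_comp G f2 f1 =
     \<lparr>codom = codom f2,
      omap = map (\<lambda>i. omap f2 ! i) (ribbon_push (rib f2) (omap f1)),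
      rib = ribbon_mult G (ribbon_pull (omap f1) (rib f2)) (rib f1)\<rparr>"

definition drbg_tensor :: "'g drbg_arr \<Rightarrow> 'g drbg_arr \<Rightarrow> 'g drbg_arr" where
  "drbg_tensor f f' =
     \<lparr>codom = codom f + codom f',
      omap = omap f @ map (\<lambda>i. codom f + i) (omap f'),
      rib = (let n = length (omap f); n' = length (omap f') in
        \<lparr>labels = labels (rib f) @ labels (rib f'),
         twists = twists (rib f) @ twists (rib f'),
         rbraid = braid_class (n + n')
           (braid_rep (rbraid (rib f)) @ shift_word n (braid_rep (rbraid (rib f'))))\<rparr>)\<rparr>"

text \<open>The full twist of \<open>n\<close> is the full twist of \<open>n\<close> parallel ribbons together: every
  ribbon is twisted once, and the ribbons perform the full twist braid.\<close>

definition DRBG :: "('g, 'm) monoid_scheme \<Rightarrow> (nat, 'g drbg_arr) balcat" where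
  "DRBG G =
     \<lparr>Obj = UNIV,
      Arr = {f. omap f \<in> monotone_lists (length (omap f)) (codom f) \<and>
                rib f \<in> ribbons G (length (omap f))},
      Dom = (\<lambda>f. length (omap f)),
      Cod = codom,
      Ident = drbg_ident G,
      Comp = drbg_comp G,
      TObj = (+),
      TArr = drbg_tensor,
      Unit = 0,
      Assoc = (\<lambda>a b c. drbg_ident G (a + b + c)),
      LUnit = drbg_ident G,
      RUnit = drbg_ident G,
      Braid = (\<lambda>n m. ribbon_arr (n + m) (trivial_ribbon G (n + m) 0 (block_word n m))),
      Twist = (\<lambda>n. ribbon_arr n (trivial_ribbon G n 1 (full_twist_word n)))\<rparr>"

definition DRB :: "(nat, unit drbg_arr) balcat" where
  "DRB = DRBG (singleton_group ())"

end

theory Submission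
  imports Defs
begin

text \<open>
  The category \<open>DRBG G\<close> is generated under composition and tensor product by the multiplication
  \<open>2 \<rightarrow> 1\<close>, the unit \<open>0 \<rightarrow> 1\<close>, the labels, the twist of one ribbon and the crossing of two. Hence a
  balanced functor \<open>F\<close> restricts to the monoid \<open>F 1\<close> with its action of \<open>G\<close>, and a monoidal
  transformation is determined by its component at \<open>1\<close>; conversely a morphism of monoids with action
  extends to the tensor powers and is natural, because it is so on the generators. The braiding and the
  twist impose nothing, as both are preserved by \<open>F\<close> and natural in the target.

  To realize a monoid \<open>A\<close> with action as an algebra, the full subcategory on the tensor powers of \<open>A\<close> is
  made strict. There a word in the braid generators is evaluated on strands coloured by powers of \<open>A\<close>.
  Naturality of the coloured evaluation, applied to the iterated multiplications, turns the braid into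
  its cabled version, and naturality of the full twist turns a twist of one ribbon into the full twist of
  the parallel ribbons; this is the composition law of \<open>DRBG G\<close>.

  The statements about comonoids follow by passing to the opposite category, the action being
  precomposed with the inversion of \<open>G\<close>.
\<close>

text \<open>Composition in \<open>DRBG G\<close> cables a chosen representative of a braid, so every
  identity between composites raises the question whether cabling respects braid equivalence. The
  proof settles it after evaluation: \<open>ev1\<close> takes equal values on equivalent words, and
  a cabled word evaluates to the coloured evaluation of the original word. Inside
  \<open>DRBG G\<close> only two kinds of composites are computed: those whose first factor has an
  identity as its monotone part, where nothing is cabled, and those whose second factor is a flat
  ribbon on at most two strands.

  Equivalences are obtained from fully faithful and essentially surjective functors, a notion that
  composes and dualizes well. The functor is evaluation at the object 1. It is essentially
  surjective only up to isomorphism: the first tensor power of \<open>A\<close> is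
  \<open>A \<diamondop> Unit C\<close>, so a monoid on \<open>A\<close> is first moved there along
  the right unitor.

  For a strict target the same realization is already a strict functor, and thus the strict
  statements follow from the general ones. The trivial group gives the statements without
  \<open>G\<close>.\<close>

lemma in_Hom: "f \<in> Hom C a b \<longleftrightarrow> f \<in> Arr C \<and> Dom C f = a \<and> Cod C f = b"
  by (simp add: Hom_def)

section \<open>Calculus of composites and inverses in a category\<close>

context category
begin

lemma comp_arr [simp]:
  assumes "f \<in> Arr C" "g \<in> Arr C" "Cod C f = Dom C g"
  shows "g \<cdot> f \<in> Arr C" "Dom C (g \<cdot> f) = Dom C f" "Cod C (g \<cdot> f) = Cod C g"
  using comp_hom[of f "Dom C f" "Dom C g" g "Cod C g"] assms by (auto simp: in_Hom)

lemma ident_arr [simp]: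
  assumes "a \<in> Obj C"
  shows "Ident C a \<in> Arr C" "Dom C (Ident C a) = a" "Cod C (Ident C a) = a"
  using ident_hom[OF assms] by (auto simp: in_Hom)

declare dom_obj [simp] cod_obj [simp]

lemma ident_comp [simp]: "f \<in> Arr C \<Longrightarrow> Cod C f = b \<Longrightarrow> Ident C b \<cdot> f = f"
  using comp_ident_left[of f "Dom C f" b] by (auto simp: in_Hom)

lemma comp_ident [simp]: "f \<in> Arr C \<Longrightarrow> Dom C f = b \<Longrightarrow> f \<cdot> Ident C b = f"
  using comp_ident_right[of f b "Cod C f"] by (auto simp: in_Hom)

lemma assoc [simp]:
  "\<lbrakk>f \<in> Arr C; g \<in> Arr C; h \<in> Arr C; Cod C f = Dom C g; Cod C g = Dom C h\<rbrakk>
    \<Longrightarrow> (h \<cdot> g) \<cdot> f = h \<cdot> g \<cdot> f"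
  using comp_assoc[of f "Dom C f" "Dom C g" g "Dom C h" h "Cod C h"] by (auto simp: in_Hom)

text \<open>The simplifier nests composites to the right, which hides the pair
  \<open>g \<cdot> f\<close> inside \<open>g \<cdot> f \<cdot> h\<close>. This form and the next
  apply an equation at the head of a longer composite.\<close>

lemma comp_rewrite:
  assumes "g \<cdot> f = k" "f \<in> Arr C" "g \<in> Arr C" "Cod C f = Dom C g" "h \<in> Arr C" "Cod C h = Dom C f"
  shows "g \<cdot> f \<cdot> h = k \<cdot> h"
  using assms by (simp flip: assoc)

lemma comp_rewrite2:
  assumes "g \<cdot> f = g' \<cdot> f'" "f \<in> Arr C" "g \<in> Arr C" "Cod C f = Dom C g"
    "f' \<in> Arr C" "g' \<in> Arr C" "Cod C f' = Dom C g'" "h \<in> Arr C" "Cod C h = Dom C f" "Dom C f = Dom C f'"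
  shows "g \<cdot> f \<cdot> h = g' \<cdot> f' \<cdot> h"
  using assms by (simp flip: assoc)

lemma inverse_arrows_unique: "inverse_arrows C f g \<Longrightarrow> inverse_arrows C f g' \<Longrightarrow> g = g'"
  unfolding inverse_arrows_def in_Hom
  by (metis assoc comp_ident ident_comp)

lemma inverse_arrowI: "inverse_arrows C f g \<Longrightarrow> inverse_arrow C f = g"
  unfolding inverse_arrow_def using inverse_arrows_unique by blast

lemma inverse_arrows_inverse_arrow: "iso_arrow C f \<Longrightarrow> inverse_arrows C f (inverse_arrow C f)"
  using inverse_arrowI unfolding iso_arrow_def by blast

lemma inverse_arrow [simp]:
  assumes "iso_arrow C f"
  shows "inverse_arrow C f \<in> Arr C" "Dom C (inverse_arrow C f) = Cod C f"
    "Cod C (inverse_arrow C f) = Dom C f"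
    "inverse_arrow C f \<cdot> f = Ident C (Dom C f)" "f \<cdot> inverse_arrow C f = Ident C (Cod C f)"
  using inverse_arrows_inverse_arrow[OF assms] unfolding inverse_arrows_def in_Hom by auto

lemma iso_arrow_arr: "iso_arrow C f \<Longrightarrow> f \<in> Arr C"
  unfolding iso_arrow_def inverse_arrows_def by blast

lemma inverse_arrow_comp [simp]:
  assumes "iso_arrow C f" "h \<in> Arr C"
  shows "Cod C h = Dom C f \<Longrightarrow> inverse_arrow C f \<cdot> f \<cdot> h = h"
    and "Cod C h = Cod C f \<Longrightarrow> f \<cdot> inverse_arrow C f \<cdot> h = h"
  using assms iso_arrow_arr[OF assms(1)] by (simp_all flip: assoc)

lemma inverse_arrows_sym: "inverse_arrows C f g \<Longrightarrow> inverse_arrows C g f"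
  unfolding inverse_arrows_def in_Hom by auto

lemma iso_inverse_arrow [simp]: "iso_arrow C f \<Longrightarrow> iso_arrow C (inverse_arrow C f)"
  using inverse_arrows_inverse_arrow inverse_arrows_sym unfolding iso_arrow_def by blast

lemma inverse_inverse_arrow [simp]: "iso_arrow C f \<Longrightarrow> inverse_arrow C (inverse_arrow C f) = f"
  using inverse_arrows_inverse_arrow inverse_arrows_sym inverse_arrowI by blast

lemma inverse_arrows_ident: "a \<in> Obj C \<Longrightarrow> inverse_arrows C (Ident C a) (Ident C a)"
  unfolding inverse_arrows_def in_Hom by auto

lemma iso_ident [simp]: "a \<in> Obj C \<Longrightarrow> iso_arrow C (Ident C a)"
  using inverse_arrows_ident unfolding iso_arrow_def by blast

lemma inverse_ident [simp]: "a \<in> Obj C \<Longrightarrow> inverse_arrow C (Ident C a) = Ident C a"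
  using inverse_arrows_ident inverse_arrowI by blast

lemma inverse_arrows_comp:
  assumes "iso_arrow C f" "iso_arrow C g" "Cod C f = Dom C g"
  shows "inverse_arrows C (g \<cdot> f) (inverse_arrow C f \<cdot> inverse_arrow C g)"
  using assms iso_arrow_arr[OF assms(1)] iso_arrow_arr[OF assms(2)]
  unfolding inverse_arrows_def in_Hom by simp

lemma iso_comp [simp]:
  "\<lbrakk>iso_arrow C f; iso_arrow C g; Cod C f = Dom C g\<rbrakk> \<Longrightarrow> iso_arrow C (g \<cdot> f)"
  using inverse_arrows_comp unfolding iso_arrow_def by blast

lemma inverse_comp:
  "\<lbrakk>iso_arrow C f; iso_arrow C g; Cod C f = Dom C g\<rbrakk> \<Longrightarrow>
    inverse_arrow C (g \<cdot> f) = inverse_arrow C f \<cdot> inverse_arrow C g"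
  using inverse_arrows_comp inverse_arrowI by blast

lemma iso_cancel_left:
  assumes "iso_arrow C f" "g \<in> Arr C" "h \<in> Arr C" "Cod C g = Dom C f" "Cod C h = Dom C f"
  shows "f \<cdot> g = f \<cdot> h \<longleftrightarrow> g = h"
  using assms by (metis inverse_arrow_comp(1))

lemma iso_cancel_right:
  assumes "iso_arrow C f" "g \<in> Arr C" "h \<in> Arr C" "Dom C g = Cod C f" "Dom C h = Cod C f"
  shows "g \<cdot> f = h \<cdot> f \<longleftrightarrow> g = h"
  using assms iso_arrow_arr[OF assms(1)] by (metis inverse_arrow(1,3,5) assoc comp_ident)

lemma iso_move_left:
  assumes "iso_arrow C f" "g \<in> Arr C" "h \<in> Arr C" "Cod C g = Dom C f" "Cod C h = Cod C f"
  shows "f \<cdot> g = h \<longleftrightarrow> g = inverse_arrow C f \<cdot> h"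
  using assms by (metis inverse_arrow_comp)

lemma iso_move_right:
  assumes "iso_arrow C f" "g \<in> Arr C" "h \<in> Arr C" "Dom C g = Cod C f" "Dom C h = Dom C f"
  shows "g \<cdot> f = h \<longleftrightarrow> g = h \<cdot> inverse_arrow C f"
  using assms iso_arrow_arr[OF assms(1)]
  by (metis assoc comp_ident inverse_arrow)

end

section \<open>Equivalences\<close>

lemma (in category) is_functorD:
  assumes "is_functor C D F"
  shows "a \<in> Obj C \<Longrightarrow> FObj F a \<in> Obj D"
    and "f \<in> Arr C \<Longrightarrow> FArr F f \<in> Arr D"
    and "f \<in> Arr C \<Longrightarrow> Dom D (FArr F f) = FObj F (Dom C f)"
    and "f \<in> Arr C \<Longrightarrow> Cod D (FArr F f) = FObj F (Cod C f)"
    and "a \<in> Obj C \<Longrightarrow> FArr F (Ident C a) = Ident D (FObj F a)"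
    and "f \<in> Arr C \<Longrightarrow> g \<in> Arr C \<Longrightarrow> Cod C f = Dom C g \<Longrightarrow> FArr F (g \<cdot> f) = FArr F g \<cdot>\<^bsub>D\<^esub> FArr F f"
  using assms unfolding is_functor_def in_Hom by (auto dest: PiE_mem)

lemma (in category) functor_inverse_arrows:
  assumes "is_functor C D F" "iso_arrow C f"
  shows "inverse_arrows D (FArr F f) (FArr F (inverse_arrow C f))"
  using assms(2) iso_arrow_arr[OF assms(2)] unfolding inverse_arrows_def in_Hom
  by (simp add: is_functorD[OF assms(1)] flip: is_functorD(6)[OF assms(1)])

lemma (in category) functor_iso:
  "is_functor C D F \<Longrightarrow> iso_arrow C f \<Longrightarrow> iso_arrow D (FArr F f)"
  using functor_inverse_arrows unfolding iso_arrow_def by blast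

definition fully_faithful ::
  "('o1, 'a1, 'm1) cat_scheme \<Rightarrow> ('o2, 'a2, 'm2) cat_scheme \<Rightarrow> ('o1, 'a1, 'o2, 'a2) func \<Rightarrow> bool" where
  "fully_faithful C D F \<longleftrightarrow>
     is_functor C D F \<and>
     (\<forall>a\<in>Obj C. \<forall>b\<in>Obj C. bij_betw (FArr F) (Hom C a b) (Hom D (FObj F a) (FObj F b)))"

definition weak_equivalence ::
  "('o1, 'a1, 'm1) cat_scheme \<Rightarrow> ('o2, 'a2, 'm2) cat_scheme \<Rightarrow> ('o1, 'a1, 'o2, 'a2) func \<Rightarrow> bool" where
  "weak_equivalence C D F \<longleftrightarrow> fully_faithful C D F \<and>
     (\<forall>d\<in>Obj D. \<exists>a\<in>Obj C. \<exists>f\<in>Hom D (FObj F a) d. iso_arrow D f)"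

text \<open>Choose for every \<open>d\<close> an object \<open>s d\<close> and an isomorphism
  \<open>e d\<close> from its image to \<open>d\<close>; the quasi-inverse lifts the conjugate of an
  arrow by these isomorphisms. All laws are checked after applying \<open>F\<close>, which is
  injective on parallel arrows (\<open>inj\<close>).\<close>

lemma weak_equivalence_imp_equivalent:
  assumes "category C" "category D" "weak_equivalence C D F"
  shows "C \<simeq>\<^sub>C D"
proof -
  interpret C: category C by fact
  interpret D: category D by fact
  have F: "is_functor C D F"
    and ff: "\<And>a b. a \<in> Obj C \<Longrightarrow> b \<in> Obj C \<Longrightarrow> bij_betw (FArr F) (Hom C a b) (Hom D (FObj F a) (FObj F b))"
    and es: "\<And>d. d \<in> Obj D \<Longrightarrow> \<exists>a f. a \<in> Obj C \<and> f \<in> Hom D (FObj F a) d \<and> iso_arrow D f"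
    using assms(3) unfolding weak_equivalence_def fully_faithful_def by blast+
  note F' [simp] = C.is_functorD[OF F]
  obtain s e where "\<And>d. d \<in> Obj D \<Longrightarrow> s d \<in> Obj C \<and> e d \<in> Hom D (FObj F (s d)) d \<and> iso_arrow D (e d)"
    using es by metis
  then have s [simp]: "\<And>d. d \<in> Obj D \<Longrightarrow> s d \<in> Obj C"
    and e [simp]: "\<And>d. d \<in> Obj D \<Longrightarrow> e d \<in> Arr D" "\<And>d. d \<in> Obj D \<Longrightarrow> Dom D (e d) = FObj F (s d)"
      "\<And>d. d \<in> Obj D \<Longrightarrow> Cod D (e d) = d" "\<And>d. d \<in> Obj D \<Longrightarrow> iso_arrow D (e d)"
    unfolding in_Hom by auto
  define lft where "lft a b h = inv_into (Hom C a b) (FArr F) h" for a b h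
  have lft [simp]: "lft a b h \<in> Arr C" "Dom C (lft a b h) = a" "Cod C (lft a b h) = b" "FArr F (lft a b h) = h"
    if "a \<in> Obj C" "b \<in> Obj C" "h \<in> Arr D" "Dom D h = FObj F a" "Cod D h = FObj F b" for a b h
  proof -
    have h: "h \<in> FArr F ` Hom C a b"
      using ff[OF that(1,2)] that unfolding bij_betw_def by (auto simp: in_Hom)
    show "lft a b h \<in> Arr C" "Dom C (lft a b h) = a" "Cod C (lft a b h) = b"
      using inv_into_into[OF h] unfolding lft_def in_Hom by auto
    show "FArr F (lft a b h) = h" using f_inv_into_f[OF h] unfolding lft_def .
  qed
  have inj: "f = g" if "FArr F f = FArr F g" "f \<in> Arr C" "g \<in> Arr C" "Dom C f = Dom C g" "Cod C f = Cod C g" for f g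
    using ff[of "Dom C f" "Cod C f"] that unfolding bij_betw_def inj_on_def by (simp add: in_Hom)
  define H where "H = \<lparr>FObj = (\<lambda>d\<in>Obj D. s d),
    FArr = (\<lambda>f\<in>Arr D. lft (s (Dom D f)) (s (Cod D f)) (inverse_arrow D (e (Cod D f)) \<cdot>\<^bsub>D\<^esub> f \<cdot>\<^bsub>D\<^esub> e (Dom D f)))\<rparr>"
  have H: "is_functor D C H"
    unfolding is_functor_def in_Hom H_def by (auto intro!: inj)
  have nD: "naturally_isomorphic D D (comp_func D F H) (id_func D)"
    unfolding naturally_isomorphic_def is_nat_trans_def
    by (rule exI[of _ "\<lambda>d\<in>Obj D. e d"]) (auto simp: in_Hom comp_func_def id_func_def H_def)
  \<comment> \<open>By fullness the isomorphism \<open>e\<close> at \<open>FObj F c\<close> is the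
    image of an arrow into \<open>c\<close>; this lift is the component at \<open>c\<close> of the
    second natural isomorphism.\<close>
  define b where "b = (\<lambda>c\<in>Obj C. lft (s (FObj F c)) c (e (FObj F c)))"
  have b [simp]: "b c \<in> Arr C" "Dom C (b c) = s (FObj F c)" "Cod C (b c) = c" "FArr F (b c) = e (FObj F c)"
    if "c \<in> Obj C" for c
    using that by (simp_all add: b_def)
  have b_iso: "iso_arrow C (b c)" if "c \<in> Obj C" for c
  proof -
    have "inverse_arrows C (b c) (lft c (s (FObj F c)) (inverse_arrow D (e (FObj F c))))"
      using that unfolding inverse_arrows_def in_Hom by (auto intro!: inj)
    then show ?thesis unfolding iso_arrow_def by blast
  qed
  have nC: "naturally_isomorphic C C (comp_func C H F) (id_func C)"
    unfolding naturally_isomorphic_def is_nat_trans_def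
    by (rule exI[of _ b]) (auto simp: in_Hom comp_func_def id_func_def H_def b_iso intro!: inj, simp add: b_def)
  show ?thesis
    unfolding equivalent_categories_def using assms(1,2) F H nC nD by blast
qed

lemma fully_faithful_comp:
  assumes "category C" "category D" "category E" "fully_faithful C D F" "fully_faithful D E H"
  shows "fully_faithful C E (comp_func C H F)"
proof -
  interpret C: category C by fact
  interpret D: category D by fact
  interpret E: category E by fact
  have F: "is_functor C D F" and H: "is_functor D E H"
    using assms(4,5) unfolding fully_faithful_def by blast+
  note F' [simp] = C.is_functorD[OF F] and H' [simp] = D.is_functorD[OF H]
  have ffF: "\<And>a b. a \<in> Obj C \<Longrightarrow> b \<in> Obj C \<Longrightarrow> bij_betw (FArr F) (Hom C a b) (Hom D (FObj F a) (FObj F b))"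
    and ffH: "\<And>a b. a \<in> Obj D \<Longrightarrow> b \<in> Obj D \<Longrightarrow> bij_betw (FArr H) (Hom D a b) (Hom E (FObj H a) (FObj H b))"
    using assms(4,5) unfolding fully_faithful_def by blast+
  have fu: "is_functor C E (comp_func C H F)"
    unfolding is_functor_def in_Hom comp_func_def by auto
  have "bij_betw (FArr (comp_func C H F)) (Hom C a b) (Hom E (FObj (comp_func C H F) a) (FObj (comp_func C H F) b))"
    if "a \<in> Obj C" "b \<in> Obj C" for a b
  proof -
    have "bij_betw (FArr H \<circ> FArr F) (Hom C a b) (Hom E (FObj H (FObj F a)) (FObj H (FObj F b)))"
      using ffF[OF that] ffH[of "FObj F a" "FObj F b"] that by (auto intro: bij_betw_trans)
    then show ?thesis
      using that by (subst bij_betw_cong[of _ _ "FArr H \<circ> FArr F"]) (auto simp: comp_func_def in_Hom)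
  qed
  then show ?thesis unfolding fully_faithful_def using fu by blast
qed

lemma weak_equivalence_comp:
  assumes "category C" "category D" "category E" "weak_equivalence C D F" "weak_equivalence D E H"
  shows "weak_equivalence C E (comp_func C H F)"
  unfolding weak_equivalence_def
proof (intro conjI ballI)
  interpret C: category C by fact
  interpret D: category D by fact
  interpret E: category E by fact
  show "fully_faithful C E (comp_func C H F)"
    using assms fully_faithful_comp unfolding weak_equivalence_def by blast
  have H: "is_functor D E H"
    using assms(5) unfolding weak_equivalence_def fully_faithful_def by blast
  note H' [simp] = D.is_functorD[OF H]
  fix d assume d: "d \<in> Obj E"
  obtain b g where b: "b \<in> Obj D" "g \<in> Hom E (FObj H b) d" "iso_arrow E g"
    using assms(5) d unfolding weak_equivalence_def by blast
  obtain a f where a: "a \<in> Obj C" "f \<in> Hom D (FObj F a) b" "iso_arrow D f"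
    using assms(4) b unfolding weak_equivalence_def by blast
  have "iso_arrow E (FArr H f)" using D.functor_iso[OF H a(3)] .
  then have "iso_arrow E (g \<cdot>\<^bsub>E\<^esub> FArr H f)" "g \<cdot>\<^bsub>E\<^esub> FArr H f \<in> Hom E (FObj (comp_func C H F) a) d"
    using a b by (auto simp: in_Hom comp_func_def)
  then show "\<exists>a\<in>Obj C. \<exists>f\<in>Hom E (FObj (comp_func C H F) a) d. iso_arrow E f" using a(1) by blast
qed

text \<open>For the plain categories of algebras, monoids and functors; \<open>opposite\<close> is
  the version that also carries a balanced structure.\<close>

definition dual :: "('o, 'a, 'm) cat_scheme \<Rightarrow> ('o, 'a) cat" where
  "dual C = \<lparr>Obj = Obj C, Arr = Arr C, Dom = Cod C, Cod = Dom C, Ident = Ident C, Comp = (\<lambda>g f. f \<cdot>\<^bsub>C\<^esub> g)\<rparr>"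

lemma dual_sel [simp]:
  "Obj (dual C) = Obj C" "Arr (dual C) = Arr C" "Dom (dual C) = Cod C" "Cod (dual C) = Dom C"
  "Ident (dual C) = Ident C" "Comp (dual C) g f = f \<cdot>\<^bsub>C\<^esub> g" "Hom (dual C) a b = Hom C b a"
  by (auto simp: dual_def Hom_def)

lemma iso_arrow_dual [simp]: "iso_arrow (dual C) f = iso_arrow C f"
  unfolding iso_arrow_def inverse_arrows_def by auto

lemma category_dual: "category C \<Longrightarrow> category (dual C)"
proof -
  assume "category C"
  then interpret category C .
  show ?thesis by unfold_locales (auto simp: in_Hom)
qed

lemma weak_equivalence_dual:
  assumes "category C" "category D" "weak_equivalence C D F"
  shows "weak_equivalence (dual C) (dual D) F"
proof -
  interpret C: category C by fact
  interpret D: category D by fact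
  have F: "is_functor C D F"
    and es: "\<And>d. d \<in> Obj D \<Longrightarrow> \<exists>a\<in>Obj C. \<exists>f\<in>Hom D (FObj F a) d. iso_arrow D f"
    and ff: "\<And>a b. a \<in> Obj C \<Longrightarrow> b \<in> Obj C \<Longrightarrow> bij_betw (FArr F) (Hom C a b) (Hom D (FObj F a) (FObj F b))"
    using assms(3) unfolding weak_equivalence_def fully_faithful_def by blast+
  have "is_functor (dual C) (dual D) F"
    using F unfolding is_functor_def by (auto simp: in_Hom)
  moreover have "\<exists>a\<in>Obj C. \<exists>f\<in>Hom D d (FObj F a). iso_arrow D f" if d: "d \<in> Obj D" for d
  proof -
    obtain a f where "a \<in> Obj C" "f \<in> Hom D (FObj F a) d" "iso_arrow D f"
      using es[OF d] by blast
    then show ?thesis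
      by (intro bexI[of _ a] bexI[of _ "inverse_arrow D f"]) (auto simp: in_Hom)
  qed
  ultimately show ?thesis
    unfolding weak_equivalence_def fully_faithful_def using ff by simp
qed

section \<open>Braid words\<close>

lemma braid_words_simps [simp]:
  "[] \<in> braid_words n"
  "(i, e) # w \<in> braid_words n \<longleftrightarrow> Suc i < n \<and> w \<in> braid_words n"
  "v @ w \<in> braid_words n \<longleftrightarrow> v \<in> braid_words n \<and> w \<in> braid_words n"
  by (auto simp: braid_words_def)

lemma braid_words_small: "n < 2 \<Longrightarrow> w \<in> braid_words n \<longleftrightarrow> w = []"
  by (cases w) (auto simp: braid_words_def)

lemma braid_words_mono: "w \<in> braid_words n \<Longrightarrow> n \<le> m \<Longrightarrow> w \<in> braid_words m"
  by (induction w) auto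

lemma shift_word_simps [simp]:
  "shift_word k [] = []"
  "shift_word k ((i, e) # w) = (i + k, e) # shift_word k w"
  "shift_word k (v @ w) = shift_word k v @ shift_word k w"
  "shift_word k (shift_word l w) = shift_word (k + l) w"
  "shift_word 0 w = w"
  by (auto simp: shift_word_def)

lemma shift_braid_words [simp]: "w \<in> braid_words n \<Longrightarrow> shift_word k w \<in> braid_words (k + n)"
  by (induction w) auto

lemma shift_braid_words': "w \<in> braid_words n \<Longrightarrow> k + n \<le> m \<Longrightarrow> shift_word k w \<in> braid_words m"
  using braid_words_mono[OF shift_braid_words] .

lemma inverse_word_simps [simp]:
  "inverse_word [] = []"
  "inverse_word ((i, e) # w) = inverse_word w @ [(i, \<not> e)]"
  by (auto simp: inverse_word_def)

lemma inverse_braid_words [simp]: "w \<in> braid_words n \<Longrightarrow> inverse_word w \<in> braid_words n"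
  by (induction w) auto

lemma block_word_simps:
  "block_word 0 q = []" "block_word p 0 = []"
  "block_word (Suc p) q = shift_word p (block_word 1 q) @ block_word p q"
  "block_word 1 (Suc q) = block_word 1 q @ [(q, True)]"
  by (auto simp: block_word_def shift_word_def comp_def add.commute)

lemma block_word_1: "block_word (Suc 0) 0 = []" "block_word (Suc 0) (Suc q) = block_word (Suc 0) q @ [(q, True)]"
  using block_word_simps(2)[of 1] block_word_simps(4)[of q] by simp_all

lemma block_1_braid_words: "block_word (Suc 0) q \<in> braid_words (Suc q)"
proof (induction q)
  case (Suc q)
  then show ?case using braid_words_mono[of _ "Suc q" "Suc (Suc q)"] by (simp add: block_word_1)
qed (simp add: block_word_1)

lemma block_braid_words [simp]: "block_word p q \<in> braid_words (p + q)"
proof (induction p)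
  case (Suc p)
  have "shift_word p (block_word (Suc 0) q) \<in> braid_words (p + Suc q)"
    by (rule shift_braid_words[OF block_1_braid_words])
  with Suc show ?case using braid_words_mono[of _ "p + q" "Suc (p + q)"] by (subst block_word_simps(3)) simp
qed (simp add: block_word_simps)

lemma full_twist_braid_words [simp]: "full_twist_word r \<in> braid_words r"
proof (induction r)
  case (Suc r)
  have "block_word r 1 \<in> braid_words (Suc r)" "block_word 1 r \<in> braid_words (Suc r)"
    using block_braid_words[of r 1] block_braid_words[of 1 r] by simp_all
  with Suc show ?case using braid_words_mono[of _ r "Suc r"] by simp
qed simp

lemma concat_replicate_braid_words: "w \<in> braid_words n \<Longrightarrow> concat (replicate k w) \<in> braid_words n"
  by (induction k) auto

lemma power_braid_words [simp]: "w \<in> braid_words n \<Longrightarrow> power_word w k \<in> braid_words n"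
  by (simp add: power_word_def concat_replicate_braid_words)

section \<open>Permutation of lists by braid words\<close>

definition swap_at :: "nat \<Rightarrow> 'x list \<Rightarrow> 'x list" where
  "swap_at i xs = xs[i := xs ! Suc i, Suc i := xs ! i]"

lemma swap_at_append [simp]: "swap_at (length us) (us @ a # b # vs) = us @ b # a # vs"
  by (simp add: swap_at_def nth_append list_update_append)

text \<open>With the list split around the two exchanged entries, the expressions in
  \<open>take\<close>, \<open>drop\<close> and \<open>!\<close> that describe a letter all simplify,
  so no index arithmetic remains.\<close>

lemma swap_at_cases:
  assumes "Suc i < length xs"
  obtains us a b vs where "xs = us @ a # b # vs" "i = length us"
proof
  show "xs = take i xs @ xs ! i # xs ! Suc i # drop (Suc (Suc i)) xs"
    using assms by (simp add: Cons_nth_drop_Suc)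
  show "i = length (take i xs)" using assms by simp
qed

lemma length_swap_at [simp]: "length (swap_at i xs) = length xs"
  by (simp add: swap_at_def)

lemma swap_at_replicate [simp]: "swap_at i (replicate n x) = replicate n x" if "Suc i < n"
  using that by (intro nth_equalityI) (auto simp: swap_at_def nth_list_update)

lemma map_swap_at: "Suc i < length xs \<Longrightarrow> map f (swap_at i xs) = swap_at i (map f xs)"
  by (simp add: swap_at_def map_update)

lemma sum_list_swap_at [simp]: "sum_list (swap_at i xs) = sum_list xs"
  if "Suc i < length xs" for xs :: "nat list"
  using that by (elim swap_at_cases) simp

lemma set_swap_at [simp]: "set (swap_at i xs) = set xs" if "Suc i < length xs"
  using that by (elim swap_at_cases) auto

lemma swap_at_swap_at [simp]: "swap_at i (swap_at i xs) = xs" if "Suc i < length xs"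
  using that by (elim swap_at_cases) auto

text \<open>A list of data attached to the strands is carried from their starting to their final
  positions.\<close>

fun act_word :: "braid_word \<Rightarrow> 'x list \<Rightarrow> 'x list" where
  "act_word [] xs = xs"
| "act_word ((i, e) # w) xs = act_word w (swap_at i xs)"

lemma length_act_word [simp]: "length (act_word w xs) = length xs"
  by (induction w xs rule: act_word.induct) auto

lemma act_word_replicate [simp]: "w \<in> braid_words n \<Longrightarrow> act_word w (replicate n x) = replicate n x"
  by (induction w) auto

lemma map_act_word: "w \<in> braid_words (length xs) \<Longrightarrow> map f (act_word w xs) = act_word w (map f xs)"
  by (induction w xs rule: act_word.induct) (auto simp: map_swap_at)

lemma sum_list_act_word [simp]: "w \<in> braid_words (length xs) \<Longrightarrow> sum_list (act_word w xs) = sum_list xs"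
  for xs :: "nat list"
  by (induction w xs rule: act_word.induct) auto

lemma set_act_word [simp]: "w \<in> braid_words (length xs) \<Longrightarrow> set (act_word w xs) = set xs"
  by (induction w xs rule: act_word.induct) auto

lemma act_word_append [simp]: "act_word (v @ w) xs = act_word w (act_word v xs)"
  by (induction v xs rule: act_word.induct) auto

text \<open>Links two descriptions of the same permutation: moving all entries letter by letter, and
  following one strand to its end. It translates naturality of the evaluation into statements about
  labels and fibre sizes, which are indexed by starting positions.\<close>

lemma act_word_nth:
  "w \<in> braid_words (length xs) \<Longrightarrow> i < length xs \<Longrightarrow>
    word_perm w i < length xs \<and> act_word w xs ! word_perm w i = xs ! i"
proof (induction w xs arbitrary: i rule: act_word.induct)
  case (2 j e w xs)
  have t: "Transposition.transpose j (Suc j) i < length xs"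
    "swap_at j xs ! Transposition.transpose j (Suc j) i = xs ! i"
    using 2(2,3) by (auto simp: Transposition.transpose_def swap_at_def nth_list_update)
  then show ?case using 2(1)[of "Transposition.transpose j (Suc j) i"] 2(2) by auto
qed simp

lemma word_perm_inj: "word_perm w i = word_perm w j \<Longrightarrow> i = j"
  by (induction w i arbitrary: j rule: word_perm.induct) (auto, metis transpose_involutory)

lemma bij_word_perm:
  assumes "w \<in> braid_words n"
  shows "bij_betw (word_perm w) {..<n} {..<n}"
proof -
  have "inj_on (word_perm w) {..<n}" by (auto intro: inj_onI word_perm_inj)
  moreover have "word_perm w ` {..<n} \<subseteq> {..<n}"
    using act_word_nth[of w "replicate n ()"] assms by auto
  ultimately show ?thesis by (simp add: bij_betw_def endo_inj_surj)
qed

lemma word_perm_append [simp]: "word_perm (v @ w) i = word_perm w (word_perm v i)"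
  by (induction v i rule: word_perm.induct) auto

section \<open>Braid equivalence and representatives\<close>

lemma braid_eq_words: "braid_eq n v w \<Longrightarrow> v \<in> braid_words n \<and> w \<in> braid_words n"
  by (induction rule: braid_eq.induct) auto

lemma braid_eq_perm: "braid_eq n v w \<Longrightarrow> word_perm v = word_perm w"
proof (induction rule: braid_eq.induct)
  case (far u v i j)
  then show ?case by (intro ext) (auto simp: Transposition.transpose_def)
next
  case (artin u v i)
  then show ?case by (intro ext) (auto simp: Transposition.transpose_def)
qed auto

lemma braid_eq_append:
  assumes "braid_eq n v w" "u \<in> braid_words n" "z \<in> braid_words n"
  shows "braid_eq n (u @ v @ z) (u @ w @ z)"
  using assms(1)
proof (induction rule: braid_eq.induct)
  case (cancel a b i e)
  then show ?case using braid_eq.cancel[of "u @ a" n "b @ z" i e] assms by simp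
next
  case (far a b i j)
  then show ?case using braid_eq.far[of "u @ a" n "b @ z" i j] assms by simp
next
  case (artin a b i)
  then show ?case using braid_eq.artin[of "u @ a" n "b @ z" i] assms by simp
qed (use assms in \<open>auto intro: braid_eq.intros\<close>)

lemma braid_eq_append2:
  "braid_eq n v v' \<Longrightarrow> braid_eq n w w' \<Longrightarrow> braid_eq n (v @ w) (v' @ w')"
  using braid_eq_append[of n v v' "[]" w] braid_eq_append[of n w w' v' "[]"] braid_eq_words
  by (auto intro: braid_eq.trans)

lemma braid_eq_shift:
  "braid_eq n v w \<Longrightarrow> k + n \<le> m \<Longrightarrow> braid_eq m (shift_word k v) (shift_word k w)"
proof (induction rule: braid_eq.induct)
  case (cancel a b i e)
  then have "shift_word k a \<in> braid_words m" "shift_word k b \<in> braid_words m"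
    by (auto intro: shift_braid_words')
  then show ?case using braid_eq.cancel[of "shift_word k a" m "shift_word k b" "i + k" e] cancel by simp
next
  case (far a b i j)
  then have "shift_word k a \<in> braid_words m" "shift_word k b \<in> braid_words m"
    by (auto intro: shift_braid_words')
  then show ?case using braid_eq.far[of "shift_word k a" m "shift_word k b" "i + k" "j + k"] far by simp
next
  case (artin a b i)
  then have "shift_word k a \<in> braid_words m" "shift_word k b \<in> braid_words m"
    by (auto intro: shift_braid_words')
  then show ?case using braid_eq.artin[of "shift_word k a" m "shift_word k b" "i + k"] artin by simp
qed (auto intro: braid_eq.intros shift_braid_words')

lemma braid_class_eq: "braid_eq n v w \<Longrightarrow> braid_class n v = braid_class n w"
  by (auto simp: braid_class_def intro: braid_eq.intros)

lemma braid_rep_class: "w \<in> braid_words n \<Longrightarrow> braid_eq n w (braid_rep (braid_class n w))"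
  unfolding braid_rep_def braid_class_def
  by (rule someI2[of _ w]) (auto intro: braid_eq.intros)

lemma braid_class_rep: "b \<in> braids n \<Longrightarrow> braid_class n (braid_rep b) = b"
  unfolding braids_def using braid_rep_class braid_class_eq by fastforce

lemma braid_rep_words: "b \<in> braids n \<Longrightarrow> braid_rep b \<in> braid_words n"
  unfolding braids_def using braid_rep_class braid_eq_words by blast

lemma braid_class_braids [simp]: "w \<in> braid_words n \<Longrightarrow> braid_class n w \<in> braids n"
  by (auto simp: braids_def)

lemma braid_rep_class_words [simp]: "w \<in> braid_words n \<Longrightarrow> braid_rep (braid_class n w) \<in> braid_words n"
  by (simp add: braid_rep_words)

lemma braid_perm_class: "w \<in> braid_words n \<Longrightarrow> braid_perm (braid_class n w) = word_perm w"
  unfolding braid_perm_def using braid_rep_class braid_eq_perm by metis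

section \<open>Strand numbers of cabled words\<close>

lemma cable_letter_braid_words:
  "(if e then block_word m n else inverse_word (block_word n m)) \<in> braid_words (m + n)"
  using block_braid_words[of m n] block_braid_words[of n m] by (simp add: add.commute)

lemma cable_word_braid_words:
  "w \<in> braid_words (length ns) \<Longrightarrow> cable_word ns w \<in> braid_words (sum_list ns)"
proof (induction w arbitrary: ns)
  case (Cons l w)
  obtain i e where l: "l = (i, e)" by force
  have i: "Suc i < length ns" and w: "w \<in> braid_words (length ns)" using Cons.prems l by auto
  show ?case using i
  proof (cases rule: swap_at_cases)
    case (1 us m n vs)
    have "cable_word ns (l # w) = shift_word (sum_list us) (if e then block_word m n else inverse_word (block_word n m))
        @ cable_word (swap_at i ns) w"
      using 1 by (simp add: l swap_at_def nth_append list_update_append)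
    moreover have "cable_word (swap_at i ns) w \<in> braid_words (sum_list ns)"
      using Cons.IH[of "swap_at i ns"] i w by simp
    moreover have "shift_word (sum_list us) (if e then block_word m n else inverse_word (block_word n m)) \<in> braid_words (sum_list ns)"
      by (rule shift_braid_words'[OF cable_letter_braid_words]) (simp add: 1)
    ultimately show ?thesis by simp
  qed
qed simp

text \<open>The offset of a block depends only on the blocks before it, so the definition by indices
  becomes a recursion that removes the last block.\<close>

lemma cable_twists_snoc:
  assumes "length ks = length ns"
  shows "cable_twists (ns @ [n]) (ks @ [k]) = cable_twists ns ks @ shift_word (sum_list ns) (power_word (full_twist_word n) k)"
proof -
  define F where "F = (\<lambda>i. shift_word (sum_list (take i (ns @ [n]))) (power_word (full_twist_word ((ns @ [n]) ! i)) ((ks @ [k]) ! i)))"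
  have "cable_twists (ns @ [n]) (ks @ [k]) = concat (map F [0..<length (ns @ [n])])"
    unfolding cable_twists_def F_def ..
  moreover have "map F [0..<length ns] =
      map (\<lambda>i. shift_word (sum_list (take i ns)) (power_word (full_twist_word (ns ! i)) (ks ! i))) [0..<length ns]"
    using assms by (intro map_cong) (auto simp: nth_append F_def)
  moreover have "F (length ns) = shift_word (sum_list ns) (power_word (full_twist_word n) k)"
    using assms by (simp add: F_def nth_append)
  ultimately show ?thesis by (simp add: cable_twists_def)
qed

lemma cable_twists_braid_words: "length ks = length ns \<Longrightarrow> cable_twists ns ks \<in> braid_words (sum_list ns)"
proof (induction ns arbitrary: ks rule: rev_induct)
  case (snoc n ns)
  then obtain ks' k where ks: "ks = ks' @ [k]" by (cases ks rule: rev_cases) auto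
  have "cable_twists ns ks' \<in> braid_words (sum_list ns + n)"
    using snoc ks braid_words_mono[of _ "sum_list ns" "sum_list ns + n"] by auto
  then show ?case using snoc.prems by (simp add: ks cable_twists_snoc)
qed (simp add: cable_twists_def)

section \<open>Strict balanced categories on the natural numbers\<close>

text \<open>Strictness is literal here: the objects are the numbers under addition and no
  associators or unitors occur in the axioms. This is the target in which braids are evaluated; it
  will be instantiated by the tensor powers of one object.\<close>

locale balanced_pro = category S
  for S :: "(nat, 'a) balcat" (structure) +
  assumes Obj_UNIV [simp]: "Obj S = UNIV"
    and tensor_arr [simp]: "\<lbrakk>f \<in> Arr S; g \<in> Arr S\<rbrakk> \<Longrightarrow> f \<star> g \<in> Arr S"
      "\<lbrakk>f \<in> Arr S; g \<in> Arr S\<rbrakk> \<Longrightarrow> Dom S (f \<star> g) = Dom S f + Dom S g"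
      "\<lbrakk>f \<in> Arr S; g \<in> Arr S\<rbrakk> \<Longrightarrow> Cod S (f \<star> g) = Cod S f + Cod S g"
    and tensor_ident [simp]: "Ident S m \<star> Ident S n = Ident S (m + n)"
    and interchange: "\<lbrakk>f \<in> Arr S; g \<in> Arr S; f' \<in> Arr S; g' \<in> Arr S; Cod S f = Dom S g; Cod S f' = Dom S g'\<rbrakk>
        \<Longrightarrow> (g \<star> g') \<cdot> (f \<star> f') = (g \<cdot> f) \<star> (g' \<cdot> f')"
    and tensor_assoc [simp]: "\<lbrakk>f \<in> Arr S; g \<in> Arr S; h \<in> Arr S\<rbrakk> \<Longrightarrow> (f \<star> g) \<star> h = f \<star> g \<star> h"
    and tensor_unit [simp]: "f \<in> Arr S \<Longrightarrow> Ident S 0 \<star> f = f" "f \<in> Arr S \<Longrightarrow> f \<star> Ident S 0 = f"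
    and braid_arr [simp]: "Dom S (Braid S m n) = m + n" "Cod S (Braid S m n) = n + m"
    and braid_iso [simp]: "iso_arrow S (Braid S m n)"
    and braid_natural: "\<lbrakk>f \<in> Arr S; g \<in> Arr S\<rbrakk>
        \<Longrightarrow> Braid S (Cod S f) (Cod S g) \<cdot> (f \<star> g) = (g \<star> f) \<cdot> Braid S (Dom S f) (Dom S g)"
    and hexagon1: "Braid S l (m + n) = (Ident S m \<star> Braid S l n) \<cdot> (Braid S l m \<star> Ident S n)"
    and hexagon2: "Braid S (l + m) n = (Braid S l n \<star> Ident S m) \<cdot> (Ident S l \<star> Braid S m n)"
    and twist_arr [simp]: "Dom S (Twist S n) = n" "Cod S (Twist S n) = n"
    and twist_iso [simp]: "iso_arrow S (Twist S n)"
    and twist_natural: "f \<in> Arr S \<Longrightarrow> Twist S (Cod S f) \<cdot> f = f \<cdot> Twist S (Dom S f)"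
    and twist_unit [simp]: "Twist S 0 = Ident S 0"
    and twist_tensor: "Twist S (m + n) = Braid S n m \<cdot> Braid S m n \<cdot> (Twist S m \<star> Twist S n)"
begin

abbreviation I :: "nat \<Rightarrow> 'a" where "I \<equiv> Ident S"

lemma braid_in [simp]: "Braid S m n \<in> Arr S" and twist_in [simp]: "Twist S n \<in> Arr S"
  by (rule iso_arrow_arr, simp)+

lemma whisker_right:
  "\<lbrakk>f \<in> Arr S; g \<in> Arr S; Cod S f = Dom S g\<rbrakk> \<Longrightarrow> (g \<cdot> f) \<star> I n = (g \<star> I n) \<cdot> (f \<star> I n)"
  by (simp add: interchange)

lemma ident_ident_tensor [simp]: "f \<in> Arr S \<Longrightarrow> I m \<star> I n \<star> f = I (m + n) \<star> f"
  using tensor_assoc[of "I m" "I n" f] by (simp del: tensor_assoc)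

lemma inverse_arrows_tensor:
  assumes "iso_arrow S f" "iso_arrow S g"
  shows "inverse_arrows S (f \<star> g) (inverse_arrow S f \<star> inverse_arrow S g)"
  using assms iso_arrow_arr[OF assms(1)] iso_arrow_arr[OF assms(2)]
  unfolding inverse_arrows_def in_Hom by (simp add: interchange)

lemma iso_tensor [simp]: "iso_arrow S f \<Longrightarrow> iso_arrow S g \<Longrightarrow> iso_arrow S (f \<star> g)"
  using inverse_arrows_tensor unfolding iso_arrow_def by blast

lemma inverse_tensor:
  "iso_arrow S f \<Longrightarrow> iso_arrow S g \<Longrightarrow> inverse_arrow S (f \<star> g) = inverse_arrow S f \<star> inverse_arrow S g"
  using inverse_arrows_tensor inverse_arrowI by blast

text \<open>For \<open>0 = 0 + 0\<close> the hexagons make the braiding with the unit idempotent,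
  and an invertible idempotent is an identity.\<close>

lemma braid_unit [simp]: "Braid S 0 n = I n" "Braid S n 0 = I n"
proof -
  have "Braid S 0 n \<cdot> Braid S 0 n = Braid S 0 n \<cdot> I n" using hexagon2[of 0 0 n] by simp
  then show "Braid S 0 n = I n" by (subst (asm) iso_cancel_left) auto
  have "Braid S n 0 \<cdot> Braid S n 0 = Braid S n 0 \<cdot> I n" using hexagon1[of n 0 0] by simp
  then show "Braid S n 0 = I n" by (subst (asm) iso_cancel_left) auto
qed

section \<open>Tensor products of lists of arrows\<close>

definition tens :: "'a list \<Rightarrow> 'a" where
  "tens fs = foldr (TArr S) fs (I 0)"

lemma tens_simps [simp]: "tens [] = I 0" "tens (f # fs) = f \<star> tens fs"
  by (simp_all add: tens_def)

lemma tens_arr [simp]: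
  assumes "set fs \<subseteq> Arr S"
  shows "tens fs \<in> Arr S" "Dom S (tens fs) = sum_list (map (Dom S) fs)" "Cod S (tens fs) = sum_list (map (Cod S) fs)"
  using assms by (induction fs) auto

lemma tens_append: "set fs \<subseteq> Arr S \<Longrightarrow> set gs \<subseteq> Arr S \<Longrightarrow> tens (fs @ gs) = tens fs \<star> tens gs"
  by (induction fs) auto

lemma tens_comp:
  assumes "\<And>x. x \<in> set xs \<Longrightarrow> f x \<in> Arr S \<and> g x \<in> Arr S \<and> Cod S (f x) = Dom S (g x)"
  shows "tens (map g xs) \<cdot> tens (map f xs) = tens (map (\<lambda>x. g x \<cdot> f x) xs)"
  using assms
proof (induction xs)
  case (Cons x xs)
  have "sum_list (map (Cod S \<circ> f) xs) = sum_list (map (Dom S \<circ> g) xs)"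
    using Cons.prems by (intro arg_cong[of _ _ sum_list]) auto
  moreover have "set (map f xs) \<subseteq> Arr S" "set (map g xs) \<subseteq> Arr S" using Cons.prems by auto
  ultimately show ?case using Cons by (simp add: interchange del: set_map)
qed simp

lemma tens_ident [simp]: "tens (map I ns) = I (sum_list ns)"
  by (induction ns) auto

lemma tens_replicate_ident [simp]: "tens (replicate n (I m)) = I (n * m)"
  using tens_ident[of "replicate n m"] by (simp add: sum_list_replicate)

lemma tens_concat: "\<forall>fs\<in>set fss. set fs \<subseteq> Arr S \<Longrightarrow> tens (concat fss) = tens (map tens fss)"
  by (induction fss) (auto simp: tens_append UN_subset_iff)

subsection \<open>Evaluation of coloured braid words\<close>

text \<open>In both cases the arguments are the objects on the incoming strands. A negative crossing
  of \<open>m\<close> and \<open>n\<close> undoes the positive crossing of \<open>n\<close> and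
  \<open>m\<close>, hence the exchanged arguments under the inverse.\<close>

definition cross :: "bool \<Rightarrow> nat \<Rightarrow> nat \<Rightarrow> 'a" where
  "cross e m n = (if e then Braid S m n else inverse_arrow S (Braid S n m))"

lemma cross_arr [simp]:
  "cross e m n \<in> Arr S" "Dom S (cross e m n) = m + n" "Cod S (cross e m n) = n + m" "iso_arrow S (cross e m n)"
  by (auto simp: cross_def add.commute)

lemma cross_inverse: "cross (\<not> e) n m \<cdot> cross e m n = I (m + n)"
  by (auto simp: cross_def add.commute)

lemma cross_natural:
  assumes "f \<in> Arr S" "g \<in> Arr S"
  shows "cross e (Cod S f) (Cod S g) \<cdot> (f \<star> g) = (g \<star> f) \<cdot> cross e (Dom S f) (Dom S g)"
proof (cases e)
  case False
  have "Braid S (Cod S g) (Cod S f) \<cdot> (g \<star> f) = (f \<star> g) \<cdot> Braid S (Dom S g) (Dom S f)"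
    using braid_natural[OF assms(2,1)] .
  then have "inverse_arrow S (Braid S (Cod S g) (Cod S f)) \<cdot> ((f \<star> g) \<cdot> Braid S (Dom S g) (Dom S f))
      \<cdot> inverse_arrow S (Braid S (Dom S g) (Dom S f)) =
    inverse_arrow S (Braid S (Cod S g) (Cod S f)) \<cdot> (Braid S (Cod S g) (Cod S f) \<cdot> (g \<star> f))
      \<cdot> inverse_arrow S (Braid S (Dom S g) (Dom S f))" by simp
  then show ?thesis using False assms by (simp add: cross_def)
qed (simp add: cross_def braid_natural assms)

definition letter :: "nat list \<Rightarrow> nat \<times> bool \<Rightarrow> 'a" where
  "letter ns l = (case l of (i, e) \<Rightarrow>
     I (sum_list (take i ns)) \<star> cross e (ns ! i) (ns ! Suc i) \<star> I (sum_list (drop (Suc (Suc i)) ns)))"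

text \<open>The entry \<open>ns ! i\<close> is the object colouring the strand at position
  \<open>i\<close>, and the colours move along with the strands. Words are read in time order, so
  the head of the word is the rightmost factor.\<close>

fun ev :: "nat list \<Rightarrow> braid_word \<Rightarrow> 'a" where
  "ev ns [] = I (sum_list ns)"
| "ev ns (l # w) = ev (swap_at (fst l) ns) w \<cdot> letter ns l"

lemma letter_append [simp]:
  "letter (us @ m # n # vs) (length us, e) = I (sum_list us) \<star> cross e m n \<star> I (sum_list vs)"
  by (simp add: letter_def nth_append)

lemma letter_arr [simp]:
  assumes "Suc i < length ns"
  shows "letter ns (i, e) \<in> Arr S" "Dom S (letter ns (i, e)) = sum_list ns" "Cod S (letter ns (i, e)) = sum_list ns"
    "iso_arrow S (letter ns (i, e))"
  using assms by (elim swap_at_cases, simp)+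

lemma ev_arr [simp]:
  assumes "w \<in> braid_words (length ns)"
  shows "ev ns w \<in> Arr S" "Dom S (ev ns w) = sum_list ns" "Cod S (ev ns w) = sum_list ns" "iso_arrow S (ev ns w)"
  using assms by (induction w arbitrary: ns) auto

lemma ev_append:
  "v \<in> braid_words (length ns) \<Longrightarrow> w \<in> braid_words (length ns) \<Longrightarrow> ev ns (v @ w) = ev (act_word v ns) w \<cdot> ev ns v"
  by (induction v arbitrary: ns) auto

lemma letter_natural:
  assumes "set fs \<subseteq> Arr S" "Suc i < length fs"
  shows "letter (map (Cod S) fs) (i, e) \<cdot> tens fs = tens (swap_at i fs) \<cdot> letter (map (Dom S) fs) (i, e)"
  using assms(2)
proof (cases rule: swap_at_cases)
  case (1 us f g vs)
  then have [simp]: "f \<in> Arr S" "g \<in> Arr S" "set us \<subseteq> Arr S" "set vs \<subseteq> Arr S" using assms by auto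
  have "letter (map (Cod S) fs) (i, e) = I (sum_list (map (Cod S) us)) \<star> cross e (Cod S f) (Cod S g) \<star> I (sum_list (map (Cod S) vs))"
    "letter (map (Dom S) fs) (i, e) = I (sum_list (map (Dom S) us)) \<star> cross e (Dom S f) (Dom S g) \<star> I (sum_list (map (Dom S) vs))"
    using 1 letter_append[of "map (Cod S) us"] letter_append[of "map (Dom S) us"] by simp_all
  moreover have "tens fs = tens us \<star> (f \<star> g) \<star> tens vs" "tens (swap_at i fs) = tens us \<star> (g \<star> f) \<star> tens vs"
    using 1 by (simp_all add: tens_append)
  ultimately show ?thesis
    by (simp add: interchange cross_natural del: tensor_assoc)
qed

text \<open>Each letter passes the family of arrows by naturality of a single crossing. The braid is
  coloured by the targets on one side and by the sources on the other, which is why the evaluation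
  has to allow arbitrary colours.\<close>

lemma ev_natural:
  assumes "set fs \<subseteq> Arr S" "w \<in> braid_words (length fs)"
  shows "ev (map (Cod S) fs) w \<cdot> tens fs = tens (act_word w fs) \<cdot> ev (map (Dom S) fs) w"
  using assms
proof (induction w arbitrary: fs)
  case (Cons l w)
  obtain i e where l: "l = (i, e)" by force
  have i: "Suc i < length fs" and w: "w \<in> braid_words (length fs)" using Cons.prems l by auto
  have s: "map (Cod S) (swap_at i fs) = swap_at i (map (Cod S) fs)" "map (Dom S) (swap_at i fs) = swap_at i (map (Dom S) fs)"
    using i by (simp_all add: map_swap_at)
  have IH: "ev (swap_at i (map (Cod S) fs)) w \<cdot> tens (swap_at i fs) = tens (act_word w (swap_at i fs)) \<cdot> ev (swap_at i (map (Dom S) fs)) w"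
    using Cons.IH[of "swap_at i fs"] Cons.prems i w s by simp
  have *: "set (act_word w (swap_at i fs)) \<subseteq> Arr S"
    using Cons.prems i w by simp
  have t: "tens fs \<in> Arr S" "Dom S (tens fs) = sum_list (map (Dom S) fs)" "Cod S (tens fs) = sum_list (map (Cod S) fs)"
    "tens (swap_at i fs) \<in> Arr S" "Dom S (tens (swap_at i fs)) = sum_list (map (Dom S) fs)"
    "Cod S (tens (swap_at i fs)) = sum_list (map (Cod S) fs)"
    "tens (act_word w (swap_at i fs)) \<in> Arr S" "Dom S (tens (act_word w (swap_at i fs))) = sum_list (map (Dom S) fs)"
    using Cons.prems i w * by (simp_all add: s map_act_word)
  have "ev (map (Cod S) fs) (l # w) \<cdot> tens fs
      = ev (swap_at i (map (Cod S) fs)) w \<cdot> tens (swap_at i fs) \<cdot> letter (map (Dom S) fs) (i, e)"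
    using i w t letter_natural[OF Cons.prems(1) i, of e] by (simp add: l)
  also have "\<dots> = tens (act_word w (swap_at i fs)) \<cdot> ev (swap_at i (map (Dom S) fs)) w \<cdot> letter (map (Dom S) fs) (i, e)"
    using comp_rewrite2[OF IH, of "letter (map (Dom S) fs) (i, e)"] i w t by simp
  finally show ?case using i w t by (simp add: l)
qed simp

section \<open>Evaluation with all strands coloured by 1\<close>

definition ev1 :: "nat \<Rightarrow> braid_word \<Rightarrow> 'a" where
  "ev1 n w = ev (replicate n (Suc 0)) w"

lemma ev1_arr [simp]:
  assumes "w \<in> braid_words n"
  shows "ev1 n w \<in> Arr S" "Dom S (ev1 n w) = n" "Cod S (ev1 n w) = n" "iso_arrow S (ev1 n w)"
  using assms by (simp_all add: ev1_def sum_list_replicate)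

lemma ev1_Nil [simp]: "ev1 n [] = I n"
  by (simp add: ev1_def sum_list_replicate)

lemma ev1_append [simp]: "v \<in> braid_words n \<Longrightarrow> w \<in> braid_words n \<Longrightarrow> ev1 n (v @ w) = ev1 n w \<cdot> ev1 n v"
  by (simp add: ev1_def ev_append)

lemma ev1_letter: "Suc i < n \<Longrightarrow> ev1 n [(i, e)] = I i \<star> cross e 1 1 \<star> I (n - Suc (Suc i))"
  by (simp add: ev1_def sum_list_replicate letter_def min_def)

lemma ev1_Cons: "Suc i < n \<Longrightarrow> w \<in> braid_words n \<Longrightarrow> ev1 n ((i, e) # w) = ev1 n w \<cdot> ev1 n [(i, e)]"
  using ev1_append[of "[(i, e)]" n w] by (simp del: ev1_append)

lemma ev1_natural:
  assumes "set fs \<subseteq> Arr S" "w \<in> braid_words (length fs)" "\<And>f. f \<in> set fs \<Longrightarrow> Dom S f = 1 \<and> Cod S f = 1"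
  shows "ev1 (length fs) w \<cdot> tens fs = tens (act_word w fs) \<cdot> ev1 (length fs) w"
proof -
  have "map (Dom S) fs = replicate (length fs) (Suc 0)" "map (Cod S) fs = replicate (length fs) (Suc 0)"
    using assms(3) by (simp_all add: map_replicate_const[symmetric])
  then show ?thesis using ev_natural[OF assms(1,2)] by (simp add: ev1_def)
qed

lemma ev1_shift: "w \<in> braid_words n \<Longrightarrow> ev1 (k + n + m) (shift_word k w) = I k \<star> ev1 n w \<star> I m"
proof (induction w)
  case (Cons l w)
  obtain i e where l: "l = (i, e)" by force
  have i: "Suc i < n" and w: "w \<in> braid_words n" using Cons.prems l by auto
  have sw: "shift_word k w \<in> braid_words (k + n + m)" using w by (intro shift_braid_words') auto
  have "ev1 (k + n + m) [(i + k, e)] = I k \<star> ev1 n [(i, e)] \<star> I m"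
  proof -
    have "ev1 (k + n + m) [(i + k, e)] = I (k + i) \<star> cross e 1 1 \<star> I (n - Suc (Suc i) + m)"
      using i ev1_letter[of "i + k" "k + n + m" e] by (simp add: add.commute[of i k])
    also have "\<dots> = I k \<star> ev1 n [(i, e)] \<star> I m"
      by (simp add: ev1_letter[OF i])
    finally show ?thesis .
  qed
  then have "ev1 (k + n + m) (shift_word k (l # w)) = (I k \<star> ev1 n w \<star> I m) \<cdot> (I k \<star> ev1 n [(i, e)] \<star> I m)"
    using i w sw Cons.IH ev1_Cons[of "i + k" "k + n + m" "shift_word k w" e] by (simp add: l)
  also have "\<dots> = I k \<star> ev1 n (l # w) \<star> I m"
    using i w by (simp add: l ev1_Cons[OF i w] interchange)
  finally show ?case .
qed (simp add: add.assoc)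

lemma ev1_widen: "w \<in> braid_words n \<Longrightarrow> ev1 (n + m) w = ev1 n w \<star> I m"
  using ev1_shift[of w n 0 m] by simp

lemma ev1_widen_Suc: "w \<in> braid_words n \<Longrightarrow> ev1 (Suc n) w = ev1 n w \<star> I 1"
  using ev1_widen[of w n 1] by simp

lemma ev1_cancel: "Suc i < n \<Longrightarrow> ev1 n [(i, \<not> e)] \<cdot> ev1 n [(i, e)] = I n"
  by (simp add: ev1_letter interchange cross_inverse Suc_diff_Suc numeral_2_eq_2)

text \<open>This is naturality of the braiding of one strand past two, applied to the crossing of
  these two, with the braiding expanded by the first hexagon.\<close>

lemma yang_baxter:
  "(Braid S 1 1 \<star> I 1) \<cdot> (I 1 \<star> Braid S 1 1) \<cdot> (Braid S 1 1 \<star> I 1) =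
   (I 1 \<star> Braid S 1 1) \<cdot> (Braid S 1 1 \<star> I 1) \<cdot> (I 1 \<star> Braid S 1 1)"
proof -
  have h: "Braid S 1 (1 + 1) = (I 1 \<star> Braid S 1 1) \<cdot> (Braid S 1 1 \<star> I 1)" by (rule hexagon1)
  have "(Braid S 1 1 \<star> I 1) \<cdot> Braid S 1 (1 + 1) = Braid S 1 (1 + 1) \<cdot> (I 1 \<star> Braid S 1 1)"
    using braid_natural[of "I 1" "Braid S 1 1"] by simp
  then show ?thesis unfolding h by simp
qed

lemma ev1_subst:
  assumes "ev1 n v = ev1 n w" "v \<in> braid_words n" "w \<in> braid_words n" "u \<in> braid_words n" "z \<in> braid_words n"
  shows "ev1 n (u @ v @ z) = ev1 n (u @ w @ z)"
  using assms by simp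

text \<open>The three relations come from three sources: invertibility of a crossing, the
  interchange law for crossings on disjoint strands, and the Yang-Baxter equation.\<close>

lemma ev1_braid_eq: "braid_eq n v w \<Longrightarrow> ev1 n v = ev1 n w"
proof (induction rule: braid_eq.induct)
  case (cancel u v i e)
  have "ev1 n [(i, e), (i, \<not> e)] = I n"
    using cancel ev1_cancel[of i n e] ev1_append[of "[(i, e)]" n "[(i, \<not> e)]"] by (simp del: ev1_append)
  then show ?case using cancel ev1_subst[of n "[(i, e), (i, \<not> e)]" "[]" u v] by simp
next
  case (far u v i j)
  obtain a b where j: "j = Suc (Suc i) + a" and n: "n = Suc (Suc j) + b"
    using far by (metis Suc_leI le_iff_add)
  \<comment> \<open>Both letters are written as the same whiskering of arrows on a middle block of
    \<open>a + 4\<close> strands; there one crosses the first two strands and the other the last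
    two.\<close>
  have e: "ev1 n [(i, True)] = I i \<star> (Braid S 1 1 \<star> I (a + 2)) \<star> I b"
    "ev1 n [(j, True)] = I i \<star> (I 2 \<star> I a \<star> Braid S 1 1) \<star> I b"
    using ev1_letter[of i n True] ev1_letter[of j n True] j n by (simp_all add: cross_def)
  have "ev1 n [(j, True)] \<cdot> ev1 n [(i, True)] = ev1 n [(i, True)] \<cdot> ev1 n [(j, True)]"
    unfolding e by (simp add: interchange del: tensor_assoc ident_ident_tensor)
  then have "ev1 n [(i, True), (j, True)] = ev1 n [(j, True), (i, True)]"
    using far ev1_append[of "[(i, True)]" n "[(j, True)]"] ev1_append[of "[(j, True)]" n "[(i, True)]"]
    by (simp del: ev1_append)
  then show ?case using far by (intro ev1_subst) auto
next
  case (artin u v i)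
  define b where "b = n - (i + 3)"
  with artin have n: "n = i + 3 + b" by simp
  let ?c = "Braid S 1 1"
  have e: "ev1 n [(i, True)] = I i \<star> (?c \<star> I 1) \<star> I b" "ev1 n [(Suc i, True)] = I i \<star> (I 1 \<star> ?c) \<star> I b"
    using ev1_letter[of i n True] ev1_letter[of "Suc i" n True] n tensor_ident[of 1 b] tensor_ident[of i 1]
    by (simp_all add: cross_def del: tensor_ident)
  have "ev1 n [(i, True)] \<cdot> ev1 n [(Suc i, True)] \<cdot> ev1 n [(i, True)] = ev1 n [(Suc i, True)] \<cdot> ev1 n [(i, True)] \<cdot> ev1 n [(Suc i, True)]"
    unfolding e using yang_baxter by (simp add: interchange del: tensor_assoc)
  then have "ev1 n [(i, True), (Suc i, True), (i, True)] = ev1 n [(Suc i, True), (i, True), (Suc i, True)]"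
    using artin ev1_Cons[of i n "[(Suc i, True), (i, True)]" True] ev1_Cons[of i n "[(Suc i, True)]" True]
      ev1_Cons[of "Suc i" n "[(i, True), (Suc i, True)]" True] ev1_Cons[of "Suc i" n "[(i, True)]" True] by simp
  then show ?case using artin by (intro ev1_subst) auto
qed auto

lemma ev1_rep [simp]: "w \<in> braid_words n \<Longrightarrow> ev1 n (braid_rep (braid_class n w)) = ev1 n w"
  using ev1_braid_eq[OF braid_rep_class] by simp

lemma ev1_inverse_word: "w \<in> braid_words n \<Longrightarrow> ev1 n (inverse_word w) = inverse_arrow S (ev1 n w)"
proof (induction w)
  case (Cons l w)
  obtain i e where l: "l = (i, e)" by force
  have i: "Suc i < n" and w: "w \<in> braid_words n" using Cons.prems l by auto
  have "ev1 n [(i, \<not> e)] = inverse_arrow S (ev1 n [(i, e)])"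
    using ev1_cancel[OF i, of e] ev1_cancel[OF i, of "\<not> e"] i
    by (intro inverse_arrowI[symmetric]) (simp add: inverse_arrows_def in_Hom)
  then show ?case using i w Cons.IH by (simp add: l ev1_Cons[OF i w] inverse_comp)
qed simp

text \<open>Each enlargement by one strand is a hexagon: the first one when the block being crossed
  grows, the second one when the crossing block grows. Hence the inner induction treats a single
  strand crossing \<open>n\<close> strands.\<close>

lemma ev1_block: "ev1 (m + n) (block_word m n) = Braid S m n"
proof -
  have 1: "ev1 (Suc n) (block_word (Suc 0) n) = Braid S 1 n" for n
  proof (induction n)
    case (Suc n)
    have b: "block_word (Suc 0) n \<in> braid_words (Suc n)" using block_braid_words[of 1 n] by simp
    then have b': "block_word (Suc 0) n \<in> braid_words (Suc (Suc n))" by (rule braid_words_mono) simp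
    have "ev1 (Suc (Suc n)) (block_word (Suc 0) (Suc n)) = (I n \<star> Braid S 1 1) \<cdot> (Braid S 1 n \<star> I 1)"
      using b b' Suc ev1_widen_Suc[OF b] ev1_letter[of n "Suc (Suc n)" True] by (simp add: block_word_1 cross_def)
    then show ?case using hexagon1[of 1 n 1] by simp
  qed (simp add: block_word_1)
  show ?thesis
  proof (induction m)
    case (Suc m)
    have b: "block_word 1 n \<in> braid_words (Suc n)" using block_braid_words[of 1 n] by simp
    have "ev1 (m + Suc n) (shift_word m (block_word 1 n)) = I m \<star> Braid S 1 n"
      using ev1_shift[OF b, of m 0] 1 by simp
    moreover have "shift_word m (block_word 1 n) \<in> braid_words (m + Suc n)" using b by (rule shift_braid_words)
    moreover have "block_word m n \<in> braid_words (Suc (m + n))" by (rule braid_words_mono[OF block_braid_words]) simp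
    moreover have "ev1 (Suc (m + n)) (block_word m n) = Braid S m n \<star> I 1"
      using ev1_widen_Suc[of "block_word m n" "m + n"] Suc by simp
    ultimately have "ev1 (Suc m + n) (block_word (Suc m) n) = (Braid S m n \<star> I 1) \<cdot> (I m \<star> Braid S 1 n)"
      by (subst block_word_simps(3)) simp
    then show ?case using hexagon2[of m 1 n] by simp
  qed (simp add: block_word_simps)
qed

lemma ev1_cable_letter:
  "ev1 (m + n) (if e then block_word m n else inverse_word (block_word n m)) = cross e m n"
  using ev1_block[of m n] ev1_block[of n m] block_braid_words[of n m]
  by (simp add: cross_def ev1_inverse_word add.commute)

text \<open>A strand of colour \<open>n\<close> amounts to \<open>n\<close> parallel strands of
  colour 1, because a crossing of coloured strands is the value of a block crossing
  (\<open>ev1_cable_letter\<close>). Thus cabling a word and colouring its strands have the same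
  value.\<close>

lemma ev_cable:
  "w \<in> braid_words (length ns) \<Longrightarrow> ev1 (sum_list ns) (cable_word ns w) = ev ns w"
proof (induction w arbitrary: ns)
  case (Cons l w)
  obtain i e where l: "l = (i, e)" by force
  have i: "Suc i < length ns" and w: "w \<in> braid_words (length ns)" using Cons.prems l by auto
  show ?case using i
  proof (cases rule: swap_at_cases)
    case (1 us m n vs)
    let ?b = "if e then block_word m n else inverse_word (block_word n m)"
    have "cable_word ns (l # w) = shift_word (sum_list us) ?b @ cable_word (swap_at i ns) w"
      using 1 by (simp add: l swap_at_def nth_append list_update_append)
    moreover have "cable_word (swap_at i ns) w \<in> braid_words (sum_list ns)"
      using cable_word_braid_words[of w "swap_at i ns"] i w by simp
    moreover have "shift_word (sum_list us) ?b \<in> braid_words (sum_list ns)"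
      by (rule shift_braid_words'[OF cable_letter_braid_words]) (simp add: 1)
    moreover have "ev1 (sum_list ns) (shift_word (sum_list us) ?b) = letter ns (i, e)"
      using ev1_shift[OF cable_letter_braid_words[of e m n], of "sum_list us" "sum_list vs"] ev1_cable_letter[of m n e]
      by (simp add: 1 add.assoc)
    moreover have "ev1 (sum_list ns) (cable_word (swap_at i ns) w) = ev (swap_at i ns) w"
      using Cons.IH[of "swap_at i ns"] i w by simp
    ultimately show ?thesis by (simp add: l)
  qed
qed simp

text \<open>The recursion of \<open>full_twist_word\<close> mirrors \<open>twist_tensor\<close> for
  the decomposition of \<open>Suc n\<close> into \<open>n\<close> and 1; the twists of the single
  ribbons are collected in the tensor power of \<open>Twist S 1\<close>.\<close>

lemma ev1_full_twist: "ev1 n (full_twist_word n) \<cdot> tens (replicate n (Twist S 1)) = Twist S n"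
proof (induction n)
  case (Suc n)
  have w: "full_twist_word n \<in> braid_words (Suc n)" by (rule braid_words_mono[OF full_twist_braid_words]) simp
  have b: "block_word n 1 \<in> braid_words (Suc n)" "block_word 1 n \<in> braid_words (Suc n)"
    using block_braid_words[of n 1] block_braid_words[of 1 n] by simp_all
  have r: "replicate (Suc n) (Twist S 1) = replicate n (Twist S 1) @ [Twist S 1]" by (simp add: replicate_append_same)
  have t: "tens (replicate (Suc n) (Twist S 1)) = tens (replicate n (Twist S 1)) \<star> Twist S 1"
    unfolding r by (subst tens_append) (auto simp: set_replicate_conv_if)
  have "set (replicate n (Twist S 1)) \<subseteq> Arr S" by (auto simp: set_replicate_conv_if)
  note tt = tens_arr[OF this]
  have "ev1 (Suc n) (full_twist_word (Suc n)) \<cdot> tens (replicate (Suc n) (Twist S 1))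
     = (Braid S 1 n \<cdot> Braid S n 1 \<cdot> (ev1 n (full_twist_word n) \<star> I 1)) \<cdot> (tens (replicate n (Twist S 1)) \<star> Twist S 1)"
    unfolding t using w b ev1_block[of n 1] ev1_block[of 1 n] by (simp add: ev1_widen_Suc)
  also have "\<dots> = Braid S 1 n \<cdot> Braid S n 1 \<cdot> (Twist S n \<star> Twist S 1)"
    using tt Suc by (simp add: interchange sum_list_replicate)
  also have "\<dots> = Twist S (Suc n)" using twist_tensor[of n 1] by simp
  finally show ?case .
qed simp

end

section \<open>Monotone lists and their fibres\<close>

text \<open>If the values of \<open>h\<close> increase along the list, every fibre is a contiguous
  piece. Used with the identity to cut a monotone list into constant blocks, and with a monotone map
  on \<open>[0..<m]\<close> to cut its source into fibres.\<close>

lemma concat_fibres: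
  fixes h :: "'x \<Rightarrow> nat"
  assumes "sorted (map h xs)" "\<And>x. x \<in> set xs \<Longrightarrow> h x < m"
  shows "concat (map (\<lambda>j. filter (\<lambda>x. h x = j) xs) [0..<m]) = xs"
proof -
  have step: "filter (\<lambda>x. h x < k) ys @ filter (\<lambda>x. h x = k) ys = filter (\<lambda>x. h x < Suc k) ys"
    if "sorted (map h ys)" for k ys
    using that
  proof (induction ys)
    case (Cons y ys)
    moreover have "filter (\<lambda>x. h x < k) ys = []" if "\<not> h y < k"
      using Cons.prems that by (auto simp: filter_empty_conv)
    ultimately show ?case
      by (cases "h y < k"; cases "h y = k") (auto simp: less_Suc_eq)
  qed simp
  have "concat (map (\<lambda>j. filter (\<lambda>x. h x = j) xs) [0..<k]) = filter (\<lambda>x. h x < k) xs" for k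
    by (induction k) (simp_all add: step[OF assms(1)])
  then show ?thesis using assms(2) by (simp add: filter_id_conv)
qed

text \<open>For a fixed codomain these numbers determine a monotone list
  (\<open>monotone_list_blocks\<close>), and they say into how many ribbons each strand is
  cut.\<close>

definition fibre_sizes :: "nat list \<Rightarrow> nat \<Rightarrow> nat list" where
  "fibre_sizes \<phi> m = map (count_list \<phi>) [0..<m]"

lemma length_fibre_sizes [simp]: "length (fibre_sizes \<phi> m) = m"
  by (simp add: fibre_sizes_def)

lemma filter_eq_replicate: "filter (\<lambda>x. x = j) xs = replicate (count_list xs j) j"
  by (induction xs) auto

lemma monotone_list_blocks:
  assumes "\<phi> \<in> monotone_lists n m"
  shows "concat (map (\<lambda>j. replicate (count_list \<phi> j) j) [0..<m]) = \<phi>"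
  using concat_fibres[of "\<lambda>x. x" \<phi> m] assms
  by (auto simp: monotone_lists_def filter_eq_replicate)

lemma sum_list_fibre_sizes [simp]: "\<phi> \<in> monotone_lists n m \<Longrightarrow> sum_list (fibre_sizes \<phi> m) = n"
  using arg_cong[OF monotone_list_blocks, of \<phi> n m length]
  by (simp add: length_concat fibre_sizes_def comp_def monotone_lists_def)

lemma monotone_list_map_blocks:
  assumes "\<phi> \<in> monotone_lists n m"
  shows "map f \<phi> = concat (map (\<lambda>j. replicate (count_list \<phi> j) (f j)) [0..<m])"
  by (subst (1) monotone_list_blocks[OF assms, symmetric]) (simp add: map_concat comp_def)

text \<open>A fibre of a composite is the disjoint union of the fibres of the first map over the
  points of a fibre of the second.\<close>

lemma count_list_map_sum:
  assumes "set \<phi> \<subseteq> {..<m}"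
  shows "count_list (map f \<phi>) j = sum_list (map (count_list \<phi>) (filter (\<lambda>i. f i = j) [0..<m]))"
proof -
  have "count_list (map f \<phi>) j = (\<Sum>i | i < m \<and> f i = j. count_list \<phi> i)"
    using assms
  proof (induction \<phi>)
    case (Cons x \<phi>)
    have "(\<Sum>i | i < m \<and> f i = j. count_list (x # \<phi>) i)
        = (\<Sum>i | i < m \<and> f i = j. count_list \<phi> i + (if i = x then 1 else 0))"
      by (intro sum.cong) auto
    also have "\<dots> = (\<Sum>i | i < m \<and> f i = j. count_list \<phi> i) + (if f x = j then 1 else 0)"
      using Cons.prems by (simp add: sum.distrib sum.delta')
    finally show ?case using Cons by simp
  qed simp
  also have "\<dots> = sum_list (map (count_list \<phi>) (filter (\<lambda>i. f i = j) [0..<m]))"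
    by (simp add: sum_list_distinct_conv_sum_set)
  finally show ?thesis .
qed

lemma count_list_sort [simp]: "count_list (sort xs) x = count_list xs x"
  by (simp add: count_list_eq_length_filter filter_sort)

text \<open>Sorting retains only the fibre sizes, and each of these travels with its strand.\<close>

lemma fibre_sizes_push:
  assumes "set \<phi> \<subseteq> {..<m}" "w \<in> braid_words m"
  shows "fibre_sizes (sort (map (word_perm w) \<phi>)) m = act_word w (fibre_sizes \<phi> m)"
proof (rule nth_equalityI)
  fix j assume "j < length (fibre_sizes (sort (map (word_perm w) \<phi>)) m)"
  then have "j < m" by simp
  then obtain i where i: "i < m" "j = word_perm w i"
    using bij_word_perm[OF assms(2)] unfolding bij_betw_def by auto
  have "inj (word_perm w)" by (auto intro: injI word_perm_inj)
  then have "count_list (map (word_perm w) \<phi>) j = count_list \<phi> i"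
    unfolding i(2) by (induction \<phi>) (auto dest: injD)
  then show "fibre_sizes (sort (map (word_perm w) \<phi>)) m ! j = act_word w (fibre_sizes \<phi> m) ! j"
    using act_word_nth[of w "fibre_sizes \<phi> m" i] assms(2) i \<open>j < m\<close> by (simp add: fibre_sizes_def)
qed simp

lemma fibre_sizes_append:
  assumes "set \<phi> \<subseteq> {..<m}"
  shows "fibre_sizes (\<phi> @ map ((+) m) \<psi>) (m + m') = fibre_sizes \<phi> m @ fibre_sizes \<psi> m'"
proof -
  have "m + j \<notin> set \<phi>" for j using assms by auto
  then have "count_list \<phi> (m + j) = 0" for j by simp
  moreover have "count_list (map ((+) m) \<psi>) j = 0" if "j < m" for j
    using that by (intro count_notin) auto
  moreover have "count_list (map ((+) m) \<psi>) (m + j) = count_list \<psi> j" for j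
    by (induction \<psi>) auto
  moreover have "[0..<m + m'] = [0..<m] @ map ((+) m) [0..<m']"
    by (rule nth_equalityI) (auto simp: nth_append)
  ultimately show ?thesis
    by (simp add: fibre_sizes_def comp_def)
qed

lemma fibre_sizes_upt: "fibre_sizes [0..<n] n = replicate n 1"
  by (intro nth_equalityI) (auto simp: fibre_sizes_def count_list_eq_length_filter distinct_length_filter)

lemma ribbon_push_monotone:
  assumes "g \<in> ribbons G m" "\<phi> \<in> monotone_lists n m"
  shows "ribbon_push g \<phi> \<in> monotone_lists n m"
proof -
  have "word_perm (braid_rep (rbraid g)) i < m" if "i < m" for i
    using bij_word_perm[OF braid_rep_words[of "rbraid g" m]] assms(1) that
    by (auto simp: ribbons_def bij_betw_def)
  then show ?thesis
    using assms(2) by (auto simp: ribbon_push_def monotone_lists_def braid_perm_def)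
qed

lemma monotone_comp:
  assumes "\<phi> \<in> monotone_lists n m" "\<psi> \<in> monotone_lists m p"
  shows "map ((!) \<psi>) \<phi> \<in> monotone_lists n p"
  using assms unfolding monotone_lists_def
  by (auto simp: sorted_iff_nth_mono subset_iff)

lemma ribbons_label [simp]: "g \<in> ribbons G n \<Longrightarrow> i < n \<Longrightarrow> labels g ! i \<in> carrier G"
  by (auto simp: ribbons_def)

lemma ribbon_pull_ribbons:
  assumes "g \<in> ribbons G m" "\<phi> \<in> monotone_lists n m"
  shows "ribbon_pull \<phi> g \<in> ribbons G n"
    and "cable_twists (fibre_sizes \<phi> m) (twists g) \<in> braid_words n"
    and "cable_word (fibre_sizes \<phi> m) (braid_rep (rbraid g)) \<in> braid_words n"
proof -
  have g: "length (labels g) = m" "set (labels g) \<subseteq> carrier G" "length (twists g) = m" "rbraid g \<in> braids m"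
    using assms by (auto simp: ribbons_def)
  show c: "cable_twists (fibre_sizes \<phi> m) (twists g) \<in> braid_words n"
    "cable_word (fibre_sizes \<phi> m) (braid_rep (rbraid g)) \<in> braid_words n"
    using cable_twists_braid_words[of "twists g" "fibre_sizes \<phi> m"]
      cable_word_braid_words[of "braid_rep (rbraid g)" "fibre_sizes \<phi> m"] g assms(2)
    by (simp_all add: braid_rep_words)
  have "\<phi> ! i < m" if "i < n" for i using assms(2) that by (auto simp: monotone_lists_def subset_iff)
  then show "ribbon_pull \<phi> g \<in> ribbons G n"
    using g c assms(2)
    by (auto simp: ribbons_def ribbon_pull_def monotone_lists_def fibre_sizes_def Let_def subset_iff)
qed

lemma (in group) ribbon_mult_ribbons:
  assumes "g \<in> ribbons G n" "h \<in> ribbons G n"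
  shows "ribbon_mult G h g \<in> ribbons G n"
proof -
  have "braid_perm (rbraid g) i < n" if "i < n" for i
    using bij_word_perm[OF braid_rep_words[of "rbraid g" n]] assms(1) that
    by (auto simp: ribbons_def bij_betw_def braid_perm_def)
  then show ?thesis
    using assms ribbons_label[OF assms(1)] ribbons_label[OF assms(2)]
    by (auto simp: ribbons_def ribbon_mult_def Let_def braid_rep_words)
qed

lemma DRBG_arrD:
  assumes "f \<in> Arr (DRBG G)"
  shows "omap f \<in> monotone_lists (length (omap f)) (codom f)" "rib f \<in> ribbons G (length (omap f))"
    "braid_rep (rbraid (rib f)) \<in> braid_words (length (omap f))"
  using assms by (auto simp: DRBG_def ribbons_def braid_rep_words)

section \<open>The functor determined by a monoid with a group action\<close>

text \<open>What an algebra leaves at the object 1. All objects are tensor powers of 1, so these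
  data, together with the braiding and the twist of \<open>S\<close>, suffice to assign an arrow to
  every arrow of \<open>DRBG G\<close>.\<close>

locale pro_monoid = balanced_pro S + G: group G
  for S :: "(nat, 'a) balcat" (structure) and G :: "('g, 'm) monoid_scheme" +
  fixes mu eta :: 'a and rho :: "'g \<Rightarrow> 'a"
  assumes mu_arr [simp]: "mu \<in> Arr S" "Dom S mu = 2" "Cod S mu = 1"
    and eta_arr [simp]: "eta \<in> Arr S" "Dom S eta = 0" "Cod S eta = 1"
    and mu_assoc: "mu \<cdot> (mu \<star> Ident S 1) = mu \<cdot> (Ident S 1 \<star> mu)"
    and mu_unit: "mu \<cdot> (eta \<star> Ident S 1) = Ident S 1" "mu \<cdot> (Ident S 1 \<star> eta) = Ident S 1"
    and rho_arr [simp]: "x \<in> carrier G \<Longrightarrow> rho x \<in> Arr S" "x \<in> carrier G \<Longrightarrow> Dom S (rho x) = 1"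
      "x \<in> carrier G \<Longrightarrow> Cod S (rho x) = 1"
    and rho_mult: "x \<in> carrier G \<Longrightarrow> y \<in> carrier G \<Longrightarrow> rho (x \<otimes>\<^bsub>G\<^esub> y) = rho x \<cdot> rho y"
    and rho_one [simp]: "rho \<one>\<^bsub>G\<^esub> = Ident S 1"
    and rho_mu: "x \<in> carrier G \<Longrightarrow> rho x \<cdot> mu = mu \<cdot> (rho x \<star> rho x)"
    and rho_eta: "x \<in> carrier G \<Longrightarrow> rho x \<cdot> eta = eta"

section \<open>Integer powers of automorphisms and of the twist\<close>

context balanced_pro
begin

text \<open>A ribbon may carry a negative number of full twists; the automorphism group supplies
  integer powers and their laws.\<close>

definition Aut :: "nat \<Rightarrow> 'a monoid" where
  "Aut n = \<lparr>carrier = {f \<in> Hom S n n. iso_arrow S f}, monoid.mult = (\<lambda>g f. g \<cdot> f), one = I n\<rparr>"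

lemma Aut_simps: "carrier (Aut n) = {f \<in> Hom S n n. iso_arrow S f}" "monoid.mult (Aut n) g f = g \<cdot> f" "one (Aut n) = I n"
  by (simp_all add: Aut_def)

lemma AutD:
  assumes "f \<in> carrier (Aut n)"
  shows "f \<in> Arr S" "Dom S f = n" "Cod S f = n" "iso_arrow S f"
  using assms by (auto simp: Aut_simps in_Hom)

lemma AutI: "iso_arrow S f \<Longrightarrow> Dom S f = n \<Longrightarrow> Cod S f = n \<Longrightarrow> f \<in> carrier (Aut n)"
  by (auto simp: Aut_simps in_Hom iso_arrow_arr)

lemma group_Aut: "group (Aut n)"
  by (rule groupI, auto simp: Aut_simps in_Hom, metis iso_inverse_arrow inverse_arrow(1-4))

lemma inv_Aut: "f \<in> carrier (Aut n) \<Longrightarrow> inv\<^bsub>Aut n\<^esub> f = inverse_arrow S f"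
  by (rule group.inv_equality[OF group_Aut]) (auto simp: Aut_simps in_Hom)

lemma int_pow_Aut: "f \<in> carrier (Aut n) \<Longrightarrow> f [^]\<^bsub>Aut n\<^esub> (k :: int) \<in> carrier (Aut n)"
  by (rule group.int_pow_closed[OF group_Aut])

lemma nat_pow_intertwine:
  fixes k :: nat
  assumes "h \<in> Arr S" "f \<in> carrier (Aut (Dom S h))" "g \<in> carrier (Aut (Cod S h))" "h \<cdot> f = g \<cdot> h"
  shows "h \<cdot> (f [^]\<^bsub>Aut (Dom S h)\<^esub> k) = (g [^]\<^bsub>Aut (Cod S h)\<^esub> k) \<cdot> h"
proof (induction k)
  case 0
  then show ?case using assms by (simp add: Aut_simps)
next
  case (Suc k)
  interpret D: group "Aut (Dom S h)" by (rule group_Aut)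
  interpret C: group "Aut (Cod S h)" by (rule group_Aut)
  let ?f = "f [^]\<^bsub>Aut (Dom S h)\<^esub> k" and ?g = "g [^]\<^bsub>Aut (Cod S h)\<^esub> k"
  have c: "?f \<in> carrier (Aut (Dom S h))" "?g \<in> carrier (Aut (Cod S h))" using assms by auto
  note [simp] = AutD[OF c(1)] AutD[OF c(2)] AutD[OF assms(2)] AutD[OF assms(3)]
  have "h \<cdot> ?f \<cdot> f = ?g \<cdot> h \<cdot> f" by (rule comp_rewrite2[OF Suc]) (use assms in auto)
  then show ?case using assms by (simp add: Aut_simps)
qed

text \<open>For negative \<open>k\<close> the identity for \<open>- k\<close> is multiplied on both
  sides by the inverses of the two automorphisms; \<open>h\<close> may fail to be invertible and is
  never inverted.\<close>

lemma int_pow_intertwine: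
  fixes k :: int
  assumes "h \<in> Arr S" "f \<in> carrier (Aut (Dom S h))" "g \<in> carrier (Aut (Cod S h))" "h \<cdot> f = g \<cdot> h"
  shows "h \<cdot> (f [^]\<^bsub>Aut (Dom S h)\<^esub> k) = (g [^]\<^bsub>Aut (Cod S h)\<^esub> k) \<cdot> h"
proof (cases "k < 0")
  case True
  interpret D: group "Aut (Dom S h)" by (rule group_Aut)
  interpret C: group "Aut (Cod S h)" by (rule group_Aut)
  define F where "F = f [^]\<^bsub>Aut (Dom S h)\<^esub> nat (- k)"
  define H where "H = g [^]\<^bsub>Aut (Cod S h)\<^esub> nat (- k)"
  have c: "F \<in> carrier (Aut (Dom S h))" "H \<in> carrier (Aut (Cod S h))" using assms by (auto simp: F_def H_def)
  note [simp] = AutD[OF c(1)] AutD[OF c(2)]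
  have "h \<cdot> F = H \<cdot> h" unfolding F_def H_def by (rule nat_pow_intertwine[OF assms])
  then have "inverse_arrow S H \<cdot> (H \<cdot> h) \<cdot> inverse_arrow S F = inverse_arrow S H \<cdot> (h \<cdot> F) \<cdot> inverse_arrow S F" by simp
  then have "h \<cdot> inverse_arrow S F = inverse_arrow S H \<cdot> h" using assms(1) by simp
  then show ?thesis using True c by (simp add: int_pow_def2 inv_Aut F_def[symmetric] H_def[symmetric])
next
  case False
  then show ?thesis unfolding int_pow_def2 using nat_pow_intertwine[OF assms, of "nat k"] by simp
qed

lemma ev1_Aut [simp]: "w \<in> braid_words n \<Longrightarrow> ev1 n w \<in> carrier (Aut n)"
  by (intro AutI) auto

lemma ev1_power_word:
  assumes "w \<in> braid_words n"
  shows "ev1 n (power_word w k) = ev1 n w [^]\<^bsub>Aut n\<^esub> k"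
proof -
  interpret group "Aut n" by (rule group_Aut)
  have nat: "ev1 n (concat (replicate m w)) = ev1 n w [^]\<^bsub>Aut n\<^esub> m" if "w \<in> braid_words n" for m w
    by (induction m) (use that in \<open>simp_all add: Aut_simps(2,3) concat_replicate_braid_words\<close>)
  show ?thesis
  proof (cases "k \<ge> 0")
    case True
    then show ?thesis unfolding int_pow_def2 using nat[OF assms, of "nat k"] by (simp add: power_word_def)
  next
    case False
    have "ev1 n (power_word w k) = inverse_arrow S (ev1 n w) [^]\<^bsub>Aut n\<^esub> nat (- k)"
      using False nat[OF inverse_braid_words[OF assms], of "nat (- k)"] assms
      by (simp add: power_word_def ev1_inverse_word)
    also have "inverse_arrow S (ev1 n w) = inv\<^bsub>Aut n\<^esub> (ev1 n w)"
      using assms by (simp add: inv_Aut)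
    also have "\<dots> [^]\<^bsub>Aut n\<^esub> nat (- k) = inv\<^bsub>Aut n\<^esub> (ev1 n w [^]\<^bsub>Aut n\<^esub> nat (- k))"
      using assms by (simp add: nat_pow_inv)
    finally show ?thesis using False unfolding int_pow_def2 by simp
  qed
qed

lemma tens_replicate_arr [simp]:
  assumes "f \<in> Arr S"
  shows "tens (replicate n f) \<in> Arr S" "Dom S (tens (replicate n f)) = n * Dom S f"
    "Cod S (tens (replicate n f)) = n * Cod S f"
  using assms by (induction n) auto

lemma tens_replicate_comp:
  "f \<in> Arr S \<Longrightarrow> g \<in> Arr S \<Longrightarrow> Cod S f = Dom S g \<Longrightarrow>
    tens (replicate n g) \<cdot> tens (replicate n f) = tens (replicate n (g \<cdot> f))"
  by (induction n) (simp_all add: interchange)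

lemma iso_tens_replicate [simp]: "iso_arrow S f \<Longrightarrow> iso_arrow S (tens (replicate n f))"
  by (induction n) auto

lemma tens_replicate_pow:
  assumes "f \<in> carrier (Aut 1)"
  shows "tens (replicate n (f [^]\<^bsub>Aut 1\<^esub> (k :: int))) = tens (replicate n f) [^]\<^bsub>Aut n\<^esub> k"
proof (rule hom_int_pow[where h = "\<lambda>f. tens (replicate n f)", OF _ assms group_Aut group_Aut])
  show "(\<lambda>f. tens (replicate n f)) \<in> hom (Aut 1) (Aut n)"
    by (auto simp: hom_def Aut_simps in_Hom tens_replicate_comp)
qed

definition twist_pow :: "int \<Rightarrow> 'a" where
  "twist_pow k = Twist S 1 [^]\<^bsub>Aut 1\<^esub> k"

lemma twist_Aut [simp]: "Twist S n \<in> carrier (Aut n)"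
  by (intro AutI) auto

lemma twist_pow_arr [simp]: "twist_pow k \<in> Arr S" "Dom S (twist_pow k) = 1" "Cod S (twist_pow k) = 1"
  using AutD[OF int_pow_Aut[OF twist_Aut]] unfolding twist_pow_def by auto

lemma twist_pow_add: "twist_pow (k + l) = twist_pow k \<cdot> twist_pow l"
  unfolding twist_pow_def by (subst group.int_pow_mult[OF group_Aut]) (simp_all add: Aut_simps(2))

lemma twist_pow_0 [simp]: "twist_pow 0 = I 1"
  unfolding twist_pow_def by (simp add: Aut_simps)

lemma twist_pow_1 [simp]: "twist_pow 1 = Twist S 1"
  unfolding twist_pow_def by (simp add: group.int_pow_1[OF group_Aut])

text \<open>Naturality moves the power of the twist from 1 to the source of \<open>f\<close>. There
  the twist is the product of the full twist braid and of the separate twists, and its powers split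
  accordingly because these two factors commute.\<close>

lemma twist_pow_natural:
  assumes "f \<in> Arr S" "Cod S f = 1"
  shows "twist_pow k \<cdot> f = f \<cdot> ev1 (Dom S f) (power_word (full_twist_word (Dom S f)) k) \<cdot> tens (replicate (Dom S f) (twist_pow k))"
proof -
  define n where "n = Dom S f"
  interpret group "Aut n" by (rule group_Aut)
  let ?e = "ev1 n (full_twist_word n)" and ?t = "tens (replicate n (Twist S 1))"
  have t: "?t \<in> carrier (Aut n)" by (intro AutI) auto
  \<comment> \<open>The twist is the composite of \<open>?e\<close> and \<open>?t\<close>, and it
    commutes with \<open>?e\<close> by naturality. Cancelling one factor \<open>?e\<close> shows
    that \<open>?e\<close> and \<open>?t\<close> commute.\<close>
  have "?e \<cdot> (?e \<cdot> ?t) = (?e \<cdot> ?t) \<cdot> ?e"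
    unfolding ev1_full_twist using twist_natural[of ?e] by simp
  then have "?e \<cdot> ?e \<cdot> ?t = ?e \<cdot> ?t \<cdot> ?e" by simp
  then have et: "?e \<cdot> ?t = ?t \<cdot> ?e" by (subst (asm) iso_cancel_left) auto
  have A: "f \<cdot> (Twist S n [^]\<^bsub>Aut n\<^esub> k) = (Twist S 1 [^]\<^bsub>Aut 1\<^esub> k) \<cdot> f"
    using int_pow_intertwine[OF assms(1), of "Twist S n" "Twist S 1" k] twist_natural[OF assms(1)] assms(2)
    by (simp add: n_def)
  have B: "Twist S n [^]\<^bsub>Aut n\<^esub> k = (?e [^]\<^bsub>Aut n\<^esub> k) \<cdot> (?t [^]\<^bsub>Aut n\<^esub> k)"
    using int_pow_mult_distrib[of ?e ?t k, unfolded Aut_simps(2), OF et ev1_Aut[OF full_twist_braid_words] t]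
    unfolding ev1_full_twist .
  show ?thesis
    unfolding twist_pow_def tens_replicate_pow[OF twist_Aut] n_def[symmetric]
      ev1_power_word[OF full_twist_braid_words] A[symmetric] B ..
qed

lemma ev1_cable_twists:
  assumes "length ks = length ns"
  shows "ev1 (sum_list ns) (cable_twists ns ks) =
    tens (map (\<lambda>(n, k). ev1 n (power_word (full_twist_word n) k)) (zip ns ks))"
  using assms
proof (induction ns arbitrary: ks rule: rev_induct)
  case (snoc n ns)
  then obtain ks' k where ks: "ks = ks' @ [k]" by (cases ks rule: rev_cases) auto
  let ?w = "power_word (full_twist_word n) k" and ?v = "cable_twists ns ks'"
  have v: "?v \<in> braid_words (sum_list ns)"
    using cable_twists_braid_words snoc.prems ks by simp
  then have v': "?v \<in> braid_words (sum_list ns + n)" by (rule braid_words_mono) simp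
  have "ev1 (sum_list (ns @ [n])) (cable_twists (ns @ [n]) ks)
      = ev1 (sum_list ns + n) (shift_word (sum_list ns) ?w) \<cdot> ev1 (sum_list ns + n) ?v"
    using snoc.prems v' by (simp add: ks cable_twists_snoc)
  also have "\<dots> = (I (sum_list ns) \<star> ev1 n ?w) \<cdot> (ev1 (sum_list ns) ?v \<star> I n)"
    using ev1_shift[of ?w n "sum_list ns" 0] ev1_widen[OF v] by simp
  also have "\<dots> = ev1 (sum_list ns) ?v \<star> ev1 n ?w"
    using v by (simp add: interchange)
  also have "\<dots> = tens (map (\<lambda>(n, k). ev1 n (power_word (full_twist_word n) k)) (zip ns ks') @ [ev1 n ?w])"
    using snoc ks by (subst tens_append) (auto dest: set_zip_leftD)
  finally show ?case using snoc.prems ks by simp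
qed (simp add: cable_twists_def)

end

section \<open>Iterated multiplications, decorations and the arrow map\<close>

context pro_monoid
begin

text \<open>The \<open>r\<close>-fold multiplication, bracketed to the left and starting from
  \<open>eta\<close>, so that it is the identity for \<open>r = 1\<close> by the unit law and not by
  definition.\<close>

fun iter :: "nat \<Rightarrow> 'a" where
  "iter 0 = eta"
| "iter (Suc r) = mu \<cdot> (iter r \<star> I 1)"

lemma iter_arr [simp]: "iter r \<in> Arr S" "Dom S (iter r) = r" "Cod S (iter r) = 1"
  by (induction r) auto

lemma iter_1: "iter (Suc 0) = I 1"
  using mu_unit by simp

text \<open>General associativity. The induction runs over \<open>n\<close> because the recursion of
  \<open>iter\<close> splits off the last factor.\<close>

lemma iter_add: "iter (m + n) = mu \<cdot> (iter m \<star> iter n)"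
proof (induction n)
  case 0
  have "mu \<cdot> (iter m \<star> eta) = mu \<cdot> (I 1 \<star> eta) \<cdot> (iter m \<star> I 0)"
    by (subst interchange) simp_all
  also have "\<dots> = (mu \<cdot> (I 1 \<star> eta)) \<cdot> iter m" by simp
  also have "\<dots> = iter m" unfolding mu_unit by simp
  finally show ?case by simp
next
  case (Suc n)
  have "iter (m + Suc n) = mu \<cdot> ((mu \<cdot> (iter m \<star> iter n)) \<star> I 1)"
    using Suc by simp
  also have "\<dots> = mu \<cdot> (mu \<star> I 1) \<cdot> (iter m \<star> iter n \<star> I 1)"
    by (simp add: whisker_right)
  also have "\<dots> = mu \<cdot> (I 1 \<star> mu) \<cdot> (iter m \<star> iter n \<star> I 1)"
    by (rule comp_rewrite2[OF mu_assoc]) auto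
  also have "\<dots> = mu \<cdot> (iter m \<star> (mu \<cdot> (iter n \<star> I 1)))"
    by (subst interchange) auto
  finally show ?case by simp
qed

lemma set_map_iter: "set (map iter ns) \<subseteq> Arr S"
  by auto

lemma image_iter [simp]: "iter ` X \<subseteq> Arr S"
  by auto

lemma tens_iter_arr [simp]: "tens (map iter ns) \<in> Arr S" "Dom S (tens (map iter ns)) = sum_list ns"
  "Cod S (tens (map iter ns)) = length ns"
  using tens_arr[OF set_map_iter] by (simp_all add: comp_def sum_list_triv)

text \<open>Multiplying inside blocks and then across them is the same as multiplying at once. This
  is functoriality of \<open>om\<close> for maps onto the codomain 1; \<open>om_comp\<close> applies
  it fibre by fibre.\<close>

lemma iter_sum_list: "iter (sum_list ns) = iter (length ns) \<cdot> tens (map iter ns)"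
proof (induction ns rule: rev_induct)
  case (snoc n ns)
  have "iter (length (ns @ [n])) \<cdot> tens (map iter (ns @ [n]))
      = (mu \<cdot> (iter (length ns) \<star> I 1)) \<cdot> (tens (map iter ns) \<star> iter n)"
    using tens_append[of "map iter ns" "[iter n]"] by simp
  also have "\<dots> = mu \<cdot> (iter (sum_list ns) \<star> iter n)"
    by (simp add: interchange snoc)
  finally show ?case using iter_add[of "sum_list ns" n] by simp
qed simp

lemma tens_replicate_Suc: "f \<in> Arr S \<Longrightarrow> f \<star> tens (replicate r f) = tens (replicate r f) \<star> f"
proof (induction r)
  case (Suc r)
  have "(f \<star> tens (replicate r f)) \<star> f = f \<star> (tens (replicate r f) \<star> f)" using Suc.prems by simp
  also have "\<dots> = f \<star> f \<star> tens (replicate r f)" using Suc by simp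
  finally show ?case by simp
qed simp

lemma rho_iter: "x \<in> carrier G \<Longrightarrow> rho x \<cdot> iter r = iter r \<cdot> tens (replicate r (rho x))"
proof (induction r)
  case 0
  then show ?case by (simp add: rho_eta)
next
  case (Suc r)
  have t: "tens (replicate (Suc r) (rho x)) = tens (replicate r (rho x)) \<star> rho x"
    using tens_replicate_Suc[of "rho x" r] Suc.prems by simp
  have "rho x \<cdot> iter (Suc r) = (rho x \<cdot> mu) \<cdot> (iter r \<star> I 1)" using Suc.prems by simp
  also have "\<dots> = mu \<cdot> ((rho x \<cdot> iter r) \<star> rho x)"
    using Suc.prems by (simp add: rho_mu interchange)
  also have "\<dots> = mu \<cdot> (iter r \<star> I 1) \<cdot> (tens (replicate r (rho x)) \<star> rho x)"
    using Suc by (simp add: interchange)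
  finally show ?case using Suc.prems unfolding t by simp
qed

text \<open>The value of an order-preserving map: one iterated multiplication per fibre, with
  \<open>eta\<close> at the empty fibres.\<close>

definition om :: "nat list \<Rightarrow> nat \<Rightarrow> 'a" where
  "om \<phi> m = tens (map iter (fibre_sizes \<phi> m))"

lemma om_arr [simp]: "om \<phi> m \<in> Arr S" "Cod S (om \<phi> m) = m"
  by (simp_all add: om_def)

lemma om_dom: "\<phi> \<in> monotone_lists n m \<Longrightarrow> Dom S (om \<phi> m) = n"
  by (simp add: om_def)

text \<open>The fibres of \<psi> are intervals, so the fibre sizes of \<phi> form consecutive
  sublists, one above each point \<open>j\<close>. On each of them the claim is
  \<open>iter_sum_list\<close>.\<close>

lemma om_comp:
  assumes "\<phi> \<in> monotone_lists n m" "\<psi> \<in> monotone_lists m p"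
  shows "om (map ((!) \<psi>) \<phi>) p = om \<psi> p \<cdot> om \<phi> m"
proof -
  \<comment> \<open>The sizes of the fibres of \<phi> over the points that \<psi> sends to
    \<open>j\<close>.\<close>
  define gs where "gs j = map (count_list \<phi>) (filter (\<lambda>i. \<psi> ! i = j) [0..<m])" for j
  have \<psi>: "length \<psi> = m" "sorted \<psi>" "set \<psi> \<subseteq> {..<p}" and \<phi>: "set \<phi> \<subseteq> {..<m}"
    using assms by (auto simp: monotone_lists_def)
  have \<psi>_map: "map ((!) \<psi>) [0..<m] = \<psi>" using \<psi>(1) by (metis map_nth)
  have "\<psi> ! i < p" if "i < m" for i using \<psi> that by (auto simp: subset_iff)
  then have "concat (map (\<lambda>j. filter (\<lambda>i. \<psi> ! i = j) [0..<m]) [0..<p]) = [0..<m]"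
    using \<psi>_map \<psi>(2) by (intro concat_fibres) auto
  then have conc: "concat (map gs [0..<p]) = fibre_sizes \<phi> m"
    using map_concat[of "count_list \<phi>" "map (\<lambda>j. filter (\<lambda>i. \<psi> ! i = j) [0..<m]) [0..<p]"]
    by (simp add: gs_def[abs_def] fibre_sizes_def comp_def)
  have len: "length (gs j) = count_list \<psi> j" for j
  proof -
    have "length (gs j) = length (filter ((=) j) (map ((!) \<psi>) [0..<m]))"
      by (simp add: gs_def filter_map comp_def eq_commute[of j])
    then show ?thesis by (simp add: \<psi>_map count_list_eq_length_filter)
  qed
  have step: "iter (sum_list (gs j)) = iter (count_list \<psi> j) \<cdot> tens (map iter (gs j))" for j
    using iter_sum_list[of "gs j"] by (simp only: len)
  have "om (map ((!) \<psi>) \<phi>) p = tens (map (\<lambda>j. iter (sum_list (gs j))) [0..<p])"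
  proof -
    have "count_list (map ((!) \<psi>) \<phi>) j = sum_list (gs j)" for j
      unfolding gs_def by (rule count_list_map_sum[OF \<phi>])
    then show ?thesis by (simp add: om_def fibre_sizes_def comp_def del: iter.simps)
  qed
  also have "\<dots> = tens (map (\<lambda>j. iter (count_list \<psi> j)) [0..<p]) \<cdot> tens (map (\<lambda>j. tens (map iter (gs j))) [0..<p])"
    unfolding step by (rule tens_comp[symmetric]) (auto simp: len)
  also have "tens (map (\<lambda>j. iter (count_list \<psi> j)) [0..<p]) = om \<psi> p"
    by (simp add: om_def fibre_sizes_def comp_def)
  also have "tens (map (\<lambda>j. tens (map iter (gs j))) [0..<p]) = tens (concat (map (map iter \<circ> gs) [0..<p]))"
    by (subst tens_concat) (auto simp: comp_def)
  also have "concat (map (map iter \<circ> gs) [0..<p]) = map iter (fibre_sizes \<phi> m)"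
    unfolding conc[symmetric] by (simp add: map_concat)
  finally show ?thesis by (simp add: om_def)
qed

text \<open>The strands carry the iterated multiplications. After them every colour is 1, before
  them the colours are the fibre sizes, and the braid with these colours is the cabled word by
  \<open>ev_cable\<close>.\<close>

lemma om_push:
  assumes "g \<in> ribbons G m" "\<phi> \<in> monotone_lists n m"
  shows "ev1 m (braid_rep (rbraid g)) \<cdot> om \<phi> m =
    om (ribbon_push g \<phi>) m \<cdot> ev1 n (cable_word (fibre_sizes \<phi> m) (braid_rep (rbraid g)))"
proof -
  let ?w = "braid_rep (rbraid g)" and ?fs = "map iter (fibre_sizes \<phi> m)"
  have w: "?w \<in> braid_words m" using assms(1) by (auto simp: ribbons_def braid_rep_words)
  have \<phi>: "set \<phi> \<subseteq> {..<m}" using assms by (auto simp: monotone_lists_def)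
  have "map (Cod S) ?fs = replicate m (Suc 0)" "map (Dom S) ?fs = fibre_sizes \<phi> m"
    by (simp_all add: comp_def map_replicate_const)
  then have "ev1 m ?w \<cdot> tens ?fs = tens (act_word ?w ?fs) \<cdot> ev (fibre_sizes \<phi> m) ?w"
    using ev_natural[of ?fs ?w] w by (simp add: ev1_def)
  moreover have "act_word ?w ?fs = map iter (fibre_sizes (ribbon_push g \<phi>) m)"
    using fibre_sizes_push[OF \<phi> w] map_act_word[of ?w "fibre_sizes \<phi> m" iter] w
    by (simp add: ribbon_push_def braid_perm_def)
  moreover have "ev (fibre_sizes \<phi> m) ?w = ev1 n (cable_word (fibre_sizes \<phi> m) ?w)"
    using ev_cable[of ?w "fibre_sizes \<phi> m"] w assms(2) by simp
  ultimately show ?thesis by (simp add: om_def)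
qed

text \<open>One endomorphism of the object 1 for each ribbon. Labels and twists are indexed by
  starting positions, hence the decorations are performed before the braid in
  \<open>pro_map\<close>.\<close>

definition decor :: "'g ribbon \<Rightarrow> 'a list" where
  "decor g = map2 (\<lambda>x k. twist_pow k \<cdot> rho x) (labels g) (twists g)"

lemma decor_nth:
  "g \<in> ribbons G n \<Longrightarrow> length (decor g) = n"
  "g \<in> ribbons G n \<Longrightarrow> i < n \<Longrightarrow> decor g ! i = twist_pow (twists g ! i) \<cdot> rho (labels g ! i)"
  by (auto simp: decor_def ribbons_def)

lemma decor_arr:
  assumes "g \<in> ribbons G n" "f \<in> set (decor g)"
  shows "f \<in> Arr S" "Dom S f = 1" "Cod S f = 1"
proof -
  obtain i where "i < n" "f = twist_pow (twists g ! i) \<cdot> rho (labels g ! i)"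
    using assms decor_nth[OF assms(1)] by (metis in_set_conv_nth)
  then show "f \<in> Arr S" "Dom S f = 1" "Cod S f = 1" using assms(1) by simp_all
qed

lemma tens_decor:
  assumes "g \<in> ribbons G n"
  shows "tens (decor g) \<in> Arr S" "Dom S (tens (decor g)) = n" "Cod S (tens (decor g)) = n"
proof -
  have "set (decor g) \<subseteq> Arr S" "map (Dom S) (decor g) = replicate n (Suc 0)" "map (Cod S) (decor g) = replicate n (Suc 0)"
    using decor_arr[OF assms] decor_nth(1)[OF assms] by (auto simp: map_replicate_const[symmetric])
  then show "tens (decor g) \<in> Arr S" "Dom S (tens (decor g)) = n" "Cod S (tens (decor g)) = n"
    by (simp_all add: sum_list_replicate)
qed

lemma twist_pow_rho: "x \<in> carrier G \<Longrightarrow> twist_pow k \<cdot> rho x = rho x \<cdot> twist_pow k"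
  using int_pow_intertwine[of "rho x" "Twist S 1" "Twist S 1" k] twist_natural[of "rho x"]
  by (simp add: twist_pow_def)

lemma decor_iter:
  assumes "x \<in> carrier G"
  shows "(twist_pow k \<cdot> rho x) \<cdot> iter r =
    iter r \<cdot> ev1 r (power_word (full_twist_word r) k) \<cdot> tens (replicate r (twist_pow k \<cdot> rho x))"
proof -
  let ?e = "ev1 r (power_word (full_twist_word r) k)"
  have "(twist_pow k \<cdot> rho x) \<cdot> iter r = (twist_pow k \<cdot> iter r) \<cdot> tens (replicate r (rho x))"
    using assms by (simp add: rho_iter)
  also have "twist_pow k \<cdot> iter r = iter r \<cdot> ?e \<cdot> tens (replicate r (twist_pow k))"
    using twist_pow_natural[of "iter r" k] by simp
  also have "(iter r \<cdot> ?e \<cdot> tens (replicate r (twist_pow k))) \<cdot> tens (replicate r (rho x))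
      = iter r \<cdot> ?e \<cdot> tens (replicate r (twist_pow k)) \<cdot> tens (replicate r (rho x))"
    using assms by simp
  also have "tens (replicate r (twist_pow k)) \<cdot> tens (replicate r (rho x)) = tens (replicate r (twist_pow k \<cdot> rho x))"
    using assms by (simp add: tens_replicate_comp)
  finally show ?thesis .
qed

text \<open>Over each point \<open>decor_iter\<close> produces a power of the full twist braid and
  copies of one decoration. The powers assemble to \<open>cable_twists\<close>, the copies to the
  decorations of the ribbons obtained by cutting.\<close>

lemma decor_om:
  assumes g: "g \<in> ribbons G m" and \<phi>: "\<phi> \<in> monotone_lists n m"
  shows "tens (decor g) \<cdot> om \<phi> m =
    om \<phi> m \<cdot> ev1 n (cable_twists (fibre_sizes \<phi> m) (twists g)) \<cdot> tens (map ((!) (decor g)) \<phi>)"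
proof -
  define e where "e j = ev1 (count_list \<phi> j) (power_word (full_twist_word (count_list \<phi> j)) (twists g ! j))" for j
  define t where "t j = tens (replicate (count_list \<phi> j) (decor g ! j))" for j
  have d: "decor g = map ((!) (decor g)) [0..<m]" using decor_nth(1)[OF g] by (metis map_nth)
  have dj: "decor g ! j \<in> Arr S" "Dom S (decor g ! j) = 1" "Cod S (decor g ! j) = 1" if "j < m" for j
    using decor_arr[OF g nth_mem, of j] decor_nth(1)[OF g] that by simp_all
  have et: "e j \<in> Arr S" "Dom S (e j) = count_list \<phi> j" "Cod S (e j) = count_list \<phi> j" for j
    by (simp_all add: e_def)
  have tt: "t j \<in> Arr S" "Dom S (t j) = count_list \<phi> j" "Cod S (t j) = count_list \<phi> j" if "j < m" for j
    using dj[OF that] by (simp_all add: t_def)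
  have step: "decor g ! j \<cdot> iter (count_list \<phi> j) = iter (count_list \<phi> j) \<cdot> e j \<cdot> t j" if "j < m" for j
    using decor_iter[of "labels g ! j" "twists g ! j" "count_list \<phi> j"] that g
    by (simp add: decor_nth(2)[OF g that] e_def t_def)
  have om: "om \<phi> m = tens (map (\<lambda>j. iter (count_list \<phi> j)) [0..<m])"
    by (simp add: om_def fibre_sizes_def comp_def)
  have "tens (decor g) \<cdot> om \<phi> m = tens (map (\<lambda>j. decor g ! j \<cdot> iter (count_list \<phi> j)) [0..<m])"
    unfolding om by (subst d, subst tens_comp) (auto simp: dj)
  also have "\<dots> = tens (map (\<lambda>j. iter (count_list \<phi> j) \<cdot> e j \<cdot> t j) [0..<m])"
    by (intro arg_cong[of _ _ tens] map_cong) (auto simp: step)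
  also have "\<dots> = om \<phi> m \<cdot> tens (map (\<lambda>j. e j \<cdot> t j) [0..<m])"
    unfolding om by (rule tens_comp[symmetric]) (auto simp: et tt)
  also have "tens (map (\<lambda>j. e j \<cdot> t j) [0..<m]) = tens (map e [0..<m]) \<cdot> tens (map t [0..<m])"
    by (rule tens_comp[symmetric]) (auto simp: et tt)
  also have "tens (map e [0..<m]) = ev1 n (cable_twists (fibre_sizes \<phi> m) (twists g))"
  proof -
    have tw: "length (twists g) = m" using g by (simp add: ribbons_def)
    have "map e [0..<m] = map (\<lambda>(n, k). ev1 n (power_word (full_twist_word n) k)) (zip (fibre_sizes \<phi> m) (twists g))"
      using tw by (intro nth_equalityI) (auto simp: e_def fibre_sizes_def)
    then show ?thesis using ev1_cable_twists[of "twists g" "fibre_sizes \<phi> m"] tw \<phi> by simp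
  qed
  also have "tens (map t [0..<m]) = tens (map ((!) (decor g)) \<phi>)"
    unfolding monotone_list_map_blocks[OF \<phi>] t_def
    by (subst tens_concat) (auto simp: comp_def dj)
  finally show ?thesis .
qed

lemma decor_pull:
  assumes "g \<in> ribbons G m" "\<phi> \<in> monotone_lists n m"
  shows "decor (ribbon_pull \<phi> g) = map ((!) (decor g)) \<phi>"
proof (rule nth_equalityI)
  have n: "length \<phi> = n" using assms(2) by (simp add: monotone_lists_def)
  show "length (decor (ribbon_pull \<phi> g)) = length (map ((!) (decor g)) \<phi>)"
    using n decor_nth(1)[OF ribbon_pull_ribbons(1)[OF assms]] by simp
  fix i assume "i < length (decor (ribbon_pull \<phi> g))"
  then have i: "i < n" using decor_nth(1)[OF ribbon_pull_ribbons(1)[OF assms]] by simp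
  then have "\<phi> ! i < m" using assms(2) by (auto simp: monotone_lists_def subset_iff)
  then show "decor (ribbon_pull \<phi> g) ! i = map ((!) (decor g)) \<phi> ! i"
    using i n by (simp add: decor_nth(2)[OF ribbon_pull_ribbons(1)[OF assms] i] decor_nth(2)[OF assms(1)])
      (simp add: ribbon_pull_def Let_def)
qed

text \<open>The decorations of \<open>h\<close> sit at the end of the braid of \<open>g\<close>.
  Sliding them back to its beginning reindexes them by the permutation of \<open>g\<close>, which is
  the rule by which labels and twists multiply along ribbons.\<close>

lemma decor_mult:
  assumes g: "g \<in> ribbons G n" and h: "h \<in> ribbons G n"
  shows "tens (decor h) \<cdot> ev1 n (braid_rep (rbraid g)) \<cdot> tens (decor g) =
    ev1 n (braid_rep (rbraid g)) \<cdot> tens (decor (ribbon_mult G h g))"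
proof -
  let ?w = "braid_rep (rbraid g)"
  have w: "?w \<in> braid_words n" using g by (auto simp: ribbons_def braid_rep_words)
  have p: "word_perm ?w i < n" if "i < n" for i
    using bij_word_perm[OF w] that by (auto simp: bij_betw_def)
  \<comment> \<open>The decorations of \<open>h\<close> listed by the starting positions of the
    strands of \<open>g\<close>, so that the action of the word carries \<open>d\<close> to
    \<open>decor h\<close>.\<close>
  define d where "d = map (\<lambda>i. decor h ! word_perm ?w i) [0..<n]"
  have dl: "length d = n" by (simp add: d_def)
  have d: "f \<in> Arr S \<and> Dom S f = 1 \<and> Cod S f = 1" if f: "f \<in> set d" for f
  proof -
    obtain i where "i < n" "f = decor h ! word_perm ?w i" using f unfolding d_def by auto
    then have "f \<in> set (decor h)" using p decor_nth(1)[OF h] by auto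
    then show ?thesis using decor_arr[OF h] by blast
  qed
  have dd: "set d \<subseteq> Arr S" using d by auto
  have act: "act_word ?w d = decor h"
  proof (rule nth_equalityI)
    show "length (act_word ?w d) = length (decor h)" using dl decor_nth(1)[OF h] by simp
    fix j assume "j < length (act_word ?w d)"
    then have "j < n" using dl by simp
    then obtain i where i: "i < n" "j = word_perm ?w i"
      using bij_word_perm[OF w] unfolding bij_betw_def by auto
    then show "act_word ?w d ! j = decor h ! j"
      using act_word_nth[of ?w d i] w dl by (simp add: d_def)
  qed
  have dn: "decor g = map ((!) (decor g)) [0..<n]" using decor_nth(1)[OF g] by (metis map_nth)
  have dj: "decor g ! j \<in> Arr S" "Dom S (decor g ! j) = 1" "Cod S (decor g ! j) = 1"
    "decor h ! j \<in> Arr S" "Dom S (decor h ! j) = 1" "Cod S (decor h ! j) = 1" if "j < n" for j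
    using decor_arr[OF g nth_mem, of j] decor_arr[OF h nth_mem, of j] decor_nth(1)[OF g] decor_nth(1)[OF h] that by simp_all
  have dm: "decor (ribbon_mult G h g) ! i = decor h ! word_perm ?w i \<cdot> decor g ! i" if i: "i < n" for i
  proof -
    let ?x = "labels h ! word_perm ?w i" and ?k = "twists h ! word_perm ?w i"
    let ?y = "labels g ! i" and ?l = "twists g ! i"
    have xy: "?x \<in> carrier G" "?y \<in> carrier G" using p[OF i] i g h by auto
    have "decor (ribbon_mult G h g) ! i = twist_pow (?k + ?l) \<cdot> rho (?x \<otimes>\<^bsub>G\<^esub> ?y)"
      using i g by (subst decor_nth(2)[OF G.ribbon_mult_ribbons[OF g h] i])
        (simp add: ribbon_mult_def Let_def braid_perm_def ribbons_def)
    \<comment> \<open>The twist of \<open>g\<close> is exchanged with the label of \<open>h\<close>;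
      this is allowed since the twist is natural.\<close>
    also have "\<dots> = twist_pow ?k \<cdot> (twist_pow ?l \<cdot> rho ?x) \<cdot> rho ?y"
      using xy by (simp add: twist_pow_add rho_mult)
    also have "\<dots> = (twist_pow ?k \<cdot> rho ?x) \<cdot> twist_pow ?l \<cdot> rho ?y"
      using xy by (simp only: twist_pow_rho[OF xy(1), of ?l]) simp
    finally show ?thesis using p[OF i] i by (simp add: decor_nth(2)[OF g] decor_nth(2)[OF h])
  qed
  have "tens (decor h) \<cdot> ev1 n ?w = ev1 n ?w \<cdot> tens d"
    using ev1_natural[OF dd, of ?w] w d dl act by simp
  then have "tens (decor h) \<cdot> ev1 n ?w \<cdot> tens (decor g) = (ev1 n ?w \<cdot> tens d) \<cdot> tens (decor g)"
    using w tens_decor[OF g] tens_decor[OF h] by (intro comp_rewrite) simp_all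
  also have "\<dots> = ev1 n ?w \<cdot> tens d \<cdot> tens (decor g)"
    using tens_decor[OF g] w dd d dl by (intro assoc) (simp_all add: sum_list_triv cong: map_cong)
  also have "tens d \<cdot> tens (decor g) = tens (map (\<lambda>i. decor h ! word_perm ?w i \<cdot> decor g ! i) [0..<n])"
    unfolding d_def by (subst dn, subst tens_comp) (auto simp: dj p)
  also have "map (\<lambda>i. decor h ! word_perm ?w i \<cdot> decor g ! i) [0..<n] = decor (ribbon_mult G h g)"
    using decor_nth(1)[OF G.ribbon_mult_ribbons[OF g h]] by (intro nth_equalityI) (auto simp: dm)
  finally show ?thesis .
qed

text \<open>The pair is read as \<phi> after \<open>g\<close>, and \<open>g\<close> as its labels
  and twists followed by its braid.\<close>

definition pro_map :: "'g drbg_arr \<Rightarrow> 'a" where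
  "pro_map f = om (omap f) (codom f) \<cdot> ev1 (length (omap f)) (braid_rep (rbraid (rib f))) \<cdot> tens (decor (rib f))"

lemma pro_map_arr [simp]:
  assumes "f \<in> Arr (DRBG G)"
  shows "pro_map f \<in> Arr S" "Dom S (pro_map f) = length (omap f)" "Cod S (pro_map f) = codom f"
  using DRBG_arrD[OF assms] om_dom[OF DRBG_arrD(1)[OF assms]] tens_decor[OF DRBG_arrD(2)[OF assms]]
  by (simp_all add: pro_map_def)

text \<open>Read backwards, the calculation moves the second ribbon braid past \<phi>: its
  decorations by \<open>decor_om\<close>, its braid by \<open>om_push\<close>. What results on
  \<open>n\<close> strands merges with the first ribbon braid by \<open>decor_mult\<close>, and the
  monotone parts merge by \<open>om_comp\<close>.\<close>

lemma pro_map_comp: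
  assumes f: "f \<in> Arr (DRBG G)" and f': "f' \<in> Arr (DRBG G)" and cod: "codom f = length (omap f')"
  shows "pro_map (drbg_comp G f' f) = pro_map f' \<cdot> pro_map f"
proof -
  define n m p where "n = length (omap f)" and "m = codom f" and "p = codom f'"
  define \<phi> \<psi> g h where "\<phi> = omap f" and "\<psi> = omap f'" and "g = rib f" and "h = rib f'"
  define w v where "w = braid_rep (rbraid g)" and "v = braid_rep (rbraid h)"
  have \<phi>: "\<phi> \<in> monotone_lists n m" and g: "g \<in> ribbons G n" and w: "w \<in> braid_words n"
    and \<psi>: "\<psi> \<in> monotone_lists m p" and h: "h \<in> ribbons G m" and v: "v \<in> braid_words m"
    using DRBG_arrD[OF f] DRBG_arrD[OF f'] cod by (auto simp: n_def m_def p_def \<phi>_def \<psi>_def g_def h_def w_def v_def)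
  define q where "q = ribbon_pull \<phi> h"
  \<comment> \<open>A word for the braid of the pulled back ribbon: the full twists of the blocks
    come first, then the cabled crossings.\<close>
  define u where "u = cable_twists (fibre_sizes \<phi> m) (twists h) @ cable_word (fibre_sizes \<phi> m) v"
  let ?ct = "cable_twists (fibre_sizes \<phi> m) (twists h)" and ?cw = "cable_word (fibre_sizes \<phi> m) v"
  note pull = ribbon_pull_ribbons[OF h \<phi>, folded q_def v_def]
  have u: "u \<in> braid_words n" using pull by (simp add: u_def)
  have lenh: "length (labels h) = m" "length \<phi> = n" using h \<phi> by (auto simp: ribbons_def monotone_lists_def)
  have rq: "rbraid q = braid_class n u"
    using lenh by (simp add: q_def ribbon_pull_def Let_def u_def v_def fibre_sizes_def)
  let ?w' = "w @ braid_rep (rbraid q)"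
  have w': "?w' \<in> braid_words n" using w u by (simp add: rq)
  have rm: "rbraid (ribbon_mult G q g) = braid_class n ?w'"
    using g by (simp add: ribbon_mult_def Let_def ribbons_def w_def)
  have push: "ribbon_push h \<phi> \<in> monotone_lists n m" by (rule ribbon_push_monotone[OF h \<phi>])
  note arrs = \<phi> \<psi> w v u pull push tens_decor[OF g] tens_decor[OF h] tens_decor[OF pull(1)]
    tens_decor[OF G.ribbon_mult_ribbons[OF g pull(1)]] om_dom[OF \<phi>] om_dom[OF \<psi>] om_dom[OF push]
  have pro: "pro_map f' = om \<psi> p \<cdot> ev1 m v \<cdot> tens (decor h)" "pro_map f = om \<phi> m \<cdot> ev1 n w \<cdot> tens (decor g)"
    using cod by (simp_all add: pro_map_def \<phi>_def \<psi>_def g_def h_def p_def m_def n_def w_def v_def)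
  have comp: "omap (drbg_comp G f' f) = map ((!) \<psi>) (ribbon_push h \<phi>)" "codom (drbg_comp G f' f) = p"
    "rib (drbg_comp G f' f) = ribbon_mult G q g"
    by (simp_all add: drbg_comp_def \<phi>_def \<psi>_def g_def h_def p_def q_def)
  have "pro_map (drbg_comp G f' f) = om (map ((!) \<psi>) (ribbon_push h \<phi>)) p \<cdot> ev1 n (braid_rep (braid_class n ?w')) \<cdot> tens (decor (ribbon_mult G q g))"
    using push by (simp add: pro_map_def comp rm monotone_lists_def)
  also have "\<dots> = (om \<psi> p \<cdot> om (ribbon_push h \<phi>) m) \<cdot> (ev1 n u \<cdot> ev1 n w) \<cdot> tens (decor (ribbon_mult G q g))"
    using w w' u by (simp add: om_comp[OF push \<psi>] rq)
  also have "\<dots> = om \<psi> p \<cdot> om (ribbon_push h \<phi>) m \<cdot> ev1 n u \<cdot> ev1 n w \<cdot> tens (decor (ribbon_mult G q g))"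
    using arrs by simp
  also have "ev1 n w \<cdot> tens (decor (ribbon_mult G q g)) = tens (decor q) \<cdot> ev1 n w \<cdot> tens (decor g)"
    using decor_mult[OF g pull(1)] by (simp add: w_def)
  also have "om \<psi> p \<cdot> om (ribbon_push h \<phi>) m \<cdot> ev1 n u \<cdot> tens (decor q) \<cdot> ev1 n w \<cdot> tens (decor g)
     = om \<psi> p \<cdot> (om (ribbon_push h \<phi>) m \<cdot> ev1 n ?cw) \<cdot> ev1 n ?ct \<cdot> tens (decor q) \<cdot> ev1 n w \<cdot> tens (decor g)"
    using arrs by (simp add: u_def)
  also have "om (ribbon_push h \<phi>) m \<cdot> ev1 n ?cw = ev1 m v \<cdot> om \<phi> m"
    using om_push[OF h \<phi>] by (simp add: v_def)
  also have "om \<psi> p \<cdot> (ev1 m v \<cdot> om \<phi> m) \<cdot> ev1 n ?ct \<cdot> tens (decor q) \<cdot> ev1 n w \<cdot> tens (decor g)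
     = om \<psi> p \<cdot> ev1 m v \<cdot> (om \<phi> m \<cdot> ev1 n ?ct \<cdot> tens (decor q)) \<cdot> ev1 n w \<cdot> tens (decor g)"
    using arrs by simp
  also have "om \<phi> m \<cdot> ev1 n ?ct \<cdot> tens (decor q) = tens (decor h) \<cdot> om \<phi> m"
    using decor_om[OF h \<phi>] decor_pull[OF h \<phi>] by (simp add: q_def)
  also have "om \<psi> p \<cdot> ev1 m v \<cdot> (tens (decor h) \<cdot> om \<phi> m) \<cdot> ev1 n w \<cdot> tens (decor g) = pro_map f' \<cdot> pro_map f"
    using arrs unfolding pro by simp
  finally show ?thesis .
qed

lemma decor_trivial: "decor (trivial_ribbon G n k w) = replicate n (twist_pow k)"
  by (intro nth_equalityI) (auto simp: decor_def trivial_ribbon_def)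

lemma om_ident: "om [0..<n] n = I n"
  using iter_1 by (simp add: om_def fibre_sizes_upt map_replicate del: iter.simps)

lemma pro_map_ribbon_arr:
  "w \<in> braid_words n \<Longrightarrow> pro_map (ribbon_arr n (trivial_ribbon G n k w)) = ev1 n w \<cdot> tens (replicate n (twist_pow k))"
  by (simp add: pro_map_def ribbon_arr_def decor_trivial om_ident, simp add: trivial_ribbon_def)

lemma pro_map_ident: "pro_map (drbg_ident G n) = I n"
  unfolding drbg_ident_def by (subst pro_map_ribbon_arr) auto

lemma pro_map_braid: "pro_map (ribbon_arr (n + m) (trivial_ribbon G (n + m) 0 (block_word n m))) = Braid S n m"
  by (subst pro_map_ribbon_arr) (auto simp: ev1_block)

lemma pro_map_twist: "pro_map (ribbon_arr n (trivial_ribbon G n 1 (full_twist_word n))) = Twist S n"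
  by (subst pro_map_ribbon_arr) (auto simp: ev1_full_twist[unfolded One_nat_def])

lemma pro_map_tensor:
  assumes f: "f \<in> Arr (DRBG G)" and f': "f' \<in> Arr (DRBG G)"
  shows "pro_map (drbg_tensor f f') = pro_map f \<star> pro_map f'"
proof -
  define n n' where "n = length (omap f)" and "n' = length (omap f')"
  let ?w = "braid_rep (rbraid (rib f))" and ?w' = "braid_rep (rbraid (rib f'))"
  note D = DRBG_arrD[OF f, folded n_def] and D' = DRBG_arrD[OF f', folded n'_def]
  have w: "?w \<in> braid_words (n + n')" by (rule braid_words_mono[OF D(3)]) simp
  have w': "shift_word n ?w' \<in> braid_words (n + n')" by (rule shift_braid_words[OF D'(3)])
  have s: "set (decor (rib f)) \<subseteq> Arr S" "set (decor (rib f')) \<subseteq> Arr S"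
    using decor_arr[OF D(2)] decor_arr[OF D'(2)] by auto
  have "om (omap (drbg_tensor f f')) (codom f + codom f') = om (omap f) (codom f) \<star> om (omap f') (codom f')"
    using D(1) by (simp add: om_def drbg_tensor_def fibre_sizes_append monotone_lists_def tens_append)
  moreover have "decor (rib (drbg_tensor f f')) = decor (rib f) @ decor (rib f')"
    using D(2) D'(2) by (simp add: decor_def drbg_tensor_def Let_def ribbons_def)
  moreover have "ev1 (n + n') (braid_rep (rbraid (rib (drbg_tensor f f')))) = ev1 n ?w \<star> ev1 n' ?w'"
  proof -
    have "ev1 (n + n') (braid_rep (rbraid (rib (drbg_tensor f f')))) = ev1 (n + n') (shift_word n ?w') \<cdot> ev1 (n + n') ?w"
      using w w' by (simp add: drbg_tensor_def Let_def n_def n'_def)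
    also have "\<dots> = (I n \<star> ev1 n' ?w') \<cdot> (ev1 n ?w \<star> I n')"
      using ev1_shift[OF D'(3), of n 0] ev1_widen[OF D(3), of n'] D' by simp
    finally show ?thesis using D D' by (simp add: interchange)
  qed
  moreover have "length (omap (drbg_tensor f f')) = n + n'" "codom (drbg_tensor f f') = codom f + codom f'"
    by (simp_all add: drbg_tensor_def n_def n'_def)
  ultimately show ?thesis
    using D D' s om_dom[OF D(1)] om_dom[OF D'(1)] tens_decor[OF D(2)] tens_decor[OF D'(2)]
    by (simp add: pro_map_def tens_append interchange flip: n_def n'_def)
qed

end

section \<open>Tensor powers in a monoidal category\<close>

context monoidal_category
begin

declare unit_obj [simp] tensor_obj [simp] tensor_ident [simp]

lemma tensor_arr [simp]:
  assumes "f \<in> Arr C" "g \<in> Arr C"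
  shows "f \<star> g \<in> Arr C" "Dom C (f \<star> g) = Dom C f \<diamondop> Dom C g" "Cod C (f \<star> g) = Cod C f \<diamondop> Cod C g"
  using tensor_hom[of f "Dom C f" "Cod C f" g "Dom C g" "Cod C g"] assms by (auto simp: in_Hom)

lemma tensor_comp:
  "\<lbrakk>f \<in> Arr C; g \<in> Arr C; f' \<in> Arr C; g' \<in> Arr C; Cod C f = Dom C g; Cod C f' = Dom C g'\<rbrakk>
    \<Longrightarrow> (g \<star> g') \<cdot> (f \<star> f') = (g \<cdot> f) \<star> (g' \<cdot> f')"
  using interchange[of f "Dom C f" "Dom C g" g "Cod C g" f' "Dom C f'" "Dom C g'" g' "Cod C g'"]
  by (auto simp: in_Hom)

lemma assoc_arr [simp]:
  assumes "a \<in> Obj C" "b \<in> Obj C" "c \<in> Obj C"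
  shows "Assoc C a b c \<in> Arr C" "Dom C (Assoc C a b c) = (a \<diamondop> b) \<diamondop> c"
    "Cod C (Assoc C a b c) = a \<diamondop> b \<diamondop> c"
  using assoc_hom[OF assms] by (auto simp: in_Hom)

lemma unit_arr [simp]:
  assumes "a \<in> Obj C"
  shows "LUnit C a \<in> Arr C" "Dom C (LUnit C a) = Unit C \<diamondop> a" "Cod C (LUnit C a) = a"
    "RUnit C a \<in> Arr C" "Dom C (RUnit C a) = a \<diamondop> Unit C" "Cod C (RUnit C a) = a"
  using lunit_hom[OF assms] runit_hom[OF assms] by (auto simp: in_Hom)

declare assoc_iso [simp] lunit_iso [simp] runit_iso [simp]

lemma assoc_nat:
  "\<lbrakk>f \<in> Arr C; g \<in> Arr C; h \<in> Arr C\<rbrakk> \<Longrightarrow>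
    Assoc C (Cod C f) (Cod C g) (Cod C h) \<cdot> ((f \<star> g) \<star> h) = (f \<star> g \<star> h) \<cdot> Assoc C (Dom C f) (Dom C g) (Dom C h)"
  by (rule assoc_natural) (auto simp: in_Hom)

lemma lunit_nat: "f \<in> Arr C \<Longrightarrow> LUnit C (Cod C f) \<cdot> (Ident C (Unit C) \<star> f) = f \<cdot> LUnit C (Dom C f)"
  by (rule lunit_natural) (auto simp: in_Hom)

lemma runit_nat: "f \<in> Arr C \<Longrightarrow> RUnit C (Cod C f) \<cdot> (f \<star> Ident C (Unit C)) = f \<cdot> RUnit C (Dom C f)"
  by (rule runit_natural) (auto simp: in_Hom)

lemma inverse_arrows_tensor:
  assumes "iso_arrow C f" "iso_arrow C g"
  shows "inverse_arrows C (f \<star> g) (inverse_arrow C f \<star> inverse_arrow C g)"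
  using assms iso_arrow_arr[OF assms(1)] iso_arrow_arr[OF assms(2)]
  unfolding inverse_arrows_def in_Hom by (simp add: tensor_comp)

lemma iso_tensor [simp]: "iso_arrow C f \<Longrightarrow> iso_arrow C g \<Longrightarrow> iso_arrow C (f \<star> g)"
  using inverse_arrows_tensor unfolding iso_arrow_def by blast

lemma inverse_tensor [simp]:
  "iso_arrow C f \<Longrightarrow> iso_arrow C g \<Longrightarrow> inverse_arrow C (f \<star> g) = inverse_arrow C f \<star> inverse_arrow C g"
  using inverse_arrows_tensor inverse_arrowI by blast

text \<open>Tensoring with the unit is naturally isomorphic to the identity functor through the
  unitors, hence faithful.\<close>

lemma unit_tensor_cancel:
  assumes "f \<in> Arr C" "g \<in> Arr C" "Dom C f = Dom C g" "Cod C f = Cod C g"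
  shows "Ident C (Unit C) \<star> f = Ident C (Unit C) \<star> g \<Longrightarrow> f = g"
    and "f \<star> Ident C (Unit C) = g \<star> Ident C (Unit C) \<Longrightarrow> f = g"
proof -
  assume "Ident C (Unit C) \<star> f = Ident C (Unit C) \<star> g"
  then have "f \<cdot> LUnit C (Dom C f) = g \<cdot> LUnit C (Dom C f)"
    using lunit_nat[of f] lunit_nat[of g] assms by simp
  then show "f = g" using assms by (subst (asm) iso_cancel_right) auto
next
  assume "f \<star> Ident C (Unit C) = g \<star> Ident C (Unit C)"
  then have "f \<cdot> RUnit C (Dom C f) = g \<cdot> RUnit C (Dom C f)"
    using runit_nat[of f] runit_nat[of g] assms by simp
  then show "f = g" using assms by (subst (asm) iso_cancel_right) auto
qed

text \<open>Kelly's argument: after tensoring with the unit on the left, the claim follows from the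
  pentagon, two triangles and naturality of the associator.\<close>

lemma lunit_tensor:
  assumes [simp]: "a \<in> Obj C" "b \<in> Obj C"
  shows "LUnit C (a \<diamondop> b) \<cdot> Assoc C (Unit C) a b = LUnit C a \<star> Ident C b"
proof (rule unit_tensor_cancel(1))
  let ?I = "Unit C" and ?i = "Ident C"
  \<comment> \<open>This isomorphism completes the left side to one path of the pentagon; it is
    cancelled at the end.\<close>
  let ?X = "Assoc C ?I (?I \<diamondop> a) b \<cdot> (Assoc C ?I ?I a \<star> ?i b)"
  have "(?i ?I \<star> LUnit C (a \<diamondop> b)) \<cdot> (?i ?I \<star> Assoc C ?I a b) \<cdot> ?X
      = (?i ?I \<star> LUnit C (a \<diamondop> b)) \<cdot> Assoc C ?I ?I (a \<diamondop> b) \<cdot> Assoc C (?I \<diamondop> ?I) a b"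
    by (simp add: pentagon)
  also have "\<dots> = (RUnit C ?I \<star> ?i a \<star> ?i b) \<cdot> Assoc C (?I \<diamondop> ?I) a b"
    by (subst comp_rewrite[OF triangle]) simp_all
  also have "\<dots> = Assoc C ?I a b \<cdot> ((RUnit C ?I \<star> ?i a) \<star> ?i b)"
    using assoc_nat[of "RUnit C ?I" "?i a" "?i b"] by simp
  also have "RUnit C ?I \<star> ?i a = (?i ?I \<star> LUnit C a) \<cdot> Assoc C ?I ?I a"
    by (simp add: triangle)
  also have "((?i ?I \<star> LUnit C a) \<cdot> Assoc C ?I ?I a) \<star> ?i b
      = ((?i ?I \<star> LUnit C a) \<star> ?i b) \<cdot> (Assoc C ?I ?I a \<star> ?i b)"
    by (simp add: tensor_comp)
  also have "Assoc C ?I a b \<cdot> ((?i ?I \<star> LUnit C a) \<star> ?i b) \<cdot> (Assoc C ?I ?I a \<star> ?i b)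
      = (?i ?I \<star> LUnit C a \<star> ?i b) \<cdot> ?X"
    using assoc_nat[of "?i ?I" "LUnit C a" "?i b"] by (subst comp_rewrite2) simp_all
  finally have "((?i ?I \<star> LUnit C (a \<diamondop> b)) \<cdot> (?i ?I \<star> Assoc C ?I a b)) \<cdot> ?X = (?i ?I \<star> LUnit C a \<star> ?i b) \<cdot> ?X"
    by simp
  then have "(?i ?I \<star> LUnit C (a \<diamondop> b)) \<cdot> (?i ?I \<star> Assoc C ?I a b) = ?i ?I \<star> LUnit C a \<star> ?i b"
    by (subst (asm) iso_cancel_right) simp_all
  then show "?i ?I \<star> (LUnit C (a \<diamondop> b) \<cdot> Assoc C ?I a b) = ?i ?I \<star> LUnit C a \<star> ?i b"
    by (simp add: tensor_comp)
qed simp_all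

text \<open>The mirror image of \<open>lunit_tensor\<close>, with the unit tensored on the
  right.\<close>

lemma runit_tensor:
  assumes [simp]: "a \<in> Obj C" "b \<in> Obj C"
  shows "(Ident C a \<star> RUnit C b) \<cdot> Assoc C a b (Unit C) = RUnit C (a \<diamondop> b)"
proof (rule unit_tensor_cancel(2))
  let ?I = "Unit C" and ?i = "Ident C"
  have "Assoc C a b ?I \<cdot> ((?i a \<star> RUnit C b) \<star> ?i ?I) \<cdot> (Assoc C a b ?I \<star> ?i ?I)
      = (?i a \<star> RUnit C b \<star> ?i ?I) \<cdot> Assoc C a (b \<diamondop> ?I) ?I \<cdot> (Assoc C a b ?I \<star> ?i ?I)"
    using assoc_nat[of "?i a" "RUnit C b" "?i ?I"] by (subst comp_rewrite2) simp_all
  also have "RUnit C b \<star> ?i ?I = (?i b \<star> LUnit C ?I) \<cdot> Assoc C b ?I ?I"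
    by (simp add: triangle)
  also have "?i a \<star> \<dots> = (?i a \<star> ?i b \<star> LUnit C ?I) \<cdot> (?i a \<star> Assoc C b ?I ?I)"
    by (simp add: tensor_comp)
  also have "((?i a \<star> ?i b \<star> LUnit C ?I) \<cdot> (?i a \<star> Assoc C b ?I ?I)) \<cdot> Assoc C a (b \<diamondop> ?I) ?I \<cdot> (Assoc C a b ?I \<star> ?i ?I)
      = (?i a \<star> ?i b \<star> LUnit C ?I) \<cdot> Assoc C a b (?I \<diamondop> ?I) \<cdot> Assoc C (a \<diamondop> b) ?I ?I"
    by (simp add: pentagon)
  also have "\<dots> = Assoc C a b ?I \<cdot> (?i (a \<diamondop> b) \<star> LUnit C ?I) \<cdot> Assoc C (a \<diamondop> b) ?I ?I"
    using assoc_nat[of "?i a" "?i b" "LUnit C ?I"] by (subst comp_rewrite2[symmetric]) simp_all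
  also have "\<dots> = Assoc C a b ?I \<cdot> (RUnit C (a \<diamondop> b) \<star> ?i ?I)"
    by (simp add: triangle)
  finally have "((?i a \<star> RUnit C b) \<star> ?i ?I) \<cdot> (Assoc C a b ?I \<star> ?i ?I) = RUnit C (a \<diamondop> b) \<star> ?i ?I"
    by (subst (asm) iso_cancel_left) simp_all
  then show "((?i a \<star> RUnit C b) \<cdot> Assoc C a b ?I) \<star> ?i ?I = RUnit C (a \<diamondop> b) \<star> ?i ?I"
    by (simp add: tensor_comp)
qed simp_all

text \<open>Naturality of the left unitor at itself identifies the left unitor of the square of the
  unit with a whiskered one. Then \<open>lunit_tensor\<close> and the triangle at the unit give two
  values of the same composite.\<close>

lemma lunit_eq_runit: "LUnit C (Unit C) = RUnit C (Unit C)"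
proof (rule unit_tensor_cancel(2))
  let ?I = "Unit C" and ?i = "Ident C"
  have "LUnit C ?I \<cdot> LUnit C (?I \<diamondop> ?I) = LUnit C ?I \<cdot> (?i ?I \<star> LUnit C ?I)"
    using lunit_nat[of "LUnit C ?I"] by simp
  then have "LUnit C (?I \<diamondop> ?I) = ?i ?I \<star> LUnit C ?I"
    by (subst (asm) iso_cancel_left) simp_all
  then show "LUnit C ?I \<star> ?i ?I = RUnit C ?I \<star> ?i ?I"
    using lunit_tensor[of ?I ?I] triangle[of ?I ?I] by simp
qed simp_all

end

section \<open>Tensor powers and their comparison isomorphisms\<close>

locale tensor_powers = monoidal_category C
  for C :: "('o, 'a, 'm) moncat_scheme" (structure) +
  fixes A :: 'o
  assumes A_obj [simp]: "A \<in> Obj C"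
begin

text \<open>Since the recursion ends in the unit object, \<open>pow 1\<close> is
  \<open>A \<diamondop> Unit C\<close>; this is where monoids on \<open>A\<close> will be
  moved.\<close>

fun pow :: "nat \<Rightarrow> 'o" where
  "pow 0 = Unit C"
| "pow (Suc n) = A \<diamondop> pow n"

text \<open>The canonical comparison, which moves the factors of the first power over one by one. It
  becomes the monoidal structure of the realized algebra, and \<open>phi_assoc\<close>,
  \<open>phi_0\<close> and the base case are the coherence conditions for it.\<close>

fun phi :: "nat \<Rightarrow> nat \<Rightarrow> 'a" where
  "phi 0 n = LUnit C (pow n)"
| "phi (Suc m) n = (Ident C A \<star> phi m n) \<cdot> Assoc C A (pow m) (pow n)"

lemma pow_obj [simp]: "pow n \<in> Obj C"
  by (induction n) auto

lemma phi_arr [simp]: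
  "phi m n \<in> Arr C" "Dom C (phi m n) = pow m \<diamondop> pow n" "Cod C (phi m n) = pow (m + n)" "iso_arrow C (phi m n)"
  by (induction m) auto

lemma phi_0: "phi m 0 = RUnit C (pow m)"
  by (induction m) (auto simp: runit_tensor lunit_eq_runit)

text \<open>The induction step is the pentagon for \<open>A\<close>, \<open>pow l\<close>,
  \<open>pow m\<close> and \<open>pow n\<close>, with two naturality squares of the associator to
  bring the comparison arrows into place; the base case is \<open>lunit_tensor\<close>.\<close>

lemma phi_assoc:
  "phi (l + m) n \<cdot> (phi l m \<star> Ident C (pow n)) =
   phi l (m + n) \<cdot> (Ident C (pow l) \<star> phi m n) \<cdot> Assoc C (pow l) (pow m) (pow n)"
proof (induction l)
  case 0
  have "LUnit C (pow (m + n)) \<cdot> (Ident C (Unit C) \<star> phi m n) \<cdot> Assoc C (Unit C) (pow m) (pow n)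
      = phi m n \<cdot> LUnit C (pow m \<diamondop> pow n) \<cdot> Assoc C (Unit C) (pow m) (pow n)"
    using lunit_nat[of "phi m n"] by (subst comp_rewrite2) simp_all
  then show ?case by (simp add: lunit_tensor)
next
  case (Suc l)
  let ?i = "Ident C"
  have "phi (Suc l + m) n \<cdot> (phi (Suc l) m \<star> ?i (pow n))
      = (?i A \<star> phi (l + m) n) \<cdot> Assoc C A (pow (l + m)) (pow n) \<cdot>
        (((?i A \<star> phi l m) \<star> ?i (pow n)) \<cdot> (Assoc C A (pow l) (pow m) \<star> ?i (pow n)))"
    by (simp add: tensor_comp)
  also have "\<dots> = (?i A \<star> phi (l + m) n) \<cdot> (?i A \<star> phi l m \<star> ?i (pow n)) \<cdot>
      Assoc C A (pow l \<diamondop> pow m) (pow n) \<cdot> (Assoc C A (pow l) (pow m) \<star> ?i (pow n))"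
    using assoc_nat[of "?i A" "phi l m" "?i (pow n)"] by (subst comp_rewrite2) simp_all
  also have "\<dots> = ((?i A \<star> phi (l + m) n) \<cdot> (?i A \<star> phi l m \<star> ?i (pow n))) \<cdot>
      Assoc C A (pow l \<diamondop> pow m) (pow n) \<cdot> (Assoc C A (pow l) (pow m) \<star> ?i (pow n))"
    by simp
  also have "(?i A \<star> phi (l + m) n) \<cdot> (?i A \<star> phi l m \<star> ?i (pow n))
      = (?i A \<star> phi l (m + n)) \<cdot> (?i A \<star> ?i (pow l) \<star> phi m n) \<cdot> (?i A \<star> Assoc C (pow l) (pow m) (pow n))"
    by (simp add: tensor_comp Suc add.assoc)
  also have "(\<dots>) \<cdot> Assoc C A (pow l \<diamondop> pow m) (pow n) \<cdot> (Assoc C A (pow l) (pow m) \<star> ?i (pow n))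
      = (?i A \<star> phi l (m + n)) \<cdot> (?i A \<star> ?i (pow l) \<star> phi m n) \<cdot>
        Assoc C A (pow l) (pow m \<diamondop> pow n) \<cdot> Assoc C (A \<diamondop> pow l) (pow m) (pow n)"
    by (simp add: pentagon add.assoc)
  also have "\<dots> = (?i A \<star> phi l (m + n)) \<cdot> Assoc C A (pow l) (pow (m + n)) \<cdot>
      (?i (A \<diamondop> pow l) \<star> phi m n) \<cdot> Assoc C (A \<diamondop> pow l) (pow m) (pow n)"
    using assoc_nat[of "?i A" "?i (pow l)" "phi m n"] by (subst (2) comp_rewrite2) simp_all
  finally show ?case by (simp add: add.assoc)
qed

text \<open>The comparisons for the two bracketings of a threefold product. They differ by the
  associator (\<open>left3_right3\<close>), which is how the coherence arrows of \<open>C\<close>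
  disappear after transport.\<close>

definition left3 :: "nat \<Rightarrow> nat \<Rightarrow> nat \<Rightarrow> 'a" where
  "left3 l m n = phi (l + m) n \<cdot> (phi l m \<star> Ident C (pow n))"

definition right3 :: "nat \<Rightarrow> nat \<Rightarrow> nat \<Rightarrow> 'a" where
  "right3 l m n = phi l (m + n) \<cdot> (Ident C (pow l) \<star> phi m n)"

lemma left3_arr [simp]:
  "left3 l m n \<in> Arr C" "Dom C (left3 l m n) = (pow l \<diamondop> pow m) \<diamondop> pow n" "Cod C (left3 l m n) = pow (l + m + n)"
  "iso_arrow C (left3 l m n)"
  by (simp_all add: left3_def)

lemma right3_arr [simp]:
  "right3 l m n \<in> Arr C" "Dom C (right3 l m n) = pow l \<diamondop> pow m \<diamondop> pow n" "Cod C (right3 l m n) = pow (l + m + n)"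
  "iso_arrow C (right3 l m n)"
  by (simp_all add: right3_def add.assoc)

lemma left3_right3: "left3 l m n = right3 l m n \<cdot> Assoc C (pow l) (pow m) (pow n)"
  by (simp add: left3_def right3_def phi_assoc add.assoc)

lemma inverse_left3: "inverse_arrow C (left3 l m n) =
    inverse_arrow C (Assoc C (pow l) (pow m) (pow n)) \<cdot> inverse_arrow C (right3 l m n)"
  by (simp add: left3_right3 inverse_comp)

text \<open>Conjugation by the comparison arrows. The tensor product of the strict category is the
  transport of the tensor product of \<open>C\<close>.\<close>

definition transport :: "nat \<Rightarrow> nat \<Rightarrow> nat \<Rightarrow> nat \<Rightarrow> 'a \<Rightarrow> 'a" where
  "transport m n m' n' f = phi m' n' \<cdot> f \<cdot> inverse_arrow C (phi m n)"

lemma transport_arr [simp]: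
  assumes "f \<in> Arr C" "Dom C f = pow m \<diamondop> pow n" "Cod C f = pow m' \<diamondop> pow n'"
  shows "transport m n m' n' f \<in> Arr C" "Dom C (transport m n m' n' f) = pow (m + n)" "Cod C (transport m n m' n' f) = pow (m' + n')"
  using assms by (simp_all add: transport_def)

lemma transport_comp:
  assumes "f \<in> Arr C" "Dom C f = pow m \<diamondop> pow n" "Cod C f = pow m' \<diamondop> pow n'"
    "g \<in> Arr C" "Dom C g = pow m' \<diamondop> pow n'" "Cod C g = pow m'' \<diamondop> pow n''"
  shows "transport m' n' m'' n'' g \<cdot> transport m n m' n' f = transport m n m'' n'' (g \<cdot> f)"
  using assms by (simp add: transport_def)

lemma transport_ident [simp]: "transport m n m n (Ident C (pow m \<diamondop> pow n)) = Ident C (pow (m + n))"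
  by (simp add: transport_def)

lemma transport_left:
  assumes "f \<in> Arr C" "Dom C f = pow l \<diamondop> pow m" "Cod C f = pow l' \<diamondop> pow m'"
    "h \<in> Arr C" "Dom C h = pow n" "Cod C h = pow n'"
  shows "transport (l + m) n (l' + m') n' (transport l m l' m' f \<star> h) = left3 l' m' n' \<cdot> (f \<star> h) \<cdot> inverse_arrow C (left3 l m n)"
proof -
  have "transport l m l' m' f \<star> h = (phi l' m' \<star> Ident C (pow n')) \<cdot> (f \<star> h) \<cdot> (inverse_arrow C (phi l m) \<star> Ident C (pow n))"
    using assms by (simp add: transport_def tensor_comp)
  then show ?thesis using assms by (simp add: transport_def[of "l + m"] left3_def inverse_comp)
qed

lemma transport_right:
  assumes "f \<in> Arr C" "Dom C f = pow m \<diamondop> pow n" "Cod C f = pow m' \<diamondop> pow n'"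
    "h \<in> Arr C" "Dom C h = pow l" "Cod C h = pow l'"
  shows "transport l (m + n) l' (m' + n') (h \<star> transport m n m' n' f) = right3 l' m' n' \<cdot> (h \<star> f) \<cdot> inverse_arrow C (right3 l m n)"
proof -
  have "h \<star> transport m n m' n' f = (Ident C (pow l') \<star> phi m' n') \<cdot> (h \<star> f) \<cdot> (Ident C (pow l) \<star> inverse_arrow C (phi m n))"
    using assms by (simp add: transport_def tensor_comp)
  then show ?thesis using assms by (simp add: transport_def[of l] right3_def inverse_comp)
qed

lemma transport_assoc:
  assumes "f \<in> Arr C" "Dom C f = pow l" "Cod C f = pow l'" "g \<in> Arr C" "Dom C g = pow m" "Cod C g = pow m'"
    "h \<in> Arr C" "Dom C h = pow n" "Cod C h = pow n'"
  shows "transport (l + m) n (l' + m') n' (transport l m l' m' (f \<star> g) \<star> h) = transport l (m + n) l' (m' + n') (f \<star> transport m n m' n' (g \<star> h))"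
proof -
  let ?a = "Assoc C (pow l) (pow m) (pow n)" and ?a' = "Assoc C (pow l') (pow m') (pow n')"
  have "(?a' \<cdot> ((f \<star> g) \<star> h)) \<cdot> inverse_arrow C ?a = f \<star> g \<star> h"
    using assoc_nat[of f g h] assms by simp
  then have "((?a' \<cdot> ((f \<star> g) \<star> h)) \<cdot> inverse_arrow C ?a) \<cdot> inverse_arrow C (right3 l m n)
      = (f \<star> g \<star> h) \<cdot> inverse_arrow C (right3 l m n)" by (simp only:)
  then show ?thesis using assms
    by (simp add: transport_left transport_right inverse_left3) (simp add: left3_right3)
qed

lemma transport_unit:
  assumes "f \<in> Arr C" "Dom C f = pow m" "Cod C f = pow m'"
  shows "transport 0 m 0 m' (Ident C (Unit C) \<star> f) = f" "transport m 0 m' 0 (f \<star> Ident C (Unit C)) = f"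
proof -
  have "(LUnit C (pow m') \<cdot> (Ident C (Unit C) \<star> f)) \<cdot> inverse_arrow C (LUnit C (pow m)) = f"
    using lunit_nat[of f] assms by simp
  then show "transport 0 m 0 m' (Ident C (Unit C) \<star> f) = f" using assms by (simp add: transport_def)
  have "(RUnit C (pow m') \<cdot> (f \<star> Ident C (Unit C))) \<cdot> inverse_arrow C (RUnit C (pow m)) = f"
    using runit_nat[of f] assms by simp
  then show "transport m 0 m' 0 (f \<star> Ident C (Unit C)) = f" using assms by (simp add: transport_def phi_0)
qed

end

section \<open>Braiding and twist on tensor powers\<close>

context braided_monoidal_category
begin

lemma braid_arr [simp]:
  assumes "a \<in> Obj C" "b \<in> Obj C"
  shows "Braid C a b \<in> Arr C" "Dom C (Braid C a b) = a \<diamondop> b" "Cod C (Braid C a b) = b \<diamondop> a"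
  using braid_hom[OF assms] by (auto simp: in_Hom)

declare braid_iso [simp]

lemma braid_nat: "f \<in> Arr C \<Longrightarrow> g \<in> Arr C \<Longrightarrow>
    Braid C (Cod C f) (Cod C g) \<cdot> (f \<star> g) = (g \<star> f) \<cdot> Braid C (Dom C f) (Dom C g)"
  by (rule braid_natural) (auto simp: in_Hom)

end

context balanced_category
begin

lemma twist_arr [simp]:
  assumes "a \<in> Obj C"
  shows "Twist C a \<in> Arr C" "Dom C (Twist C a) = a" "Cod C (Twist C a) = a"
  using twist_hom[OF assms] by (auto simp: in_Hom)

declare twist_iso [simp]

lemma twist_nat: "f \<in> Arr C \<Longrightarrow> Twist C (Cod C f) \<cdot> f = f \<cdot> Twist C (Dom C f)"
  by (rule twist_natural) (auto simp: in_Hom)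

end

locale balanced_powers = balanced_category C + tensor_powers C A
  for C :: "('o, 'a, 'm) balcat_scheme" (structure) and A
begin

definition pbraid :: "nat \<Rightarrow> nat \<Rightarrow> 'a" where
  "pbraid m n = transport m n n m (Braid C (pow m) (pow n))"

lemma pbraid_arr [simp]:
  "pbraid m n \<in> Arr C" "Dom C (pbraid m n) = pow (m + n)" "Cod C (pbraid m n) = pow (n + m)" "iso_arrow C (pbraid m n)"
  by (simp_all add: pbraid_def) (simp add: transport_def)

lemma pbraid_natural:
  assumes "f \<in> Arr C" "Dom C f = pow m" "Cod C f = pow m'" "g \<in> Arr C" "Dom C g = pow n" "Cod C g = pow n'"
  shows "pbraid m' n' \<cdot> transport m n m' n' (f \<star> g) = transport n m n' m' (g \<star> f) \<cdot> pbraid m n"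
  using braid_nat[of f g] assms by (simp add: pbraid_def transport_comp)

lemma braid_left3:
  "pbraid l (m + n) = left3 m n l \<cdot> Braid C (pow l) (pow m \<diamondop> pow n) \<cdot> inverse_arrow C (right3 l m n)"
proof -
  have "(Braid C (pow l) (pow (m + n)) \<cdot> (Ident C (pow l) \<star> phi m n)) \<cdot> inverse_arrow C (right3 l m n)
    = ((phi m n \<star> Ident C (pow l)) \<cdot> Braid C (pow l) (pow m \<diamondop> pow n)) \<cdot> inverse_arrow C (right3 l m n)"
    using braid_nat[of "Ident C (pow l)" "phi m n"] by simp
  then show ?thesis
    using inverse_arrow_comp(2)[of "Ident C (pow l) \<star> phi m n" "inverse_arrow C (phi l (m + n))"]
    by (simp add: pbraid_def transport_def left3_def right3_def inverse_comp)
qed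

lemma braid_right3:
  "pbraid (l + m) n = right3 n l m \<cdot> Braid C (pow l \<diamondop> pow m) (pow n) \<cdot> inverse_arrow C (left3 l m n)"
proof -
  have "(Braid C (pow (l + m)) (pow n) \<cdot> (phi l m \<star> Ident C (pow n))) \<cdot> inverse_arrow C (left3 l m n)
    = ((Ident C (pow n) \<star> phi l m) \<cdot> Braid C (pow l \<diamondop> pow m) (pow n)) \<cdot> inverse_arrow C (left3 l m n)"
    using braid_nat[of "phi l m" "Ident C (pow n)"] by simp
  then show ?thesis
    using inverse_arrow_comp(2)[of "phi l m \<star> Ident C (pow n)" "inverse_arrow C (phi (l + m) n)"]
    by (simp add: pbraid_def transport_def left3_def right3_def inverse_comp)
qed

text \<open>Whiskered transports are conjugates by \<open>left3\<close> and \<open>right3\<close>.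
  Where the two factors meet, a \<open>right3\<close> is cancelled against a \<open>left3\<close>
  and leaves the middle associator of the hexagon in \<open>C\<close>.\<close>

lemma pbraid_hexagon1:
  "pbraid l (m + n) =
    transport m (l + n) m (n + l) (Ident C (pow m) \<star> pbraid l n) \<cdot> transport (l + m) n (m + l) n (pbraid l m \<star> Ident C (pow n))"
proof -
  let ?a = "\<lambda>l m n. Assoc C (pow l) (pow m) (pow n)"
  have "transport m (l + n) m (n + l) (Ident C (pow m) \<star> pbraid l n) \<cdot> transport (l + m) n (m + l) n (pbraid l m \<star> Ident C (pow n))
     = right3 m n l \<cdot> ((Ident C (pow m) \<star> Braid C (pow l) (pow n)) \<cdot> ?a m l n \<cdot> (Braid C (pow l) (pow m) \<star> Ident C (pow n)))
        \<cdot> inverse_arrow C (left3 l m n)"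
    unfolding pbraid_def by (subst transport_right, simp_all, subst transport_left, simp_all) (simp add: left3_right3[of m l n])
  also have "\<dots> = right3 m n l \<cdot> (?a m n l \<cdot> Braid C (pow l) (pow m \<diamondop> pow n) \<cdot> ?a l m n) \<cdot> inverse_arrow C (left3 l m n)"
    by (simp only: hexagon1 pow_obj)
  also have "\<dots> = pbraid l (m + n)"
    by (simp add: braid_left3 inverse_left3) (simp add: left3_right3)
  finally show ?thesis ..
qed

lemma pbraid_hexagon2:
  "pbraid (l + m) n =
    transport (l + n) m (n + l) m (pbraid l n \<star> Ident C (pow m)) \<cdot> transport l (m + n) l (n + m) (Ident C (pow l) \<star> pbraid m n)"
proof -
  let ?a = "\<lambda>l m n. Assoc C (pow l) (pow m) (pow n)"
  have "transport (l + n) m (n + l) m (pbraid l n \<star> Ident C (pow m)) \<cdot> transport l (m + n) l (n + m) (Ident C (pow l) \<star> pbraid m n)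
     = left3 n l m \<cdot> ((Braid C (pow l) (pow n) \<star> Ident C (pow m)) \<cdot> inverse_arrow C (?a l n m) \<cdot>
        (Ident C (pow l) \<star> Braid C (pow m) (pow n))) \<cdot> inverse_arrow C (right3 l m n)"
    unfolding pbraid_def by (subst transport_left, simp_all, subst transport_right, simp_all) (simp add: inverse_left3[of l n m])
  also have "\<dots> = right3 n l m \<cdot> (?a n l m \<cdot> (Braid C (pow l) (pow n) \<star> Ident C (pow m)) \<cdot> inverse_arrow C (?a l n m) \<cdot>
        (Ident C (pow l) \<star> Braid C (pow m) (pow n)) \<cdot> ?a l m n) \<cdot> inverse_arrow C (left3 l m n)"
    by (simp add: inverse_left3) (simp add: left3_right3)
  also have "\<dots> = pbraid (l + m) n"
    by (simp only: hexagon2[symmetric] pow_obj braid_right3)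
  finally show ?thesis ..
qed

text \<open>Naturality of the twist at \<open>phi m n\<close> reduces the twist of a power to the
  twist of a product, where \<open>twist_tensor\<close> applies.\<close>

lemma twist_pow_add:
  "Twist C (pow (m + n)) = pbraid n m \<cdot> pbraid m n \<cdot> transport m n m n (Twist C (pow m) \<star> Twist C (pow n))"
proof -
  have "Twist C (pow (m + n)) \<cdot> phi m n = phi m n \<cdot> Twist C (pow m \<diamondop> pow n)"
    using twist_nat[of "phi m n"] by simp
  then have "(Twist C (pow (m + n)) \<cdot> phi m n) \<cdot> inverse_arrow C (phi m n) = transport m n m n (Twist C (pow m \<diamondop> pow n))"
    by (simp add: transport_def)
  then have "Twist C (pow (m + n)) = transport m n m n (Twist C (pow m \<diamondop> pow n))" by simp
  then show ?thesis by (simp add: twist_tensor pbraid_def transport_comp)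
qed

text \<open>The full subcategory on the tensor powers of \<open>A\<close>, made strict by transport along \<^term>\<open>phi\<close>.
  An arrow has to record its source and target, since \<^term>\<open>pow\<close> need not be injective.\<close>

definition power_pro :: "(nat, nat \<times> 'a \<times> nat) balcat" where
  "power_pro =
     \<lparr>Obj = UNIV, Arr = {(m, f, n). f \<in> Hom C (pow m) (pow n)}, Dom = (\<lambda>(m, f, n). m), Cod = (\<lambda>(m, f, n). n),
      Ident = (\<lambda>n. (n, Ident C (pow n), n)),
      Comp = (\<lambda>(_, g, p) (m, f, _). (m, g \<cdot> f, p)),
      TObj = (+),
      TArr = (\<lambda>(m, f, m') (n, g, n'). (m + n, transport m n m' n' (f \<star> g), m' + n')),
      Unit = 0,
      Assoc = (\<lambda>l m n. (l + m + n, Ident C (pow (l + m + n)), l + m + n)),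
      LUnit = (\<lambda>n. (n, Ident C (pow n), n)), RUnit = (\<lambda>n. (n, Ident C (pow n), n)),
      Braid = (\<lambda>m n. (m + n, pbraid m n, n + m)),
      Twist = (\<lambda>n. (n, Twist C (pow n), n))\<rparr>"

lemma power_pro_sel [simp]:
  "Obj power_pro = UNIV"
  "(m, f, n) \<in> Arr power_pro \<longleftrightarrow> f \<in> Arr C \<and> Dom C f = pow m \<and> Cod C f = pow n"
  "Dom power_pro (m, f, n) = m" "Cod power_pro (m, f, n) = n"
  "Ident power_pro k = (k, Ident C (pow k), k)"
  "(m', g, n) \<cdot>\<^bsub>power_pro\<^esub> (m, f, n') = (m, g \<cdot> f, n)"
  "(m, f, m') \<star>\<^bsub>power_pro\<^esub> (n, g, n') = (m + n, transport m n m' n' (f \<star> g), m' + n')"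
  "Braid power_pro i j = (i + j, pbraid i j, j + i)"
  "Twist power_pro k = (k, Twist C (pow k), k)"
  by (auto simp: power_pro_def in_Hom)

lemma category_power_pro: "category power_pro"
  by unfold_locales (auto simp: in_Hom)

lemma iso_power_pro:
  assumes "iso_arrow C f" "Dom C f = pow m" "Cod C f = pow n"
  shows "iso_arrow power_pro (m, f, n)"
proof -
  have "inverse_arrows power_pro (m, f, n) (n, inverse_arrow C f, m)"
    using assms iso_arrow_arr[OF assms(1)] unfolding inverse_arrows_def in_Hom by simp
  then show ?thesis unfolding iso_arrow_def by blast
qed

lemma balanced_pro_power_pro: "balanced_pro power_pro"
proof -
  interpret S: category power_pro by (rule category_power_pro)
  have arr: "\<exists>m g n. f = (m, g, n) \<and> g \<in> Arr C \<and> Dom C g = pow m \<and> Cod C g = pow n" if "f \<in> Arr power_pro" for f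
    using that by (cases f) auto
  show ?thesis
  proof
    fix f g h assume "f \<in> Arr power_pro" "g \<in> Arr power_pro" "h \<in> Arr power_pro"
    then show "(f \<star>\<^bsub>power_pro\<^esub> g) \<star>\<^bsub>power_pro\<^esub> h = f \<star>\<^bsub>power_pro\<^esub> g \<star>\<^bsub>power_pro\<^esub> h"
      by (auto dest!: arr simp: transport_assoc add.assoc)
  next
    fix f g f' g'
    assume "f \<in> Arr power_pro" "g \<in> Arr power_pro" "f' \<in> Arr power_pro" "g' \<in> Arr power_pro"
      "Cod power_pro f = Dom power_pro g" "Cod power_pro f' = Dom power_pro g'"
    then show "(g \<star>\<^bsub>power_pro\<^esub> g') \<cdot>\<^bsub>power_pro\<^esub> (f \<star>\<^bsub>power_pro\<^esub> f') =
        (g \<cdot>\<^bsub>power_pro\<^esub> f) \<star>\<^bsub>power_pro\<^esub> (g' \<cdot>\<^bsub>power_pro\<^esub> f')"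
      by (auto dest!: arr simp: transport_comp tensor_comp)
  next
    fix f g assume "f \<in> Arr power_pro" "g \<in> Arr power_pro"
    then show "Braid power_pro (Cod power_pro f) (Cod power_pro g) \<cdot>\<^bsub>power_pro\<^esub> (f \<star>\<^bsub>power_pro\<^esub> g) =
        (g \<star>\<^bsub>power_pro\<^esub> f) \<cdot>\<^bsub>power_pro\<^esub> Braid power_pro (Dom power_pro f) (Dom power_pro g)"
      by (auto dest!: arr simp: pbraid_natural)
  next
    fix f assume "f \<in> Arr power_pro"
    then show "Twist power_pro (Cod power_pro f) \<cdot>\<^bsub>power_pro\<^esub> f = f \<cdot>\<^bsub>power_pro\<^esub> Twist power_pro (Dom power_pro f)"
      by (auto dest!: arr) (metis twist_nat)
  next
    fix m n show "iso_arrow power_pro (Braid power_pro m n)" by (simp add: iso_power_pro)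
    show "iso_arrow power_pro (Twist power_pro n)" by (simp add: iso_power_pro)
    show "Twist power_pro 0 = Ident power_pro 0" by (simp add: twist_unit)
    show "Twist power_pro (m + n) = Braid power_pro n m \<cdot>\<^bsub>power_pro\<^esub> Braid power_pro m n \<cdot>\<^bsub>power_pro\<^esub>
        (Twist power_pro m \<star>\<^bsub>power_pro\<^esub> Twist power_pro n)"
      by (simp add: twist_pow_add)
    fix l show "Braid power_pro l (m + n) = (Ident power_pro m \<star>\<^bsub>power_pro\<^esub> Braid power_pro l n) \<cdot>\<^bsub>power_pro\<^esub>
        (Braid power_pro l m \<star>\<^bsub>power_pro\<^esub> Ident power_pro n)"
      by (simp add: pbraid_hexagon1 ac_simps)
    show "Braid power_pro (l + m) n = (Braid power_pro l n \<star>\<^bsub>power_pro\<^esub> Ident power_pro m) \<cdot>\<^bsub>power_pro\<^esub>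
        (Ident power_pro l \<star>\<^bsub>power_pro\<^esub> Braid power_pro m n)"
      by (simp add: pbraid_hexagon2 ac_simps)
  qed (auto dest!: arr simp: transport_unit)
qed

end

section \<open>Generators of the category \<open>DRBG\<close>\<close>

lemma upt_add_map: "[0..<m] @ map ((+) m) [0..<n] = [0..<m + n]"
  by (rule nth_equalityI) (auto simp: nth_append)

lemma inverse_word_cancel:
  "w \<in> braid_words n \<Longrightarrow> braid_eq n (w @ inverse_word w) [] \<and> braid_eq n (inverse_word w @ w) []"
proof (induction w)
  case (Cons l w)
  obtain i e where l: "l = (i, e)" by force
  have i: "Suc i < n" and w: "w \<in> braid_words n" using Cons.prems l by auto
  have "braid_eq n ([(i, e)] @ (w @ inverse_word w) @ [(i, \<not> e)]) ([(i, e)] @ [] @ [(i, \<not> e)])"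
    using Cons.IH[OF w] i by (intro braid_eq_append) auto
  moreover have "braid_eq n ([] @ [(i, e), (i, \<not> e)] @ []) ([] @ [])"
    using i by (intro braid_eq.cancel) auto
  moreover have "braid_eq n (inverse_word w @ [(i, \<not> e), (i, \<not> \<not> e)] @ w) (inverse_word w @ w)"
    using w i by (intro braid_eq.cancel) auto
  ultimately show ?case using Cons.IH[OF w] by (auto simp: l intro: braid_eq.trans)
qed (auto intro: braid_eq.refl)

lemma cable_word_append: "cable_word ns (v @ w) = cable_word ns v @ cable_word (act_word v ns) w"
  by (induction v arbitrary: ns) (auto simp: swap_at_def Let_def)

text \<open>Cabling is compatible with the braid relations for any number of strands, but on two strands
  only the cancellation relation has to be checked, and this suffices to generate the category.\<close>

lemma cable_word_2_eq: "braid_eq 2 v w \<Longrightarrow> length ns = 2 \<Longrightarrow>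
    act_word v ns = act_word w ns \<and> braid_eq (sum_list ns) (cable_word ns v) (cable_word ns w)"
proof (induction arbitrary: ns rule: braid_eq.induct)
  case (refl w)
  then show ?case using cable_word_braid_words[of w ns] by (auto intro: braid_eq.refl)
next
  case (cancel u v i e)
  define ms where "ms = act_word u ns"
  have ms: "length ms = 2" "sum_list ms = sum_list ns" using cancel by (auto simp: ms_def)
  then obtain p q where pq: "ms = [p, q]" by (auto simp: numeral_2_eq_2 length_Suc_conv)
  have i: "i = 0" using cancel by simp
  have "braid_eq (p + q) (cable_word [p, q] [(0, e), (0, \<not> e)]) []"
    using inverse_word_cancel[OF block_braid_words[of p q]] inverse_word_cancel[OF block_braid_words[of q p]]
    by (cases e) (auto simp: add.commute)
  then have "braid_eq (sum_list ns) (cable_word ms [(0, e), (0, \<not> e)]) []" using ms pq by simp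
  moreover have "act_word [(0, e), (0, \<not> e)] ms = ms" using ms by simp
  moreover have "cable_word ns u \<in> braid_words (sum_list ns)" "cable_word ms v \<in> braid_words (sum_list ns)"
    using cable_word_braid_words[of u ns] cable_word_braid_words[of v ms] cancel ms by auto
  ultimately have "braid_eq (sum_list ns) (cable_word ns u @ cable_word ms [(0, e), (0, \<not> e)] @ cable_word ms v)
      (cable_word ns u @ [] @ cable_word ms v)" and act: "act_word [(0, e), (0, \<not> e)] ms = ms"
    by (blast intro: braid_eq_append)+
  moreover have "cable_word ns (u @ [(0, e), (0, \<not> e)] @ v) = cable_word ns u @ cable_word ms [(0, e), (0, \<not> e)] @ cable_word ms v"
    "cable_word ns (u @ v) = cable_word ns u @ [] @ cable_word ms v"
    "act_word (u @ [(0, e), (0, \<not> e)] @ v) ns = act_word (u @ v) ns"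
    unfolding cable_word_append act_word_append ms_def[symmetric] act by simp_all
  ultimately show ?case unfolding i by simp
qed (auto intro: braid_eq.intros)

lemma braid_class_nil_rep [simp]: "braid_eq n [] (braid_rep (braid_class n []))"
  by (rule braid_rep_class) simp

lemma braid_class_append_rep:
  assumes "v \<in> braid_words n" "w \<in> braid_words n"
  shows "braid_class n (braid_rep (braid_class n v) @ braid_rep (braid_class n w)) = braid_class n (v @ w)"
  using assms by (intro braid_class_eq braid_eq_append2 braid_eq.sym[OF braid_rep_class])

section \<open>Ribbons with the trivial braid\<close>

definition flat_ribbon :: "'g list \<Rightarrow> int list \<Rightarrow> 'g ribbon" where
  "flat_ribbon xs ks = \<lparr>labels = xs, twists = ks, rbraid = braid_class (length xs) []\<rparr>"

lemma trivial_eq_flat: "trivial_ribbon G n k [] = flat_ribbon (replicate n \<one>\<^bsub>G\<^esub>) (replicate n k)"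
  by (simp add: trivial_ribbon_def flat_ribbon_def)

lemma ribbon_push_flat: "sorted \<phi> \<Longrightarrow> ribbon_push (flat_ribbon xs ks) \<phi> = \<phi>"
  by (simp add: ribbon_push_def flat_ribbon_def braid_perm_class map_idI sorted_sort_id)

lemma ribbon_push_ident:
  assumes "g \<in> ribbons G n"
  shows "ribbon_push g [0..<n] = [0..<n]"
proof -
  have "braid_rep (rbraid g) \<in> braid_words n" using assms by (auto simp: ribbons_def braid_rep_words)
  from bij_word_perm[OF this] have "set (map (ribbon_perm g) [0..<n]) = {0..<n}" "distinct (map (ribbon_perm g) [0..<n])"
    by (auto simp: bij_betw_def braid_perm_def distinct_map lessThan_atLeast0)
  then have "sort (map (ribbon_perm g) [0..<n]) = sorted_list_of_set {0..<n}"
    by (metis sorted_list_of_set_sort_remdups distinct_remdups_id)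
  then show ?thesis by (simp add: ribbon_push_def)
qed

lemma ribbon_mult_flat:
  "length ys = length xs \<Longrightarrow> length ls = length ks \<Longrightarrow> length ks = length xs \<Longrightarrow>
    ribbon_mult G (flat_ribbon ys ls) (flat_ribbon xs ks) = flat_ribbon (map2 (\<lambda>y x. y \<otimes>\<^bsub>G\<^esub> x) ys xs) (map2 (+) ls ks)"
  using braid_class_append_rep[of "[]" "length xs" "[]"]
  by (auto simp: ribbon_mult_def flat_ribbon_def Let_def braid_perm_class intro!: nth_equalityI)

lemma fibre_sizes_ones: "map (count_list [0..<n]) [0..<n] = replicate n 1"
  using fibre_sizes_upt[of n] by (simp add: fibre_sizes_def)

lemma power_word_nil [simp]: "power_word [] k = []"
  by (simp add: power_word_def inverse_word_def)

lemma cable_twists_ones: "cable_twists (replicate n (Suc 0)) ks = []"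
  by (simp add: cable_twists_def block_word_simps)

lemma block_word_1_1: "block_word (Suc 0) (Suc 0) = [(0, True)]"
  by (simp add: block_word_1)

lemma cable_word_ones: "w \<in> braid_words n \<Longrightarrow> cable_word (replicate n (Suc 0)) w = w"
proof (induction w)
  case (Cons l w)
  obtain i e where l: "l = (i, e)" by force
  have "swap_at i (replicate n (Suc 0)) = replicate n (Suc 0)" using Cons.prems l by simp
  then have "(replicate n (Suc 0))[i := Suc 0, Suc i := Suc 0] = replicate n (Suc 0)"
    using Cons.prems l by (simp add: swap_at_def)
  then show ?case using Cons l by (cases e) (auto simp: Let_def block_word_1_1 sum_list_replicate min_def)
qed simp

lemma ribbon_pull_ident:
  assumes "g \<in> ribbons G n"
  shows "ribbon_pull [0..<n] g = g"
proof -
  have "labels g = map ((!) (labels g)) [0..<n]" "twists g = map ((!) (twists g)) [0..<n]"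
    using assms map_nth[of "labels g"] map_nth[of "twists g"] by (auto simp: ribbons_def)
  then show ?thesis
    using assms fibre_sizes_ones[of n]
    by (simp add: ribbons_def ribbon_pull_def Let_def cable_twists_ones cable_word_ones braid_rep_words braid_class_rep)
qed

lemma cable_twists_zero: "cable_twists rs (replicate (length rs) 0) = []"
  by (simp add: cable_twists_def power_word_def shift_word_def)

text \<open>The representative of the trivial braid is an unknown word equivalent to the empty one,
  so its cabling has to be shown trivial. On two strands this is \<open>cable_word_2_eq\<close>; on
  fewer strands every word is empty.\<close>

lemma ribbon_pull_flat:
  assumes "\<phi> \<in> monotone_lists n m" "length xs = m" "m \<le> 2"
  shows "ribbon_pull \<phi> (flat_ribbon xs (replicate m 0)) = flat_ribbon (map ((!) xs) \<phi>) (replicate n 0)"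
proof -
  let ?rs = "fibre_sizes \<phi> m" and ?w = "braid_rep (braid_class m [])"
  have w: "?w \<in> braid_words m" by simp
  have n: "length \<phi> = n" "sum_list ?rs = n" using assms by (auto simp: monotone_lists_def)
  have "braid_eq n (cable_word ?rs ?w) []"
  proof (cases "m = 2")
    case True
    then show ?thesis
      using cable_word_2_eq[OF braid_eq.sym[OF braid_class_nil_rep], of ?rs] n by simp
  next
    case False
    then have "?w = []" using assms(3) w by (subst (asm) braid_words_small) auto
    then show ?thesis by (simp add: braid_eq.refl)
  qed
  then have "braid_class n (cable_word ?rs ?w) = braid_class n []" by (rule braid_class_eq)
  moreover have "map (\<lambda>j. replicate m (0::int) ! j) \<phi> = replicate n 0"
    using assms by (auto simp: monotone_lists_def subset_iff intro!: nth_equalityI)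
  moreover have "cable_twists ?rs (replicate m 0) = []"
    using cable_twists_zero[of ?rs] by simp
  ultimately show ?thesis
    using assms n by (simp add: ribbon_pull_def flat_ribbon_def Let_def fibre_sizes_def)
qed

section \<open>The generating arrows and their composites\<close>

definition gen_mu :: "('g, 'm) monoid_scheme \<Rightarrow> 'g drbg_arr" where
  "gen_mu G = \<lparr>codom = 1, omap = [0, 0], rib = trivial_ribbon G 2 0 []\<rparr>"

definition gen_eta :: "('g, 'm) monoid_scheme \<Rightarrow> 'g drbg_arr" where
  "gen_eta G = \<lparr>codom = 1, omap = [], rib = trivial_ribbon G 0 0 []\<rparr>"

definition gen_label :: "'g \<Rightarrow> 'g drbg_arr" where
  "gen_label x = ribbon_arr 1 (flat_ribbon [x] [0])"

text \<open>Multiplication, unit, labels and identities all have this form, and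
  \<open>comp_flat_arr\<close> and \<open>tensor_flat_arr\<close> reduce their composites and tensor
  products to operations on lists.\<close>

definition flat_arr :: "nat \<Rightarrow> nat list \<Rightarrow> 'g list \<Rightarrow> int list \<Rightarrow> 'g drbg_arr" where
  "flat_arr m \<phi> xs ks = \<lparr>codom = m, omap = \<phi>, rib = flat_ribbon xs ks\<rparr>"

lemma DRBG_sel [simp]:
  "Obj (DRBG G) = UNIV" "Dom (DRBG G) f = length (omap f)" "Cod (DRBG G) = codom"
  "Ident (DRBG G) = drbg_ident G" "Comp (DRBG G) = drbg_comp G" "TObj (DRBG G) = (+)" "TArr (DRBG G) = drbg_tensor"
  "Unit (DRBG G) = 0" "Assoc (DRBG G) a b c = drbg_ident G (a + b + c)" "LUnit (DRBG G) = drbg_ident G"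
  "RUnit (DRBG G) = drbg_ident G"
  "Braid (DRBG G) n m = ribbon_arr (n + m) (trivial_ribbon G (n + m) 0 (block_word n m))"
  "Twist (DRBG G) n = ribbon_arr n (trivial_ribbon G n 1 (full_twist_word n))"
  by (simp_all add: DRBG_def)

lemma DRBG_arrI:
  "omap f \<in> monotone_lists (length (omap f)) (codom f) \<Longrightarrow> rib f \<in> ribbons G (length (omap f)) \<Longrightarrow> f \<in> Arr (DRBG G)"
  by (simp add: DRBG_def)

lemma flat_arr_eqs:
  "gen_mu G = flat_arr 1 [0, 0] [\<one>\<^bsub>G\<^esub>, \<one>\<^bsub>G\<^esub>] [0, 0]"
  "gen_eta G = flat_arr 1 [] [] []"
  "gen_label x = flat_arr 1 [0] [x] [0]"
  "drbg_ident G n = flat_arr n [0..<n] (replicate n \<one>\<^bsub>G\<^esub>) (replicate n 0)"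
  by (simp_all add: gen_mu_def gen_eta_def gen_label_def drbg_ident_def ribbon_arr_def flat_arr_def trivial_eq_flat
      numeral_2_eq_2)

lemma flat_arr_sel [simp]:
  "codom (flat_arr m \<phi> xs ks) = m" "omap (flat_arr m \<phi> xs ks) = \<phi>" "rib (flat_arr m \<phi> xs ks) = flat_ribbon xs ks"
  "codom (ribbon_arr n g) = n" "omap (ribbon_arr n g) = [0..<n]" "rib (ribbon_arr n g) = g"
  by (simp_all add: flat_arr_def ribbon_arr_def)

lemma flat_ribbon_ribbons: "set xs \<subseteq> carrier G \<Longrightarrow> length xs = n \<Longrightarrow> length ks = n \<Longrightarrow> flat_ribbon xs ks \<in> ribbons G n"
  by (simp add: flat_ribbon_def ribbons_def)

lemma upt_monotone [simp]: "[0..<n] \<in> monotone_lists n n"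
  by (auto simp: monotone_lists_def)

lemma flat_arr_in:
  "\<phi> \<in> monotone_lists n m \<Longrightarrow> set xs \<subseteq> carrier G \<Longrightarrow> length xs = n \<Longrightarrow> length ks = n \<Longrightarrow> flat_arr m \<phi> xs ks \<in> Arr (DRBG G)"
  by (rule DRBG_arrI) (auto simp: flat_ribbon_ribbons monotone_lists_def)

lemma ribbon_arr_in: "g \<in> ribbons G n \<Longrightarrow> ribbon_arr n g \<in> Arr (DRBG G)"
  by (rule DRBG_arrI) auto

lemma trivial_ribbon_ribbons: "group G \<Longrightarrow> w \<in> braid_words n \<Longrightarrow> trivial_ribbon G n k w \<in> ribbons G n"
  by (auto simp: trivial_ribbon_def ribbons_def set_replicate_conv_if group.is_monoid)

lemma tensor_flat_arr:
  assumes "length xs = length \<phi>" "length xs' = length \<phi>'"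
  shows "drbg_tensor (flat_arr m \<phi> xs ks) (flat_arr m' \<phi>' xs' ks') =
    flat_arr (m + m') (\<phi> @ map (\<lambda>i. m + i) \<phi>') (xs @ xs') (ks @ ks')"
proof -
  let ?n = "length xs" and ?n' = "length xs'"
  have "braid_eq (?n + ?n') (shift_word 0 []) (shift_word 0 (braid_rep (braid_class ?n [])))"
    by (rule braid_eq_shift[OF braid_class_nil_rep]) simp
  moreover have "braid_eq (?n + ?n') (shift_word ?n []) (shift_word ?n (braid_rep (braid_class ?n' [])))"
    by (rule braid_eq_shift[OF braid_class_nil_rep]) simp
  ultimately have "braid_eq (?n + ?n') ([] @ []) (braid_rep (braid_class ?n []) @ shift_word ?n (braid_rep (braid_class ?n' [])))"
    by (intro braid_eq_append2) simp_all
  then show ?thesis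
    using assms by (simp add: drbg_tensor_def flat_arr_def flat_ribbon_def Let_def braid_class_eq)
qed

lemma tensor_trivial:
  assumes "v \<in> braid_words m" "w \<in> braid_words n"
  shows "drbg_tensor (ribbon_arr m (trivial_ribbon G m k v)) (ribbon_arr n (trivial_ribbon G n k w)) =
    ribbon_arr (m + n) (trivial_ribbon G (m + n) k (v @ shift_word m w))"
proof -
  have "braid_eq (m + n) (shift_word 0 (braid_rep (braid_class m v))) (shift_word 0 v)"
    by (rule braid_eq_shift[OF braid_eq.sym[OF braid_rep_class[OF assms(1)]]]) simp
  moreover have "braid_eq (m + n) (shift_word m (braid_rep (braid_class n w))) (shift_word m w)"
    by (rule braid_eq_shift[OF braid_eq.sym[OF braid_rep_class[OF assms(2)]]]) simp
  ultimately have "braid_eq (m + n) (braid_rep (braid_class m v) @ shift_word m (braid_rep (braid_class n w))) (v @ shift_word m w)"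
    by (intro braid_eq_append2) simp_all
  then show ?thesis
    using upt_add_map[of m n]
    by (simp add: drbg_tensor_def ribbon_arr_def trivial_ribbon_def Let_def replicate_add braid_class_eq)
qed

lemma comp_flat_arr:
  assumes "\<phi> \<in> monotone_lists n m" "length ys = m" "m \<le> 2" "length xs = n" "length ks = n"
  shows "drbg_comp G (flat_arr p \<psi> ys (replicate m 0)) (flat_arr m' \<phi> xs ks) =
    flat_arr p (map ((!) \<psi>) \<phi>) (map2 (\<lambda>i x. ys ! i \<otimes>\<^bsub>G\<^esub> x) \<phi> xs) ks"
proof -
  have "length \<phi> = n" "sorted \<phi>" using assms by (auto simp: monotone_lists_def)
  moreover have "map2 (+) (replicate n 0) ks = ks" using assms by (intro nth_equalityI) auto
  ultimately show ?thesis using assms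
    by (simp add: drbg_comp_def ribbon_push_flat ribbon_pull_flat ribbon_mult_flat zip_map1 case_prod_unfold comp_def flat_arr_def)
qed

lemma (in group) ribbon_mult_trivial_left:
  assumes "g \<in> ribbons G n"
  shows "ribbon_mult G (trivial_ribbon G n 0 []) g = g"
proof -
  have w: "braid_rep (rbraid g) \<in> braid_words n" using assms by (auto simp: ribbons_def braid_rep_words)
  have p: "braid_perm (rbraid g) i < n" if "i < n" for i
    using bij_word_perm[OF w] that by (auto simp: bij_betw_def braid_perm_def)
  have "braid_class n (braid_rep (rbraid g) @ braid_rep (braid_class n [])) = rbraid g"
    using braid_class_append_rep[OF w, of "[]"] assms braid_class_rep[of "rbraid g" n] by (simp add: ribbons_def)
  moreover have "map (\<lambda>i. replicate n \<one> ! braid_perm (rbraid g) i \<otimes> labels g ! i) [0..<n] = labels g"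
    using assms p ribbons_label[OF assms] by (intro nth_equalityI) (auto simp: ribbons_def)
  moreover have "map (\<lambda>i. replicate n 0 ! braid_perm (rbraid g) i + twists g ! i) [0..<n] = twists g"
    using assms p by (intro nth_equalityI) (auto simp: ribbons_def)
  ultimately show ?thesis
    using assms by (simp add: ribbon_mult_def trivial_ribbon_def Let_def ribbons_def)
qed

text \<open>Pulling back along the identity map cables every strand by 1, hence changes nothing.
  Composites of this kind can therefore be computed for any number of strands.\<close>

lemma (in group) comp_ribbon_arr:
  assumes "f \<in> Arr (DRBG G)" "length (omap f) = n"
  shows "drbg_comp G f (ribbon_arr n h) = \<lparr>codom = codom f, omap = omap f, rib = ribbon_mult G (rib f) h\<rparr>"
proof -
  note f = DRBG_arrD[OF assms(1), unfolded assms(2)]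
  have "map ((!) (omap f)) [0..<n] = omap f" using assms(2) by (metis map_nth)
  then show ?thesis
    using f by (simp add: drbg_comp_def ribbon_push_ident ribbon_pull_ident)
qed

section \<open>Relations between the generators, and generation\<close>

context group
begin

lemma DRBG_comp_in:
  assumes "f \<in> Arr (DRBG G)" "g \<in> Arr (DRBG G)" "codom f = length (omap g)"
  shows "drbg_comp G g f \<in> Arr (DRBG G)" "length (omap (drbg_comp G g f)) = length (omap f)"
    "codom (drbg_comp G g f) = codom g"
proof -
  note f = DRBG_arrD[OF assms(1), unfolded assms(3)] and g = DRBG_arrD[OF assms(2)]
  note p = ribbon_push_monotone[OF g(2) f(1)]
  note m = monotone_comp[OF p g(1)]
  show l: "length (omap (drbg_comp G g f)) = length (omap f)"
    using p by (simp add: drbg_comp_def monotone_lists_def)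
  show "codom (drbg_comp G g f) = codom g" by (simp add: drbg_comp_def)
  show "drbg_comp G g f \<in> Arr (DRBG G)"
    using l m ribbon_mult_ribbons[OF f(2) ribbon_pull_ribbons(1)[OF g(2) f(1)]]
    by (intro DRBG_arrI) (simp_all add: drbg_comp_def)
qed

lemma DRBG_tensor_in:
  assumes "f \<in> Arr (DRBG G)" "g \<in> Arr (DRBG G)"
  shows "drbg_tensor f g \<in> Arr (DRBG G)" "length (omap (drbg_tensor f g)) = length (omap f) + length (omap g)"
    "codom (drbg_tensor f g) = codom f + codom g"
proof -
  note f = DRBG_arrD[OF assms(1)] and g = DRBG_arrD[OF assms(2)]
  have "omap f @ map (\<lambda>i. codom f + i) (omap g) \<in> monotone_lists (length (omap f) + length (omap g)) (codom f + codom g)"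
    using f(1) g(1) by (auto simp: monotone_lists_def sorted_append subset_iff sorted_map)
  moreover have "braid_rep (rbraid (rib f)) \<in> braid_words (length (omap f) + length (omap g))"
    "shift_word (length (omap f)) (braid_rep (rbraid (rib g))) \<in> braid_words (length (omap f) + length (omap g))"
    using f(3) g(3) by (auto intro: braid_words_mono)
  ultimately show "drbg_tensor f g \<in> Arr (DRBG G)"
    using f(2) g(2) by (intro DRBG_arrI) (auto simp: drbg_tensor_def Let_def ribbons_def)
  show "length (omap (drbg_tensor f g)) = length (omap f) + length (omap g)" "codom (drbg_tensor f g) = codom f + codom g"
    by (simp_all add: drbg_tensor_def)
qed

lemma DRBG_ident_in [simp]: "drbg_ident G n \<in> Arr (DRBG G)"
  unfolding flat_arr_eqs by (rule flat_arr_in[where n = n]) (auto simp: set_replicate_conv_if)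

lemma gen_in [simp]:
  "gen_mu G \<in> Arr (DRBG G)" "gen_eta G \<in> Arr (DRBG G)" "x \<in> carrier G \<Longrightarrow> gen_label x \<in> Arr (DRBG G)"
  unfolding flat_arr_eqs by (auto intro!: flat_arr_in simp: monotone_lists_def)

lemma gen_sel [simp]:
  "omap (gen_mu G) = [0, 0]" "codom (gen_mu G) = 1" "omap (gen_eta G) = []" "codom (gen_eta G) = 1"
  "omap (gen_label x) = [0]" "codom (gen_label x) = 1" "omap (drbg_ident G n) = [0..<n]" "codom (drbg_ident G n) = n"
  by (simp_all add: flat_arr_eqs)

lemma comp_gen_mu:
  assumes "\<phi> \<in> monotone_lists (length \<phi>) 2" "length xs = length \<phi>" "length ks = length \<phi>" "set xs \<subseteq> carrier G"
  shows "drbg_comp G (gen_mu G) (flat_arr m \<phi> xs ks) = flat_arr 1 (replicate (length \<phi>) 0) xs ks"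
proof -
  have \<phi>: "\<phi> ! i < 2" if "i < length \<phi>" for i
    using assms(1) nth_mem[OF that] by (auto simp: monotone_lists_def)
  then have z: "\<phi> ! i = 0 \<or> \<phi> ! i = 1" if "i < length \<phi>" for i
    using \<phi>[OF that] by arith
  have "map2 (\<lambda>i x. [\<one>, \<one>] ! i \<otimes> x) \<phi> xs = xs"
  proof (rule nth_equalityI)
    fix i assume "i < length (map2 (\<lambda>i x. [\<one>, \<one>] ! i \<otimes> x) \<phi> xs)"
    moreover from this have "xs ! i \<in> carrier G" using assms by (auto simp: subset_iff)
    ultimately show "map2 (\<lambda>i x. [\<one>, \<one>] ! i \<otimes> x) \<phi> xs ! i = xs ! i"
      using assms z[of i] by auto
  qed (use assms in simp)
  moreover have "map ((!) [0, 0]) \<phi> = replicate (length \<phi>) (0::nat)"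
  proof (rule nth_equalityI)
    fix i assume "i < length (map ((!) [0::nat, 0]) \<phi>)"
    then show "map ((!) [0, 0]) \<phi> ! i = replicate (length \<phi>) (0::nat) ! i"
      using z[of i] by auto
  qed simp
  ultimately show ?thesis
    using comp_flat_arr[OF assms(1), of "[\<one>, \<one>]" xs ks G 1 "[0, 0]" m] assms
    by (simp add: flat_arr_eqs numeral_2_eq_2)
qed

lemma comp_gen_label:
  assumes "\<phi> \<in> monotone_lists (length \<phi>) 1" "length xs = length \<phi>" "length ks = length \<phi>"
  shows "drbg_comp G (gen_label x) (flat_arr m \<phi> xs ks) = flat_arr 1 (replicate (length \<phi>) 0) (map (\<lambda>y. x \<otimes> y) xs) ks"
proof -
  have \<phi>: "\<phi> ! i = 0" if "i < length \<phi>" for i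
    using assms(1) nth_mem[OF that] by (auto simp: monotone_lists_def)
  have "map2 (\<lambda>i y. [x] ! i \<otimes> y) \<phi> xs = map (\<lambda>y. x \<otimes> y) xs"
    using assms \<phi> by (auto intro!: nth_equalityI)
  moreover have "map ((!) [0]) \<phi> = replicate (length \<phi>) (0::nat)"
    using \<phi> by (auto intro!: nth_equalityI)
  ultimately show ?thesis
    using comp_flat_arr[OF assms(1), of "[x]" xs ks G 1 "[0]" m] assms
    by (simp add: flat_arr_eqs)
qed

lemma gen_mu_assoc:
  "drbg_comp G (gen_mu G) (drbg_tensor (gen_mu G) (drbg_ident G 1)) =
   drbg_comp G (gen_mu G) (drbg_tensor (drbg_ident G 1) (gen_mu G))"
  by (simp add: flat_arr_eqs(1)[of G] flat_arr_eqs(4) tensor_flat_arr)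
    (simp add: comp_gen_mu monotone_lists_def flip: flat_arr_eqs(1)[unfolded One_nat_def])

lemma gen_mu_unit:
  "drbg_comp G (gen_mu G) (drbg_tensor (gen_eta G) (drbg_ident G 1)) = drbg_ident G 1"
  "drbg_comp G (gen_mu G) (drbg_tensor (drbg_ident G 1) (gen_eta G)) = drbg_ident G 1"
  by (simp_all add: flat_arr_eqs(2,4) tensor_flat_arr comp_gen_mu monotone_lists_def)

lemma gen_label_one: "gen_label \<one> = drbg_ident G 1"
  by (simp add: flat_arr_eqs)

lemma gen_label_mult:
  "x \<in> carrier G \<Longrightarrow> y \<in> carrier G \<Longrightarrow> drbg_comp G (gen_label x) (gen_label y) = gen_label (x \<otimes> y)"
  by (subst flat_arr_eqs(3)[of y], subst comp_gen_label) (simp_all add: monotone_lists_def flat_arr_eqs)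

lemma gen_label_mu:
  "x \<in> carrier G \<Longrightarrow> drbg_comp G (gen_label x) (gen_mu G) = drbg_comp G (gen_mu G) (drbg_tensor (gen_label x) (gen_label x))"
  by (subst flat_arr_eqs(1), subst comp_gen_label)
    (simp_all add: monotone_lists_def flat_arr_eqs(3) tensor_flat_arr comp_gen_mu numeral_2_eq_2)

lemma gen_label_eta: "x \<in> carrier G \<Longrightarrow> drbg_comp G (gen_label x) (gen_eta G) = gen_eta G"
  by (simp add: flat_arr_eqs(2) comp_gen_label monotone_lists_def)

text \<open>An arrow is a monotone map after a ribbon braid. The ribbon braid is a braid after
  labels and twists; the braid is a composite of whiskered crossings; the monotone map is a tensor
  product of maps onto one point, each an iterated multiplication.\<close>

lemma drbg_induct [consumes 1, case_names comp tensor ident mu eta label twist cross]: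
  assumes "f \<in> Arr (DRBG G)"
    and comp: "\<And>f g. \<lbrakk>f \<in> Arr (DRBG G); g \<in> Arr (DRBG G); codom f = length (omap g); P f; P g\<rbrakk> \<Longrightarrow> P (drbg_comp G g f)"
    and tensor: "\<And>f g. \<lbrakk>f \<in> Arr (DRBG G); g \<in> Arr (DRBG G); P f; P g\<rbrakk> \<Longrightarrow> P (drbg_tensor f g)"
    and ident: "\<And>n. P (drbg_ident G n)"
    and mu: "P (gen_mu G)" and eta: "P (gen_eta G)"
    and label: "\<And>x. x \<in> carrier G \<Longrightarrow> P (gen_label x)"
    and twist: "\<And>k. P (ribbon_arr 1 (flat_ribbon [\<one>] [k]))"
    and cross: "\<And>e. P (ribbon_arr 2 (trivial_ribbon G 2 0 [(0, e)]))"
  shows "P f"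
proof -
  have flat: "P (ribbon_arr n (flat_ribbon xs ks))" if "length xs = n" "length ks = n" "set xs \<subseteq> carrier G" for n xs ks
    using that
  proof (induction n arbitrary: xs ks)
    case 0
    then show ?case using ident[of 0] by (simp add: flat_arr_eqs flat_arr_def ribbon_arr_def)
  next
    case (Suc n)
    then obtain x xs' k ks' where [simp]: "xs = x # xs'" "ks = k # ks'" by (metis length_Suc_conv)
    have "P (drbg_comp G (ribbon_arr 1 (flat_ribbon [\<one>] [k])) (gen_label x))"
      using Suc.prems by (intro comp label twist ribbon_arr_in flat_ribbon_ribbons gen_in) auto
    moreover have "drbg_comp G (ribbon_arr 1 (flat_ribbon [\<one>] [k])) (gen_label x) = ribbon_arr 1 (flat_ribbon [x] [k])"
      using comp_ribbon_arr[of "ribbon_arr 1 (flat_ribbon [\<one>] [k])" 1 "flat_ribbon [x] [0]"] Suc.prems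
        ribbon_arr_in[OF flat_ribbon_ribbons, of "[\<one>]" G 1 "[k]"]
      by (simp add: gen_label_def ribbon_mult_flat ribbon_arr_def)
    ultimately have "P (ribbon_arr 1 (flat_ribbon [x] [k]))" by simp
    moreover have "P (ribbon_arr n (flat_ribbon xs' ks'))" using Suc by simp
    ultimately have "P (drbg_tensor (ribbon_arr 1 (flat_ribbon [x] [k])) (ribbon_arr n (flat_ribbon xs' ks')))"
      using Suc.prems by (intro tensor ribbon_arr_in flat_ribbon_ribbons) auto
    moreover have "drbg_tensor (ribbon_arr 1 (flat_ribbon [x] [k])) (ribbon_arr n (flat_ribbon xs' ks')) = ribbon_arr (Suc n) (flat_ribbon xs ks)"
      using tensor_flat_arr[of "[x]" "[0]" xs' "[0..<n]" 1 "[k]" n ks'] Suc.prems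
      by (simp add: flat_arr_def ribbon_arr_def map_Suc_upt upt_conv_Cons)
    ultimately show ?case by simp
  qed
  have word: "P (ribbon_arr n (trivial_ribbon G n 0 w))" if "w \<in> braid_words n" for n w
    using that
  proof (induction w)
    case Nil
    then show ?case using ident[of n] by (simp add: drbg_ident_def)
  next
    case (Cons l w)
    obtain i e where l: "l = (i, e)" by force
    \<comment> \<open>The number of strands to the right of the crossing, which is whiskered by
      \<open>i\<close> strands on the left and \<open>j\<close> on the right.\<close>
    define j where "j = n - Suc (Suc i)"
    have i: "n = i + 2 + j" and w: "w \<in> braid_words n" using Cons.prems l by (auto simp: j_def)
    let ?c = "ribbon_arr 2 (trivial_ribbon G 2 0 [(0, e)])"
    have c: "?c \<in> Arr (DRBG G)" by (intro ribbon_arr_in trivial_ribbon_ribbons) (auto simp: group_axioms)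
    have "P (drbg_tensor (drbg_tensor (drbg_ident G i) ?c) (drbg_ident G j))"
      using c by (intro tensor ident cross DRBG_tensor_in(1)) auto
    moreover have "drbg_tensor (drbg_tensor (drbg_ident G i) ?c) (drbg_ident G j) = ribbon_arr n (trivial_ribbon G n 0 [(i, e)])"
    proof -
      have "drbg_tensor (drbg_ident G i) ?c = ribbon_arr (i + 2) (trivial_ribbon G (i + 2) 0 [(i, e)])"
        unfolding drbg_ident_def by (subst tensor_trivial) auto
      also have "drbg_tensor \<dots> (drbg_ident G j) = ribbon_arr n (trivial_ribbon G n 0 [(i, e)])"
        unfolding drbg_ident_def i by (subst tensor_trivial) auto
      finally show ?thesis .
    qed
    ultimately have "P (ribbon_arr n (trivial_ribbon G n 0 [(i, e)]))" by simp
    then have "P (drbg_comp G (ribbon_arr n (trivial_ribbon G n 0 w)) (ribbon_arr n (trivial_ribbon G n 0 [(i, e)])))"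
      using Cons.IH w i by (intro comp ribbon_arr_in trivial_ribbon_ribbons) (auto simp: group_axioms)
    moreover have "ribbon_mult G (trivial_ribbon G n 0 w) (trivial_ribbon G n 0 [(i, e)]) = trivial_ribbon G n 0 (l # w)"
    proof -
      have v: "[(i, e)] \<in> braid_words n" using i by simp
      have "word_perm [(i, e)] k < n" if "k < n" for k
        using bij_word_perm[OF v] that by (auto simp: bij_betw_def)
      then show ?thesis
        using braid_class_append_rep[OF v w] braid_perm_class[OF v]
        by (auto simp: ribbon_mult_def trivial_ribbon_def Let_def l intro!: nth_equalityI)
    qed
    ultimately show ?case
      using w by (subst (asm) comp_ribbon_arr)
        (auto intro!: ribbon_arr_in trivial_ribbon_ribbons simp: group_axioms, simp add: ribbon_arr_def)
  qed
  have ribbon: "P (ribbon_arr n g)" if g: "g \<in> ribbons G n" for n g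
  proof -
    let ?w = "braid_rep (rbraid g)"
    have w: "?w \<in> braid_words n" and l: "length (labels g) = n" "length (twists g) = n" "set (labels g) \<subseteq> carrier G"
      using g by (auto simp: ribbons_def braid_rep_words)
    have "P (drbg_comp G (ribbon_arr n (trivial_ribbon G n 0 ?w)) (ribbon_arr n (flat_ribbon (labels g) (twists g))))"
      using w l by (intro comp flat word ribbon_arr_in flat_ribbon_ribbons trivial_ribbon_ribbons) (auto simp: group_axioms)
    moreover have "ribbon_mult G (trivial_ribbon G n 0 ?w) (flat_ribbon (labels g) (twists g)) = g"
    proof -
      have "map (\<lambda>i. replicate n \<one> ! i \<otimes> labels g ! i) [0..<n] = labels g"
        using l ribbons_label[OF g] by (intro nth_equalityI) auto
      moreover have "map (\<lambda>i. replicate n 0 ! i + twists g ! i) [0..<n] = twists g"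
        using l by (intro nth_equalityI) auto
      ultimately show ?thesis
        using braid_class_append_rep[of "[]" n ?w] w l g
        by (simp add: ribbon_mult_def trivial_ribbon_def flat_ribbon_def Let_def braid_perm_class ribbons_def braid_class_rep)
    qed
    ultimately show ?thesis
      using w by (subst (asm) comp_ribbon_arr)
        (auto intro!: ribbon_arr_in trivial_ribbon_ribbons simp: group_axioms, simp add: ribbon_arr_def)
  qed
  \<comment> \<open>The map from \<open>r\<close> points to one point, built by the recursion that
    also defines \<open>iter\<close>.\<close>
  have one: "P (flat_arr 1 (replicate r 0) (replicate r \<one>) (replicate r 0))" for r
  proof (induction r)
    case 0
    then show ?case using eta by (simp add: flat_arr_eqs)
  next
    case (Suc r)
    let ?f = "flat_arr 1 (replicate r 0) (replicate r \<one>) (replicate r 0)"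
    have f: "?f \<in> Arr (DRBG G)" by (rule flat_arr_in[where n = r]) (auto simp: monotone_lists_def set_replicate_conv_if)
    have t: "drbg_tensor ?f (drbg_ident G 1) = flat_arr 2 (replicate r 0 @ [1]) (replicate (Suc r) \<one>) (replicate (Suc r) 0)"
      unfolding flat_arr_eqs by (subst tensor_flat_arr) (auto simp: replicate_append_same)
    have "P (drbg_comp G (gen_mu G) (drbg_tensor ?f (drbg_ident G 1)))"
      using Suc f DRBG_tensor_in[OF f DRBG_ident_in[of 1]] by (intro comp tensor mu ident gen_in) auto
    moreover have "drbg_comp G (gen_mu G) (drbg_tensor ?f (drbg_ident G 1)) = flat_arr 1 (replicate (Suc r) 0) (replicate (Suc r) \<one>) (replicate (Suc r) 0)"
    proof -
      have m: "replicate r 0 @ [1] \<in> monotone_lists (Suc r) 2"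
        by (auto simp: monotone_lists_def sorted_append)
      have "map2 (\<lambda>i x. [\<one>, \<one>] ! i \<otimes> x) (replicate r 0 @ [1]) (replicate (Suc r) \<one>) = replicate (Suc r) \<one>"
        by (auto simp: nth_append nth_Cons' intro!: nth_equalityI)
      moreover have "map ((!) [0, 0]) (replicate r 0 @ [1]) = replicate (Suc r) (0::nat)"
        by (simp add: replicate_append_same)
      ultimately show ?thesis
        unfolding t using comp_flat_arr[OF m, of "[\<one>, \<one>]" "replicate (Suc r) \<one>" "replicate (Suc r) 0" G 1 "[0, 0]" 2]
        by (simp add: flat_arr_eqs numeral_2_eq_2)
    qed
    ultimately show ?case by simp
  qed
  have map: "P (flat_arr m \<phi> (replicate n \<one>) (replicate n 0))" if "\<phi> \<in> monotone_lists n m" for \<phi> n m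
    using that
  proof (induction m arbitrary: \<phi> n)
    case 0
    then show ?case using ident[of 0] by (auto simp: monotone_lists_def flat_arr_eqs)
  next
    case (Suc m)
    \<comment> \<open>The fibre over the last point is split off; the remaining fibres form a
      monotone list with values below \<open>m\<close>.\<close>
    let ?\<psi> = "concat (map (\<lambda>j. replicate (count_list \<phi> j) j) [0..<m])" and ?r = "count_list \<phi> m"
    have \<phi>: "\<phi> = ?\<psi> @ replicate ?r m" using monotone_list_blocks[OF Suc.prems] by simp
    have "sorted \<phi>" "length \<phi> = n" using Suc.prems by (auto simp: monotone_lists_def)
    then have "sorted (?\<psi> @ replicate ?r m)" "length (?\<psi> @ replicate ?r m) = n" unfolding \<phi>[symmetric] .
    then have "sorted ?\<psi>" and len: "length ?\<psi> + ?r = n" unfolding sorted_append length_append length_replicate by blast+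
    moreover have "set ?\<psi> \<subseteq> {..<m}" by auto
    ultimately have \<psi>: "?\<psi> \<in> monotone_lists (length ?\<psi>) m" by (simp add: monotone_lists_def)
    let ?f = "flat_arr m ?\<psi> (replicate (length ?\<psi>) \<one>) (replicate (length ?\<psi>) 0)"
    let ?g = "flat_arr 1 (replicate ?r 0) (replicate ?r \<one>) (replicate ?r 0)"
    have "P (drbg_tensor ?f ?g)"
      by (intro tensor Suc.IH one \<psi> flat_arr_in[where n = ?r] flat_arr_in[OF \<psi>])
        (auto simp: monotone_lists_def set_replicate_conv_if)
    moreover have "drbg_tensor ?f ?g = flat_arr (Suc m) \<phi> (replicate n \<one>) (replicate n 0)"
      by (subst tensor_flat_arr) (simp_all only: length_replicate map_replicate replicate_add[symmetric] len add_0_right \<phi>[symmetric], simp)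
    ultimately show ?case by simp
  qed
  define n where "n = length (omap f)"
  note f = DRBG_arrD[OF assms(1), folded n_def]
  let ?p = "flat_arr (codom f) (omap f) (replicate n \<one>) (replicate n 0)"
  have p: "?p \<in> Arr (DRBG G)" using f by (intro flat_arr_in[OF f(1)]) (auto simp: set_replicate_conv_if)
  have "P (drbg_comp G ?p (ribbon_arr n (rib f)))"
    using f p by (intro comp map ribbon ribbon_arr_in) (auto simp: n_def)
  moreover have "drbg_comp G ?p (ribbon_arr n (rib f)) = f"
    using p f ribbon_mult_trivial_left[OF f(2)] by (subst comp_ribbon_arr) (auto simp: n_def trivial_eq_flat)
  ultimately show ?thesis by simp
qed

text \<open>Closure under two-sided inverses reduces all integer twists and both signs of a crossing
  to \<open>Twist\<close> and \<open>Braid\<close>, the two arrows that a balanced functor is known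
  to preserve. Naturality squares have this closure property.\<close>

lemma drbg_generated [consumes 1, case_names comp tensor inverse ident mu eta label twist braid]:
  assumes "f \<in> Arr (DRBG G)"
    and comp: "\<And>f g. \<lbrakk>f \<in> Arr (DRBG G); g \<in> Arr (DRBG G); codom f = length (omap g); P f; P g\<rbrakk> \<Longrightarrow> P (drbg_comp G g f)"
    and tensor: "\<And>f g. \<lbrakk>f \<in> Arr (DRBG G); g \<in> Arr (DRBG G); P f; P g\<rbrakk> \<Longrightarrow> P (drbg_tensor f g)"
    and inverse: "\<And>f g n. \<lbrakk>f \<in> Arr (DRBG G); g \<in> Arr (DRBG G); length (omap f) = n; codom f = n; length (omap g) = n; codom g = n;
      drbg_comp G g f = drbg_ident G n; drbg_comp G f g = drbg_ident G n; P f\<rbrakk> \<Longrightarrow> P g"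
    and ident: "\<And>n. P (drbg_ident G n)"
    and mu: "P (gen_mu G)" and eta: "P (gen_eta G)"
    and label: "\<And>x. x \<in> carrier G \<Longrightarrow> P (gen_label x)"
    and twist: "P (Twist (DRBG G) 1)"
    and braid: "P (Braid (DRBG G) 1 1)"
  shows "P f"
  using assms(1)
proof (induction rule: drbg_induct)
  case (twist k)
  let ?t = "\<lambda>k. ribbon_arr 1 (flat_ribbon [\<one>] [k])"
  have t: "?t k \<in> Arr (DRBG G)" for k by (intro ribbon_arr_in flat_ribbon_ribbons) auto
  have tt: "drbg_comp G (?t k) (?t l) = ?t (k + l)" for k l
    using comp_ribbon_arr[OF t[of k], of 1 "flat_ribbon [\<one>] [l]"]
    by (simp add: ribbon_mult_flat ribbon_arr_def)
  have t0: "?t 0 = drbg_ident G 1" by (simp add: drbg_ident_def trivial_eq_flat)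
  have t1: "P (?t 1)"
    using assms(9) by (simp add: trivial_eq_flat block_word_simps)
  have "P (?t (- 1))"
    by (rule inverse[OF t[of 1] t[of "-1"], of 1]) (use tt[of 1 "-1"] tt[of "-1" 1] t0 t1 in auto)
  then have m1: "P (?t (- 1))" .
  have s: "P (?t (k + l))" if "P (?t k)" "P (?t l)" for k l
    using comp[OF t t _ that(2,1)] tt[of k l] by simp
  show ?case
  proof (induction k rule: int_induct[where k = 0])
    case base
    then show ?case using t0 ident by simp
  next
    case (step1 i)
    then show ?case using s[OF _ t1] by blast
  next
    case (step2 i)
    then show ?case using s[OF _ m1, of i] by simp
  qed
next
  case (cross e)
  let ?c = "\<lambda>e. ribbon_arr 2 (trivial_ribbon G 2 0 [(0, e)])"
  have c: "?c e \<in> Arr (DRBG G)" for e by (intro ribbon_arr_in trivial_ribbon_ribbons) (auto simp: group_axioms)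
  have cc: "drbg_comp G (?c (\<not> e)) (?c e) = drbg_ident G 2" for e
  proof -
    have v: "[(0, e)] \<in> braid_words 2" "[(0, \<not> e)] \<in> braid_words 2" by auto
    have "braid_eq 2 ([] @ [(0, e), (0, \<not> e)] @ []) ([] @ [])" by (rule braid_eq.cancel) auto
    then have "braid_class 2 (braid_rep (braid_class 2 [(0, e)]) @ braid_rep (braid_class 2 [(0, \<not> e)])) = braid_class 2 []"
      using braid_class_append_rep[OF v] by (simp add: braid_class_eq)
    moreover have "word_perm [(0, e)] k < 2" if "k < 2" for k
      using that by (auto simp: Transposition.transpose_def)
    ultimately have "ribbon_mult G (trivial_ribbon G 2 0 [(0, \<not> e)]) (trivial_ribbon G 2 0 [(0, e)]) = trivial_ribbon G 2 0 []"
      using braid_perm_class[OF v(1)]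
      by (auto simp: ribbon_mult_def trivial_ribbon_def Let_def simp del: word_perm.simps intro!: nth_equalityI)
    then show ?thesis
      using comp_ribbon_arr[OF c[of "\<not> e"], of 2] by (simp add: drbg_ident_def ribbon_arr_def)
  qed
  have t: "P (?c True)"
    using assms(10) by (simp add: block_word_1_1 numeral_2_eq_2)
  have "P (?c False)"
    by (rule inverse[OF c[of True] c[of False], of 2]) (use cc[of True] cc[of False] t in auto)
  then show ?case using t by (cases e) auto
qed (use assms in auto)

end

section \<open>Categories of monoids and of algebras\<close>

lemma category_functor_category:
  assumes "category C" "category D"
  shows "category (functor_category C D)"
proof -
  interpret C: category C by fact
  interpret D: category D by fact
  have nt: "\<alpha> a \<in> Arr D" "Dom D (\<alpha> a) = FObj F a" "Cod D (\<alpha> a) = FObj F' a"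
    if "is_nat_trans C D F F' \<alpha>" "a \<in> Obj C" for \<alpha> a and F F' :: "('a, 'b, 'd, 'e) func"
    using that unfolding is_nat_trans_def in_Hom by auto
  have nat: "\<alpha> (Cod C f) \<cdot>\<^bsub>D\<^esub> FArr F f = FArr F' f \<cdot>\<^bsub>D\<^esub> \<alpha> (Dom C f)"
    if "is_nat_trans C D F F' \<alpha>" "f \<in> Arr C" for \<alpha> f and F F' :: "('a, 'b, 'd, 'e) func"
    using that unfolding is_nat_trans_def by auto
  have ext: "\<alpha> \<in> extensional (Obj C)"
    if "is_nat_trans C D F F' \<alpha>" for \<alpha> and F F' :: "('a, 'b, 'd, 'e) func"
    using that unfolding is_nat_trans_def by auto
  have id: "is_nat_trans C D F F (\<lambda>a\<in>Obj C. Ident D (FObj F a))" if "is_functor C D F" for F :: "('a, 'b, 'd, 'e) func"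
    unfolding is_nat_trans_def in_Hom by (auto simp: C.is_functorD[OF that])
  have comp: "is_nat_trans C D F F'' (\<lambda>a\<in>Obj C. \<beta> a \<cdot>\<^bsub>D\<^esub> \<alpha> a)"
    if F: "is_functor C D F" "is_functor C D F'" "is_functor C D F''"
      and \<alpha>: "is_nat_trans C D F F' \<alpha>" and \<beta>: "is_nat_trans C D F' F'' \<beta>"
    for F F' F'' :: "('a, 'b, 'd, 'e) func" and \<alpha> \<beta>
  proof -
    have "(\<beta> (Cod C f) \<cdot>\<^bsub>D\<^esub> \<alpha> (Cod C f)) \<cdot>\<^bsub>D\<^esub> FArr F f = FArr F'' f \<cdot>\<^bsub>D\<^esub> \<beta> (Dom C f) \<cdot>\<^bsub>D\<^esub> \<alpha> (Dom C f)"
      if f: "f \<in> Arr C" for f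
    proof -
      have "(\<beta> (Cod C f) \<cdot>\<^bsub>D\<^esub> \<alpha> (Cod C f)) \<cdot>\<^bsub>D\<^esub> FArr F f = \<beta> (Cod C f) \<cdot>\<^bsub>D\<^esub> FArr F' f \<cdot>\<^bsub>D\<^esub> \<alpha> (Dom C f)"
        using f nat[OF \<alpha> f] by (simp add: nt[OF \<alpha>] nt[OF \<beta>] C.is_functorD[OF F(1)])
      also have "\<dots> = (\<beta> (Cod C f) \<cdot>\<^bsub>D\<^esub> FArr F' f) \<cdot>\<^bsub>D\<^esub> \<alpha> (Dom C f)"
        using f by (simp add: nt[OF \<alpha>] nt[OF \<beta>] C.is_functorD[OF F(2)])
      finally show ?thesis
        using f nat[OF \<beta> f] by (simp add: nt[OF \<alpha>] nt[OF \<beta>] C.is_functorD[OF F(3)])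
    qed
    then show ?thesis
      unfolding is_nat_trans_def in_Hom by (auto simp: nt[OF \<alpha>] nt[OF \<beta>])
  qed
  show ?thesis
  proof
    fix f a b c g assume "f \<in> Hom (functor_category C D) a b" "g \<in> Hom (functor_category C D) b c"
    then show "g \<cdot>\<^bsub>functor_category C D\<^esub> f \<in> Hom (functor_category C D) a c"
      by (auto simp: functor_category_def in_Hom comp)
  next
    fix f a b assume "f \<in> Hom (functor_category C D) a b"
    then obtain \<alpha> where f: "f = (a, \<alpha>, b)" "is_functor C D a" "is_functor C D b" and \<alpha>: "is_nat_trans C D a b \<alpha>"
      by (auto simp: functor_category_def in_Hom)
    have "(\<lambda>x\<in>Obj C. Ident D (FObj b x) \<cdot>\<^bsub>D\<^esub> \<alpha> x) = \<alpha>" "(\<lambda>x\<in>Obj C. \<alpha> x \<cdot>\<^bsub>D\<^esub> Ident D (FObj a x)) = \<alpha>"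
      by (rule extensionalityI[OF _ ext[OF \<alpha>]], simp, simp add: nt[OF \<alpha>])+
    then show "Ident (functor_category C D) b \<cdot>\<^bsub>functor_category C D\<^esub> f = f"
      "f \<cdot>\<^bsub>functor_category C D\<^esub> Ident (functor_category C D) a = f"
      by (simp_all add: functor_category_def f cong: restrict_cong)
  next
    fix f a b c g d h assume "f \<in> Hom (functor_category C D) a b" "g \<in> Hom (functor_category C D) b c"
      "h \<in> Hom (functor_category C D) c d"
    then obtain \<alpha> \<beta> \<gamma> where f: "f = (a, \<alpha>, b)" "g = (b, \<beta>, c)" "h = (c, \<gamma>, d)"
      "is_nat_trans C D a b \<alpha>" "is_nat_trans C D b c \<beta>" "is_nat_trans C D c d \<gamma>"
      by (auto simp: functor_category_def in_Hom)
    show "(h \<cdot>\<^bsub>functor_category C D\<^esub> g) \<cdot>\<^bsub>functor_category C D\<^esub> f = h \<cdot>\<^bsub>functor_category C D\<^esub> g \<cdot>\<^bsub>functor_category C D\<^esub> f"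
      using f by (auto simp: functor_category_def nt[OF f(4)] nt[OF f(5)] nt[OF f(6)] intro!: restrict_ext)
  qed (auto simp: functor_category_def in_Hom id)
qed

lemma (in group) category_one_object: "category (one_object_category G)"
  by unfold_locales (auto simp: one_object_category_def in_Hom m_assoc)

section \<open>Monoids in a monoidal category\<close>

context monoidal_category
begin

lemma monoid_inD:
  assumes "is_monoid_in C (A, \<mu>, \<eta>)"
  shows "A \<in> Obj C" "\<mu> \<in> Arr C" "Dom C \<mu> = A \<diamondop> A" "Cod C \<mu> = A" "\<eta> \<in> Arr C" "Dom C \<eta> = Unit C" "Cod C \<eta> = A"
    "\<mu> \<cdot> (\<mu> \<star> Ident C A) = \<mu> \<cdot> (Ident C A \<star> \<mu>) \<cdot> Assoc C A A A"
    "\<mu> \<cdot> (\<eta> \<star> Ident C A) = LUnit C A" "\<mu> \<cdot> (Ident C A \<star> \<eta>) = RUnit C A"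
  using assms by (auto simp: is_monoid_in_def in_Hom)

lemma monoid_homD:
  assumes "is_monoid_hom C (A, \<mu>, \<eta>) (A', \<mu>', \<eta>') f"
  shows "f \<in> Arr C" "Dom C f = A" "Cod C f = A'" "f \<cdot> \<mu> = \<mu>' \<cdot> (f \<star> f)" "f \<cdot> \<eta> = \<eta>'"
  using assms by (auto simp: is_monoid_hom_def in_Hom)

lemma monoid_hom_ident:
  assumes "is_monoid_in C (A, \<mu>, \<eta>)"
  shows "is_monoid_hom C (A, \<mu>, \<eta>) (A, \<mu>, \<eta>) (Ident C A)"
  using monoid_inD[OF assms] by (simp add: is_monoid_hom_def in_Hom)

lemma monoid_hom_comp:
  assumes "is_monoid_in C M" "is_monoid_in C M'" "is_monoid_in C M''"
    "is_monoid_hom C M M' f" "is_monoid_hom C M' M'' g"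
  shows "is_monoid_hom C M M'' (g \<cdot> f)"
proof -
  obtain A \<mu> \<eta> A' \<mu>' \<eta>' A'' \<mu>'' \<eta>'' where M: "M = (A, \<mu>, \<eta>)" "M' = (A', \<mu>', \<eta>')" "M'' = (A'', \<mu>'', \<eta>'')"
    by (metis prod_cases3)
  note d = monoid_inD[OF assms(1)[unfolded M]] monoid_inD[OF assms(2)[unfolded M]] monoid_inD[OF assms(3)[unfolded M]]
  note f = monoid_homD[OF assms(4)[unfolded M]] and g = monoid_homD[OF assms(5)[unfolded M]]
  have "(g \<cdot> f) \<cdot> \<mu> = g \<cdot> \<mu>' \<cdot> (f \<star> f)" using d f g by simp
  also have "\<dots> = (g \<cdot> \<mu>') \<cdot> (f \<star> f)" using d(11-17) f(1-3) g(1-3) by simp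
  also have "\<dots> = \<mu>'' \<cdot> (g \<star> g) \<cdot> (f \<star> f)" unfolding g(4) using d f(1-3) g(1-3) by simp
  also have "\<dots> = \<mu>'' \<cdot> ((g \<cdot> f) \<star> (g \<cdot> f))" using f(1-3) g(1-3) by (simp add: tensor_comp)
  finally show ?thesis using d f(1-3,5) g(1-3,5) by (simp add: M is_monoid_hom_def in_Hom)
qed

lemma Mon_sel [simp]:
  "M \<in> Obj (Mon C) \<longleftrightarrow> is_monoid_in C M"
  "(M, f, M') \<in> Arr (Mon C) \<longleftrightarrow> is_monoid_in C M \<and> is_monoid_in C M' \<and> is_monoid_hom C M M' f"
  "Dom (Mon C) (M, f, M') = M" "Cod (Mon C) (M, f, M') = M'" "Ident (Mon C) M = (M, Ident C (fst M), M)"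
  "(N, g, N') \<cdot>\<^bsub>Mon C\<^esub> (M, f, M') = (M, g \<cdot> f, N')"
  by (auto simp: Mon_def)

lemma category_Mon: "category (Mon C)"
proof
  fix f a b c g assume "f \<in> Hom (Mon C) a b" "g \<in> Hom (Mon C) b c"
  then show "g \<cdot>\<^bsub>Mon C\<^esub> f \<in> Hom (Mon C) a c"
    by (cases f, cases g) (auto simp: in_Hom intro: monoid_hom_comp)
next
  fix a assume "a \<in> Obj (Mon C)"
  then show "Ident (Mon C) a \<in> Hom (Mon C) a a"
    by (cases a) (auto simp: in_Hom monoid_hom_ident)
next
  fix f a b assume "f \<in> Hom (Mon C) a b"
  then obtain h where f: "f = (a, h, b)" "is_monoid_hom C a b h" by (cases f) (auto simp: in_Hom)
  obtain A \<mu> \<eta> A' \<mu>' \<eta>' where ab: "a = (A, \<mu>, \<eta>)" "b = (A', \<mu>', \<eta>')" by (metis prod_cases3)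
  note h = monoid_homD[OF f(2)[unfolded ab]]
  show "Ident (Mon C) b \<cdot>\<^bsub>Mon C\<^esub> f = f" "f \<cdot>\<^bsub>Mon C\<^esub> Ident (Mon C) a = f"
    using h by (simp_all add: f ab)
next
  fix f a b c g d h assume "f \<in> Hom (Mon C) a b" "g \<in> Hom (Mon C) b c" "h \<in> Hom (Mon C) c d"
  then show "(h \<cdot>\<^bsub>Mon C\<^esub> g) \<cdot>\<^bsub>Mon C\<^esub> f = h \<cdot>\<^bsub>Mon C\<^esub> g \<cdot>\<^bsub>Mon C\<^esub> f"
    by (cases f, cases g, cases h, cases a) (auto simp: in_Hom is_monoid_hom_def)
qed (auto simp: Mon_def)

text \<open>Transport of structure along an isomorphism; the cases of interest are the right
  unitors, which lead from \<open>pow 1\<close> to \<open>A\<close>.\<close>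

lemma monoid_transport:
  assumes M: "is_monoid_in C (A, \<mu>, \<eta>)" and r: "iso_arrow C r" "Cod C r = A" "Dom C r = A'"
  shows "is_monoid_in C (A', inverse_arrow C r \<cdot> \<mu> \<cdot> (r \<star> r), inverse_arrow C r \<cdot> \<eta>)"
proof -
  note d [simp] = monoid_inD(1-7)[OF M] and l = monoid_inD(8-10)[OF M]
  have [simp]: "r \<in> Arr C" "A' \<in> Obj C" using iso_arrow_arr[OF r(1)] r(3) by auto
  let ?s = "inverse_arrow C r"
  let ?m = "?s \<cdot> \<mu> \<cdot> (r \<star> r)"
  have rm: "r \<cdot> ?m = \<mu> \<cdot> (r \<star> r)" using r by simp
  have "?m \<cdot> (?m \<star> Ident C A') = ?s \<cdot> \<mu> \<cdot> ((r \<cdot> ?m) \<star> (r \<cdot> Ident C A'))"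
    using r by (simp add: tensor_comp)
  also have "\<dots> = ?s \<cdot> (\<mu> \<cdot> (\<mu> \<star> Ident C A)) \<cdot> ((r \<star> r) \<star> r)"
    unfolding rm using r by (simp add: tensor_comp)
  also have "\<dots> = ?s \<cdot> \<mu> \<cdot> (Ident C A \<star> \<mu>) \<cdot> Assoc C A A A \<cdot> ((r \<star> r) \<star> r)"
    unfolding l using r by simp
  also have "Assoc C A A A \<cdot> ((r \<star> r) \<star> r) = (r \<star> r \<star> r) \<cdot> Assoc C A' A' A'"
    using assoc_nat[of r r r] r by simp
  also have "?s \<cdot> \<mu> \<cdot> (Ident C A \<star> \<mu>) \<cdot> (r \<star> r \<star> r) \<cdot> Assoc C A' A' A'
      = ?s \<cdot> \<mu> \<cdot> ((Ident C A \<star> \<mu>) \<cdot> (r \<star> r \<star> r)) \<cdot> Assoc C A' A' A'"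
    using r by simp
  also have "(Ident C A \<star> \<mu>) \<cdot> (r \<star> r \<star> r) = (r \<cdot> Ident C A') \<star> (r \<cdot> ?m)"
    unfolding rm using r by (simp add: tensor_comp)
  also have "?s \<cdot> \<mu> \<cdot> ((r \<cdot> Ident C A') \<star> (r \<cdot> ?m)) \<cdot> Assoc C A' A' A' = ?m \<cdot> (Ident C A' \<star> ?m) \<cdot> Assoc C A' A' A'"
  proof -
    have "(r \<cdot> Ident C A') \<star> (r \<cdot> ?m) = (r \<star> r) \<cdot> (Ident C A' \<star> ?m)" using r by (simp add: tensor_comp)
    then show ?thesis using r by simp
  qed
  finally have a: "?m \<cdot> (?m \<star> Ident C A') = ?m \<cdot> (Ident C A' \<star> ?m) \<cdot> Assoc C A' A' A'" .
  have "?m \<cdot> ((?s \<cdot> \<eta>) \<star> Ident C A') = ?s \<cdot> (\<mu> \<cdot> (\<eta> \<star> Ident C A)) \<cdot> (Ident C (Unit C) \<star> r)"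
    using r by (simp add: tensor_comp)
  also have "\<dots> = LUnit C A'" unfolding l using lunit_nat[of r] r by simp
  finally have b: "?m \<cdot> ((?s \<cdot> \<eta>) \<star> Ident C A') = LUnit C A'" .
  have "?m \<cdot> (Ident C A' \<star> (?s \<cdot> \<eta>)) = ?s \<cdot> (\<mu> \<cdot> (Ident C A \<star> \<eta>)) \<cdot> (r \<star> Ident C (Unit C))"
    using r by (simp add: tensor_comp)
  also have "\<dots> = RUnit C A'" unfolding l using runit_nat[of r] r by simp
  finally have c: "?m \<cdot> (Ident C A' \<star> (?s \<cdot> \<eta>)) = RUnit C A'" .
  show ?thesis unfolding is_monoid_in_def in_Hom using a b c r by simp
qed

end

section \<open>Balanced functors and monoidal transformations\<close>

context balanced_category
begin

lemma balanced_functorD: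
  fixes T :: "('u, 'v, 'w) balcat_scheme"
  assumes F: "is_balanced_functor T C F" and T: "Obj T = UNIV"
  shows "is_functor T C F" "FObj F a \<in> Obj C"
    "f \<in> Arr T \<Longrightarrow> FArr F f \<in> Arr C" "f \<in> Arr T \<Longrightarrow> Dom C (FArr F f) = FObj F (Dom T f)"
    "f \<in> Arr T \<Longrightarrow> Cod C (FArr F f) = FObj F (Cod T f)"
    "FArr F (Ident T a) = Ident C (FObj F a)"
    "f \<in> Arr T \<Longrightarrow> g \<in> Arr T \<Longrightarrow> Cod T f = Dom T g \<Longrightarrow> FArr F (g \<cdot>\<^bsub>T\<^esub> f) = FArr F g \<cdot> FArr F f"
    "MUnit F \<in> Arr C" "Dom C (MUnit F) = Unit C" "Cod C (MUnit F) = FObj F (Unit T)" "iso_arrow C (MUnit F)"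
    "MTens F (a, b) \<in> Arr C" "Dom C (MTens F (a, b)) = FObj F a \<diamondop> FObj F b"
    "Cod C (MTens F (a, b)) = FObj F (a \<diamondop>\<^bsub>T\<^esub> b)" "iso_arrow C (MTens F (a, b))"
    "f \<in> Arr T \<Longrightarrow> g \<in> Arr T \<Longrightarrow> MTens F (Cod T f, Cod T g) \<cdot> (FArr F f \<star> FArr F g) =
        FArr F (f \<star>\<^bsub>T\<^esub> g) \<cdot> MTens F (Dom T f, Dom T g)"
    "FArr F (Assoc T a b c) \<cdot> MTens F (a \<diamondop>\<^bsub>T\<^esub> b, c) \<cdot> (MTens F (a, b) \<star> Ident C (FObj F c)) =
        MTens F (a, b \<diamondop>\<^bsub>T\<^esub> c) \<cdot> (Ident C (FObj F a) \<star> MTens F (b, c)) \<cdot> Assoc C (FObj F a) (FObj F b) (FObj F c)"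
    "FArr F (LUnit T a) \<cdot> MTens F (Unit T, a) \<cdot> (MUnit F \<star> Ident C (FObj F a)) = LUnit C (FObj F a)"
    "FArr F (RUnit T a) \<cdot> MTens F (a, Unit T) \<cdot> (Ident C (FObj F a) \<star> MUnit F) = RUnit C (FObj F a)"
    "FArr F (Braid T a b) \<cdot> MTens F (a, b) = MTens F (b, a) \<cdot> Braid C (FObj F a) (FObj F b)"
    "FArr F (Twist T a) = Twist C (FObj F a)"
    "MTens F \<in> extensional UNIV" "FArr F \<in> extensional (Arr T)"
  using F unfolding is_balanced_functor_def is_functor_def in_Hom T by auto

lemma monoidal_transD:
  fixes T :: "('u, 'v, 'w) balcat_scheme"
  assumes a: "is_monoidal_trans T C F F' \<alpha>" and T: "Obj T = UNIV"
  shows "\<alpha> a \<in> Arr C" "Dom C (\<alpha> a) = FObj F a" "Cod C (\<alpha> a) = FObj F' a"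
    "f \<in> Arr T \<Longrightarrow> \<alpha> (Cod T f) \<cdot> FArr F f = FArr F' f \<cdot> \<alpha> (Dom T f)"
    "\<alpha> (Unit T) \<cdot> MUnit F = MUnit F'"
    "\<alpha> (a \<diamondop>\<^bsub>T\<^esub> b) \<cdot> MTens F (a, b) = MTens F' (a, b) \<cdot> (\<alpha> a \<star> \<alpha> b)"
  using a unfolding is_monoidal_trans_def is_nat_trans_def in_Hom T by auto

lemma monoidal_trans_comp:
  fixes T :: "('u, 'v, 'w) balcat_scheme"
  assumes T: "Obj T = UNIV"
    and F: "is_balanced_functor T C F" "is_balanced_functor T C F'" "is_balanced_functor T C F''"
    and a: "is_monoidal_trans T C F F' \<alpha>" and b: "is_monoidal_trans T C F' F'' \<beta>"
  shows "is_monoidal_trans T C F F'' (\<lambda>x. \<beta> x \<cdot> \<alpha> x)"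
proof -
  note [simp] = balanced_functorD(2-5,8-15)[OF F(1) T] balanced_functorD(2-5,8-15)[OF F(2) T] balanced_functorD(2-5,8-15)[OF F(3) T]
    monoidal_transD(1-3)[OF a T] monoidal_transD(1-3)[OF b T]
  have 1: "(\<beta> (Cod T f) \<cdot> \<alpha> (Cod T f)) \<cdot> FArr F f = FArr F'' f \<cdot> \<beta> (Dom T f) \<cdot> \<alpha> (Dom T f)" if f: "f \<in> Arr T" for f
  proof -
    have "(\<beta> (Cod T f) \<cdot> \<alpha> (Cod T f)) \<cdot> FArr F f = (\<beta> (Cod T f) \<cdot> FArr F' f) \<cdot> \<alpha> (Dom T f)"
      using f monoidal_transD(4)[OF a T f] by simp
    then show ?thesis using f monoidal_transD(4)[OF b T f] by simp
  qed
  have 2: "(\<beta> (x \<diamondop>\<^bsub>T\<^esub> y) \<cdot> \<alpha> (x \<diamondop>\<^bsub>T\<^esub> y)) \<cdot> MTens F (x, y) = MTens F'' (x, y) \<cdot> ((\<beta> x \<cdot> \<alpha> x) \<star> (\<beta> y \<cdot> \<alpha> y))" for x y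
  proof -
    have "(\<beta> (x \<diamondop>\<^bsub>T\<^esub> y) \<cdot> \<alpha> (x \<diamondop>\<^bsub>T\<^esub> y)) \<cdot> MTens F (x, y) = (\<beta> (x \<diamondop>\<^bsub>T\<^esub> y) \<cdot> MTens F' (x, y)) \<cdot> (\<alpha> x \<star> \<alpha> y)"
      using monoidal_transD(6)[OF a T, of x y] by simp
    then show ?thesis using monoidal_transD(6)[OF b T, of x y] by (simp add: tensor_comp)
  qed
  show ?thesis
    using 1 2 monoidal_transD(5)[OF a T] monoidal_transD(5)[OF b T]
    unfolding is_monoidal_trans_def is_nat_trans_def in_Hom T by simp
qed

lemma Alg_sel:
  fixes T :: "('u, 'v, 'w) balcat_scheme"
  shows "F \<in> Obj (Alg T C) \<longleftrightarrow> is_balanced_functor T C F"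
  "(F, \<alpha>, F') \<in> Arr (Alg T C) \<longleftrightarrow>
     is_balanced_functor T C F \<and> is_balanced_functor T C F' \<and> is_monoidal_trans T C F F' \<alpha>"
  "Dom (Alg T C) (F, \<alpha>, F') = F" "Cod (Alg T C) (F, \<alpha>, F') = F'"
  "Ident (Alg T C) F = (F, (\<lambda>a\<in>Obj T. Ident C (FObj F a)), F)"
  "(N, \<beta>, N') \<cdot>\<^bsub>Alg T C\<^esub> (F, \<alpha>, F') = (F, (\<lambda>a\<in>Obj T. \<beta> a \<cdot> \<alpha> a), N')"
  by (auto simp: Alg_def)

lemma category_Alg:
  fixes T :: "('u, 'v, 'w) balcat_scheme"
  assumes T: "Obj T = UNIV"
  shows "category (Alg T C)"
proof
  fix f a b c g assume "f \<in> Hom (Alg T C) a b" "g \<in> Hom (Alg T C) b c"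
  then show "g \<cdot>\<^bsub>Alg T C\<^esub> f \<in> Hom (Alg T C) a c"
    by (cases f, cases g) (auto simp: in_Hom Alg_sel T restrict_UNIV monoidal_trans_comp)
next
  fix F assume "F \<in> Obj (Alg T C)"
  then have F: "is_balanced_functor T C F" by (simp add: Alg_sel)
  show "Ident (Alg T C) F \<in> Hom (Alg T C) F F"
    using F balanced_functorD[OF F T]
    by (simp add: in_Hom Alg_sel is_monoidal_trans_def is_nat_trans_def T)
next
  fix f F F' assume "f \<in> Hom (Alg T C) F F'"
  then obtain \<alpha> where f: "f = (F, \<alpha>, F')" and \<alpha>: "is_monoidal_trans T C F F' \<alpha>"
    by (cases f) (auto simp: in_Hom Alg_sel)
  show "Ident (Alg T C) F' \<cdot>\<^bsub>Alg T C\<^esub> f = f" "f \<cdot>\<^bsub>Alg T C\<^esub> Ident (Alg T C) F = f"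
    by (simp_all add: f Alg_sel T restrict_UNIV monoidal_transD[OF \<alpha> T])
next
  fix f a b c g d h assume "f \<in> Hom (Alg T C) a b" "g \<in> Hom (Alg T C) b c" "h \<in> Hom (Alg T C) c d"
  then obtain \<alpha> \<beta> \<gamma> where f: "f = (a, \<alpha>, b)" "g = (b, \<beta>, c)" "h = (c, \<gamma>, d)"
    and t: "is_monoidal_trans T C a b \<alpha>" "is_monoidal_trans T C b c \<beta>" "is_monoidal_trans T C c d \<gamma>"
    by (cases f, cases g, cases h) (auto simp: in_Hom Alg_sel)
  show "(h \<cdot>\<^bsub>Alg T C\<^esub> g) \<cdot>\<^bsub>Alg T C\<^esub> f = h \<cdot>\<^bsub>Alg T C\<^esub> g \<cdot>\<^bsub>Alg T C\<^esub> f"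
    by (simp add: f Alg_sel T monoidal_transD[OF t(1) T] monoidal_transD[OF t(2) T] monoidal_transD[OF t(3) T])
qed (auto simp: Alg_def)

end

section \<open>From algebras to monoids with a group action\<close>

locale algebra_base = balanced_category C + G: group G
  for C :: "('o, 'a, 'm) balcat_scheme" (structure) and G :: "('g, 'n) monoid_scheme"
begin

abbreviation T :: "(nat, 'g drbg_arr) balcat" where "T \<equiv> DRBG G"
abbreviation Alg_T where "Alg_T \<equiv> Alg T C"

definition mon :: "(nat, 'g drbg_arr, 'o, 'a) mfunc \<Rightarrow> 'o \<times> 'a \<times> 'a" where
  "mon F = (FObj F 1, FArr F (gen_mu G) \<cdot> MTens F (1, 1), FArr F (gen_eta G) \<cdot> MUnit F)"

definition gmon :: "(nat, 'g drbg_arr, 'o, 'a) mfunc \<Rightarrow> (unit, 'g, 'o \<times> 'a \<times> 'a, ('o \<times> 'a \<times> 'a) \<times> 'a \<times> 'o \<times> 'a \<times> 'a) func" where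
  "gmon F = \<lparr>FObj = (\<lambda>_\<in>{()}. mon F), FArr = (\<lambda>x\<in>carrier G. (mon F, FArr F (gen_label x), mon F))\<rparr>"

definition eval_functor where
  "eval_functor = \<lparr>FObj = (\<lambda>F\<in>Obj Alg_T. gmon F),
     FArr = restrict (\<lambda>(F, \<alpha>, F'). (gmon F, (\<lambda>_\<in>{()}. (mon F, \<alpha> 1, mon F')), gmon F')) (Arr Alg_T)\<rparr>"

context
  fixes F :: "(nat, 'g drbg_arr, 'o, 'a) mfunc"
  assumes F: "is_balanced_functor T C F"
begin

lemma FD [simp]:
  "FObj F n \<in> Obj C" "f \<in> Arr T \<Longrightarrow> FArr F f \<in> Arr C" "f \<in> Arr T \<Longrightarrow> Dom C (FArr F f) = FObj F (length (omap f))"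
  "f \<in> Arr T \<Longrightarrow> Cod C (FArr F f) = FObj F (codom f)"
  "FArr F (drbg_ident G n) = Ident C (FObj F n)"
  "MUnit F \<in> Arr C" "Dom C (MUnit F) = Unit C" "Cod C (MUnit F) = FObj F 0" "iso_arrow C (MUnit F)"
  "MTens F (m, n) \<in> Arr C" "Dom C (MTens F (m, n)) = FObj F m \<diamondop> FObj F n"
  "Cod C (MTens F (m, n)) = FObj F (m + n)" "iso_arrow C (MTens F (m, n))"
  using balanced_functorD(2-15)[OF F] by simp_all

lemma F_comp: "f \<in> Arr T \<Longrightarrow> g \<in> Arr T \<Longrightarrow> codom f = length (omap g) \<Longrightarrow> FArr F (drbg_comp G g f) = FArr F g \<cdot> FArr F f"
  using balanced_functorD(7)[OF F] by simp

lemma F_tensor: "f \<in> Arr T \<Longrightarrow> g \<in> Arr T \<Longrightarrow> MTens F (codom f, codom g) \<cdot> (FArr F f \<star> FArr F g) =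
    FArr F (drbg_tensor f g) \<cdot> MTens F (length (omap f), length (omap g))"
  using balanced_functorD(16)[OF F] by simp

lemma F_assoc: "MTens F (l + m, n) \<cdot> (MTens F (l, m) \<star> Ident C (FObj F n)) =
    MTens F (l, m + n) \<cdot> (Ident C (FObj F l) \<star> MTens F (m, n)) \<cdot> Assoc C (FObj F l) (FObj F m) (FObj F n)"
  using balanced_functorD(17)[OF F, of l m n] by (simp add: add.assoc)

lemma F_lunit: "MTens F (0, n) \<cdot> (MUnit F \<star> Ident C (FObj F n)) = LUnit C (FObj F n)"
  using balanced_functorD(18)[OF F, of n] by simp

lemma F_runit: "MTens F (n, 0) \<cdot> (Ident C (FObj F n) \<star> MUnit F) = RUnit C (FObj F n)"
  using balanced_functorD(19)[OF F, of n] by simp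

text \<open>The laws of \<open>gen_mu\<close> and \<open>gen_eta\<close> are sent through
  \<open>F\<close>. To compare them with the laws in \<open>C\<close>, \<open>F_tensor\<close> moves
  the comparison arrows past a tensor product, and \<open>F_assoc\<close>, \<open>F_lunit\<close>
  and \<open>F_runit\<close> create the associator and the unitors.\<close>

lemma mon_monoid: "is_monoid_in C (mon F)"
proof -
  let ?i = "Ident C (FObj F 1)" and ?mu = "FArr F (gen_mu G)" and ?eta = "FArr F (gen_eta G)"
  let ?M = "MTens F (1, 1)" and ?id = "drbg_ident G 1"
  let ?m = "?mu \<cdot> ?M"
  note t1 = F_tensor[of "gen_mu G" ?id, simplified] and t2 = F_tensor[of ?id "gen_mu G", simplified]
  note t3 = F_tensor[of "gen_eta G" ?id, simplified] and t4 = F_tensor[of ?id "gen_eta G", simplified]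
  note in1 = G.DRBG_tensor_in[of "gen_mu G" ?id, simplified] and in2 = G.DRBG_tensor_in[of ?id "gen_mu G", simplified]
  note in3 = G.DRBG_tensor_in[of "gen_eta G" ?id, simplified] and in4 = G.DRBG_tensor_in[of ?id "gen_eta G", simplified]
  have "?m \<cdot> (?m \<star> ?i) = ?mu \<cdot> (?M \<cdot> (?mu \<star> ?i)) \<cdot> (?M \<star> ?i)"
    by (simp add: tensor_comp)
  also have "\<dots> = (?mu \<cdot> FArr F (drbg_tensor (gen_mu G) ?id)) \<cdot> MTens F (1 + 1, 1) \<cdot> (?M \<star> ?i)"
    using t1 in1 by simp
  also have "?mu \<cdot> FArr F (drbg_tensor (gen_mu G) ?id) = ?mu \<cdot> FArr F (drbg_tensor ?id (gen_mu G))"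
    using G.gen_mu_assoc in1 in2 F_comp[of "drbg_tensor (gen_mu G) ?id" "gen_mu G"] F_comp[of "drbg_tensor ?id (gen_mu G)" "gen_mu G"]
    by simp
  also have "MTens F (1 + 1, 1) \<cdot> (?M \<star> ?i) = MTens F (1, 1 + 1) \<cdot> (?i \<star> ?M) \<cdot> Assoc C (FObj F 1) (FObj F 1) (FObj F 1)"
    by (rule F_assoc)
  also have "(?mu \<cdot> FArr F (drbg_tensor ?id (gen_mu G))) \<cdot> MTens F (1, 1 + 1) \<cdot> (?i \<star> ?M) \<cdot> Assoc C (FObj F 1) (FObj F 1) (FObj F 1)
     = ?mu \<cdot> (FArr F (drbg_tensor ?id (gen_mu G)) \<cdot> MTens F (1, 1 + 1)) \<cdot> (?i \<star> ?M) \<cdot> Assoc C (FObj F 1) (FObj F 1) (FObj F 1)"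
    using in2 by simp
  also have "FArr F (drbg_tensor ?id (gen_mu G)) \<cdot> MTens F (1, 1 + 1) = ?M \<cdot> (?i \<star> ?mu)"
    using t2 by simp
  also have "?mu \<cdot> (?M \<cdot> (?i \<star> ?mu)) \<cdot> (?i \<star> ?M) \<cdot> Assoc C (FObj F 1) (FObj F 1) (FObj F 1)
      = ?m \<cdot> ((?i \<star> ?mu) \<cdot> (?i \<star> ?M)) \<cdot> Assoc C (FObj F 1) (FObj F 1) (FObj F 1)"
    by simp
  also have "(?i \<star> ?mu) \<cdot> (?i \<star> ?M) = ?i \<star> ?m" by (simp add: tensor_comp)
  finally have a: "?m \<cdot> (?m \<star> ?i) = ?m \<cdot> (?i \<star> ?m) \<cdot> Assoc C (FObj F 1) (FObj F 1) (FObj F 1)" .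
  have "?m \<cdot> ((?eta \<cdot> MUnit F) \<star> ?i) = ?mu \<cdot> (?M \<cdot> (?eta \<star> ?i)) \<cdot> (MUnit F \<star> ?i)"
    by (simp add: tensor_comp)
  also have "\<dots> = (?mu \<cdot> FArr F (drbg_tensor (gen_eta G) ?id)) \<cdot> MTens F (0, 1) \<cdot> (MUnit F \<star> ?i)"
    using t3 in3 by simp
  also have "?mu \<cdot> FArr F (drbg_tensor (gen_eta G) ?id) = ?i"
    using G.gen_mu_unit(1) in3 F_comp[of "drbg_tensor (gen_eta G) ?id" "gen_mu G"] by simp
  also have "MTens F (0, 1) \<cdot> (MUnit F \<star> ?i) = LUnit C (FObj F 1)" by (rule F_lunit)
  finally have b: "?m \<cdot> ((?eta \<cdot> MUnit F) \<star> ?i) = LUnit C (FObj F 1)" by simp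
  have "?m \<cdot> (?i \<star> (?eta \<cdot> MUnit F)) = ?mu \<cdot> (?M \<cdot> (?i \<star> ?eta)) \<cdot> (?i \<star> MUnit F)"
    by (simp add: tensor_comp)
  also have "\<dots> = (?mu \<cdot> FArr F (drbg_tensor ?id (gen_eta G))) \<cdot> MTens F (1, 0) \<cdot> (?i \<star> MUnit F)"
    using t4 in4 by simp
  also have "?mu \<cdot> FArr F (drbg_tensor ?id (gen_eta G)) = ?i"
    using G.gen_mu_unit(2) in4 F_comp[of "drbg_tensor ?id (gen_eta G)" "gen_mu G"] by simp
  also have "MTens F (1, 0) \<cdot> (?i \<star> MUnit F) = RUnit C (FObj F 1)" by (rule F_runit)
  finally have c: "?m \<cdot> (?i \<star> (?eta \<cdot> MUnit F)) = RUnit C (FObj F 1)" by simp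
  show ?thesis
    using a b c unfolding mon_def is_monoid_in_def in_Hom by simp
qed

lemma label_monoid_hom:
  assumes x: "x \<in> carrier G"
  shows "is_monoid_hom C (mon F) (mon F) (FArr F (gen_label x))"
proof -
  let ?x = "gen_label x"
  let ?xx = "drbg_tensor ?x ?x"
  note t = F_tensor[OF G.gen_in(3)[OF x] G.gen_in(3)[OF x], simplified]
  note i = G.DRBG_tensor_in[OF G.gen_in(3)[OF x] G.gen_in(3)[OF x], simplified]
  have "FArr F ?x \<cdot> FArr F (gen_mu G) \<cdot> MTens F (1, 1) = (FArr F ?x \<cdot> FArr F (gen_mu G)) \<cdot> MTens F (1, 1)"
    using x by simp
  also have "FArr F ?x \<cdot> FArr F (gen_mu G) = FArr F (gen_mu G) \<cdot> FArr F ?xx"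
    using G.gen_label_mu[OF x] x i F_comp[of "gen_mu G" ?x] F_comp[of ?xx "gen_mu G"] by simp
  also have "(FArr F (gen_mu G) \<cdot> FArr F ?xx) \<cdot> MTens F (1, 1) = (FArr F (gen_mu G) \<cdot> MTens F (1, 1)) \<cdot> (FArr F ?x \<star> FArr F ?x)"
    using t x i by simp
  finally have 1: "FArr F ?x \<cdot> FArr F (gen_mu G) \<cdot> MTens F (1, 1) = (FArr F (gen_mu G) \<cdot> MTens F (1, 1)) \<cdot> (FArr F ?x \<star> FArr F ?x)" .
  have "FArr F ?x \<cdot> FArr F (gen_eta G) \<cdot> MUnit F = (FArr F ?x \<cdot> FArr F (gen_eta G)) \<cdot> MUnit F" using x by simp
  also have "FArr F ?x \<cdot> FArr F (gen_eta G) = FArr F (gen_eta G)"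
    using G.gen_label_eta[OF x] x F_comp[of "gen_eta G" ?x] by simp
  finally show ?thesis using 1 x unfolding mon_def is_monoid_hom_def in_Hom by simp
qed

lemma gmon_functor: "is_functor (one_object_category G) (Mon C) (gmon F)"
  using mon_monoid label_monoid_hom G.gen_label_one G.gen_label_mult F_comp
  unfolding is_functor_def in_Hom one_object_category_def gmon_def
  by (auto simp: mon_def G.gen_label_mult[symmetric])

end

lemma trans_monoid_hom:
  assumes F: "is_balanced_functor T C F" "is_balanced_functor T C F'" and \<alpha>: "is_monoidal_trans T C F F' \<alpha>"
  shows "is_monoid_hom C (mon F) (mon F') (\<alpha> 1)"
proof -
  note [simp] = FD[OF F(1)] FD[OF F(2)]
  have a [simp]: "\<alpha> n \<in> Arr C" "Dom C (\<alpha> n) = FObj F n" "Cod C (\<alpha> n) = FObj F' n" for n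
    using monoidal_transD[OF \<alpha>] by auto
  have "\<alpha> 1 \<cdot> FArr F (gen_mu G) = FArr F' (gen_mu G) \<cdot> \<alpha> 2"
    using monoidal_transD(4)[OF \<alpha>, of "gen_mu G"] by (simp add: numeral_2_eq_2)
  then have "(\<alpha> 1 \<cdot> FArr F (gen_mu G)) \<cdot> MTens F (1, 1) = FArr F' (gen_mu G) \<cdot> \<alpha> (1 + 1) \<cdot> MTens F (1, 1)"
    by (simp add: numeral_2_eq_2)
  also have "\<alpha> (1 + 1) \<cdot> MTens F (1, 1) = MTens F' (1, 1) \<cdot> (\<alpha> 1 \<star> \<alpha> 1)"
    using monoidal_transD(6)[OF \<alpha>, of 1 1] by simp
  finally have 1: "(\<alpha> 1 \<cdot> FArr F (gen_mu G)) \<cdot> MTens F (1, 1) = FArr F' (gen_mu G) \<cdot> MTens F' (1, 1) \<cdot> (\<alpha> 1 \<star> \<alpha> 1)" .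
  have "\<alpha> 1 \<cdot> FArr F (gen_eta G) = FArr F' (gen_eta G) \<cdot> \<alpha> 0"
    using monoidal_transD(4)[OF \<alpha>, of "gen_eta G"] by simp
  then have "(\<alpha> 1 \<cdot> FArr F (gen_eta G)) \<cdot> MUnit F = FArr F' (gen_eta G) \<cdot> \<alpha> 0 \<cdot> MUnit F" by simp
  also have "\<alpha> 0 \<cdot> MUnit F = MUnit F'" using monoidal_transD(5)[OF \<alpha>] by simp
  finally show ?thesis using 1 unfolding mon_def is_monoid_hom_def in_Hom by simp
qed

lemma eval_is_functor: "is_functor Alg_T (GMon G C) eval_functor"
proof -
  have t: "is_nat_trans (one_object_category G) (Mon C) (gmon F) (gmon F') (\<lambda>_\<in>{()}. (mon F, \<alpha> 1, mon F'))"
    if F: "is_balanced_functor T C F" "is_balanced_functor T C F'" and \<alpha>: "is_monoidal_trans T C F F' \<alpha>" for F F' \<alpha>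
  proof -
    have "\<alpha> 1 \<cdot> FArr F (gen_label x) = FArr F' (gen_label x) \<cdot> \<alpha> 1" if "x \<in> carrier G" for x
      using monoidal_transD(4)[OF \<alpha>, of "gen_label x"] that by simp
    then show ?thesis
      using mon_monoid[OF F(1)] mon_monoid[OF F(2)] trans_monoid_hom[OF F \<alpha>]
      unfolding is_nat_trans_def in_Hom one_object_category_def gmon_def by auto
  qed
  interpret A: category Alg_T by (rule category_Alg) simp
  have e: "FArr eval_functor (F, \<alpha>, F') = (gmon F, (\<lambda>_\<in>{()}. (mon F, \<alpha> 1, mon F')), gmon F')"
    if "(F, \<alpha>, F') \<in> Arr Alg_T" for F \<alpha> F'
    using that by (simp add: eval_functor_def)
  show ?thesis
    unfolding is_functor_def
  proof (intro conjI ballI impI)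
    show "FObj eval_functor \<in> Obj Alg_T \<rightarrow>\<^sub>E Obj (GMon G C)"
      by (auto simp: eval_functor_def functor_category_def gmon_functor Alg_sel)
    show "FArr eval_functor \<in> extensional (Arr Alg_T)" by (simp add: eval_functor_def)
  next
    fix f assume f: "f \<in> Arr Alg_T"
    obtain F \<alpha> F' where fe: "f = (F, \<alpha>, F')" by (metis prod_cases3)
    then have d: "is_balanced_functor T C F" "is_balanced_functor T C F'" "is_monoidal_trans T C F F' \<alpha>"
      using f by (simp_all add: Alg_sel)
    show "FArr eval_functor f \<in> Hom (GMon G C) (FObj eval_functor (Dom Alg_T f)) (FObj eval_functor (Cod Alg_T f))"
      using d t[OF d] gmon_functor[OF d(1)] gmon_functor[OF d(2)]
      unfolding fe e[OF f[unfolded fe]] by (simp add: in_Hom functor_category_def Alg_sel eval_functor_def)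
  next
    fix F assume F: "F \<in> Obj Alg_T"
    have "Ident Alg_T F \<in> Arr Alg_T" using F by simp
    then show "FArr eval_functor (Ident Alg_T F) = Ident (GMon G C) (FObj eval_functor F)"
      using F by (simp add: Alg_sel(5) e)
        (auto simp: eval_functor_def functor_category_def one_object_category_def gmon_def mon_def)
  next
    fix f g assume f: "f \<in> Arr Alg_T" and g: "g \<in> Arr Alg_T" and fg: "Cod Alg_T f = Dom Alg_T g"
    obtain F \<alpha> F' \<beta> F'' where fe: "f = (F, \<alpha>, F')" "g = (F', \<beta>, F'')"
      using fg by (metis prod_cases3 Alg_sel(3,4))
    have "g \<cdot>\<^bsub>Alg_T\<^esub> f \<in> Arr Alg_T" using f g fg by simp
    then show "FArr eval_functor (g \<cdot>\<^bsub>Alg_T\<^esub> f) = FArr eval_functor g \<cdot>\<^bsub>GMon G C\<^esub> FArr eval_functor f"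
      using f g unfolding fe Alg_sel(6)
      by (simp add: e) (auto simp: functor_category_def one_object_category_def intro!: restrict_ext)
  qed
qed

context
  fixes F F' :: "(nat, 'g drbg_arr, 'o, 'a) mfunc" and h :: 'a
  assumes F: "is_balanced_functor T C F" and F': "is_balanced_functor T C F'"
    and h: "h \<in> Arr C" "Dom C h = FObj F 1" "Cod C h = FObj F' 1"
begin

text \<open>The recursion is forced: compatibility with the unit comparison and with the comparison
  at \<open>(1, n)\<close> determines every component of a monoidal transformation from the one at
  1.\<close>

fun extend :: "nat \<Rightarrow> 'a" where
  "extend 0 = MUnit F' \<cdot> inverse_arrow C (MUnit F)"
| "extend (Suc n) = MTens F' (1, n) \<cdot> (h \<star> extend n) \<cdot> inverse_arrow C (MTens F (1, n))"

lemmas [simp] = FD[OF F] FD[OF F'] h h[unfolded One_nat_def]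

lemma extend_arr [simp]: "extend n \<in> Arr C" "Dom C (extend n) = FObj F n" "Cod C (extend n) = FObj F' n"
  by (induction n) auto

lemma extend_Suc: "extend (1 + n) \<cdot> MTens F (1, n) = MTens F' (1, n) \<cdot> (h \<star> extend n)"
  by simp

text \<open>The definition guarantees this only for \<open>m = 1\<close>. The general case follows
  by induction from \<open>F_assoc\<close> for both functors, after precomposition with a whiskered
  comparison that is cancelled at the end.\<close>

lemma extend_add: "extend (m + n) \<cdot> MTens F (m, n) = MTens F' (m, n) \<cdot> (extend m \<star> extend n)"
proof (induction m)
  case 0
  have "(extend n \<cdot> MTens F (0, n)) \<cdot> (MUnit F \<star> Ident C (FObj F n)) = extend n \<cdot> LUnit C (FObj F n)"
    by (simp add: F_lunit[OF F])
  also have "\<dots> = LUnit C (FObj F' n) \<cdot> (Ident C (Unit C) \<star> extend n)"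
    using lunit_nat[of "extend n"] by simp
  also have "\<dots> = (MTens F' (0, n) \<cdot> (MUnit F' \<star> Ident C (FObj F' n))) \<cdot> (Ident C (Unit C) \<star> extend n)"
    unfolding F_lunit[OF F'] ..
  also have "\<dots> = (MTens F' (0, n) \<cdot> (extend 0 \<star> extend n)) \<cdot> (MUnit F \<star> Ident C (FObj F n))"
    by (simp add: tensor_comp)
  finally show ?case by (subst (asm) iso_cancel_right) simp_all
next
  case (Suc m)
  let ?i = "\<lambda>n. Ident C (FObj F n)" and ?i' = "\<lambda>n. Ident C (FObj F' n)"
  let ?a = "Assoc C (FObj F 1) (FObj F m) (FObj F n)" and ?a' = "Assoc C (FObj F' 1) (FObj F' m) (FObj F' n)"
  have "(extend (1 + (m + n)) \<cdot> MTens F (1 + m, n)) \<cdot> (MTens F (1, m) \<star> ?i n)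
      = extend (1 + (m + n)) \<cdot> (MTens F (1 + m, n) \<cdot> (MTens F (1, m) \<star> ?i n))"
    by (subst assoc) (simp_all del: extend.simps)
  also have "\<dots> = extend (1 + (m + n)) \<cdot> MTens F (1, m + n) \<cdot> (?i 1 \<star> MTens F (m, n)) \<cdot> ?a"
    unfolding F_assoc[OF F] ..
  also have "\<dots> = (extend (1 + (m + n)) \<cdot> MTens F (1, m + n)) \<cdot> (?i 1 \<star> MTens F (m, n)) \<cdot> ?a"
    by (subst assoc) (simp_all del: extend.simps)
  also have "\<dots> = MTens F' (1, m + n) \<cdot> ((h \<star> extend (m + n)) \<cdot> (?i 1 \<star> MTens F (m, n))) \<cdot> ?a"
    unfolding extend_Suc by simp
  also have "(h \<star> extend (m + n)) \<cdot> (?i 1 \<star> MTens F (m, n)) = (?i' 1 \<star> MTens F' (m, n)) \<cdot> (h \<star> extend m \<star> extend n)"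
    by (simp add: tensor_comp Suc)
  also have "MTens F' (1, m + n) \<cdot> (\<dots>) \<cdot> ?a = MTens F' (1, m + n) \<cdot> (?i' 1 \<star> MTens F' (m, n)) \<cdot> ((h \<star> extend m \<star> extend n) \<cdot> ?a)"
    by simp
  also have "(h \<star> extend m \<star> extend n) \<cdot> ?a = ?a' \<cdot> ((h \<star> extend m) \<star> extend n)"
    using assoc_nat[of h "extend m" "extend n"] by simp
  also have "MTens F' (1, m + n) \<cdot> (?i' 1 \<star> MTens F' (m, n)) \<cdot> ?a' \<cdot> ((h \<star> extend m) \<star> extend n)
      = (MTens F' (1, m + n) \<cdot> (?i' 1 \<star> MTens F' (m, n)) \<cdot> ?a') \<cdot> ((h \<star> extend m) \<star> extend n)"
    by simp
  also have "\<dots> = (MTens F' (1 + m, n) \<cdot> (MTens F' (1, m) \<star> ?i' n)) \<cdot> ((h \<star> extend m) \<star> extend n)"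
    unfolding F_assoc[OF F'] ..
  also have "\<dots> = MTens F' (1 + m, n) \<cdot> ((MTens F' (1, m) \<cdot> (h \<star> extend m)) \<star> extend n)"
    by (simp add: tensor_comp)
  also have "\<dots> = MTens F' (1 + m, n) \<cdot> ((extend (1 + m) \<cdot> MTens F (1, m)) \<star> extend n)"
    unfolding extend_Suc ..
  also have "\<dots> = (MTens F' (1 + m, n) \<cdot> (extend (1 + m) \<star> extend n)) \<cdot> (MTens F (1, m) \<star> ?i n)"
    by (simp add: tensor_comp del: extend.simps)
  finally have "extend (1 + (m + n)) \<cdot> MTens F (1 + m, n) = MTens F' (1 + m, n) \<cdot> (extend (1 + m) \<star> extend n)"
    by (subst (asm) iso_cancel_right) (simp_all del: extend.simps)
  then show ?case by (simp del: extend.simps)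
qed

text \<open>\<open>extend 1\<close> is defined through \<open>extend 0\<close>, so it equals
  \<open>h\<close> only because both functors are compatible with the right unitor, which is natural
  at \<open>h\<close>.\<close>

lemma extend_1: "extend 1 = h"
proof -
  have "(extend (1 + 0) \<cdot> MTens F (1, 0)) \<cdot> (Ident C (FObj F 1) \<star> MUnit F)
      = MTens F' (1, 0) \<cdot> (h \<star> extend 0) \<cdot> (Ident C (FObj F 1) \<star> MUnit F)"
    unfolding extend_Suc by simp
  also have "\<dots> = (MTens F' (1, 0) \<cdot> (Ident C (FObj F' 1) \<star> MUnit F')) \<cdot> (h \<star> Ident C (Unit C))"
    by (simp add: tensor_comp)
  also have "\<dots> = h \<cdot> RUnit C (FObj F 1)"
    unfolding F_runit[OF F'] using runit_nat[of h] by simp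
  finally have "extend 1 \<cdot> (MTens F (1, 0) \<cdot> (Ident C (FObj F 1) \<star> MUnit F)) = h \<cdot> RUnit C (FObj F 1)"
    by (simp del: extend.simps)
  then have "extend 1 \<cdot> RUnit C (FObj F 1) = h \<cdot> RUnit C (FObj F 1)" unfolding F_runit[OF F] .
  then show ?thesis by (subst (asm) iso_cancel_right) (simp_all del: extend.simps)
qed

lemma extend_unique:
  assumes "is_monoidal_trans T C F F' \<alpha>" "\<alpha> 1 = h"
  shows "\<alpha> n = extend n"
proof (induction n)
  case 0
  have "\<alpha> 0 \<cdot> MUnit F = MUnit F'" using monoidal_transD(5)[OF assms(1)] by simp
  then show ?case using monoidal_transD(1-3)[OF assms(1), of 0] by (simp add: iso_move_right)
next
  case (Suc n)
  have "\<alpha> (1 + n) \<cdot> MTens F (1, n) = MTens F' (1, n) \<cdot> (h \<star> \<alpha> n)"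
    using monoidal_transD(6)[OF assms(1), of 1 n] assms(2) by simp
  then show ?case using monoidal_transD(1-3)[OF assms(1), of "Suc n"] by (simp add: iso_move_right Suc)
qed

text \<open>For tensor products, \<open>mu\<close>, \<open>eta\<close> and the braiding, the square
  is checked after precomposition with a comparison arrow, where \<open>extend_add\<close> or the
  unit case of \<open>extend\<close> applies; the comparison is then cancelled. A square at an arrow
  yields the square at its inverse.\<close>

lemma extend_natural:
  assumes hom: "is_monoid_hom C (mon F) (mon F') h"
    and act: "\<And>x. x \<in> carrier G \<Longrightarrow> h \<cdot> FArr F (gen_label x) = FArr F' (gen_label x) \<cdot> h"
    and f: "f \<in> Arr T"
  shows "extend (codom f) \<cdot> FArr F f = FArr F' f \<cdot> extend (length (omap f))"
proof -
  note e1 = extend_1[unfolded One_nat_def]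
  from f show ?thesis
  proof (induction rule: G.drbg_generated)
    case (comp f g)
    note i = G.DRBG_comp_in[OF comp(1-3)]
    have "extend (codom g) \<cdot> FArr F g \<cdot> FArr F f = (extend (codom g) \<cdot> FArr F g) \<cdot> FArr F f"
      using comp(1-3) by simp
    also have "\<dots> = FArr F' g \<cdot> (extend (codom f) \<cdot> FArr F f)" unfolding comp(5) using comp(1-3) by simp
    also have "\<dots> = FArr F' g \<cdot> FArr F' f \<cdot> extend (length (omap f))" unfolding comp(4) ..
    finally show ?case using comp(1-3) i by (simp add: F_comp[OF F] F_comp[OF F'])
  next
    case (tensor f g)
    note i = G.DRBG_tensor_in[OF tensor(1,2)]
    let ?m = "length (omap f)" and ?n = "length (omap g)"
    have "(extend (codom f + codom g) \<cdot> FArr F (drbg_tensor f g)) \<cdot> MTens F (?m, ?n)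
       = (extend (codom f + codom g) \<cdot> MTens F (codom f, codom g)) \<cdot> (FArr F f \<star> FArr F g)"
      using tensor(1,2) i F_tensor[OF F tensor(1,2)] by simp
    also have "\<dots> = MTens F' (codom f, codom g) \<cdot> ((extend (codom f) \<cdot> FArr F f) \<star> (extend (codom g) \<cdot> FArr F g))"
      unfolding extend_add using tensor(1,2) by (simp add: tensor_comp)
    also have "\<dots> = (MTens F' (codom f, codom g) \<cdot> (FArr F' f \<star> FArr F' g)) \<cdot> (extend ?m \<star> extend ?n)"
      unfolding tensor(3,4) using tensor(1,2) by (simp add: tensor_comp)
    also have "\<dots> = FArr F' (drbg_tensor f g) \<cdot> (MTens F' (?m, ?n) \<cdot> (extend ?m \<star> extend ?n))"
      unfolding F_tensor[OF F' tensor(1,2)] using tensor(1,2) i by simp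
    also have "\<dots> = (FArr F' (drbg_tensor f g) \<cdot> extend (?m + ?n)) \<cdot> MTens F (?m, ?n)"
      unfolding extend_add[symmetric] using tensor(1,2) i by simp
    finally show ?case using tensor(1,2) i by (subst (asm) iso_cancel_right) simp_all
  next
    case (inverse f g n)
    have fg: "FArr F f \<cdot> FArr F g = Ident C (FObj F n)" "FArr F' g \<cdot> FArr F' f = Ident C (FObj F' n)"
      using inverse F_comp[OF F, of g f] F_comp[OF F', of f g] by simp_all
    have "extend n \<cdot> FArr F g = (FArr F' g \<cdot> FArr F' f) \<cdot> extend n \<cdot> FArr F g"
      unfolding fg using inverse by simp
    also have "\<dots> = FArr F' g \<cdot> (FArr F' f \<cdot> extend n) \<cdot> FArr F g" using inverse by simp
    also have "FArr F' f \<cdot> extend n = extend n \<cdot> FArr F f" using inverse by simp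
    also have "FArr F' g \<cdot> (extend n \<cdot> FArr F f) \<cdot> FArr F g = FArr F' g \<cdot> extend n \<cdot> (FArr F f \<cdot> FArr F g)"
      using inverse(1-6) by simp
    finally show ?case unfolding fg using inverse by simp
  next
    case mu
    have "(h \<cdot> FArr F (gen_mu G)) \<cdot> MTens F (1, 1) = (FArr F' (gen_mu G) \<cdot> MTens F' (1, 1)) \<cdot> (h \<star> h)"
      using hom by (simp add: mon_def is_monoid_hom_def)
    also have "\<dots> = FArr F' (gen_mu G) \<cdot> (MTens F' (1, 1) \<cdot> (extend 1 \<star> extend 1))"
      by (simp add: e1 del: extend.simps)
    also have "\<dots> = (FArr F' (gen_mu G) \<cdot> extend (1 + 1)) \<cdot> MTens F (1, 1)"
      unfolding extend_add[symmetric] by (simp del: extend.simps)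
    finally have "h \<cdot> FArr F (gen_mu G) = FArr F' (gen_mu G) \<cdot> extend (1 + 1)"
      by (subst (asm) iso_cancel_right) (simp_all del: extend.simps)
    then show ?case by (simp add: e1 del: extend.simps)
  next
    case eta
    have "(h \<cdot> FArr F (gen_eta G)) \<cdot> MUnit F = FArr F' (gen_eta G) \<cdot> MUnit F'"
      using hom by (simp add: mon_def is_monoid_hom_def)
    also have "\<dots> = (FArr F' (gen_eta G) \<cdot> extend 0) \<cdot> MUnit F" by simp
    finally have "h \<cdot> FArr F (gen_eta G) = FArr F' (gen_eta G) \<cdot> extend 0"
      by (subst (asm) iso_cancel_right) (simp_all del: extend.simps)
    then show ?case by (simp add: e1 del: extend.simps)
  next
    case (label x)
    then show ?case using act by (simp add: e1 del: extend.simps)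
  next
    case twist
    show ?case using balanced_functorD(21)[OF F, of 1] balanced_functorD(21)[OF F', of 1] twist_nat[of h]
      by (simp add: e1 del: extend.simps)
  next
    case braid
    let ?b = "Braid T 1 1"
    have b: "?b \<in> Arr T"
      by (simp add: block_word_1_1 ribbon_arr_in trivial_ribbon_ribbons[OF G.group_axioms])
    have e2: "extend (Suc (Suc 0)) \<cdot> MTens F (1, 1) = MTens F' (1, 1) \<cdot> (h \<star> h)"
      using extend_add[of 1 1] by (simp add: e1 del: extend.simps)
    have "(extend (Suc (Suc 0)) \<cdot> FArr F ?b) \<cdot> MTens F (1, 1) = extend (Suc (Suc 0)) \<cdot> (FArr F ?b \<cdot> MTens F (1, 1))"
      using b by (simp del: extend.simps)
    also have "FArr F ?b \<cdot> MTens F (1, 1) = MTens F (1, 1) \<cdot> Braid C (FObj F 1) (FObj F 1)"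
      using balanced_functorD(20)[OF F, of 1 1] by simp
    also have "extend (Suc (Suc 0)) \<cdot> MTens F (1, 1) \<cdot> Braid C (FObj F 1) (FObj F 1)
        = (MTens F' (1, 1) \<cdot> (h \<star> h)) \<cdot> Braid C (FObj F 1) (FObj F 1)"
      by (rule comp_rewrite[OF e2]) (simp_all del: extend.simps)
    also have "\<dots> = (MTens F' (1, 1) \<cdot> Braid C (FObj F' 1) (FObj F' 1)) \<cdot> (h \<star> h)"
      using braid_nat[of h h] by simp
    also have "MTens F' (1, 1) \<cdot> Braid C (FObj F' 1) (FObj F' 1) = FArr F' ?b \<cdot> MTens F' (1, 1)"
      using balanced_functorD(20)[OF F', of 1 1] by simp
    also have "(FArr F' ?b \<cdot> MTens F' (1, 1)) \<cdot> (h \<star> h) = FArr F' ?b \<cdot> (MTens F' (1, 1) \<cdot> (h \<star> h))"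
      using b by simp
    also have "\<dots> = (FArr F' ?b \<cdot> extend (Suc (Suc 0))) \<cdot> MTens F (1, 1)"
      unfolding e2[symmetric] using b by (simp del: extend.simps)
    finally have "extend (Suc (Suc 0)) \<cdot> FArr F ?b = FArr F' ?b \<cdot> extend (Suc (Suc 0))"
      using b by (subst (asm) iso_cancel_right) (simp_all del: extend.simps)
    then show ?case by (simp del: extend.simps)
  qed (simp del: extend.simps)
qed

end

text \<open>Injectivity is \<open>extend_unique\<close>. For surjectivity, a morphism of monoids
  commuting with the action is extended by \<open>extend\<close>, which is natural by
  \<open>extend_natural\<close> and monoidal by \<open>extend_add\<close>.\<close>

lemma eval_fully_faithful: "fully_faithful Alg_T (GMon G C) eval_functor"
  unfolding fully_faithful_def
proof (intro conjI ballI eval_is_functor)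
  fix F F' assume "F \<in> Obj Alg_T" "F' \<in> Obj Alg_T"
  then have F: "is_balanced_functor T C F" "is_balanced_functor T C F'" by (simp_all add: Alg_sel)
  note [simp] = FD[OF F(1)] FD[OF F(2)]
  have e: "FArr eval_functor (F, \<alpha>, F') = (gmon F, (\<lambda>_\<in>{()}. (mon F, \<alpha> 1, mon F')), gmon F')"
    if "is_monoidal_trans T C F F' \<alpha>" for \<alpha>
    using F that by (simp add: eval_functor_def Alg_sel)
  have o: "FObj eval_functor F = gmon F" "FObj eval_functor F' = gmon F'"
    using F by (simp_all add: eval_functor_def Alg_sel)
  have inj: "inj_on (FArr eval_functor) (Hom Alg_T F F')"
  proof (rule inj_onI)
    fix f g assume f: "f \<in> Hom Alg_T F F'" and g: "g \<in> Hom Alg_T F F'" and eq: "FArr eval_functor f = FArr eval_functor g"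
    obtain \<alpha> \<beta> where [simp]: "f = (F, \<alpha>, F')" "g = (F, \<beta>, F')"
      and t: "is_monoidal_trans T C F F' \<alpha>" "is_monoidal_trans T C F F' \<beta>"
      using f g by (cases f, cases g) (auto simp: in_Hom Alg_sel)
    have "(\<lambda>_\<in>{()}. (mon F, \<alpha> 1, mon F')) () = (\<lambda>_\<in>{()}. (mon F, \<beta> 1, mon F')) ()"
      using eq e[OF t(1)] e[OF t(2)] by simp
    then have 1: "\<alpha> 1 = \<beta> 1" by simp
    have d: "\<beta> 1 \<in> Arr C" "Dom C (\<beta> 1) = FObj F 1" "Cod C (\<beta> 1) = FObj F' 1"
      using monoidal_transD(1-3)[OF t(2)] by auto
    have "\<alpha> n = \<beta> n" for n
      by (rule HOL.trans[OF extend_unique[OF F d t(1) 1] extend_unique[OF F d t(2) HOL.refl, symmetric]])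
    then show "f = g" by auto
  qed
  have "FArr eval_functor ` Hom Alg_T F F' = Hom (GMon G C) (gmon F) (gmon F')"
  proof (intro equalityI subsetI)
    fix f assume "f \<in> FArr eval_functor ` Hom Alg_T F F'"
    then show "f \<in> Hom (GMon G C) (gmon F) (gmon F')"
      using eval_is_functor F o unfolding is_functor_def by (auto simp: in_Hom)
  next
    fix f assume "f \<in> Hom (GMon G C) (gmon F) (gmon F')"
    then obtain \<beta> where f: "f = (gmon F, \<beta>, gmon F')" and \<beta>: "is_nat_trans (one_object_category G) (Mon C) (gmon F) (gmon F') \<beta>"
      by (auto simp: in_Hom functor_category_def)
    have b: "\<beta> () \<in> Arr (Mon C)" "Dom (Mon C) (\<beta> ()) = mon F" "Cod (Mon C) (\<beta> ()) = mon F'"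
      using \<beta> by (auto simp: is_nat_trans_def in_Hom one_object_category_def gmon_def)
    then obtain h where bh: "\<beta> () = (mon F, h, mon F')" and hom: "is_monoid_hom C (mon F) (mon F') h"
      by (cases "\<beta> ()") auto
    have \<beta>_eq: "\<beta> = (\<lambda>_\<in>{()}. (mon F, h, mon F'))"
      using bh \<beta> by (intro extensionalityI[of \<beta> "{()}"]) (auto simp: is_nat_trans_def one_object_category_def)
    have h: "h \<in> Arr C" "Dom C h = FObj F 1" "Cod C h = FObj F' 1"
      using hom by (auto simp: mon_def is_monoid_hom_def in_Hom)
    have act: "h \<cdot> FArr F (gen_label x) = FArr F' (gen_label x) \<cdot> h" if "x \<in> carrier G" for x
      using \<beta> that bh by (auto simp: is_nat_trans_def one_object_category_def gmon_def)
    let ?\<alpha> = "extend F F' h"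
    note earr = extend_arr[OF F h]
    have "?\<alpha> 0 \<cdot> MUnit F = MUnit F'" by (simp add: extend.simps[OF F h])
    then have t: "is_monoidal_trans T C F F' ?\<alpha>"
      unfolding is_monoidal_trans_def is_nat_trans_def in_Hom
      using earr extend_natural[OF F h hom act] extend_add[OF F h] by simp
    have "FArr eval_functor (F, ?\<alpha>, F') = f"
      unfolding e[OF t] f \<beta>_eq extend_1[OF F h] ..
    moreover have "(F, ?\<alpha>, F') \<in> Hom Alg_T F F'" using F t by (simp add: in_Hom Alg_sel)
    ultimately show "f \<in> FArr eval_functor ` Hom Alg_T F F'" by blast
  qed
  then show "bij_betw (FArr eval_functor) (Hom Alg_T F F') (Hom (GMon G C) (FObj eval_functor F) (FObj eval_functor F'))"
    using inj o by (simp add: bij_betw_def)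
qed

end

section \<open>From monoids with a group action to algebras\<close>

context pro_monoid
begin

lemma iter_2: "iter (Suc (Suc 0)) = mu"
  using mu_unit(1) by (simp add: numeral_2_eq_2)

lemma pro_map_mu: "pro_map (gen_mu G) = mu"
proof -
  have "om [0, 0] (Suc 0) = mu"
    using iter_2 by (simp add: om_def fibre_sizes_def del: iter.simps)
  moreover have "pro_map (gen_mu G) = om [0, 0] (Suc 0) \<cdot> ev1 2 (braid_rep (braid_class 2 [])) \<cdot> tens (replicate 2 (twist_pow 0))"
    unfolding pro_map_def gen_mu_def drbg_arr.simps decor_trivial by (simp add: trivial_ribbon_def numeral_2_eq_2)
  ultimately show ?thesis by simp
qed

lemma pro_map_eta: "pro_map (gen_eta G) = eta"
proof -
  have "om [] (Suc 0) = eta"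
    by (simp add: om_def fibre_sizes_def)
  moreover have "pro_map (gen_eta G) = om [] (Suc 0) \<cdot> ev1 0 (braid_rep (braid_class 0 [])) \<cdot> tens (replicate 0 (twist_pow 0))"
    unfolding pro_map_def gen_eta_def drbg_arr.simps decor_trivial by (simp add: trivial_ribbon_def)
  ultimately show ?thesis by simp
qed

lemma pro_map_label:
  assumes "x \<in> carrier G"
  shows "pro_map (gen_label x) = rho x"
proof -
  have "pro_map (gen_label x) = om [0..<1] 1 \<cdot> ev1 1 (braid_rep (braid_class 1 [])) \<cdot> tens (decor (flat_ribbon [x] [0]))"
    by (simp add: pro_map_def gen_label_def ribbon_arr_def) (simp add: flat_ribbon_def)
  also have "decor (flat_ribbon [x] [0]) = [rho x]"
    using assms by (simp add: decor_def flat_ribbon_def)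
  finally show ?thesis unfolding om_ident using assms by simp
qed

end

text \<open>The monoid is carried by \<open>pow 1\<close> and not by \<open>A\<close>, so that its
  structure arrows lie between powers and belong to the strict category of powers.\<close>

locale monoid_realization = balanced_powers C A + G: group G
  for C :: "('o, 'a, 'm) balcat_scheme" (structure) and A and G :: "('g, 'n) monoid_scheme" +
  fixes m e :: 'a and rho :: "'g \<Rightarrow> 'a"
  assumes monoid: "is_monoid_in C (pow 1, m, e)"
    and rho_hom: "x \<in> carrier G \<Longrightarrow> is_monoid_hom C (pow 1, m, e) (pow 1, m, e) (rho x)"
    and rho_mult: "x \<in> carrier G \<Longrightarrow> y \<in> carrier G \<Longrightarrow> rho (x \<otimes>\<^bsub>G\<^esub> y) = rho x \<cdot> rho y"
    and rho_one: "rho \<one>\<^bsub>G\<^esub> = Ident C (pow 1)"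
begin

declare pow.simps(2) [simp del] phi.simps [simp del]

lemmas m_facts = monoid_inD[OF monoid]
lemmas [simp] = m_facts(2-7) m_facts(2-7)[unfolded One_nat_def]

lemma rho_facts [simp]:
  "x \<in> carrier G \<Longrightarrow> rho x \<in> Arr C" "x \<in> carrier G \<Longrightarrow> Dom C (rho x) = pow 1" "x \<in> carrier G \<Longrightarrow> Cod C (rho x) = pow 1"
  using monoid_homD[OF rho_hom] by auto

text \<open>A multiplication in the strict category starts at \<open>pow 2\<close>, hence the
  inverse of \<open>phi 1 1\<close>. Its associativity is that of \<open>m\<close>, because the two
  comparisons of the threefold product differ by the associator.\<close>

lemma pro_monoid: "pro_monoid power_pro G (2, m \<cdot> inverse_arrow C (phi 1 1), 1) (0, e, 1) (\<lambda>x. (1, rho x, 1))"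
proof -
  interpret S: balanced_pro power_pro by (rule balanced_pro_power_pro)
  let ?i = "Ident C (pow 1)"
  let ?p = "inverse_arrow C (phi 1 1)"
  have l: "transport (1 + 1) 1 1 1 ((m \<cdot> ?p) \<star> ?i) = phi 1 1 \<cdot> (m \<star> ?i) \<cdot> inverse_arrow C (left3 1 1 1)"
  proof -
    have "(m \<cdot> ?p) \<star> ?i = (m \<star> ?i) \<cdot> (?p \<star> ?i)" by (simp add: tensor_comp)
    then show ?thesis by (simp add: transport_def left3_def inverse_comp)
  qed
  have r: "transport 1 (1 + 1) 1 1 (?i \<star> (m \<cdot> ?p)) = phi 1 1 \<cdot> (?i \<star> m) \<cdot> inverse_arrow C (right3 1 1 1)"
  proof -
    have "?i \<star> (m \<cdot> ?p) = (?i \<star> m) \<cdot> (?i \<star> ?p)" by (simp add: tensor_comp)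
    then show ?thesis by (simp add: transport_def right3_def inverse_comp)
  qed
  have assoc1: "(m \<cdot> ?p) \<cdot> transport (1 + 1) 1 1 1 ((m \<cdot> ?p) \<star> ?i) = (m \<cdot> ?p) \<cdot> transport 1 (1 + 1) 1 1 (?i \<star> (m \<cdot> ?p))"
  proof -
    have "(m \<cdot> ?p) \<cdot> transport (1 + 1) 1 1 1 ((m \<cdot> ?p) \<star> ?i) = (m \<cdot> (m \<star> ?i)) \<cdot> inverse_arrow C (left3 1 1 1)"
      unfolding l by simp
    also have "\<dots> = (m \<cdot> ?p) \<cdot> transport 1 (1 + 1) 1 1 (?i \<star> (m \<cdot> ?p))"
      unfolding r inverse_left3 m_facts(8) by simp
    finally show ?thesis .
  qed
  have unit1: "(m \<cdot> ?p) \<cdot> transport 0 1 1 1 (e \<star> ?i) = ?i"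
  proof -
    have "(m \<cdot> ?p) \<cdot> transport 0 1 1 1 (e \<star> ?i) = (m \<cdot> (e \<star> ?i)) \<cdot> inverse_arrow C (LUnit C (pow 1))"
      by (simp add: transport_def phi.simps(1))
    then show ?thesis unfolding m_facts(9) by simp
  qed
  have unit2: "(m \<cdot> ?p) \<cdot> transport 1 0 1 1 (?i \<star> e) = ?i"
  proof -
    have "(m \<cdot> ?p) \<cdot> transport 1 0 1 1 (?i \<star> e) = (m \<cdot> (?i \<star> e)) \<cdot> inverse_arrow C (RUnit C (pow 1))"
      by (simp add: transport_def phi_0)
    then show ?thesis unfolding m_facts(10) by simp
  qed
  have act: "rho x \<cdot> m \<cdot> ?p = (m \<cdot> ?p) \<cdot> transport 1 1 1 1 (rho x \<star> rho x)" if "x \<in> carrier G" for x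
  proof -
    have "(rho x \<cdot> m) \<cdot> ?p = (m \<cdot> (rho x \<star> rho x)) \<cdot> ?p" using monoid_homD(4)[OF rho_hom[OF that]] by simp
    then show ?thesis using that by (simp add: transport_def)
  qed
  show ?thesis
  proof
    show "(2, m \<cdot> ?p, 1) \<cdot>\<^bsub>power_pro\<^esub> ((2, m \<cdot> ?p, 1) \<star>\<^bsub>power_pro\<^esub> Ident power_pro 1) =
       (2, m \<cdot> ?p, 1) \<cdot>\<^bsub>power_pro\<^esub> (Ident power_pro 1 \<star>\<^bsub>power_pro\<^esub> (2, m \<cdot> ?p, 1))"
      using assoc1 by (simp add: numeral_2_eq_2 del: transport_arr)
    show "(2, m \<cdot> ?p, 1) \<cdot>\<^bsub>power_pro\<^esub> ((0, e, 1) \<star>\<^bsub>power_pro\<^esub> Ident power_pro 1) = Ident power_pro 1"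
      "(2, m \<cdot> ?p, 1) \<cdot>\<^bsub>power_pro\<^esub> (Ident power_pro 1 \<star>\<^bsub>power_pro\<^esub> (0, e, 1)) = Ident power_pro 1"
      using unit1 unit2 by simp_all
  next
    fix x assume x: "x \<in> carrier G"
    show "(1, rho x, 1) \<cdot>\<^bsub>power_pro\<^esub> (2, m \<cdot> ?p, 1) = (2, m \<cdot> ?p, 1) \<cdot>\<^bsub>power_pro\<^esub> ((1, rho x, 1) \<star>\<^bsub>power_pro\<^esub> (1, rho x, 1))"
      using act[OF x] x by (simp add: numeral_2_eq_2)
    show "(1, rho x, 1) \<cdot>\<^bsub>power_pro\<^esub> (0, e, 1) = (0, e, 1)"
      using monoid_homD(5)[OF rho_hom[OF x]] by simp
  qed (use rho_one rho_mult in \<open>auto simp: numeral_2_eq_2\<close>)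
qed

sublocale S: pro_monoid power_pro G "(2, m \<cdot> inverse_arrow C (phi 1 1), 1)" "(0, e, 1)" "\<lambda>x. (1, rho x, 1)"
  by (rule pro_monoid)

definition under :: "'g drbg_arr \<Rightarrow> 'a" where
  "under f = fst (snd (S.pro_map f))"

text \<open>The strict category serves to define the arrows. Read in \<open>C\<close> again, with
  \<open>phi\<close> as comparison arrows, they form a functor that preserves the monoidal structure
  up to coherent isomorphism.\<close>

definition realize :: "(nat, 'g drbg_arr, 'o, 'a) mfunc" where
  "realize = \<lparr>FObj = pow, FArr = (\<lambda>f\<in>Arr (DRBG G). under f), MUnit = Ident C (Unit C), MTens = (\<lambda>(m, n). phi m n)\<rparr>"

lemma pro_map_under: "f \<in> Arr (DRBG G) \<Longrightarrow> S.pro_map f = (length (omap f), under f, codom f)"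
  using S.pro_map_arr[of f] unfolding under_def by (cases "S.pro_map f") auto

lemma under_arr [simp]:
  assumes "f \<in> Arr (DRBG G)"
  shows "under f \<in> Arr C" "Dom C (under f) = pow (length (omap f))" "Cod C (under f) = pow (codom f)"
  using S.pro_map_arr(1)[OF assms] pro_map_under[OF assms] by auto

lemma realize_balanced: "is_balanced_functor (DRBG G) C realize"
proof -
  have id: "under (drbg_ident G n) = Ident C (pow n)" for n
    using S.pro_map_ident[of n] by (simp add: under_def)
  have comp: "under (drbg_comp G g f) = under g \<cdot> under f"
    if "f \<in> Arr (DRBG G)" "g \<in> Arr (DRBG G)" "codom f = length (omap g)" for f g
    unfolding under_def[of "drbg_comp G g f"] S.pro_map_comp[OF that] pro_map_under[OF that(1)] pro_map_under[OF that(2)]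
    by simp
  have tensor: "under (drbg_tensor f g) \<cdot> phi (length (omap f)) (length (omap g)) = phi (codom f) (codom g) \<cdot> (under f \<star> under g)"
    if "f \<in> Arr (DRBG G)" "g \<in> Arr (DRBG G)" for f g
    unfolding under_def[of "drbg_tensor f g"] S.pro_map_tensor[OF that] pro_map_under[OF that(1)] pro_map_under[OF that(2)]
    using that by (simp add: transport_def)
  have braid: "under (ribbon_arr (k + n) (trivial_ribbon G (k + n) 0 (block_word k n))) \<cdot> phi k n = phi n k \<cdot> Braid C (pow k) (pow n)" for k n
    using S.pro_map_braid[of k n] by (simp add: under_def pbraid_def transport_def)
  have twist: "under (ribbon_arr n (trivial_ribbon G n 1 (full_twist_word n))) = Twist C (pow n)" for n
    using S.pro_map_twist[of n] by (simp add: under_def)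
  have in_b: "ribbon_arr (k + n) (trivial_ribbon G (k + n) 0 (block_word k n)) \<in> Arr (DRBG G)" for k n
    by (intro ribbon_arr_in trivial_ribbon_ribbons G.group_axioms) simp
  have in_t: "ribbon_arr n (trivial_ribbon G n 1 (full_twist_word n)) \<in> Arr (DRBG G)" for n
    by (intro ribbon_arr_in trivial_ribbon_ribbons G.group_axioms) simp
  show ?thesis
    unfolding is_balanced_functor_def is_functor_def in_Hom realize_def
    using G.DRBG_comp_in G.DRBG_tensor_in
    by (simp add: id comp tensor braid twist[unfolded One_nat_def] in_b in_t[unfolded One_nat_def] phi_assoc phi_0 phi.simps(1) extensional_def PiE_def Pi_def add.assoc)
qed

lemma realize_gen:
  "FArr realize (gen_mu G) \<cdot> MTens realize (1, 1) = m" "FArr realize (gen_eta G) \<cdot> MUnit realize = e"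
  "x \<in> carrier G \<Longrightarrow> FArr realize (gen_label x) = rho x"
  using S.pro_map_mu S.pro_map_eta S.pro_map_label by (simp_all add: realize_def under_def)

end

section \<open>Essential surjectivity of evaluation\<close>

lemma iso_functor_category:
  assumes "category C" "category D" "is_functor C D F" "is_functor C D F'" "is_nat_trans C D F F' \<alpha>"
    and iso: "\<And>a. a \<in> Obj C \<Longrightarrow> iso_arrow D (\<alpha> a)"
  shows "iso_arrow (functor_category C D) (F, \<alpha>, F')"
proof -
  interpret C: category C by fact
  interpret D: category D by fact
  note [simp] = C.is_functorD[OF assms(3)] C.is_functorD[OF assms(4)] iso
  have a [simp]: "\<alpha> a \<in> Arr D" "Dom D (\<alpha> a) = FObj F a" "Cod D (\<alpha> a) = FObj F' a" if "a \<in> Obj C" for a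
    using assms(5) that unfolding is_nat_trans_def in_Hom by auto
  let ?\<beta> = "\<lambda>a\<in>Obj C. inverse_arrow D (\<alpha> a)"
  have "?\<beta> (Cod C f) \<cdot>\<^bsub>D\<^esub> FArr F' f = FArr F f \<cdot>\<^bsub>D\<^esub> ?\<beta> (Dom C f)" if f: "f \<in> Arr C" for f
  proof -
    have "\<alpha> (Cod C f) \<cdot>\<^bsub>D\<^esub> FArr F f = FArr F' f \<cdot>\<^bsub>D\<^esub> \<alpha> (Dom C f)"
      using assms(5) f unfolding is_nat_trans_def by auto
    then have "inverse_arrow D (\<alpha> (Cod C f)) \<cdot>\<^bsub>D\<^esub> (\<alpha> (Cod C f) \<cdot>\<^bsub>D\<^esub> FArr F f) \<cdot>\<^bsub>D\<^esub> inverse_arrow D (\<alpha> (Dom C f))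
      = inverse_arrow D (\<alpha> (Cod C f)) \<cdot>\<^bsub>D\<^esub> (FArr F' f \<cdot>\<^bsub>D\<^esub> \<alpha> (Dom C f)) \<cdot>\<^bsub>D\<^esub> inverse_arrow D (\<alpha> (Dom C f))"
      by simp
    then show ?thesis using f by simp
  qed
  then have "is_nat_trans C D F' F ?\<beta>"
    unfolding is_nat_trans_def in_Hom by simp
  then have "inverse_arrows (functor_category C D) (F, \<alpha>, F') (F', ?\<beta>, F)"
    using assms unfolding inverse_arrows_def in_Hom by (auto simp: functor_category_def intro!: restrict_ext)
  then show ?thesis unfolding iso_arrow_def by blast
qed

lemma (in monoidal_category) iso_Mon:
  assumes h: "is_monoid_hom C M M' f" and M: "is_monoid_in C M" "is_monoid_in C M'" and f: "iso_arrow C f"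
  shows "iso_arrow (Mon C) (M, f, M')"
proof -
  obtain A \<mu> \<eta> A' \<mu>' \<eta>' where e: "M = (A, \<mu>, \<eta>)" "M' = (A', \<mu>', \<eta>')" by (metis prod_cases3)
  note [simp] = monoid_inD(1-7)[OF M(1)[unfolded e]] monoid_inD(1-7)[OF M(2)[unfolded e]] monoid_homD(1-3)[OF h[unfolded e]] f
  note fh = monoid_homD(4-5)[OF h[unfolded e]]
  let ?g = "inverse_arrow C f"
  have "?g \<cdot> \<mu>' = ?g \<cdot> (\<mu>' \<cdot> (f \<star> f)) \<cdot> (?g \<star> ?g)" by (simp add: tensor_comp)
  also have "\<dots> = \<mu> \<cdot> (?g \<star> ?g)" unfolding fh(1)[symmetric] by simp
  finally have 1: "?g \<cdot> \<mu>' = \<mu> \<cdot> (?g \<star> ?g)" .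
  have 2: "?g \<cdot> \<eta>' = \<eta>" unfolding fh(2)[symmetric] by simp
  have "is_monoid_hom C M' M ?g" using 1 2 unfolding is_monoid_hom_def e in_Hom by simp
  then have "inverse_arrows (Mon C) (M, f, M') (M', ?g, M)"
    using h M unfolding inverse_arrows_def in_Hom by (simp add: e)
  then show ?thesis unfolding iso_arrow_def by blast
qed

context algebra_base
begin

text \<open>The realization itself is exported, and not merely some algebra, because for a strict
  target it has to be recognized as a strict functor.\<close>

lemma realize_essentially_surjective:
  assumes P: "is_functor (one_object_category G) (Mon C) P"
  obtains A m e rho where "monoid_realization C A G m e rho"
    "\<exists>f\<in>Hom (GMon G C) (gmon (monoid_realization.realize C A G m e rho)) P. iso_arrow (GMon G C) f"
proof -
  obtain A \<mu> \<eta> where Pob: "FObj P () = (A, \<mu>, \<eta>)" by (metis prod_cases3)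
  interpret O: category "one_object_category G" by (rule G.category_one_object)
  note PD = O.is_functorD[OF P, unfolded one_object_category_def cat.simps]
  have M: "is_monoid_in C (A, \<mu>, \<eta>)" using PD(1) Pob by auto
  define rho where "rho x = fst (snd (FArr P x))" for x
  have Parr: "FArr P x = ((A, \<mu>, \<eta>), rho x, (A, \<mu>, \<eta>))" if "x \<in> carrier G" for x
    using PD(2-4)[of x] that Pob by (cases "FArr P x") (auto simp: rho_def)
  have rh: "is_monoid_hom C (A, \<mu>, \<eta>) (A, \<mu>, \<eta>) (rho x)" if "x \<in> carrier G" for x
    using PD(2)[of x] Parr[OF that] that by simp
  note d [simp] = monoid_inD(1-7)[OF M]
  note rd [simp] = monoid_homD(1-3)[OF rh]
  have rmult: "rho (x \<otimes>\<^bsub>G\<^esub> y) = rho x \<cdot> rho y" if "x \<in> carrier G" "y \<in> carrier G" for x y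
    using PD(6)[of y x] that Parr by simp
  have rone: "rho \<one>\<^bsub>G\<^esub> = Ident C A" using PD(5) Parr[of "\<one>\<^bsub>G\<^esub>"] Pob by simp
  interpret B: balanced_powers C A by unfold_locales simp
  \<comment> \<open>The right unitor leads from \<open>pow 1\<close> to \<open>A\<close>. The monoid
    and the action are pulled back along it, and it is also the component of the final isomorphism
    onto \<open>P\<close>.\<close>
  let ?r = "RUnit C A" and ?s = "inverse_arrow C (RUnit C A)"
  have p1: "B.pow 1 = A \<diamondop> Unit C" by simp
  define m where "m = ?s \<cdot> \<mu> \<cdot> (?r \<star> ?r)"
  define e where "e = ?s \<cdot> \<eta>"
  have mon: "is_monoid_in C (B.pow 1, m, e)"
    unfolding m_def e_def by (rule monoid_transport[OF M]) simp_all
  have arrs: "m \<in> Arr C" "Dom C m = (A \<diamondop> Unit C) \<diamondop> (A \<diamondop> Unit C)" "Cod C m = A \<diamondop> Unit C"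
    "e \<in> Arr C" "Dom C e = Unit C" "Cod C e = A \<diamondop> Unit C"
    by (simp_all add: m_def e_def)
  define sg where "sg x = ?s \<cdot> rho x \<cdot> ?r" for x
  have sg: "sg x \<in> Arr C" "Dom C (sg x) = A \<diamondop> Unit C" "Cod C (sg x) = A \<diamondop> Unit C" "?r \<cdot> sg x = rho x \<cdot> ?r" if "x \<in> carrier G" for x
    using that by (simp_all add: sg_def)
  have rm: "?r \<cdot> m = \<mu> \<cdot> (?r \<star> ?r)" and re: "?r \<cdot> e = \<eta>" by (simp_all add: m_def e_def)
  interpret R: monoid_realization C A G m e sg
  proof
    show "is_monoid_in C (B.pow 1, m, e)" by (rule mon)
    fix x assume x: "x \<in> carrier G"
    have "?r \<cdot> sg x \<cdot> m = (?r \<cdot> sg x) \<cdot> m" using x sg(1-3) arrs by simp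
    also have "\<dots> = rho x \<cdot> (?r \<cdot> m)" using x sg arrs by simp
    also have "\<dots> = (rho x \<cdot> \<mu>) \<cdot> (?r \<star> ?r)" unfolding rm using x by simp
    also have "\<dots> = \<mu> \<cdot> ((?r \<cdot> sg x) \<star> (?r \<cdot> sg x))"
      using x monoid_homD(4)[OF rh[OF x]] sg[OF x] by (simp add: tensor_comp)
    also have "\<dots> = (\<mu> \<cdot> (?r \<star> ?r)) \<cdot> (sg x \<star> sg x)" using x sg by (simp add: tensor_comp)
    also have "\<dots> = ?r \<cdot> m \<cdot> (sg x \<star> sg x)" unfolding rm[symmetric] using x sg arrs by simp
    finally have 1: "sg x \<cdot> m = m \<cdot> (sg x \<star> sg x)"
      using x sg arrs by (subst (asm) iso_cancel_left) simp_all
    have "sg x \<cdot> e = ?s \<cdot> (rho x \<cdot> (?r \<cdot> e))" using x by (simp add: sg_def e_def)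
    also have "\<dots> = e" unfolding re e_def using monoid_homD(5)[OF rh[OF x]] by simp
    finally show "is_monoid_hom C (B.pow 1, m, e) (B.pow 1, m, e) (sg x)"
      using 1 sg[OF x] unfolding is_monoid_hom_def in_Hom p1 by simp
    fix y assume y: "y \<in> carrier G"
    show "sg (x \<otimes>\<^bsub>G\<^esub> y) = sg x \<cdot> sg y" using x y by (simp add: sg_def rmult)
  next
    show "sg \<one>\<^bsub>G\<^esub> = Ident C (B.pow 1)" by (simp add: sg_def rone)
  qed
  note F = R.realize_balanced
  have monF: "mon R.realize = (A \<diamondop> Unit C, m, e)"
    using R.realize_gen(1,2) p1 by (simp add: mon_def) (simp add: R.realize_def)
  have gF: "FObj (gmon R.realize) () = (A \<diamondop> Unit C, m, e)"
    "FArr (gmon R.realize) x = ((A \<diamondop> Unit C, m, e), sg x, (A \<diamondop> Unit C, m, e))" if "x \<in> carrier G" for x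
    using that R.realize_gen(3) by (simp_all add: gmon_def monF)
  have hom: "is_monoid_hom C (A \<diamondop> Unit C, m, e) (A, \<mu>, \<eta>) ?r"
    using rm re arrs unfolding is_monoid_hom_def in_Hom by simp
  have mon': "is_monoid_in C (A \<diamondop> Unit C, m, e)" using mon unfolding p1 .
  let ?\<alpha> = "\<lambda>_\<in>{()}. ((A \<diamondop> Unit C, m, e), ?r, (A, \<mu>, \<eta>))"
  have nt: "is_nat_trans (one_object_category G) (Mon C) (gmon R.realize) P ?\<alpha>"
    using hom mon' M sg(4) gF Parr Pob unfolding is_nat_trans_def in_Hom one_object_category_def
    by (auto simp: gmon_def monF)
  have "iso_arrow (GMon G C) (gmon R.realize, ?\<alpha>, P)"
  proof (rule iso_functor_category[OF G.category_one_object category_Mon gmon_functor[OF F] P nt])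
    fix a show "iso_arrow (Mon C) (?\<alpha> a)" using iso_Mon[OF hom mon' M] by simp
  qed
  moreover have "(gmon R.realize, ?\<alpha>, P) \<in> Hom (GMon G C) (gmon R.realize) P"
    using nt P gmon_functor[OF F] by (simp add: in_Hom functor_category_def)
  ultimately show thesis using that R.monoid_realization_axioms by blast
qed

lemma eval_weak_equivalence: "weak_equivalence Alg_T (GMon G C) eval_functor"
  unfolding weak_equivalence_def
proof (intro conjI ballI eval_fully_faithful)
  fix P assume "P \<in> Obj (GMon G C)"
  then have "is_functor (one_object_category G) (Mon C) P" by (simp add: functor_category_def)
  then show "\<exists>F\<in>Obj Alg_T. \<exists>f\<in>Hom (GMon G C) (FObj eval_functor F) P. iso_arrow (GMon G C) f"
  proof (rule realize_essentially_surjective)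
    fix A m e rho assume R: "monoid_realization C A G m e rho"
      and f: "\<exists>f\<in>Hom (GMon G C) (gmon (monoid_realization.realize C A G m e rho)) P. iso_arrow (GMon G C) f"
    have "monoid_realization.realize C A G m e rho \<in> Obj Alg_T"
      using monoid_realization.realize_balanced[OF R] by (simp add: Alg_sel)
    then show ?thesis using f by (intro bexI[of _ "monoid_realization.realize C A G m e rho"]) (simp_all add: eval_functor_def)
  qed
qed

end

section \<open>Strict algebras\<close>

text \<open>Identities have the source and target required of comparison arrows because a strict
  functor preserves the unit and the tensor product of objects on the nose.\<close>

definition weaken ::
  "('u, 'v, 'w) balcat_scheme \<Rightarrow> ('o, 'a, 'm) balcat_scheme \<Rightarrow> ('u, 'v, 'o, 'a) func \<Rightarrow> ('u, 'v, 'o, 'a) mfunc" where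
  "weaken T C F = \<lparr>FObj = FObj F, FArr = FArr F, MUnit = Ident C (Unit C),
     MTens = (\<lambda>(a, b)\<in>Obj T \<times> Obj T. Ident C (FObj F a \<diamondop>\<^bsub>C\<^esub> FObj F b))\<rparr>"

definition weaken_functor where
  "weaken_functor T C = \<lparr>FObj = (\<lambda>F\<in>Obj (Alg_strict T C). weaken T C F),
     FArr = restrict (\<lambda>(F, \<alpha>, F'). (weaken T C F, \<alpha>, weaken T C F')) (Arr (Alg_strict T C))\<rparr>"

lemma weaken_sel [simp]:
  "FObj (weaken T C F) = FObj F" "FArr (weaken T C F) = FArr F" "MUnit (weaken T C F) = Ident C (Unit C)"
  by (simp_all add: weaken_def)

lemma Alg_strict_sel:
  "F \<in> Obj (Alg_strict T C) \<longleftrightarrow> is_strict_balanced_functor T C F"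
  "(F, \<alpha>, F') \<in> Arr (Alg_strict T C) \<longleftrightarrow>
     is_strict_balanced_functor T C F \<and> is_strict_balanced_functor T C F' \<and> is_strict_monoidal_trans T C F F' \<alpha>"
  "Dom (Alg_strict T C) (F, \<alpha>, F') = F" "Cod (Alg_strict T C) (F, \<alpha>, F') = F'"
  "Ident (Alg_strict T C) F = (F, (\<lambda>a\<in>Obj T. Ident C (FObj F a)), F)"
  "(N, \<beta>, N') \<cdot>\<^bsub>Alg_strict T C\<^esub> (F, \<alpha>, F') = (F, (\<lambda>a\<in>Obj T. \<beta> a \<cdot>\<^bsub>C\<^esub> \<alpha> a), N')"
  by (auto simp: Alg_strict_def)

locale strict_balanced_category = balanced_category C
  for C :: "('o, 'a, 'm) balcat_scheme" (structure) +
  assumes strict: "strict_monoidal C"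
begin

lemma strictD:
  "\<lbrakk>a \<in> Obj C; b \<in> Obj C; c \<in> Obj C\<rbrakk> \<Longrightarrow> (a \<diamondop> b) \<diamondop> c = a \<diamondop> b \<diamondop> c"
  "\<lbrakk>a \<in> Obj C; b \<in> Obj C; c \<in> Obj C\<rbrakk> \<Longrightarrow> Assoc C a b c = Ident C (a \<diamondop> b \<diamondop> c)"
  "a \<in> Obj C \<Longrightarrow> Unit C \<diamondop> a = a" "a \<in> Obj C \<Longrightarrow> LUnit C a = Ident C a"
  "a \<in> Obj C \<Longrightarrow> a \<diamondop> Unit C = a" "a \<in> Obj C \<Longrightarrow> RUnit C a = Ident C a"
  using strict unfolding strict_monoidal_def by auto

context
  fixes T :: "('u, 'v, 'w) balcat_scheme"
  assumes T: "Obj T = UNIV"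
begin

lemma weaken_MTens [simp]: "MTens (weaken T C F) (a, b) = Ident C (FObj F a \<diamondop> FObj F b)"
  by (simp add: weaken_def T)

lemma strict_balanced_functorD:
  assumes F: "is_strict_balanced_functor T C F"
  shows "is_functor T C F" "FObj F a \<in> Obj C"
    "f \<in> Arr T \<Longrightarrow> FArr F f \<in> Arr C" "f \<in> Arr T \<Longrightarrow> Dom C (FArr F f) = FObj F (Dom T f)"
    "f \<in> Arr T \<Longrightarrow> Cod C (FArr F f) = FObj F (Cod T f)"
    "FObj F (Unit T) = Unit C" "FObj F (a \<diamondop>\<^bsub>T\<^esub> b) = FObj F a \<diamondop> FObj F b"
    "f \<in> Arr T \<Longrightarrow> g \<in> Arr T \<Longrightarrow> FArr F (f \<star>\<^bsub>T\<^esub> g) = FArr F f \<star> FArr F g"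
    "FArr F (Assoc T a b c) = Assoc C (FObj F a) (FObj F b) (FObj F c)"
    "FArr F (LUnit T a) = LUnit C (FObj F a)" "FArr F (RUnit T a) = RUnit C (FObj F a)"
    "FArr F (Braid T a b) = Braid C (FObj F a) (FObj F b)" "FArr F (Twist T a) = Twist C (FObj F a)"
  using F unfolding is_strict_balanced_functor_def is_functor_def in_Hom T by (auto simp: PiE_def Pi_def)

lemma weaken_balanced:
  assumes F: "is_strict_balanced_functor T C F"
  shows "is_balanced_functor T C (weaken T C F)"
proof -
  note d [simp] = strict_balanced_functorD(2-)[OF F]
  have fu: "is_functor T C (weaken T C F)"
    using strict_balanced_functorD(1)[OF F] unfolding is_functor_def by simp
  have ext: "MTens (weaken T C F) \<in> extensional (UNIV \<times> UNIV)" by (simp add: weaken_def T)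
  have "FArr F f \<star> FArr F g \<in> Arr C" "Dom C (FArr F f \<star> FArr F g) = FObj F (Dom T f) \<diamondop> FObj F (Dom T g)"
    "Cod C (FArr F f \<star> FArr F g) = FObj F (Cod T f) \<diamondop> FObj F (Cod T g)" if "f \<in> Arr T" "g \<in> Arr T" for f g
    using that by simp_all
  then show ?thesis
    using fu ext unfolding is_balanced_functor_def in_Hom T by (simp add: strictD)
qed

text \<open>With identities as comparison arrows, the two conditions on a monoidal transformation
  lose these arrows and become the strict ones. This makes the inclusion of strict algebras fully
  faithful.\<close>

lemma strict_trans_iff:
  assumes F: "is_strict_balanced_functor T C F" and F': "is_strict_balanced_functor T C F'"
  shows "is_strict_monoidal_trans T C F F' \<alpha> \<longleftrightarrow> is_monoidal_trans T C (weaken T C F) (weaken T C F') \<alpha>"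
proof -
  note [simp] = strict_balanced_functorD(2-)[OF F] strict_balanced_functorD(2-)[OF F']
  have n: "is_nat_trans T C (weaken T C F) (weaken T C F') \<alpha> \<longleftrightarrow> is_nat_trans T C F F' \<alpha>"
    unfolding is_nat_trans_def by simp
  show ?thesis
  proof (cases "is_nat_trans T C F F' \<alpha>")
    case True
    then have a [simp]: "\<alpha> x \<in> Arr C" "Dom C (\<alpha> x) = FObj F x" "Cod C (\<alpha> x) = FObj F' x" for x
      unfolding is_nat_trans_def in_Hom T by auto
    show ?thesis unfolding is_strict_monoidal_trans_def is_monoidal_trans_def n T by simp
  qed (simp add: is_strict_monoidal_trans_def is_monoidal_trans_def n)
qed

lemma category_Alg_strict: "category (Alg_strict T C)"
proof -
  interpret A: category "Alg T C" by (rule category_Alg[OF T])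
  have arr: "(F, \<alpha>, F') \<in> Arr (Alg_strict T C) \<longleftrightarrow>
      is_strict_balanced_functor T C F \<and> is_strict_balanced_functor T C F' \<and> (weaken T C F, \<alpha>, weaken T C F') \<in> Arr (Alg T C)" for F \<alpha> F'
    by (auto simp: Alg_strict_sel Alg_sel weaken_balanced strict_trans_iff)
  show ?thesis
  proof
    fix f a b c g assume "f \<in> Hom (Alg_strict T C) a b" "g \<in> Hom (Alg_strict T C) b c"
    then obtain \<alpha> \<beta> where fg: "f = (a, \<alpha>, b)" "g = (b, \<beta>, c)" "(a, \<alpha>, b) \<in> Arr (Alg_strict T C)" "(b, \<beta>, c) \<in> Arr (Alg_strict T C)"
      by (cases f, cases g) (auto simp: in_Hom Alg_strict_sel(3,4))
    have "(weaken T C b, \<beta>, weaken T C c) \<cdot>\<^bsub>Alg T C\<^esub> (weaken T C a, \<alpha>, weaken T C b) \<in> Arr (Alg T C)"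
      using fg(3,4) by (intro A.comp_arr) (auto simp: arr Alg_sel(3,4))
    then show "g \<cdot>\<^bsub>Alg_strict T C\<^esub> f \<in> Hom (Alg_strict T C) a c"
      using fg(3,4) by (simp add: in_Hom fg(1,2) Alg_strict_sel(3-6) arr Alg_sel(6))
  next
    fix F assume "F \<in> Obj (Alg_strict T C)"
    then have F: "is_strict_balanced_functor T C F" by (simp add: Alg_strict_sel)
    have "Ident (Alg T C) (weaken T C F) \<in> Arr (Alg T C)" using weaken_balanced[OF F] by (intro A.ident_arr) (simp add: Alg_sel)
    then show "Ident (Alg_strict T C) F \<in> Hom (Alg_strict T C) F F"
      using F by (simp add: in_Hom Alg_strict_sel(3-5) arr Alg_sel(5))
  next
    fix f F F' assume "f \<in> Hom (Alg_strict T C) F F'"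
    then obtain \<alpha> where f: "f = (F, \<alpha>, F')" "(F, \<alpha>, F') \<in> Arr (Alg_strict T C)"
      by (cases f) (auto simp: in_Hom Alg_strict_sel(3,4))
    have a: "(weaken T C F, \<alpha>, weaken T C F') \<in> Arr (Alg T C)" using f(2) by (simp add: arr)
    show "Ident (Alg_strict T C) F' \<cdot>\<^bsub>Alg_strict T C\<^esub> f = f" "f \<cdot>\<^bsub>Alg_strict T C\<^esub> Ident (Alg_strict T C) F = f"
      using A.ident_comp[OF a HOL.refl] A.comp_ident[OF a HOL.refl] by (simp_all add: f(1) Alg_strict_sel(5,6) Alg_sel(3-6))
  next
    fix f a b c g d h assume "f \<in> Hom (Alg_strict T C) a b" "g \<in> Hom (Alg_strict T C) b c" "h \<in> Hom (Alg_strict T C) c d"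
    then obtain \<alpha> \<beta> \<gamma> where f: "f = (a, \<alpha>, b)" "g = (b, \<beta>, c)" "h = (c, \<gamma>, d)"
      "(a, \<alpha>, b) \<in> Arr (Alg_strict T C)" "(b, \<beta>, c) \<in> Arr (Alg_strict T C)" "(c, \<gamma>, d) \<in> Arr (Alg_strict T C)"
      by (cases f, cases g, cases h) (auto simp: in_Hom Alg_strict_sel(3,4))
    show "(h \<cdot>\<^bsub>Alg_strict T C\<^esub> g) \<cdot>\<^bsub>Alg_strict T C\<^esub> f = h \<cdot>\<^bsub>Alg_strict T C\<^esub> g \<cdot>\<^bsub>Alg_strict T C\<^esub> f"
      using f(4-6) A.assoc[of "(weaken T C a, \<alpha>, weaken T C b)" "(weaken T C b, \<beta>, weaken T C c)" "(weaken T C c, \<gamma>, weaken T C d)"]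
      by (simp add: f(1-3) Alg_strict_sel(6) Alg_sel(3,4,6) arr)
  qed (auto simp: Alg_strict_def)
qed

lemma weaken_fully_faithful: "fully_faithful (Alg_strict T C) (Alg T C) (weaken_functor T C)"
  unfolding fully_faithful_def
proof (intro conjI ballI)
  interpret S: category "Alg_strict T C" by (rule category_Alg_strict)
  have e: "FArr (weaken_functor T C) (F, \<alpha>, F') = (weaken T C F, \<alpha>, weaken T C F')" if "(F, \<alpha>, F') \<in> Arr (Alg_strict T C)" for F \<alpha> F'
    using that by (simp add: weaken_functor_def)
  show "is_functor (Alg_strict T C) (Alg T C) (weaken_functor T C)"
    unfolding is_functor_def
  proof (intro conjI ballI impI)
    show "FObj (weaken_functor T C) \<in> Obj (Alg_strict T C) \<rightarrow>\<^sub>E Obj (Alg T C)"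
      by (auto simp: weaken_functor_def Alg_sel Alg_strict_sel weaken_balanced)
    show "FArr (weaken_functor T C) \<in> extensional (Arr (Alg_strict T C))" by (simp add: weaken_functor_def)
  next
    fix f assume f: "f \<in> Arr (Alg_strict T C)"
    obtain F \<alpha> F' where fe: "f = (F, \<alpha>, F')" by (metis prod_cases3)
    show "FArr (weaken_functor T C) f \<in> Hom (Alg T C) (FObj (weaken_functor T C) (Dom (Alg_strict T C) f)) (FObj (weaken_functor T C) (Cod (Alg_strict T C) f))"
      using f unfolding fe e[OF f[unfolded fe]]
      by (auto simp: in_Hom Alg_sel Alg_strict_sel weaken_functor_def weaken_balanced strict_trans_iff)
  next
    fix F assume F: "F \<in> Obj (Alg_strict T C)"
    have "Ident (Alg_strict T C) F \<in> Arr (Alg_strict T C)" using F by simp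
    then show "FArr (weaken_functor T C) (Ident (Alg_strict T C) F) = Ident (Alg T C) (FObj (weaken_functor T C) F)"
      using F by (simp add: Alg_strict_sel(5) e) (simp add: weaken_functor_def Alg_sel)
  next
    fix f g assume f: "f \<in> Arr (Alg_strict T C)" and g: "g \<in> Arr (Alg_strict T C)"
      and fg: "Cod (Alg_strict T C) f = Dom (Alg_strict T C) g"
    obtain F \<alpha> F' \<beta> F'' where fe: "f = (F, \<alpha>, F')" "g = (F', \<beta>, F'')"
      using fg by (metis prod_cases3 Alg_strict_sel(3,4))
    have "g \<cdot>\<^bsub>Alg_strict T C\<^esub> f \<in> Arr (Alg_strict T C)" using f g fg by simp
    then show "FArr (weaken_functor T C) (g \<cdot>\<^bsub>Alg_strict T C\<^esub> f) = FArr (weaken_functor T C) g \<cdot>\<^bsub>Alg T C\<^esub> FArr (weaken_functor T C) f"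
      using f g unfolding fe Alg_strict_sel(6) by (simp add: e Alg_sel)
  qed
  fix F F' assume "F \<in> Obj (Alg_strict T C)" "F' \<in> Obj (Alg_strict T C)"
  then have F: "is_strict_balanced_functor T C F" "is_strict_balanced_functor T C F'" by (simp_all add: Alg_strict_sel)
  have "bij_betw (\<lambda>(F, \<alpha>, F'). (weaken T C F, \<alpha>, weaken T C F')) (Hom (Alg_strict T C) F F') (Hom (Alg T C) (weaken T C F) (weaken T C F'))"
  proof (rule bij_betwI')
    fix f g assume "f \<in> Hom (Alg_strict T C) F F'" "g \<in> Hom (Alg_strict T C) F F'"
    then show "((\<lambda>(F, \<alpha>, F'). (weaken T C F, \<alpha>, weaken T C F')) f = (\<lambda>(F, \<alpha>, F'). (weaken T C F, \<alpha>, weaken T C F')) g) \<longleftrightarrow> f = g"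
      by (cases f, cases g) (auto simp: in_Hom Alg_strict_sel)
  next
    fix f assume "f \<in> Hom (Alg_strict T C) F F'"
    then show "(\<lambda>(F, \<alpha>, F'). (weaken T C F, \<alpha>, weaken T C F')) f \<in> Hom (Alg T C) (weaken T C F) (weaken T C F')"
      using F by (cases f) (auto simp: in_Hom Alg_strict_sel Alg_sel weaken_balanced strict_trans_iff)
  next
    fix g assume "g \<in> Hom (Alg T C) (weaken T C F) (weaken T C F')"
    then obtain \<alpha> where "g = (weaken T C F, \<alpha>, weaken T C F')" "is_monoidal_trans T C (weaken T C F) (weaken T C F') \<alpha>"
      by (cases g) (auto simp: in_Hom Alg_sel)
    then show "\<exists>f\<in>Hom (Alg_strict T C) F F'. g = (\<lambda>(F, \<alpha>, F'). (weaken T C F, \<alpha>, weaken T C F')) f"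
      using F strict_trans_iff[OF F] by (intro bexI[of _ "(F, \<alpha>, F')"]) (auto simp: in_Hom Alg_strict_sel)
  qed
  moreover have "FObj (weaken_functor T C) F = weaken T C F" "FObj (weaken_functor T C) F' = weaken T C F'"
    using F by (simp_all add: weaken_functor_def Alg_strict_sel)
  moreover have "FArr (weaken_functor T C) f = (\<lambda>(F, \<alpha>, F'). (weaken T C F, \<alpha>, weaken T C F')) f" if "f \<in> Hom (Alg_strict T C) F F'" for f
    using that by (auto simp: weaken_functor_def in_Hom)
  ultimately show "bij_betw (FArr (weaken_functor T C)) (Hom (Alg_strict T C) F F')
      (Hom (Alg T C) (FObj (weaken_functor T C) F) (FObj (weaken_functor T C) F'))"
    using bij_betw_cong[of "Hom (Alg_strict T C) F F'" "FArr (weaken_functor T C)"] by metis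
qed

end

end

text \<open>In a strict category every \<open>phi\<close> is an identity, so the realization has
  identity comparisons and comes from a strict functor. Thus the algebras built for an arbitrary
  target already give essential surjectivity in the strict case.\<close>

lemma realize_strict:
  assumes "strict_monoidal C" and R: "monoid_realization C A G m e rho"
  obtains F where "is_strict_balanced_functor (DRBG G) C F" "monoid_realization.realize C A G m e rho = weaken (DRBG G) C F"
proof -
  interpret R: monoid_realization C A G m e rho by fact
  interpret strict_balanced_category C by unfold_locales fact
  define F where "F = \<lparr>FObj = R.pow, FArr = FArr R.realize\<rparr>"
  have pow: "R.pow (k + n) = R.pow k \<diamondop>\<^bsub>C\<^esub> R.pow n" for k n
    by (induction k) (simp_all add: R.pow.simps strictD)
  have phi: "R.phi k n = Ident C (R.pow k \<diamondop>\<^bsub>C\<^esub> R.pow n)" for k n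
    by (induction k) (simp_all add: R.pow.simps R.phi.simps strictD pow)
  have w: "R.realize = weaken (DRBG G) C F"
    by (simp add: R.realize_def weaken_def F_def phi fun_eq_iff)
  note b = R.realize_balanced
  have T: "Obj (DRBG G) = UNIV" by simp
  have o: "FObj R.realize = R.pow" "MTens R.realize (k, n) = Ident C (R.pow k \<diamondop>\<^bsub>C\<^esub> R.pow n)" for k n
    by (simp_all add: R.realize_def phi)
  have fu: "is_functor (DRBG G) C F"
    using R.balanced_functorD(1)[OF b] unfolding is_functor_def F_def by (simp add: o)
  have in_b: "ribbon_arr (k + n) (trivial_ribbon G (k + n) 0 (block_word k n)) \<in> Arr (DRBG G)" for k n
    by (intro ribbon_arr_in trivial_ribbon_ribbons R.G.group_axioms) simp
  have tensor: "FArr R.realize (drbg_tensor f g) = FArr R.realize f \<star>\<^bsub>C\<^esub> FArr R.realize g"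
    if "f \<in> Arr (DRBG G)" "g \<in> Arr (DRBG G)" for f g
    using R.balanced_functorD(16)[OF b T that] that R.G.DRBG_tensor_in[OF that]
      R.balanced_functorD(3-5)[OF b T] by (simp add: o pow)
  have braid: "FArr R.realize (Braid (DRBG G) k n) = Braid C (R.pow k) (R.pow n)" for k n
    using R.balanced_functorD(20)[OF b T, of k n] R.balanced_functorD(3-5)[OF b T] in_b[of k n] by (simp add: o pow)
  have twist: "FArr R.realize (Twist (DRBG G) n) = Twist C (R.pow n)" for n
    using R.balanced_functorD(21)[OF b T, of n] by (simp add: o)
  have id: "FArr R.realize (drbg_ident G n) = Ident C (R.pow n)" for n
    using R.balanced_functorD(6)[OF b T, of n] by (simp add: o)
  have "is_strict_balanced_functor (DRBG G) C F"
    using fu tensor braid twist id unfolding is_strict_balanced_functor_def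
    by (simp add: F_def pow strictD)
  then show thesis using w that by blast
qed

context algebra_base
begin

lemma strict_eval_weak_equivalence:
  assumes "strict_monoidal C"
  shows "weak_equivalence (Alg_strict T C) (GMon G C) (comp_func (Alg_strict T C) eval_functor (weaken_functor T C))"
  unfolding weak_equivalence_def
proof (intro conjI ballI)
  interpret strict_balanced_category C by unfold_locales fact
  have T: "Obj T = UNIV" by simp
  show "fully_faithful (Alg_strict T C) (GMon G C) (comp_func (Alg_strict T C) eval_functor (weaken_functor T C))"
    by (rule fully_faithful_comp[OF category_Alg_strict[OF T] category_Alg[OF T]
          category_functor_category[OF G.category_one_object category_Mon] weaken_fully_faithful[OF T] eval_fully_faithful])
  fix P assume "P \<in> Obj (GMon G C)"
  then have "is_functor (one_object_category G) (Mon C) P" by (simp add: functor_category_def)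
  then show "\<exists>F\<in>Obj (Alg_strict T C). \<exists>f\<in>Hom (GMon G C) (FObj (comp_func (Alg_strict T C) eval_functor (weaken_functor T C)) F) P.
      iso_arrow (GMon G C) f"
  proof (rule realize_essentially_surjective)
    fix A m e rho assume R: "monoid_realization C A G m e rho"
      and f: "\<exists>f\<in>Hom (GMon G C) (gmon (monoid_realization.realize C A G m e rho)) P. iso_arrow (GMon G C) f"
    obtain F where F: "is_strict_balanced_functor T C F" "monoid_realization.realize C A G m e rho = weaken T C F"
      using realize_strict[OF assms R] by blast
    have "FObj (comp_func (Alg_strict T C) eval_functor (weaken_functor T C)) F = gmon (weaken T C F)"
      using F weaken_balanced[OF T F(1)] by (simp add: comp_func_def weaken_functor_def eval_functor_def Alg_sel Alg_strict_sel)
    then show ?thesis using F f by (intro bexI[of _ F]) (simp_all add: Alg_strict_sel)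
  qed
qed

end

section \<open>Duality\<close>

lemma dual_dual: "dual (dual C) = C" for C :: "('o, 'a) cat"
  by (cases C) (simp add: dual_def)

text \<open>The common pattern of all the dualities below. An arrow is a triple of source, data and
  target; the functor exchanges the ends and changes the data by a bijection \<open>k\<close> with
  inverse \<open>k'\<close>. Every object of the target is literally an image, so identities witness
  essential surjectivity.\<close>

lemma triple_duality:
  fixes A :: "('o, 'o \<times> 'x \<times> 'o) cat" and D :: "('p, 'p \<times> 'y \<times> 'p) cat"
  assumes A: "category A" and D: "category D"
    and dcA: "\<And>f. f \<in> Arr A \<Longrightarrow> Dom A f = fst f \<and> Cod A f = snd (snd f)"
    and dcD: "\<And>f. f \<in> Arr D \<Longrightarrow> Dom D f = fst f \<and> Cod D f = snd (snd f)"
    and ob: "\<And>F. F \<in> Obj A \<Longrightarrow> ob F \<in> Obj D"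
    and surj: "\<And>P. P \<in> Obj D \<Longrightarrow> \<exists>F\<in>Obj A. ob F = P"
    and arr: "\<And>F F' \<alpha>. (F, \<alpha>, F') \<in> Arr A \<Longrightarrow> (ob F', k \<alpha>, ob F) \<in> Arr D \<and> k' (k \<alpha>) = \<alpha>"
    and arr': "\<And>F F' \<beta>. \<lbrakk>F \<in> Obj A; F' \<in> Obj A; (ob F', \<beta>, ob F) \<in> Arr D\<rbrakk> \<Longrightarrow> (F, k' \<beta>, F') \<in> Arr A \<and> k (k' \<beta>) = \<beta>"
    and ident: "\<And>F \<alpha>. F \<in> Obj A \<Longrightarrow> Ident A F = (F, \<alpha>, F) \<Longrightarrow> Ident D (ob F) = (ob F, k \<alpha>, ob F)"
    and comp: "\<And>F F' F'' \<alpha> \<beta> \<gamma>. \<lbrakk>(F, \<alpha>, F') \<in> Arr A; (F', \<beta>, F'') \<in> Arr A; (F', \<beta>, F'') \<cdot>\<^bsub>A\<^esub> (F, \<alpha>, F') = (F, \<gamma>, F'')\<rbrakk> \<Longrightarrow>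
        (ob F', k \<alpha>, ob F) \<cdot>\<^bsub>D\<^esub> (ob F'', k \<beta>, ob F') = (ob F'', k \<gamma>, ob F)"
  shows "weak_equivalence A (dual D) \<lparr>FObj = restrict ob (Obj A), FArr = restrict (\<lambda>(F, \<alpha>, F'). (ob F', k \<alpha>, ob F)) (Arr A)\<rparr>"
    (is "weak_equivalence A (dual D) ?H")
proof -
  interpret A: category A by fact
  interpret D: category D by fact
  have e: "FArr ?H (F, \<alpha>, F') = (ob F', k \<alpha>, ob F)" if "(F, \<alpha>, F') \<in> Arr A" for F \<alpha> F' using that by simp
  have o: "FObj ?H F = ob F" if "F \<in> Obj A" for F using that by simp
  have arrA: "F \<in> Obj A" "F' \<in> Obj A" "Dom A (F, \<alpha>, F') = F" "Cod A (F, \<alpha>, F') = F'" if "(F, \<alpha>, F') \<in> Arr A" for F \<alpha> F'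
    using dcA[OF that] A.dom_obj[OF that] A.cod_obj[OF that] by simp_all
  have split: "\<exists>F \<alpha> F'. f = (F, \<alpha>, F')" for f :: "'o \<times> 'x \<times> 'o" by (metis prod_cases3)
  have fu: "is_functor A (dual D) ?H"
    unfolding is_functor_def
  proof (intro conjI ballI impI)
    show "FObj ?H \<in> Obj A \<rightarrow>\<^sub>E Obj (dual D)" using ob by auto
    show "FArr ?H \<in> extensional (Arr A)" by simp
  next
    fix f assume f: "f \<in> Arr A"
    obtain F \<alpha> F' where fe: "f = (F, \<alpha>, F')" using split by blast
    note f' = f[unfolded fe]
    show "FArr ?H f \<in> Hom (dual D) (FObj ?H (Dom A f)) (FObj ?H (Cod A f))"
      unfolding fe e[OF f'] arrA[OF f'] o[OF arrA(1)[OF f']] o[OF arrA(2)[OF f']]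
      using arr[OF f'] dcD[OF conjunct1[OF arr[OF f']]] by (simp add: in_Hom)
  next
    fix F assume F: "F \<in> Obj A"
    have i: "Ident A F \<in> Arr A" using F by simp
    obtain \<alpha> where a: "Ident A F = (F, \<alpha>, F)"
      using dcA[OF i] F by (metis A.ident_arr(2,3) prod.collapse)
    show "FArr ?H (Ident A F) = Ident (dual D) (FObj ?H F)"
      unfolding o[OF F] a e[OF i[unfolded a]] using ident[OF F a] by simp
  next
    fix f g assume f: "f \<in> Arr A" and g: "g \<in> Arr A" and fg: "Cod A f = Dom A g"
    obtain F \<alpha> F' G \<beta> F'' where "f = (F, \<alpha>, F')" "g = (G, \<beta>, F'')" using split by metis
    with fg arrA f g have fe: "f = (F, \<alpha>, F')" "g = (F', \<beta>, F'')" by auto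
    have gf: "g \<cdot>\<^bsub>A\<^esub> f \<in> Arr A" using f g fg by simp
    obtain \<gamma> where c: "g \<cdot>\<^bsub>A\<^esub> f = (F, \<gamma>, F'')"
      using dcA[OF gf] dcA[OF f] dcA[OF g] f g fg fe by (metis A.comp_arr(2,3) prod.collapse fst_conv snd_conv)
    have c': "(F', \<beta>, F'') \<cdot>\<^bsub>A\<^esub> (F, \<alpha>, F') = (F, \<gamma>, F'')" using c unfolding fe .
    have "FArr ?H (g \<cdot>\<^bsub>A\<^esub> f) = (ob F'', k \<gamma>, ob F)" unfolding c by (rule e[OF gf[unfolded c]])
    also have "\<dots> = FArr ?H g \<cdot>\<^bsub>dual D\<^esub> FArr ?H f"
      using comp[OF f[unfolded fe(1)] g[unfolded fe(2)] c'] unfolding fe e[OF f[unfolded fe(1)]] e[OF g[unfolded fe(2)]] by simp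
    finally show "FArr ?H (g \<cdot>\<^bsub>A\<^esub> f) = FArr ?H g \<cdot>\<^bsub>dual D\<^esub> FArr ?H f" .
  qed
  have "bij_betw (FArr ?H) (Hom A F F') (Hom (dual D) (FObj ?H F) (FObj ?H F'))" if F: "F \<in> Obj A" "F' \<in> Obj A" for F F'
  proof (rule bij_betwI')
    fix f g assume f: "f \<in> Hom A F F'" and g: "g \<in> Hom A F F'"
    obtain \<alpha> \<beta> where fe: "f = (F, \<alpha>, F')" "g = (F, \<beta>, F')" "(F, \<alpha>, F') \<in> Arr A" "(F, \<beta>, F') \<in> Arr A"
    proof -
      obtain a \<alpha> b a' \<beta> b' where fg: "f = (a, \<alpha>, b)" "g = (a', \<beta>, b')" using split by metis
      note fa = f[unfolded in_Hom fg] and ga = g[unfolded in_Hom fg]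
      have "a = F" "b = F'" "a' = F" "b' = F'"
        using fa ga arrA(3,4)[OF conjunct1[OF fa]] arrA(3,4)[OF conjunct1[OF ga]] by simp_all
      then show thesis using that[of \<alpha> \<beta>] fg fa ga by simp
    qed
    show "FArr ?H f = FArr ?H g \<longleftrightarrow> f = g"
      unfolding fe(1,2) e[OF fe(3)] e[OF fe(4)] prod.inject using arr[OF fe(3)] arr[OF fe(4)] by metis
  next
    fix f assume "f \<in> Hom A F F'"
    then show "FArr ?H f \<in> Hom (dual D) (FObj ?H F) (FObj ?H F')"
      using fu unfolding is_functor_def in_Hom by auto
  next
    fix g assume "g \<in> Hom (dual D) (FObj ?H F) (FObj ?H F')"
    then have g: "g \<in> Arr D" "Dom D g = ob F'" "Cod D g = ob F" using F by (auto simp: in_Hom)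
    obtain \<beta> where ge: "g = (ob F', \<beta>, ob F)" using dcD[OF g(1)] g by (metis prod.collapse)
    note a = arr'[OF F g(1)[unfolded ge]]
    then show "\<exists>f\<in>Hom A F F'. g = FArr ?H f"
      using e[OF conjunct1[OF a]] arrA[OF conjunct1[OF a]] by (intro bexI[of _ "(F, k' \<beta>, F')"]) (auto simp: in_Hom ge)
  qed
  moreover have "\<exists>a\<in>Obj A. \<exists>f\<in>Hom (dual D) (FObj ?H a) d. iso_arrow (dual D) f" if d: "d \<in> Obj (dual D)" for d
  proof -
    obtain F where "F \<in> Obj A" "ob F = d" using surj d by auto
    then show ?thesis using d by (intro bexI[of _ F] bexI[of _ "Ident D d"]) (auto simp: in_Hom)
  qed
  ultimately show ?thesis unfolding weak_equivalence_def fully_faithful_def using fu by blast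
qed

section \<open>Reversal of arrows and of group actions\<close>

fun rev_arrow :: "'o \<times> 'a \<times> 'o \<Rightarrow> 'o \<times> 'a \<times> 'o" where
  "rev_arrow (a, f, b) = (b, f, a)"

lemma rev_rev_arrow [simp]: "rev_arrow (rev_arrow f) = f"
  by (cases f) simp

lemma rev_arrow_sel [simp]: "fst (rev_arrow f) = snd (snd f)" "snd (snd (rev_arrow f)) = fst f" "fst (snd (rev_arrow f)) = fst (snd f)"
  by (cases f; simp)+

text \<open>\<open>dual\<close> keeps the arrows as they are, whereas a triple in
  \<open>Comon\<close> begins with its own source. Therefore \<open>Comon C\<close> is the dual of
  \<open>Mon (opposite C)\<close> only after the ends of each triple are exchanged.\<close>

definition rev_related :: "('o, 'o \<times> 'a \<times> 'o) cat \<Rightarrow> ('o, 'o \<times> 'a \<times> 'o) cat \<Rightarrow> bool" where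
  "rev_related X Y \<longleftrightarrow> Obj X = Obj Y \<and> (\<forall>f. f \<in> Arr X \<longleftrightarrow> rev_arrow f \<in> Arr Y) \<and>
     (\<forall>f\<in>Arr X. Dom X f = fst f \<and> Cod X f = snd (snd f)) \<and> (\<forall>f\<in>Arr Y. Dom Y f = fst f \<and> Cod Y f = snd (snd f)) \<and>
     (\<forall>a\<in>Obj X. Ident Y a = rev_arrow (Ident X a)) \<and>
     (\<forall>f\<in>Arr X. \<forall>g\<in>Arr X. snd (snd f) = fst g \<longrightarrow> rev_arrow f \<cdot>\<^bsub>Y\<^esub> rev_arrow g = rev_arrow (g \<cdot>\<^bsub>X\<^esub> f))"

lemma rev_relatedD:
  assumes "rev_related X Y"
  shows "Obj Y = Obj X" "rev_arrow f \<in> Arr Y \<longleftrightarrow> f \<in> Arr X"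
    "f \<in> Arr X \<Longrightarrow> Dom X f = fst f" "f \<in> Arr X \<Longrightarrow> Cod X f = snd (snd f)"
    "f \<in> Arr Y \<Longrightarrow> Dom Y f = fst f" "f \<in> Arr Y \<Longrightarrow> Cod Y f = snd (snd f)"
    "a \<in> Obj X \<Longrightarrow> Ident Y a = rev_arrow (Ident X a)"
    "f \<in> Arr X \<Longrightarrow> g \<in> Arr X \<Longrightarrow> snd (snd f) = fst g \<Longrightarrow> rev_arrow f \<cdot>\<^bsub>Y\<^esub> rev_arrow g = rev_arrow (g \<cdot>\<^bsub>X\<^esub> f)"
  using assms unfolding rev_related_def by (auto simp del: split_paired_All)

lemma rev_related_arr: "rev_related X Y \<Longrightarrow> f \<in> Arr Y \<longleftrightarrow> rev_arrow f \<in> Arr X"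
  using rev_relatedD(2)[of X Y "rev_arrow f"] by simp

lemma rev_related_sym:
  assumes r: "rev_related X Y"
  shows "rev_related Y X"
proof -
  have "rev_arrow f \<cdot>\<^bsub>X\<^esub> rev_arrow g = rev_arrow (g \<cdot>\<^bsub>Y\<^esub> f)" if "f \<in> Arr Y" "g \<in> Arr Y" "snd (snd f) = fst g" for f g
    using rev_relatedD(8)[OF r, of "rev_arrow g" "rev_arrow f"] that by (simp add: rev_related_arr[OF r])
  then show ?thesis
    unfolding rev_related_def using rev_relatedD(1-7)[OF r]
    by (auto simp: rev_related_arr[OF r] simp del: split_paired_All)
qed

text \<open>Reversal is an involution, so an equation between arrows of \<open>Y\<close> is checked
  by reversing both sides and calculating in \<open>X\<close>.\<close>

lemma rev_related_category:
  assumes r: "rev_related X Y" and X: "category X"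
  shows "category Y"
proof -
  interpret X: category X by fact
  note d = rev_relatedD[OF r] and a = rev_related_arr[OF r]
  have dc: "Dom X (rev_arrow f) = Cod Y f" "Cod X (rev_arrow f) = Dom Y f" if "f \<in> Arr Y" for f
    using that a[of f] d(3-6) by simp_all
  have comp: "g \<cdot>\<^bsub>Y\<^esub> f = rev_arrow (rev_arrow f \<cdot>\<^bsub>X\<^esub> rev_arrow g)" if "f \<in> Arr Y" "g \<in> Arr Y" "Cod Y f = Dom Y g" for f g
    using d(8)[of "rev_arrow g" "rev_arrow f"] that d(5,6) a by simp
  have rc: "g \<cdot>\<^bsub>Y\<^esub> f \<in> Arr Y" "rev_arrow (g \<cdot>\<^bsub>Y\<^esub> f) = rev_arrow f \<cdot>\<^bsub>X\<^esub> rev_arrow g" "Dom Y (g \<cdot>\<^bsub>Y\<^esub> f) = Dom Y f" "Cod Y (g \<cdot>\<^bsub>Y\<^esub> f) = Cod Y g"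
    if "f \<in> Arr Y" "g \<in> Arr Y" "Cod Y f = Dom Y g" for f g
  proof -
    have c: "rev_arrow f \<cdot>\<^bsub>X\<^esub> rev_arrow g \<in> Arr X" "Dom X (rev_arrow f \<cdot>\<^bsub>X\<^esub> rev_arrow g) = Cod Y g" "Cod X (rev_arrow f \<cdot>\<^bsub>X\<^esub> rev_arrow g) = Dom Y f"
      using that dc a by simp_all
    show 1: "g \<cdot>\<^bsub>Y\<^esub> f \<in> Arr Y" "rev_arrow (g \<cdot>\<^bsub>Y\<^esub> f) = rev_arrow f \<cdot>\<^bsub>X\<^esub> rev_arrow g" using comp[OF that] c(1) d(2) by simp_all
    show "Dom Y (g \<cdot>\<^bsub>Y\<^esub> f) = Dom Y f" "Cod Y (g \<cdot>\<^bsub>Y\<^esub> f) = Cod Y g" using dc[OF 1(1)] 1 c by simp_all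
  qed
  have id: "Ident Y b \<in> Arr Y" "Dom Y (Ident Y b) = b" "Cod Y (Ident Y b) = b" if "b \<in> Obj Y" for b
  proof -
    have b: "b \<in> Obj X" using that d(1) by simp
    show 1: "Ident Y b \<in> Arr Y" using b d(2,7) by simp
    show "Dom Y (Ident Y b) = b" "Cod Y (Ident Y b) = b"
      using dc[OF 1] d(7)[OF b] b by simp_all
  qed
  have inj: "f = g" if "rev_arrow f = rev_arrow g" for f g :: "'a \<times> 'b \<times> 'a" using that by (metis rev_rev_arrow)
  show ?thesis
  proof
    fix f assume f: "f \<in> Arr Y"
    have fx: "rev_arrow f \<in> Arr X" using f a by simp
    show "Dom Y f \<in> Obj Y" "Cod Y f \<in> Obj Y"
      using X.dom_obj[OF fx] X.cod_obj[OF fx] dc[OF f] d(1) by simp_all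
  next
    fix f b c assume "f \<in> Hom Y b c"
    then have f: "f \<in> Arr Y" "Dom Y f = b" "Cod Y f = c" by (auto simp: in_Hom)
    have fx: "rev_arrow f \<in> Arr X" using f a by simp
    have o: "b \<in> Obj Y" "c \<in> Obj Y" "b \<in> Obj X" "c \<in> Obj X"
      using X.dom_obj[OF fx] X.cod_obj[OF fx] dc[OF f(1)] d(1) f by simp_all
    show "Ident Y c \<cdot>\<^bsub>Y\<^esub> f = f" "f \<cdot>\<^bsub>Y\<^esub> Ident Y b = f"
    proof -
      have i: "rev_arrow (Ident Y b) = Ident X b" "rev_arrow (Ident Y c) = Ident X c" using d(7) o by simp_all
      show "Ident Y c \<cdot>\<^bsub>Y\<^esub> f = f"
        using rc(2)[OF f(1) id(1)[OF o(2)]] id(2)[OF o(2)] f fx dc[OF f(1)] by - (rule inj, simp add: i)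
      show "f \<cdot>\<^bsub>Y\<^esub> Ident Y b = f"
        using rc(2)[OF id(1)[OF o(1)] f(1)] id(3)[OF o(1)] f fx dc[OF f(1)] by - (rule inj, simp add: i)
    qed
  next
    fix f g h a' b c e assume "f \<in> Hom Y a' b" "g \<in> Hom Y b c" "h \<in> Hom Y c e"
    then have f: "f \<in> Arr Y" "g \<in> Arr Y" "h \<in> Arr Y" "Cod Y f = Dom Y g" "Cod Y g = Dom Y h" by (auto simp: in_Hom)
    have x: "rev_arrow f \<in> Arr X" "rev_arrow g \<in> Arr X" "rev_arrow h \<in> Arr X" using f a by simp_all
    show "(h \<cdot>\<^bsub>Y\<^esub> g) \<cdot>\<^bsub>Y\<^esub> f = h \<cdot>\<^bsub>Y\<^esub> g \<cdot>\<^bsub>Y\<^esub> f"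
      using f x dc by - (rule inj, simp add: rc)
  qed (auto simp: in_Hom id rc)
qed

lemma rev_related_dual:
  assumes r: "rev_related X Y" and X: "category X"
  shows "weak_equivalence X (dual Y) \<lparr>FObj = restrict (\<lambda>a. a) (Obj X), FArr = restrict (\<lambda>(F, \<alpha>, F'). (F', \<alpha>, F)) (Arr X)\<rparr>"
proof (rule triple_duality[where k = "\<lambda>x. x" and k' = "\<lambda>x. x", OF X rev_related_category[OF r X]])
  note d = rev_relatedD[OF r]
  show "Dom X f = fst f \<and> Cod X f = snd (snd f)" if "f \<in> Arr X" for f using d that by blast
  show "Dom Y f = fst f \<and> Cod Y f = snd (snd f)" if "f \<in> Arr Y" for f using d that by blast
  show "(F', \<alpha>, F) \<in> Arr Y \<and> \<alpha> = \<alpha>" if "(F, \<alpha>, F') \<in> Arr X" for F \<alpha> F' using d(2)[of "(F, \<alpha>, F')"] that by simp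
  show "(F, \<alpha>, F') \<in> Arr X \<and> \<alpha> = \<alpha>" if "(F', \<alpha>, F) \<in> Arr Y" for F \<alpha> F' using d(2)[of "(F, \<alpha>, F')"] that by simp
  show "Ident Y F = (F, \<alpha>, F)" if "F \<in> Obj X" "Ident X F = (F, \<alpha>, F)" for F \<alpha> using d(7) that by simp
  show "(F', \<alpha>, F) \<cdot>\<^bsub>Y\<^esub> (F'', \<beta>, F') = (F'', \<gamma>, F)"
    if "(F, \<alpha>, F') \<in> Arr X" "(F', \<beta>, F'') \<in> Arr X" "(F', \<beta>, F'') \<cdot>\<^bsub>X\<^esub> (F, \<alpha>, F') = (F, \<gamma>, F'')" for F F' F'' \<alpha> \<beta> \<gamma>
    using d(8)[OF that(1,2)] that(3) by simp
qed (use rev_relatedD(1)[OF r] in auto)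

text \<open>Reversing arrows reverses the order of composition and turns an action into an action of
  the opposite group; the inversion of \<open>G\<close> turns it back.\<close>

definition rev_action ::
  "('g, 'm) monoid_scheme \<Rightarrow> (unit, 'g, 'o, 'o \<times> 'a \<times> 'o) func \<Rightarrow> (unit, 'g, 'o, 'o \<times> 'a \<times> 'o) func" where
  "rev_action G P = \<lparr>FObj = FObj P, FArr = (\<lambda>x\<in>carrier G. rev_arrow (FArr P (inv\<^bsub>G\<^esub> x)))\<rparr>"

context group
begin

lemma rev_action_functor:
  assumes r: "rev_related X Y" and P: "is_functor (one_object_category G) X P"
  shows "is_functor (one_object_category G) Y (rev_action G P)"
proof -
  note d = rev_relatedD[OF r] and a = rev_related_arr[OF r]
  interpret O: category "one_object_category G" by (rule category_one_object)
  note PD = O.is_functorD[OF P, unfolded one_object_category_def cat.simps]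
  have arr: "FArr P x \<in> Arr X" "fst (FArr P x) = FObj P ()" "snd (snd (FArr P x)) = FObj P ()" if "x \<in> carrier G" for x
    using PD(2-4)[of x] that d(3,4) by simp_all
  have mult: "rev_arrow (FArr P (inv (x \<otimes> y))) = rev_arrow (FArr P (inv x)) \<cdot>\<^bsub>Y\<^esub> rev_arrow (FArr P (inv y))"
    if "x \<in> carrier G" "y \<in> carrier G" for x y
    using d(8)[OF arr(1) arr(1), of "inv x" "inv y"] that arr PD(6)[of "inv x" "inv y"] by (simp add: inv_mult_group)
  have y: "rev_arrow (FArr P x) \<in> Arr Y" "Dom Y (rev_arrow (FArr P x)) = FObj P ()" "Cod Y (rev_arrow (FArr P x)) = FObj P ()"
    if "x \<in> carrier G" for x
    using arr[OF that] d by simp_all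
  have "Ident X (FObj P ()) = FArr P \<one>" using PD(5) by simp
  then have "rev_arrow (FArr P \<one>) = Ident Y (FObj P ())" using d(7) PD(1) by simp
  then show ?thesis
    using mult y PD(1) d(1) P
    unfolding is_functor_def in_Hom rev_action_def one_object_category_def by (auto simp: PiE_def)
qed

lemma rev_rev_action:
  assumes "is_functor (one_object_category G) X P"
  shows "rev_action G (rev_action G P) = P"
proof -
  have "FArr P \<in> extensional (carrier G)" using assms unfolding is_functor_def one_object_category_def by simp
  then have "(\<lambda>x\<in>carrier G. rev_arrow (FArr (rev_action G P) (inv x))) = FArr P"
    by (intro extensionalityI[of _ "carrier G"]) (auto simp: rev_action_def)
  then show ?thesis by (simp add: rev_action_def[of G "rev_action G P"]) (simp add: rev_action_def)
qed

lemma rev_trans: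
  assumes r: "rev_related X Y" and X: "category X"
    and P: "is_functor (one_object_category G) X P" "is_functor (one_object_category G) X P'"
    and \<alpha>: "is_nat_trans (one_object_category G) X P P' \<alpha>"
  shows "is_nat_trans (one_object_category G) Y (rev_action G P') (rev_action G P) (\<lambda>_\<in>{()}. rev_arrow (\<alpha> ()))"
proof -
  interpret X: category X by fact
  note d = rev_relatedD[OF r] and a = rev_related_arr[OF r]
  interpret O: category "one_object_category G" by (rule category_one_object)
  note PD = O.is_functorD[OF P(1), unfolded one_object_category_def cat.simps]
  note PD' = O.is_functorD[OF P(2), unfolded one_object_category_def cat.simps]
  have arr: "FArr P x \<in> Arr X" "fst (FArr P x) = FObj P ()" "snd (snd (FArr P x)) = FObj P ()"
    "FArr P' x \<in> Arr X" "fst (FArr P' x) = FObj P' ()" "snd (snd (FArr P' x)) = FObj P' ()" if "x \<in> carrier G" for x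
    using PD(2-4)[of x] PD'(2-4)[of x] that d(3,4) by simp_all
  have al: "\<alpha> () \<in> Arr X" "Dom X (\<alpha> ()) = FObj P ()" "Cod X (\<alpha> ()) = FObj P' ()"
    using \<alpha> unfolding is_nat_trans_def in_Hom one_object_category_def by auto
  then have al': "fst (\<alpha> ()) = FObj P ()" "snd (snd (\<alpha> ())) = FObj P' ()" using d(3,4) by auto
  have nat: "rev_arrow (\<alpha> ()) \<cdot>\<^bsub>Y\<^esub> rev_arrow (FArr P' (inv x)) = rev_arrow (FArr P (inv x)) \<cdot>\<^bsub>Y\<^esub> rev_arrow (\<alpha> ())"
    if x: "x \<in> carrier G" for x
  proof -
    have "\<alpha> () \<cdot>\<^bsub>X\<^esub> FArr P (inv x) = FArr P' (inv x) \<cdot>\<^bsub>X\<^esub> \<alpha> ()"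
      using \<alpha> x unfolding is_nat_trans_def one_object_category_def by auto
    then show ?thesis
      using d(8)[OF al(1) arr(4), of "inv x"] d(8)[OF arr(1) al(1), of "inv x"] x al' arr by simp
  qed
  have "rev_arrow (\<alpha> ()) \<in> Arr Y" using al d(2) by simp
  then show ?thesis
    using nat al' d(5,6) unfolding is_nat_trans_def in_Hom one_object_category_def rev_action_def by simp
qed

lemma rev_action_weak_equivalence:
  assumes r: "rev_related X Y" and X: "category X"
  shows "weak_equivalence (functor_category (one_object_category G) X) (dual (functor_category (one_object_category G) Y))
    \<lparr>FObj = restrict (rev_action G) (Obj (functor_category (one_object_category G) X)),
     FArr = restrict (\<lambda>(P, \<alpha>, P'). (rev_action G P', (\<lambda>_\<in>{()}. rev_arrow (\<alpha> ())), rev_action G P))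
       (Arr (functor_category (one_object_category G) X))\<rparr>"
proof (rule triple_duality[where k' = "\<lambda>\<alpha>. (\<lambda>_\<in>{()}. rev_arrow (\<alpha> ()))"])
  have Y: "category Y" by (rule rev_related_category[OF r X])
  note r' = rev_related_sym[OF r]
  note d = rev_relatedD[OF r]
  interpret O: category "one_object_category G" by (rule category_one_object)
  let ?A = "functor_category (one_object_category G) X" and ?D = "functor_category (one_object_category G) Y"
  show "category ?A" "category ?D" by (intro category_functor_category category_one_object X Y)+
  show "Dom ?A f = fst f \<and> Cod ?A f = snd (snd f)" if "f \<in> Arr ?A" for f by (cases f) (simp add: functor_category_def)
  show "Dom ?D f = fst f \<and> Cod ?D f = snd (snd f)" if "f \<in> Arr ?D" for f by (cases f) (simp add: functor_category_def)
  show "rev_action G F \<in> Obj ?D" if "F \<in> Obj ?A" for F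
    using rev_action_functor[OF r] that by (simp add: functor_category_def)
  show "\<exists>F\<in>Obj ?A. rev_action G F = P" if "P \<in> Obj ?D" for P
    using that rev_action_functor[OF r'] rev_rev_action
    by (intro bexI[of _ "rev_action G P"]) (auto simp: functor_category_def)
  have kk: "(\<lambda>_\<in>{()}. rev_arrow ((\<lambda>_\<in>{()}. rev_arrow (\<alpha> ())) ())) = \<alpha>"
    if "is_nat_trans (one_object_category G) Z F F' \<alpha>" for Z F F' \<alpha>
    using that unfolding is_nat_trans_def one_object_category_def
    by (intro extensionalityI[of _ "{()}"]) auto
  show "(rev_action G F', (\<lambda>_\<in>{()}. rev_arrow (\<alpha> ())), rev_action G F) \<in> Arr ?D \<and>
      (\<lambda>_\<in>{()}. rev_arrow ((\<lambda>_\<in>{()}. rev_arrow (\<alpha> ())) ())) = \<alpha>" if "(F, \<alpha>, F') \<in> Arr ?A" for F F' \<alpha>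
    using that rev_action_functor[OF r] rev_trans[OF r X] kk[of X F F' \<alpha>] by (simp add: functor_category_def)
  show "(F, (\<lambda>_\<in>{()}. rev_arrow (\<beta> ())), F') \<in> Arr ?A \<and> (\<lambda>_\<in>{()}. rev_arrow ((\<lambda>_\<in>{()}. rev_arrow (\<beta> ())) ())) = \<beta>"
    if "F \<in> Obj ?A" "F' \<in> Obj ?A" "(rev_action G F', \<beta>, rev_action G F) \<in> Arr ?D" for F F' \<beta>
    using that rev_trans[OF r' Y, of "rev_action G F'" "rev_action G F" \<beta>] rev_rev_action[of X F] rev_rev_action[of X F']
      kk[of Y "rev_action G F'" "rev_action G F" \<beta>]
    by (simp add: functor_category_def)
  show "Ident ?D (rev_action G F) = (rev_action G F, (\<lambda>_\<in>{()}. rev_arrow (\<alpha> ())), rev_action G F)"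
    if "F \<in> Obj ?A" "Ident ?A F = (F, \<alpha>, F)" for F \<alpha>
  proof -
    have F: "is_functor (one_object_category G) X F" using that(1) by (simp add: functor_category_def)
    have "FObj F () \<in> Obj X" using O.is_functorD(1)[OF F] by (simp add: one_object_category_def)
    moreover have "\<alpha> () = Ident X (FObj F ())" using that(2) by (auto simp: functor_category_def one_object_category_def)
    ultimately show ?thesis using d(7) by (auto simp: functor_category_def one_object_category_def rev_action_def intro!: restrict_ext)
  qed
  show "(rev_action G F', (\<lambda>_\<in>{()}. rev_arrow (\<alpha> ())), rev_action G F) \<cdot>\<^bsub>?D\<^esub>
      (rev_action G F'', (\<lambda>_\<in>{()}. rev_arrow (\<beta> ())), rev_action G F') =
      (rev_action G F'', (\<lambda>_\<in>{()}. rev_arrow (\<gamma> ())), rev_action G F)"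
    if "(F, \<alpha>, F') \<in> Arr ?A" "(F', \<beta>, F'') \<in> Arr ?A" "(F', \<beta>, F'') \<cdot>\<^bsub>?A\<^esub> (F, \<alpha>, F') = (F, \<gamma>, F'')" for F F' F'' \<alpha> \<beta> \<gamma>
  proof -
    have al: "\<alpha> () \<in> Arr X" "Cod X (\<alpha> ()) = FObj F' ()" "\<beta> () \<in> Arr X" "Dom X (\<beta> ()) = FObj F' ()"
      using that(1,2) by (auto simp: functor_category_def is_nat_trans_def in_Hom one_object_category_def)
    then have "snd (snd (\<alpha> ())) = fst (\<beta> ())" using d(3,4) by simp
    moreover have "\<gamma> () = \<beta> () \<cdot>\<^bsub>X\<^esub> \<alpha> ()" using that(3) by (auto simp: functor_category_def one_object_category_def)
    ultimately show ?thesis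
      using d(8)[OF al(1,3)] by (auto simp: functor_category_def one_object_category_def intro!: restrict_ext)
  qed
qed

end

section \<open>Opposite balanced categories and duality of algebras\<close>

lemma opposite_sel [simp]:
  "Obj (opposite C) = Obj C" "Arr (opposite C) = Arr C" "Dom (opposite C) = Cod C" "Cod (opposite C) = Dom C"
  "Ident (opposite C) = Ident C" "Comp (opposite C) g f = f \<cdot>\<^bsub>C\<^esub> g" "TObj (opposite C) = TObj C" "TArr (opposite C) = TArr C"
  "Unit (opposite C) = Unit C" "Assoc (opposite C) a b c = inverse_arrow C (Assoc C a b c)"
  "LUnit (opposite C) a = inverse_arrow C (LUnit C a)" "RUnit (opposite C) a = inverse_arrow C (RUnit C a)"
  "Braid (opposite C) a b = Braid C b a" "Twist (opposite C) = Twist C"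
  by (simp_all add: opposite_def)

lemma Hom_opposite [simp]: "Hom (opposite C) a b = Hom C b a"
  by (auto simp: in_Hom)

lemma inverse_arrows_opposite [simp]: "inverse_arrows (opposite C) = inverse_arrows C"
  by (intro ext) (auto simp: inverse_arrows_def)

lemma iso_arrow_opposite [simp]: "iso_arrow (opposite C) = iso_arrow C"
  by (intro ext) (simp add: iso_arrow_def)

lemma inverse_arrow_opposite [simp]: "inverse_arrow (opposite C) = inverse_arrow C"
  by (intro ext) (simp add: inverse_arrow_def)

text \<open>Passing to the opposite category exchanges the two hexagons. This is
  \<open>hexagon1\<close> solved for the braiding, the form that the second hexagon of the opposite
  category takes in \<open>C\<close>.\<close>

lemma (in braided_monoidal_category) hexagon1':
  assumes [simp]: "a \<in> Obj C" "b \<in> Obj C" "c \<in> Obj C"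
  shows "Braid C c (a \<diamondop> b) = inverse_arrow C (Assoc C a b c) \<cdot> (Ident C a \<star> Braid C c b) \<cdot> Assoc C a c b \<cdot>
    (Braid C c a \<star> Ident C b) \<cdot> inverse_arrow C (Assoc C c a b)"
proof -
  have "inverse_arrow C (Assoc C a b c) \<cdot> (Assoc C a b c \<cdot> Braid C c (a \<diamondop> b) \<cdot> Assoc C c a b) \<cdot> inverse_arrow C (Assoc C c a b)
     = inverse_arrow C (Assoc C a b c) \<cdot> ((Ident C a \<star> Braid C c b) \<cdot> Assoc C a c b \<cdot> (Braid C c a \<star> Ident C b)) \<cdot> inverse_arrow C (Assoc C c a b)"
    by (simp only: hexagon1 assms)
  then show ?thesis by simp
qed

lemma balanced_opposite:
  fixes C :: "('o, 'a) balcat" (structure)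
  assumes "balanced_category C"
  shows "balanced_category (opposite C)"
proof -
  interpret balanced_category C by fact
  have inv_eq: "inverse_arrow C f = inverse_arrow C g" if "f = g" for f g using that by simp
  show ?thesis
  proof
    fix f a b g c f' a' b' g' c'
    assume "f \<in> Hom (opposite C) a b" "g \<in> Hom (opposite C) b c" "f' \<in> Hom (opposite C) a' b'" "g' \<in> Hom (opposite C) b' c'"
    then show "(g \<cdot>\<^bsub>opposite C\<^esub> f) \<star>\<^bsub>opposite C\<^esub> (g' \<cdot>\<^bsub>opposite C\<^esub> f') = (g \<star>\<^bsub>opposite C\<^esub> g') \<cdot>\<^bsub>opposite C\<^esub> (f \<star>\<^bsub>opposite C\<^esub> f')"
      by (simp add: in_Hom tensor_comp)
  next
    fix f a a' g b b' h c c'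
    assume "f \<in> Hom (opposite C) a a'" "g \<in> Hom (opposite C) b b'" "h \<in> Hom (opposite C) c c'"
    then have f: "f \<in> Arr C" "g \<in> Arr C" "h \<in> Arr C" and [simp]: "a = Cod C f" "a' = Dom C f" "b = Cod C g" "b' = Dom C g" "c = Cod C h" "c' = Dom C h"
      by (auto simp: in_Hom)
    have "inverse_arrow C (Assoc C a b c) \<cdot> (Assoc C a b c \<cdot> ((f \<star> g) \<star> h)) \<cdot> inverse_arrow C (Assoc C a' b' c')
      = inverse_arrow C (Assoc C a b c) \<cdot> ((f \<star> g \<star> h) \<cdot> Assoc C a' b' c') \<cdot> inverse_arrow C (Assoc C a' b' c')"
      using assoc_nat[OF f] by simp
    then show "Assoc (opposite C) a' b' c' \<cdot>\<^bsub>opposite C\<^esub> ((f \<star>\<^bsub>opposite C\<^esub> g) \<star>\<^bsub>opposite C\<^esub> h) =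
       (f \<star>\<^bsub>opposite C\<^esub> g \<star>\<^bsub>opposite C\<^esub> h) \<cdot>\<^bsub>opposite C\<^esub> Assoc (opposite C) a b c"
      using f by simp
  next
    fix f a b assume "f \<in> Hom (opposite C) a b"
    then have f: "f \<in> Arr C" and [simp]: "a = Cod C f" "b = Dom C f" by (auto simp: in_Hom)
    have "inverse_arrow C (LUnit C a) \<cdot> (LUnit C a \<cdot> (Ident C (Unit C) \<star> f)) \<cdot> inverse_arrow C (LUnit C b)
      = inverse_arrow C (LUnit C a) \<cdot> (f \<cdot> LUnit C b) \<cdot> inverse_arrow C (LUnit C b)"
      using lunit_nat[OF f] by simp
    then show "LUnit (opposite C) b \<cdot>\<^bsub>opposite C\<^esub> (Ident (opposite C) (Unit (opposite C)) \<star>\<^bsub>opposite C\<^esub> f) = f \<cdot>\<^bsub>opposite C\<^esub> LUnit (opposite C) a"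
      using f by simp
    have "inverse_arrow C (RUnit C a) \<cdot> (RUnit C a \<cdot> (f \<star> Ident C (Unit C))) \<cdot> inverse_arrow C (RUnit C b)
      = inverse_arrow C (RUnit C a) \<cdot> (f \<cdot> RUnit C b) \<cdot> inverse_arrow C (RUnit C b)"
      using runit_nat[OF f] by simp
    then show "RUnit (opposite C) b \<cdot>\<^bsub>opposite C\<^esub> (f \<star>\<^bsub>opposite C\<^esub> Ident (opposite C) (Unit (opposite C))) = f \<cdot>\<^bsub>opposite C\<^esub> RUnit (opposite C) a"
      using f by simp
    show "Twist (opposite C) b \<cdot>\<^bsub>opposite C\<^esub> f = f \<cdot>\<^bsub>opposite C\<^esub> Twist (opposite C) a"
      using twist_nat[OF f] by simp
  next
    fix a b assume ab: "a \<in> Obj (opposite C)" "b \<in> Obj (opposite C)"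
    then have [simp]: "a \<in> Obj C" "b \<in> Obj C" by simp_all
    show "(Ident (opposite C) a \<star>\<^bsub>opposite C\<^esub> LUnit (opposite C) b) \<cdot>\<^bsub>opposite C\<^esub> Assoc (opposite C) a (Unit (opposite C)) b =
        RUnit (opposite C) a \<star>\<^bsub>opposite C\<^esub> Ident (opposite C) b"
      using inv_eq[OF triangle[of a b]] by (simp add: inverse_comp)
    \<comment> \<open>In the opposite category the factors appear in reverse order, with the
      separate twists performed last when read in \<open>C\<close>. Naturality of the braiding moves
      them past both crossings.\<close>
    have "Twist C (a \<diamondop> b) = Braid C b a \<cdot> ((Twist C b \<star> Twist C a) \<cdot> Braid C a b)"
      using braid_nat[of "Twist C a" "Twist C b"] by (simp add: twist_tensor)
    also have "\<dots> = (Braid C b a \<cdot> (Twist C b \<star> Twist C a)) \<cdot> Braid C a b" by simp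
    also have "Braid C b a \<cdot> (Twist C b \<star> Twist C a) = (Twist C a \<star> Twist C b) \<cdot> Braid C b a"
      using braid_nat[of "Twist C b" "Twist C a"] by simp
    finally show "Twist (opposite C) (a \<diamondop>\<^bsub>opposite C\<^esub> b) = Braid (opposite C) b a \<cdot>\<^bsub>opposite C\<^esub> Braid (opposite C) a b \<cdot>\<^bsub>opposite C\<^esub>
        (Twist (opposite C) a \<star>\<^bsub>opposite C\<^esub> Twist (opposite C) b)" by simp
    fix c assume "c \<in> Obj (opposite C)"
    then have [simp]: "c \<in> Obj C" by simp
    show "Assoc (opposite C) b c a \<cdot>\<^bsub>opposite C\<^esub> Braid (opposite C) a (b \<diamondop>\<^bsub>opposite C\<^esub> c) \<cdot>\<^bsub>opposite C\<^esub> Assoc (opposite C) a b c =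
      (Ident (opposite C) b \<star>\<^bsub>opposite C\<^esub> Braid (opposite C) a c) \<cdot>\<^bsub>opposite C\<^esub> Assoc (opposite C) b a c \<cdot>\<^bsub>opposite C\<^esub>
      (Braid (opposite C) a b \<star>\<^bsub>opposite C\<^esub> Ident (opposite C) c)"
      by (simp add: hexagon2)
    show "Braid (opposite C) (a \<diamondop>\<^bsub>opposite C\<^esub> b) c = Assoc (opposite C) c a b \<cdot>\<^bsub>opposite C\<^esub>
      (Braid (opposite C) a c \<star>\<^bsub>opposite C\<^esub> Ident (opposite C) b) \<cdot>\<^bsub>opposite C\<^esub> inverse_arrow (opposite C) (Assoc (opposite C) a c b) \<cdot>\<^bsub>opposite C\<^esub>
      (Ident (opposite C) a \<star>\<^bsub>opposite C\<^esub> Braid (opposite C) b c) \<cdot>\<^bsub>opposite C\<^esub> Assoc (opposite C) a b c"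
      by (simp add: hexagon1')
    fix d assume "d \<in> Obj (opposite C)"
    then have [simp]: "d \<in> Obj C" by simp
    show "(Ident (opposite C) a \<star>\<^bsub>opposite C\<^esub> Assoc (opposite C) b c d) \<cdot>\<^bsub>opposite C\<^esub> Assoc (opposite C) a (b \<diamondop>\<^bsub>opposite C\<^esub> c) d \<cdot>\<^bsub>opposite C\<^esub>
        (Assoc (opposite C) a b c \<star>\<^bsub>opposite C\<^esub> Ident (opposite C) d) =
      Assoc (opposite C) a b (c \<diamondop>\<^bsub>opposite C\<^esub> d) \<cdot>\<^bsub>opposite C\<^esub> Assoc (opposite C) (a \<diamondop>\<^bsub>opposite C\<^esub> b) c d"
      using inv_eq[OF pentagon[of a b c d]] by (simp add: inverse_comp)
  next
    fix f a a' g b b'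
    assume "f \<in> Hom (opposite C) a a'" "g \<in> Hom (opposite C) b b'"
    then show "Braid (opposite C) a' b' \<cdot>\<^bsub>opposite C\<^esub> (f \<star>\<^bsub>opposite C\<^esub> g) = (g \<star>\<^bsub>opposite C\<^esub> f) \<cdot>\<^bsub>opposite C\<^esub> Braid (opposite C) a b"
      using braid_nat[of g f] by (auto simp: in_Hom)
  qed (auto simp: in_Hom twist_unit)
qed

lemma strict_opposite:
  assumes "balanced_category C" "strict_monoidal C"
  shows "strict_monoidal (opposite C)"
proof -
  interpret balanced_category C by fact
  show ?thesis using assms(2) unfolding strict_monoidal_def by simp
qed

text \<open>The coherence arrows of \<open>opposite C\<close> are inverses, so a monoid law there
  becomes a comonoid law once the inverse is moved to the other side of the equation.\<close>

lemma rev_related_Comon: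
  fixes C :: "('o, 'a) balcat" (structure)
  assumes "balanced_category C"
  shows "rev_related (Mon (opposite C)) (Comon C)"
proof -
  interpret balanced_category C by fact
  have m: "is_monoid_in (opposite C) (A, \<delta>, \<epsilon>) \<longleftrightarrow> is_comonoid_in C (A, \<delta>, \<epsilon>)" for A \<delta> \<epsilon>
  proof (cases "A \<in> Obj C \<and> \<delta> \<in> Hom C A (A \<diamondop> A) \<and> \<epsilon> \<in> Hom C A (Unit C)")
    case True
    then have [simp]: "A \<in> Obj C" "\<delta> \<in> Arr C" "Dom C \<delta> = A" "Cod C \<delta> = A \<diamondop> A" "\<epsilon> \<in> Arr C" "Dom C \<epsilon> = A" "Cod C \<epsilon> = Unit C"
      by (auto simp: in_Hom)
    have 1: "(\<delta> \<star> Ident C A) \<cdot> \<delta> = inverse_arrow C (Assoc C A A A) \<cdot> (Ident C A \<star> \<delta>) \<cdot> \<delta> \<longleftrightarrow>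
        Assoc C A A A \<cdot> (\<delta> \<star> Ident C A) \<cdot> \<delta> = (Ident C A \<star> \<delta>) \<cdot> \<delta>"
      by (subst iso_move_left) simp_all
    have 2: "(\<epsilon> \<star> Ident C A) \<cdot> \<delta> = inverse_arrow C (LUnit C A) \<longleftrightarrow> LUnit C A \<cdot> (\<epsilon> \<star> Ident C A) \<cdot> \<delta> = Ident C A"
      by (subst iso_move_left) simp_all
    have 3: "(Ident C A \<star> \<epsilon>) \<cdot> \<delta> = inverse_arrow C (RUnit C A) \<longleftrightarrow> RUnit C A \<cdot> (Ident C A \<star> \<epsilon>) \<cdot> \<delta> = Ident C A"
      by (subst iso_move_left) simp_all
    show ?thesis using True 1 2 3 unfolding is_monoid_in_def is_comonoid_in_def by simp
  next
    case False
    then show ?thesis unfolding is_monoid_in_def is_comonoid_in_def by auto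
  qed
  have m': "is_monoid_in (opposite C) = is_comonoid_in C" using m by (auto simp: fun_eq_iff)
  have h: "is_monoid_hom (opposite C) M M' f \<longleftrightarrow> is_comonoid_hom C M' M f" for M M' f
    by (cases M, cases M') (auto simp: is_monoid_hom_def is_comonoid_hom_def)
  show ?thesis
    unfolding rev_related_def Mon_def Comon_def by (auto simp: m' h)
qed

text \<open>The properties of the source that dualization relies on, in a form preserved by
  \<open>opposite\<close>. As \<open>opposite\<close> inverts the coherence arrows, the list fixes
  the inverse of an identity, which makes \<open>opposite\<close> an involution.\<close>

definition strict_pro :: "('u, 'v) balcat \<Rightarrow> bool" where
  "strict_pro T \<longleftrightarrow> Obj T = UNIV \<and>
     (\<forall>a b c. (a \<diamondop>\<^bsub>T\<^esub> b) \<diamondop>\<^bsub>T\<^esub> c = a \<diamondop>\<^bsub>T\<^esub> b \<diamondop>\<^bsub>T\<^esub> c \<and> Assoc T a b c = Ident T (a \<diamondop>\<^bsub>T\<^esub> b \<diamondop>\<^bsub>T\<^esub> c)) \<and>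
     (\<forall>a. Unit T \<diamondop>\<^bsub>T\<^esub> a = a \<and> LUnit T a = Ident T a \<and> a \<diamondop>\<^bsub>T\<^esub> Unit T = a \<and> RUnit T a = Ident T a) \<and>
     (\<forall>a. Ident T a \<in> Arr T \<and> Dom T (Ident T a) = a \<and> Cod T (Ident T a) = a \<and> inverse_arrow T (Ident T a) = Ident T a) \<and>
     (\<forall>a b. Braid T a b \<in> Arr T \<and> Dom T (Braid T a b) = a \<diamondop>\<^bsub>T\<^esub> b \<and> Cod T (Braid T a b) = b \<diamondop>\<^bsub>T\<^esub> a) \<and>
     (\<forall>f g. f \<in> Arr T \<longrightarrow> g \<in> Arr T \<longrightarrow> f \<star>\<^bsub>T\<^esub> g \<in> Arr T \<and>
        Dom T (f \<star>\<^bsub>T\<^esub> g) = Dom T f \<diamondop>\<^bsub>T\<^esub> Dom T g \<and> Cod T (f \<star>\<^bsub>T\<^esub> g) = Cod T f \<diamondop>\<^bsub>T\<^esub> Cod T g)"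

lemma strict_pro_opposite: "strict_pro T \<Longrightarrow> strict_pro (opposite T)"
  unfolding strict_pro_def by auto

lemma opposite_opposite: "strict_pro T \<Longrightarrow> opposite (opposite T) = T"
  unfolding strict_pro_def by (intro balcat.equality ext) simp_all

lemma (in group) strict_pro_DRBG: "strict_pro (DRBG G)"
proof -
  have right: "drbg_comp G g (drbg_ident G n) = g" if "g \<in> Arr (DRBG G)" "length (omap g) = n" for g n
  proof -
    note g = DRBG_arrD[OF that(1), unfolded that(2)]
    have "ribbon_mult G (rib g) (trivial_ribbon G n 0 []) = rib g"
    proof -
      have l: "length (labels (rib g)) = n" "length (twists (rib g)) = n" "rbraid (rib g) \<in> braids n"
        using g(2) by (auto simp: ribbons_def)
      have "braid_class n (braid_rep (braid_class n []) @ braid_rep (rbraid (rib g))) = rbraid (rib g)"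
        using braid_class_append_rep[of "[]" n "braid_rep (rbraid (rib g))"] g(3) braid_class_rep[OF l(3)] by simp
      moreover have "map (\<lambda>i. labels (rib g) ! i \<otimes> replicate n \<one> ! i) [0..<n] = labels (rib g)"
        "map (\<lambda>i. twists (rib g) ! i + replicate n 0 ! i) [0..<n] = twists (rib g)"
        using l ribbons_label[OF g(2)] by (auto intro!: nth_equalityI)
      ultimately show ?thesis
        by (simp add: ribbon_mult_def trivial_ribbon_def Let_def braid_perm_class)
    qed
    then show ?thesis
      using comp_ribbon_arr[OF that, of "trivial_ribbon G n 0 []"] by (simp add: drbg_ident_def)
  qed
  have "inverse_arrow (DRBG G) (drbg_ident G n) = drbg_ident G n" for n
    unfolding inverse_arrow_def
  \<comment> \<open>Uniqueness uses only the right unit law: for an inverse \<open>g\<close> of the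
    identity, \<open>g\<close> composed with the identity is both \<open>g\<close> and the
    identity.\<close>
  proof (rule the_equality)
    show "inverse_arrows (DRBG G) (drbg_ident G n) (drbg_ident G n)"
      by (simp add: inverse_arrows_def in_Hom right)
    fix g assume g: "inverse_arrows (DRBG G) (drbg_ident G n) g"
    then have "drbg_comp G g (drbg_ident G n) = drbg_ident G n" "g \<in> Arr (DRBG G)" "length (omap g) = n"
      by (auto simp: inverse_arrows_def in_Hom)
    then show "g = drbg_ident G n" using right[of g n] by simp
  qed
  moreover have "ribbon_arr (n + k) (trivial_ribbon G (n + k) 0 (block_word n k)) \<in> Arr (DRBG G)" for n k
    by (intro ribbon_arr_in trivial_ribbon_ribbons group_axioms) simp
  ultimately show ?thesis
    unfolding strict_pro_def by (simp add: add.assoc DRBG_tensor_in)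
qed

text \<open>A functor from the opposite of \<open>T\<close> to \<open>C\<close> is a functor from
  \<open>T\<close> to the opposite of \<open>C\<close>, but its comparison arrows then point the
  wrong way and have to be inverted.\<close>

definition flip :: "('o, 'a, 'm) cat_scheme \<Rightarrow> ('u, 'v, 'o, 'a) mfunc \<Rightarrow> ('u, 'v, 'o, 'a) mfunc" where
  "flip C F = \<lparr>FObj = FObj F, FArr = FArr F, MUnit = inverse_arrow C (MUnit F),
     MTens = (\<lambda>p. inverse_arrow C (MTens F p))\<rparr>"

lemma flip_sel [simp]:
  "FObj (flip C F) = FObj F" "FArr (flip C F) = FArr F" "MUnit (flip C F) = inverse_arrow C (MUnit F)"
  "MTens (flip C F) p = inverse_arrow C (MTens F p)"
  by (simp_all add: flip_def)

lemma flip_opposite [simp]: "flip (opposite C) F = flip C F"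
  by (simp add: flip_def)

lemma flip_balanced:
  fixes C :: "('o, 'a) balcat" (structure) and T :: "('u, 'v) balcat"
  assumes C: "balanced_category C" and T: "strict_pro T" and F: "is_balanced_functor (opposite T) C F"
  shows "is_balanced_functor T (opposite C) (flip C F)"
proof -
  interpret balanced_category C by fact
  have TU: "Obj (opposite T) = UNIV" "Obj T = UNIV" using T by (simp_all add: strict_pro_def)
  have Ts [simp]: "(a \<diamondop>\<^bsub>T\<^esub> b) \<diamondop>\<^bsub>T\<^esub> c = a \<diamondop>\<^bsub>T\<^esub> b \<diamondop>\<^bsub>T\<^esub> c" "Assoc T a b c = Ident T (a \<diamondop>\<^bsub>T\<^esub> b \<diamondop>\<^bsub>T\<^esub> c)"
    "Unit T \<diamondop>\<^bsub>T\<^esub> a = a" "LUnit T a = Ident T a" "a \<diamondop>\<^bsub>T\<^esub> Unit T = a" "RUnit T a = Ident T a"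
    "inverse_arrow T (Ident T a) = Ident T a" "Braid T a b \<in> Arr T" "Dom T (Braid T a b) = a \<diamondop>\<^bsub>T\<^esub> b"
    "Cod T (Braid T a b) = b \<diamondop>\<^bsub>T\<^esub> a" "f \<in> Arr T \<Longrightarrow> g \<in> Arr T \<Longrightarrow> f \<star>\<^bsub>T\<^esub> g \<in> Arr T"
    "f \<in> Arr T \<Longrightarrow> g \<in> Arr T \<Longrightarrow> Dom T (f \<star>\<^bsub>T\<^esub> g) = Dom T f \<diamondop>\<^bsub>T\<^esub> Dom T g"
    "f \<in> Arr T \<Longrightarrow> g \<in> Arr T \<Longrightarrow> Cod T (f \<star>\<^bsub>T\<^esub> g) = Cod T f \<diamondop>\<^bsub>T\<^esub> Cod T g" for a b c f g
    using T by (simp_all add: strict_pro_def)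
  note D = balanced_functorD[OF F TU(1), simplified]
  note [simp] = balanced_functorD(2-6,8-15)[OF F TU(1), simplified]
  let ?N = "\<lambda>a b. inverse_arrow C (MTens F (a, b))"
  have fu: "is_functor T (opposite C) (flip C F)"
    using balanced_functorD(1)[OF F TU(1)] unfolding is_functor_def in_Hom by (auto simp: TU)
  have nat: "(FArr F f \<star> FArr F g) \<cdot> ?N (Cod T f) (Cod T g) = ?N (Dom T f) (Dom T g) \<cdot> FArr F (f \<star>\<^bsub>T\<^esub> g)"
    if fg: "f \<in> Arr T" "g \<in> Arr T" for f g
  proof -
    have "?N (Dom T f) (Dom T g) \<cdot> (MTens F (Dom T f, Dom T g) \<cdot> (FArr F f \<star> FArr F g)) \<cdot> ?N (Cod T f) (Cod T g)
        = ?N (Dom T f) (Dom T g) \<cdot> (FArr F (f \<star>\<^bsub>T\<^esub> g) \<cdot> MTens F (Cod T f, Cod T g)) \<cdot> ?N (Cod T f) (Cod T g)"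
      using D(16)[OF fg] by simp
    then show ?thesis using fg by simp
  qed
  have assoc: "(?N a b \<star> Ident C (FObj F c)) \<cdot> ?N (a \<diamondop>\<^bsub>T\<^esub> b) c =
      inverse_arrow C (Assoc C (FObj F a) (FObj F b) (FObj F c)) \<cdot> (Ident C (FObj F a) \<star> ?N b c) \<cdot> ?N a (b \<diamondop>\<^bsub>T\<^esub> c)" for a b c
  proof -
    have "MTens F (a \<diamondop>\<^bsub>T\<^esub> b, c) \<cdot> (MTens F (a, b) \<star> Ident C (FObj F c)) =
        MTens F (a, b \<diamondop>\<^bsub>T\<^esub> c) \<cdot> (Ident C (FObj F a) \<star> MTens F (b, c)) \<cdot> Assoc C (FObj F a) (FObj F b) (FObj F c)"
      using D(17)[of a b c] by simp
    then have "inverse_arrow C (MTens F (a \<diamondop>\<^bsub>T\<^esub> b, c) \<cdot> (MTens F (a, b) \<star> Ident C (FObj F c))) =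
        inverse_arrow C (MTens F (a, b \<diamondop>\<^bsub>T\<^esub> c) \<cdot> (Ident C (FObj F a) \<star> MTens F (b, c)) \<cdot> Assoc C (FObj F a) (FObj F b) (FObj F c))"
      by simp
    then show ?thesis by (simp add: inverse_comp)
  qed
  have lunit: "(inverse_arrow C (MUnit F) \<star> Ident C (FObj F a)) \<cdot> ?N (Unit T) a = inverse_arrow C (LUnit C (FObj F a))" for a
  proof -
    have "MTens F (Unit T, a) \<cdot> (MUnit F \<star> Ident C (FObj F a)) = LUnit C (FObj F a)" using D(18)[of a] by simp
    then have "inverse_arrow C (MTens F (Unit T, a) \<cdot> (MUnit F \<star> Ident C (FObj F a))) = inverse_arrow C (LUnit C (FObj F a))" by simp
    then show ?thesis by (simp add: inverse_comp)
  qed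
  have runit: "(Ident C (FObj F a) \<star> inverse_arrow C (MUnit F)) \<cdot> ?N a (Unit T) = inverse_arrow C (RUnit C (FObj F a))" for a
  proof -
    have "MTens F (a, Unit T) \<cdot> (Ident C (FObj F a) \<star> MUnit F) = RUnit C (FObj F a)" using D(19)[of a] by simp
    then have "inverse_arrow C (MTens F (a, Unit T) \<cdot> (Ident C (FObj F a) \<star> MUnit F)) = inverse_arrow C (RUnit C (FObj F a))" by simp
    then show ?thesis by (simp add: inverse_comp)
  qed
  have braid: "?N a b \<cdot> FArr F (Braid T a b) = Braid C (FObj F b) (FObj F a) \<cdot> ?N b a" for a b
  proof -
    have "?N a b \<cdot> (FArr F (Braid T a b) \<cdot> MTens F (b, a)) \<cdot> ?N b a
        = ?N a b \<cdot> (MTens F (a, b) \<cdot> Braid C (FObj F b) (FObj F a)) \<cdot> ?N b a"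
      using D(20)[of a b] by simp
    then show ?thesis by simp
  qed
  have twist: "FArr F (Twist T a) = Twist C (FObj F a)" for a using D(21)[of a] by simp
  show ?thesis
    using fu nat assoc lunit runit braid twist
    unfolding is_balanced_functor_def in_Hom TU by (simp add: extensional_def)
qed

text \<open>\<open>opposite (opposite C)\<close> may differ from \<open>C\<close>: at arguments that
  are not objects, its coherence arrows are unspecified values of \<open>THE\<close>. The axioms of
  a functor mention them at objects only, where the double inverse gives back the original.\<close>

lemma balanced_functor_opposite_opposite:
  fixes C :: "('o, 'a) balcat" and T :: "('u, 'v) balcat"
  assumes C: "balanced_category C" and T: "Obj T = UNIV" and F: "is_balanced_functor T (opposite (opposite C)) F"
  shows "is_balanced_functor T C F"
proof -
  interpret balanced_category C by fact
  have fu: "is_functor T C F" using F unfolding is_balanced_functor_def is_functor_def by simp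
  then have o: "FObj F a \<in> Obj C" for a unfolding is_functor_def T by auto
  show ?thesis using F fu unfolding is_balanced_functor_def by (simp add: T o)
qed

lemma flip_flip:
  fixes C :: "('o, 'a) balcat" and T :: "('u, 'v) balcat"
  assumes "balanced_category C" "Obj T = UNIV" "is_balanced_functor T C F"
  shows "flip C (flip C F) = F"
proof -
  interpret balanced_category C by fact
  note [simp] = balanced_functorD(8-15)[OF assms(3,2)]
  have "MTens (flip C (flip C F)) = MTens F" by (rule ext) (auto split: prod.splits)
  moreover have "MUnit (flip C (flip C F)) = MUnit F" by simp
  ultimately show ?thesis by (intro mfunc.equality) simp_all
qed

lemma flip_trans:
  fixes C :: "('o, 'a) balcat" (structure) and T :: "('u, 'v) balcat"
  assumes C: "balanced_category C" and T: "strict_pro T"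
    and F: "is_balanced_functor (opposite T) C F" "is_balanced_functor (opposite T) C F'"
  shows "is_monoidal_trans (opposite T) C F F' \<alpha> \<longleftrightarrow> is_monoidal_trans T (opposite C) (flip C F') (flip C F) \<alpha>"
proof -
  interpret balanced_category C by fact
  have TU: "Obj (opposite T) = UNIV" "Obj T = UNIV" using T by (simp_all add: strict_pro_def)
  note [simp] = balanced_functorD(2-6,8-15)[OF F(1) TU(1), simplified] balanced_functorD(2-6,8-15)[OF F(2) TU(1), simplified]
  have n: "is_nat_trans (opposite T) C F F' \<alpha> \<longleftrightarrow> is_nat_trans T (opposite C) (flip C F') (flip C F) \<alpha>"
    unfolding is_nat_trans_def by (auto simp: eq_commute)
  show ?thesis
  proof (cases "is_nat_trans (opposite T) C F F' \<alpha>")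
    case True
    then have a [simp]: "\<alpha> x \<in> Arr C" "Dom C (\<alpha> x) = FObj F x" "Cod C (\<alpha> x) = FObj F' x" for x
      unfolding is_nat_trans_def in_Hom TU by auto
    have u: "\<alpha> (Unit T) \<cdot> MUnit F = MUnit F' \<longleftrightarrow> inverse_arrow C (MUnit F') \<cdot> \<alpha> (Unit T) = inverse_arrow C (MUnit F)"
    proof
      assume "\<alpha> (Unit T) \<cdot> MUnit F = MUnit F'"
      then have "inverse_arrow C (MUnit F') \<cdot> (\<alpha> (Unit T) \<cdot> MUnit F) \<cdot> inverse_arrow C (MUnit F) = inverse_arrow C (MUnit F') \<cdot> MUnit F' \<cdot> inverse_arrow C (MUnit F)"
        by simp
      then show "inverse_arrow C (MUnit F') \<cdot> \<alpha> (Unit T) = inverse_arrow C (MUnit F)" by simp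
    next
      assume "inverse_arrow C (MUnit F') \<cdot> \<alpha> (Unit T) = inverse_arrow C (MUnit F)"
      then have "MUnit F' \<cdot> (inverse_arrow C (MUnit F') \<cdot> \<alpha> (Unit T)) \<cdot> MUnit F = MUnit F' \<cdot> inverse_arrow C (MUnit F) \<cdot> MUnit F"
        by simp
      then show "\<alpha> (Unit T) \<cdot> MUnit F = MUnit F'" by simp
    qed
    have t: "\<alpha> (x \<diamondop>\<^bsub>T\<^esub> y) \<cdot> MTens F (x, y) = MTens F' (x, y) \<cdot> (\<alpha> x \<star> \<alpha> y) \<longleftrightarrow>
        inverse_arrow C (MTens F' (x, y)) \<cdot> \<alpha> (x \<diamondop>\<^bsub>T\<^esub> y) = (\<alpha> x \<star> \<alpha> y) \<cdot> inverse_arrow C (MTens F (x, y))" for x y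
    proof
      assume "\<alpha> (x \<diamondop>\<^bsub>T\<^esub> y) \<cdot> MTens F (x, y) = MTens F' (x, y) \<cdot> (\<alpha> x \<star> \<alpha> y)"
      then have "inverse_arrow C (MTens F' (x, y)) \<cdot> (\<alpha> (x \<diamondop>\<^bsub>T\<^esub> y) \<cdot> MTens F (x, y)) \<cdot> inverse_arrow C (MTens F (x, y)) =
        inverse_arrow C (MTens F' (x, y)) \<cdot> (MTens F' (x, y) \<cdot> (\<alpha> x \<star> \<alpha> y)) \<cdot> inverse_arrow C (MTens F (x, y))" by simp
      then show "inverse_arrow C (MTens F' (x, y)) \<cdot> \<alpha> (x \<diamondop>\<^bsub>T\<^esub> y) = (\<alpha> x \<star> \<alpha> y) \<cdot> inverse_arrow C (MTens F (x, y))" by simp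
    next
      assume "inverse_arrow C (MTens F' (x, y)) \<cdot> \<alpha> (x \<diamondop>\<^bsub>T\<^esub> y) = (\<alpha> x \<star> \<alpha> y) \<cdot> inverse_arrow C (MTens F (x, y))"
      then have "MTens F' (x, y) \<cdot> (inverse_arrow C (MTens F' (x, y)) \<cdot> \<alpha> (x \<diamondop>\<^bsub>T\<^esub> y)) \<cdot> MTens F (x, y) =
        MTens F' (x, y) \<cdot> ((\<alpha> x \<star> \<alpha> y) \<cdot> inverse_arrow C (MTens F (x, y))) \<cdot> MTens F (x, y)" by simp
      then show "\<alpha> (x \<diamondop>\<^bsub>T\<^esub> y) \<cdot> MTens F (x, y) = MTens F' (x, y) \<cdot> (\<alpha> x \<star> \<alpha> y)" by simp
    qed
    show ?thesis
      using n True unfolding is_monoidal_trans_def TU by (simp add: u t)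
  next
    case False
    then show ?thesis using n by (simp add: is_monoidal_trans_def)
  qed
qed

text \<open>On objects the duality is \<open>flip\<close>, which is its own inverse. A
  transformation keeps its components but runs between the flipped functors in the other
  direction.\<close>

lemma Alg_opposite:
  fixes C :: "('o, 'a) balcat" and T :: "('u, 'v) balcat"
  assumes C: "balanced_category C" and T: "strict_pro T"
  shows "\<exists>H. weak_equivalence (Alg (opposite T) C) (dual (Alg T (opposite C))) H"
proof -
  interpret C: balanced_category C by fact
  interpret O: balanced_category "opposite C" by (rule balanced_opposite[OF C])
  have TU: "Obj (opposite T) = UNIV" "Obj T = UNIV" using T by (simp_all add: strict_pro_def)
  have unflip: "is_balanced_functor (opposite T) C (flip C F)" if F: "is_balanced_functor T (opposite C) F" for F
  proof -
    have "is_balanced_functor (opposite (opposite T)) (opposite C) F" using F opposite_opposite[OF T] by simp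
    from flip_balanced[OF O.balanced_category_axioms strict_pro_opposite[OF T] this]
    show ?thesis using balanced_functor_opposite_opposite[OF C TU(1)] by simp
  qed
  show ?thesis
  proof (rule exI, rule triple_duality[where ob = "flip C" and k = "\<lambda>x. x" and k' = "\<lambda>x. x"])
    show "category (Alg (opposite T) C)" "category (Alg T (opposite C))"
      using C.category_Alg[OF TU(1)] O.category_Alg[OF TU(2)] .
    show "Dom (Alg (opposite T) C) f = fst f \<and> Cod (Alg (opposite T) C) f = snd (snd f)" for f
      by (cases f) (simp add: C.Alg_sel)
    show "Dom (Alg T (opposite C)) f = fst f \<and> Cod (Alg T (opposite C)) f = snd (snd f)" for f
      by (cases f) (simp add: O.Alg_sel)
    show "flip C F \<in> Obj (Alg T (opposite C))" if "F \<in> Obj (Alg (opposite T) C)" for F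
      using that flip_balanced[OF C T] by (simp add: C.Alg_sel O.Alg_sel)
    show "\<exists>F\<in>Obj (Alg (opposite T) C). flip C F = P" if "P \<in> Obj (Alg T (opposite C))" for P
      using that unflip flip_flip[OF O.balanced_category_axioms TU(2), of P]
      by (intro bexI[of _ "flip C P"]) (simp_all add: C.Alg_sel O.Alg_sel)
    show "(flip C F', \<alpha>, flip C F) \<in> Arr (Alg T (opposite C)) \<and> \<alpha> = \<alpha>" if "(F, \<alpha>, F') \<in> Arr (Alg (opposite T) C)" for F F' \<alpha>
      using that flip_balanced[OF C T] flip_trans[OF C T, of F F' \<alpha>] by (simp add: C.Alg_sel O.Alg_sel)
    show "(F, \<beta>, F') \<in> Arr (Alg (opposite T) C) \<and> \<beta> = \<beta>"
      if "F \<in> Obj (Alg (opposite T) C)" "F' \<in> Obj (Alg (opposite T) C)" "(flip C F', \<beta>, flip C F) \<in> Arr (Alg T (opposite C))" for F F' \<beta>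
      using that flip_trans[OF C T, of F F' \<beta>] by (simp add: C.Alg_sel O.Alg_sel)
  qed (auto simp: C.Alg_sel O.Alg_sel TU)
qed

text \<open>Strict functors have no comparison arrows to invert, so this duality is the identity on
  objects and on components.\<close>

lemma Alg_strict_opposite:
  fixes C :: "('o, 'a) balcat" and T :: "('u, 'v) balcat"
  assumes C: "balanced_category C" and sC: "strict_monoidal C" and T: "strict_pro T"
  shows "\<exists>H. weak_equivalence (Alg_strict (opposite T) C) (dual (Alg_strict T (opposite C))) H"
proof -
  interpret C: strict_balanced_category C
    by (intro strict_balanced_category.intro C strict_balanced_category_axioms.intro sC)
  interpret O: strict_balanced_category "opposite C"
    by (intro strict_balanced_category.intro balanced_opposite[OF C] strict_balanced_category_axioms.intro strict_opposite[OF C sC])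
  have TU: "Obj (opposite T) = UNIV" "Obj T = UNIV" using T by (simp_all add: strict_pro_def)
  have Ts: "(a \<diamondop>\<^bsub>T\<^esub> b) \<diamondop>\<^bsub>T\<^esub> c = a \<diamondop>\<^bsub>T\<^esub> b \<diamondop>\<^bsub>T\<^esub> c" "Assoc T a b c = Ident T (a \<diamondop>\<^bsub>T\<^esub> b \<diamondop>\<^bsub>T\<^esub> c)"
    "Unit T \<diamondop>\<^bsub>T\<^esub> a = a" "LUnit T a = Ident T a" "a \<diamondop>\<^bsub>T\<^esub> Unit T = a" "RUnit T a = Ident T a"
    "inverse_arrow T (Ident T a) = Ident T a" for a b c
    using T by (simp_all add: strict_pro_def)
  have o: "is_strict_balanced_functor (opposite T) C F \<longleftrightarrow> is_strict_balanced_functor T (opposite C) F" for F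
  proof -
    have f: "is_functor (opposite T) C F \<longleftrightarrow> is_functor T (opposite C) F"
      unfolding is_functor_def by (auto simp: TU)
    show ?thesis
    proof (cases "is_functor (opposite T) C F")
      case True
      then have "FObj F a \<in> Obj C" for a unfolding is_functor_def TU by auto
      then show ?thesis using True f unfolding is_strict_balanced_functor_def TU by (auto simp: Ts C.strictD)
    qed (use f in \<open>simp add: is_strict_balanced_functor_def\<close>)
  qed
  have t: "is_strict_monoidal_trans (opposite T) C F F' \<alpha> \<longleftrightarrow> is_strict_monoidal_trans T (opposite C) F' F \<alpha>" for F F' \<alpha>
    unfolding is_strict_monoidal_trans_def is_nat_trans_def by (auto simp: eq_commute TU)
  show ?thesis
  proof (rule exI, rule triple_duality[where ob = "\<lambda>F. F" and k = "\<lambda>x. x" and k' = "\<lambda>x. x"])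
    show "category (Alg_strict (opposite T) C)" "category (Alg_strict T (opposite C))"
      using C.category_Alg_strict[OF TU(1)] O.category_Alg_strict[OF TU(2)] .
    show "Dom (Alg_strict (opposite T) C) f = fst f \<and> Cod (Alg_strict (opposite T) C) f = snd (snd f)" for f
      by (cases f) (simp add: Alg_strict_sel)
    show "Dom (Alg_strict T (opposite C)) f = fst f \<and> Cod (Alg_strict T (opposite C)) f = snd (snd f)" for f
      by (cases f) (simp add: Alg_strict_sel)
  qed (auto simp: Alg_strict_sel o t TU)
qed

text \<open>An action of the trivial group is no structure at all, so the statements about
  \<open>DRB\<close> are the case of the trivial group.\<close>

lemma trivial_group_functor_category:
  assumes D: "category D"
  shows "\<exists>H. weak_equivalence (functor_category (one_object_category (singleton_group ())) D) D H"
proof -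
  interpret D: category D by fact
  let ?O = "one_object_category (singleton_group ())" and ?A = "functor_category (one_object_category (singleton_group ())) D"
  have one: "Obj ?O = {()}" "Arr ?O = {()}" "Dom ?O x = ()" "Cod ?O x = ()" "Ident ?O x = ()" "Comp ?O x y = ()" for x y
    by (simp_all add: one_object_category_def singleton_group_def)
  have fd: "FObj P () \<in> Obj D" "FArr P () = Ident D (FObj P ())" if "is_functor ?O D P" for P
    using that unfolding is_functor_def one by auto
  have nt: "is_nat_trans ?O D P P' \<alpha> \<longleftrightarrow> \<alpha> \<in> extensional {()} \<and> \<alpha> () \<in> Hom D (FObj P ()) (FObj P' ())"
    if "is_functor ?O D P" "is_functor ?O D P'" for P P' \<alpha>
    unfolding is_nat_trans_def one using fd[OF that(1)] fd[OF that(2)] by (auto simp: in_Hom)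
  define H where "H = \<lparr>FObj = (\<lambda>P\<in>Obj ?A. FObj P ()), FArr = restrict (\<lambda>(P, \<alpha>, P'). \<alpha> ()) (Arr ?A)\<rparr>"
  have A: "category ?A"
    by (intro category_functor_category group.category_one_object D) simp
  interpret A: category ?A by (rule A)
  have fu: "is_functor ?A D H"
    unfolding is_functor_def
  proof (intro conjI ballI impI)
    show "FObj H \<in> Obj ?A \<rightarrow>\<^sub>E Obj D" by (auto simp: H_def functor_category_def fd)
    show "FArr H \<in> extensional (Arr ?A)" by (simp add: H_def)
    show "FArr H f \<in> Hom D (FObj H (Dom ?A f)) (FObj H (Cod ?A f))" if "f \<in> Arr ?A" for f
      using that by (cases f) (auto simp: H_def functor_category_def nt)
    show "FArr H (Ident ?A P) = Ident D (FObj H P)" if P: "P \<in> Obj ?A" for P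
    proof -
      have "Ident ?A P \<in> Arr ?A" using P by simp
      then show ?thesis using P by (simp add: H_def) (simp add: functor_category_def one)
    qed
    show "FArr H (g \<cdot>\<^bsub>?A\<^esub> f) = FArr H g \<cdot>\<^bsub>D\<^esub> FArr H f" if fg: "f \<in> Arr ?A" "g \<in> Arr ?A" "Cod ?A f = Dom ?A g" for f g
    proof -
      have "g \<cdot>\<^bsub>?A\<^esub> f \<in> Arr ?A" using fg by simp
      then show ?thesis using fg by (cases f, cases g) (simp add: H_def, simp add: functor_category_def one)
    qed
  qed
  have "bij_betw (FArr H) (Hom ?A P P') (Hom D (FObj H P) (FObj H P'))" if "P \<in> Obj ?A" "P' \<in> Obj ?A" for P P'
  proof -
    have P: "is_functor ?O D P" "is_functor ?O D P'" using that by (simp_all add: functor_category_def)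
    show ?thesis
    proof (rule bij_betwI')
      fix f g assume f: "f \<in> Hom ?A P P'" and g: "g \<in> Hom ?A P P'"
      obtain \<alpha> \<beta> where fg: "f = (P, \<alpha>, P')" "g = (P, \<beta>, P')" "\<alpha> \<in> extensional {()}" "\<beta> \<in> extensional {()}"
        using f g nt[OF P] by (cases f, cases g) (auto simp: in_Hom functor_category_def)
      have "FArr H f = \<alpha> ()" "FArr H g = \<beta> ()" using f g by (auto simp: H_def in_Hom fg)
      then show "FArr H f = FArr H g \<longleftrightarrow> f = g" using fg by (auto intro: extensionalityI)
    next
      fix f assume "f \<in> Hom ?A P P'"
      then show "FArr H f \<in> Hom D (FObj H P) (FObj H P')" using fu unfolding is_functor_def in_Hom by auto
    next
      fix h assume h: "h \<in> Hom D (FObj H P) (FObj H P')"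
      have a: "(P, (\<lambda>_\<in>{()}. h), P') \<in> Arr ?A"
        using h P that nt[OF P] by (simp add: functor_category_def H_def)
      then have "(P, (\<lambda>_\<in>{()}. h), P') \<in> Hom ?A P P'" by (simp add: in_Hom functor_category_def)
      moreover have "FArr H (P, (\<lambda>_\<in>{()}. h), P') = h" using a by (simp add: H_def)
      ultimately show "\<exists>f\<in>Hom ?A P P'. h = FArr H f" by force
    qed
  qed
  moreover have "\<exists>P\<in>Obj ?A. \<exists>f\<in>Hom D (FObj H P) d. iso_arrow D f" if d: "d \<in> Obj D" for d
  proof -
    let ?P = "\<lparr>FObj = (\<lambda>_\<in>{()}. d), FArr = (\<lambda>_\<in>{()}. Ident D d)\<rparr>"
    have P: "?P \<in> Obj ?A" using d by (auto simp: functor_category_def is_functor_def one in_Hom)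
    then have "FObj H ?P = d" by (simp add: H_def)
    then show ?thesis using P d by (intro bexI[of _ ?P] bexI[of _ "Ident D d"]) (auto simp: in_Hom)
  qed
  ultimately have "weak_equivalence ?A D H"
    unfolding weak_equivalence_def fully_faithful_def using fu by blast
  then show ?thesis by blast
qed

lemma Alg_DRBG:
  fixes C :: "('o, 'a) balcat" and G :: "('g, 'm) monoid_scheme"
  assumes C: "balanced_category C" and G: "group G"
  shows "\<exists>H. weak_equivalence (Alg (DRBG G) C) (GMon G C) H"
    and "strict_monoidal C \<Longrightarrow> \<exists>H. weak_equivalence (Alg_strict (DRBG G) C) (GMon G C) H"
proof -
  interpret A: algebra_base C G by (intro algebra_base.intro C G)
  show "\<exists>H. weak_equivalence (Alg (DRBG G) C) (GMon G C) H" using A.eval_weak_equivalence by blast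
  show "\<exists>H. weak_equivalence (Alg_strict (DRBG G) C) (GMon G C) H" if "strict_monoidal C"
    using A.strict_eval_weak_equivalence[OF that] by blast
qed

section \<open>Assembly of the equivalences\<close>

lemma equivalentI: "category C \<Longrightarrow> category D \<Longrightarrow> \<exists>H. weak_equivalence C D H \<Longrightarrow> C \<simeq>\<^sub>C D"
  using weak_equivalence_imp_equivalent by blast

lemma weak_equivalence_trans:
  "\<lbrakk>category C; category D; category E; \<exists>H. weak_equivalence C D H; \<exists>H. weak_equivalence D E H\<rbrakk>
    \<Longrightarrow> \<exists>H. weak_equivalence C E H"
  using weak_equivalence_comp by blast

text \<open>The route for comonoids: from algebras over the opposite source to the dual of algebras
  in the opposite target, then to the dual of monoids there, and finally to comonoids. The given
  middle equivalence is dualized before it is inserted.\<close>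

lemma equivalence_via_dual:
  assumes "category A" "category A'" "category D'" "category D"
    and "\<exists>H. weak_equivalence A (dual A') H" "\<exists>H. weak_equivalence A' D' H" "\<exists>H. weak_equivalence (dual D') D H"
  shows "\<exists>H. weak_equivalence A D H"
proof -
  have "\<exists>H. weak_equivalence (dual A') (dual D') H"
    using assms(2,3,6) weak_equivalence_dual by blast
  then have "\<exists>H. weak_equivalence A (dual D') H"
    by (rule weak_equivalence_trans[OF assms(1) category_dual[OF assms(2)] category_dual[OF assms(3)] assms(5)])
  then show ?thesis
    by (rule weak_equivalence_trans[OF assms(1) category_dual[OF assms(3)] assms(4) _ assms(7)])
qed

theorem proposition4p3:
  fixes B :: "('o, 'a) balcat" and G :: "('g, 'm) monoid_scheme"
  assumes "balanced_category B" and "group G"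
  shows "(Alg DRB B \<simeq>\<^sub>C Mon B \<and>
          Alg (DRBG G) B \<simeq>\<^sub>C GMon G B \<and>
          Alg (opposite DRB) B \<simeq>\<^sub>C Comon B \<and>
          Alg (opposite (DRBG G)) B \<simeq>\<^sub>C GComon G B) \<and>
         (strict_monoidal B \<longrightarrow>
          Alg_strict DRB B \<simeq>\<^sub>C Mon B \<and>
          Alg_strict (DRBG G) B \<simeq>\<^sub>C GMon G B \<and>
          Alg_strict (opposite DRB) B \<simeq>\<^sub>C Comon B \<and>
          Alg_strict (opposite (DRBG G)) B \<simeq>\<^sub>C GComon G B)"
proof -
  let ?B' = "opposite B" and ?E = "singleton_group ()"
  have B': "balanced_category ?B'" by (rule balanced_opposite[OF assms(1)])
  interpret B: balanced_category B by fact
  interpret B': balanced_category ?B' by (rule B')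
  interpret G: group G by fact
  have E: "group ?E" by simp
  interpret E: group ?E by (rule E)
  note rev = rev_related_Comon[OF assms(1)]
  have Comon: "category (Comon B)" by (rule rev_related_category[OF rev B'.category_Mon])
  note fcat = category_functor_category
  \<comment> \<open>\<open>DRB\<close> is \<open>DRBG\<close> of the trivial group; the group action
    is then forgotten by \<open>trivial_group_functor_category\<close>.\<close>
  have one: "\<exists>H. weak_equivalence (Alg DRB B) (Mon B) H"
    by (rule weak_equivalence_trans[OF B.category_Alg fcat[OF E.category_one_object B.category_Mon] B.category_Mon])
      (simp_all add: DRB_def Alg_DRBG(1)[OF assms(1) E] trivial_group_functor_category[OF B.category_Mon])
  have one': "\<exists>H. weak_equivalence (Alg DRB ?B') (Mon ?B') H"
    by (rule weak_equivalence_trans[OF B'.category_Alg fcat[OF E.category_one_object B'.category_Mon] B'.category_Mon])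
      (simp_all add: DRB_def Alg_DRBG(1)[OF B' E] trivial_group_functor_category[OF B'.category_Mon])
  have two': "\<exists>H. weak_equivalence (Alg (DRBG G) ?B') (GMon G ?B') H" by (rule Alg_DRBG(1)[OF B' assms(2)])
  \<comment> \<open>\<open>rev_related_dual\<close> leads from \<open>Mon ?B'\<close> to the dual of
    \<open>Comon B\<close>. Dualizing both ends gives the direction needed here, since
    \<open>dual\<close> is an involution.\<close>
  have mon: "\<exists>H. weak_equivalence (dual (Mon ?B')) (Comon B) H"
    using weak_equivalence_dual[OF B'.category_Mon category_dual[OF Comon] rev_related_dual[OF rev B'.category_Mon]]
    unfolding dual_dual by blast
  have gmon: "\<exists>H. weak_equivalence (dual (GMon G ?B')) (GComon G B) H"
    using weak_equivalence_dual[OF fcat[OF G.category_one_object B'.category_Mon]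
        category_dual[OF fcat[OF G.category_one_object Comon]] G.rev_action_weak_equivalence[OF rev B'.category_Mon]]
    unfolding dual_dual by blast
  have DRB: "Obj DRB = UNIV" "Obj (opposite DRB) = UNIV" "strict_pro DRB"
    using E.strict_pro_DRBG by (simp_all add: DRB_def)
  have DRBG: "Obj (opposite (DRBG G)) = UNIV" by simp
  have three: "\<exists>H. weak_equivalence (Alg (opposite DRB) B) (Comon B) H"
    by (rule equivalence_via_dual[OF _ _ B'.category_Mon Comon Alg_opposite[OF assms(1) DRB(3)] one' mon])
      (simp_all add: B.category_Alg B'.category_Alg DRB)
  have four: "\<exists>H. weak_equivalence (Alg (opposite (DRBG G)) B) (GComon G B) H"
    by (rule equivalence_via_dual[OF _ _ fcat[OF G.category_one_object B'.category_Mon] fcat[OF G.category_one_object Comon]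
          Alg_opposite[OF assms(1) G.strict_pro_DRBG] two' gmon])
      (simp_all add: B.category_Alg B'.category_Alg)
  have strong: "Alg DRB B \<simeq>\<^sub>C Mon B \<and> Alg (DRBG G) B \<simeq>\<^sub>C GMon G B \<and>
      Alg (opposite DRB) B \<simeq>\<^sub>C Comon B \<and> Alg (opposite (DRBG G)) B \<simeq>\<^sub>C GComon G B"
    using equivalentI[OF B.category_Alg B.category_Mon one] equivalentI[OF B.category_Alg fcat[OF G.category_one_object B.category_Mon] Alg_DRBG(1)[OF assms]]
      equivalentI[OF B.category_Alg Comon three] equivalentI[OF B.category_Alg fcat[OF G.category_one_object Comon] four] DRB DRBG
    by simp
  have "Alg_strict DRB B \<simeq>\<^sub>C Mon B \<and> Alg_strict (DRBG G) B \<simeq>\<^sub>C GMon G B \<and>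
      Alg_strict (opposite DRB) B \<simeq>\<^sub>C Comon B \<and> Alg_strict (opposite (DRBG G)) B \<simeq>\<^sub>C GComon G B"
    if s: "strict_monoidal B"
  proof -
    have s': "strict_monoidal ?B'" by (rule strict_opposite[OF assms(1) s])
    interpret S: strict_balanced_category B
      by (intro strict_balanced_category.intro assms(1) strict_balanced_category_axioms.intro s)
    interpret S': strict_balanced_category ?B'
      by (intro strict_balanced_category.intro B' strict_balanced_category_axioms.intro s')
    have one: "\<exists>H. weak_equivalence (Alg_strict DRB B) (Mon B) H"
      by (rule weak_equivalence_trans[OF S.category_Alg_strict fcat[OF E.category_one_object B.category_Mon] B.category_Mon])
        (simp_all add: DRB_def Alg_DRBG(2)[OF assms(1) E s] trivial_group_functor_category[OF B.category_Mon])
    have one': "\<exists>H. weak_equivalence (Alg_strict DRB ?B') (Mon ?B') H"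
      by (rule weak_equivalence_trans[OF S'.category_Alg_strict fcat[OF E.category_one_object B'.category_Mon] B'.category_Mon])
        (simp_all add: DRB_def Alg_DRBG(2)[OF B' E s'] trivial_group_functor_category[OF B'.category_Mon])
    have two': "\<exists>H. weak_equivalence (Alg_strict (DRBG G) ?B') (GMon G ?B') H" by (rule Alg_DRBG(2)[OF B' assms(2) s'])
    have three: "\<exists>H. weak_equivalence (Alg_strict (opposite DRB) B) (Comon B) H"
      by (rule equivalence_via_dual[OF _ _ B'.category_Mon Comon Alg_strict_opposite[OF assms(1) s DRB(3)] one' mon])
        (simp_all add: S.category_Alg_strict S'.category_Alg_strict DRB)
    have four: "\<exists>H. weak_equivalence (Alg_strict (opposite (DRBG G)) B) (GComon G B) H"
      by (rule equivalence_via_dual[OF _ _ fcat[OF G.category_one_object B'.category_Mon] fcat[OF G.category_one_object Comon]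
            Alg_strict_opposite[OF assms(1) s G.strict_pro_DRBG] two' gmon])
        (simp_all add: S.category_Alg_strict S'.category_Alg_strict)
    show ?thesis
      using equivalentI[OF S.category_Alg_strict B.category_Mon one]
        equivalentI[OF S.category_Alg_strict fcat[OF G.category_one_object B.category_Mon] Alg_DRBG(2)[OF assms s]]
        equivalentI[OF S.category_Alg_strict Comon three]
        equivalentI[OF S.category_Alg_strict fcat[OF G.category_one_object Comon] four] DRB DRBG
      by simp
  qed
  with strong show ?thesis by blast
qed

end
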